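(* Let $d\ge1$ be an integer and $s\in(0,1)$ with $d>2s$, let $1<p<\infty$, $u_0\in L^1(\mathbb{R}^d)\cap C_0(\mathbb{R}^d)$, $f\in L^1_{\mathrm{loc}}(\mathbb{R}^d)\cap C_0(\mathbb{R}^d)$, and put $p_{Crit}=\frac{d}{d-2s}$. Consider the Cauchy problem $$u_t+\mathcal{L}_{a,b}u=|u|^p+f(x)\ \text{ in }\mathbb{R}^d\times(0,+\infty),\qquad u(x,0)=u_0(x)\ \text{ in }\mathbb{R}^d. \tag{P}$$ Then the following hold. (i) If $a\ge0$, $b>0$, $1<p<p_{Crit}$ and $\int_{\mathbb{R}^d}f(x)\,dx>0$, then (P) admits no global weak solution. (ii) If $a\ge0$, $b>0$, $p=p_{Crit}$, $\int_{\mathbb{R}^d}f(x)\,dx>0$, and for some $0<\sigma\le d$ $$\limsup_{R\to\infty}R^{-\sigma}\int_{|x|<R}f(x)\,dx>0,$$ then (P) admits no global weak solution. (iii) Let $a=b=1$, $p>p_{Crit}$, $p_c^s=\frac{d(p-1)}{2s}$ and $k=\frac{p_c^s}{p}$. There exists $\delta>0$ such that for every $u_0\in C_0(\mathbb{R}^d)\cap L^{p_c^s}(\mathbb{R}^d)$ and every $f\not\equiv0$ (with $f\in L^1_{\mathrm{loc}}(\mathbb{R}^d)\cap C_0(\mathbb{R}^d)$) satisfying $\|u_0\|_{L^{p_c^s}(\mathbb{R}^d)}+\|f\|_{L^k(\mathbb{R}^d)}\le\delta$, the solution $u$ of (P) exists globally.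
   Context: All functions are real-valued. $\mathcal{L}_{a,b}=-a\Delta+b(-\Delta)^s$, where for $s\in(0,1)$ $$(-\Delta)^s v(x)=C_{d,s}\,\mathrm{P.V.}\int_{\mathbb{R}^d}\frac{v(x)-v(y)}{|x-y|^{d+2s}}\,dy,\qquad C_{d,s}=\frac{2^{2s-1}\,2s\,\Gamma(\frac{d+2s}{2})}{\pi^{d/2}\Gamma(1-s)},$$ i.e. $(-\Delta)^s$ is the Fourier multiplier with symbol $|\xi|^{2s}$. $e^{-t\mathcal{L}_{a,b}}$ is the associated heat semigroup (Fourier multiplier $e^{-t(a|\xi|^2+b|\xi|^{2s})}$, i.e. convolution with the heat kernel $\mathcal{P}_t$). $C_0(\mathbb{R}^d)$ is the space of continuous functions vanishing at infinity, with the sup norm; $C_0^\infty$ denotes smooth compactly supported functions. The condition $\int_{\mathbb{R}^d}f\,dx>0$ means that the integral exists in the extended sense, the value $+\infty$ being allowed, and is positive. Global weak solution of (P): a function $u\in L^p_{\mathrm{loc}}([0,+\infty)\times\mathbb{R}^d)$ such that for every $\varphi\in C_0^\infty([0,\infty)\times\mathbb{R}^d)$ the integrals below converge and $$\int_0^\infty\!\!\int_{\mathbb{R}^d}[|u|^p+f(x)]\varphi\,dx\,dt+\int_{\mathbb{R}^d}u_0(x)\varphi(x,0)\,dx=\int_0^\infty\!\!\int_{\mathbb{R}^d}u\,(-\varphi_t+\mathcal{L}_{a,b}\varphi)\,dx\,dt.$$ In (iii), "solution" means mild solution, and "exists globally" means that there is $u\in C([0,\infty);C_0(\mathbb{R}^d))$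 with $$u(t)=e^{-t\mathcal{L}_{a,b}}u_0+\int_0^t e^{-(t-\tau)\mathcal{L}_{a,b}}\big(|u(\tau)|^p+f\big)\,d\tau\quad\text{for all }t\ge 0.$$ *)

theory Defs
  imports "HOL-Analysis.Analysis"
begin

section \<open>Function spaces\<close>

text \<open>
  The space \<open>\<real>\<^sup>d\<close> is an arbitrary Euclidean space \<open>'a\<close>, with \<open>d = DIM('a)\<close>.
\<close>

definition C0 :: "('a::euclidean_space \<Rightarrow> real) set"
  where "C0 = {v. continuous_on UNIV v \<and> (v \<longlongrightarrow> 0) at_infinity}"

definition L1_loc :: "('a::euclidean_space \<Rightarrow> real) set"
  where "L1_loc = {v. \<forall>K. compact K \<longrightarrow> set_integrable lborel K v}"

definition Lp :: "real \<Rightarrow> ('a::euclidean_space \<Rightarrow> real) set"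
  where "Lp q = {v \<in> borel_measurable lborel. integrable lborel (\<lambda>x. \<bar>v x\<bar> powr q)}"

text \<open>Only meaningful on \<^term>\<open>Lp q\<close>: outside it the Bochner integral defaults to 0.\<close>

definition Lp_norm :: "real \<Rightarrow> ('a::euclidean_space \<Rightarrow> real) \<Rightarrow> real"
  where "Lp_norm q v = (LINT x|lborel. \<bar>v x\<bar> powr q) powr (1 / q)"

text \<open>
  Points of space-time are pairs \<open>(t, x)\<close>. The set \<open>[0,\<infinity>) \<times> \<real>\<^sup>d\<close> is closed, and its compact
  subsets may touch \<open>t = 0\<close>.
\<close>

abbreviation spacetime :: "(real \<times> 'a::euclidean_space) set"
  where "spacetime \<equiv> {0..} \<times> UNIV"

definition Lp_loc_spacetime :: "real \<Rightarrow> (real \<times> 'a::euclidean_space \<Rightarrow> real) set"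
  where "Lp_loc_spacetime q =
    {u. set_borel_measurable lebesgue spacetime u \<and>
        (\<forall>K. compact K \<and> K \<subseteq> spacetime \<longrightarrow> set_integrable lebesgue K (\<lambda>z. \<bar>u z\<bar> powr q))}"

primrec C_k :: "nat \<Rightarrow> ('b::euclidean_space \<Rightarrow> real) \<Rightarrow> bool"
  where
    "C_k 0 v \<longleftrightarrow> continuous_on UNIV v"
  | "C_k (Suc k) v \<longleftrightarrow>
       (\<forall>x. v differentiable (at x)) \<and> (\<forall>i\<in>Basis. C_k k (\<lambda>x. frechet_derivative v (at x) i))"

text \<open>
  An element of \<open>C\<^sub>0\<^sup>\<infinity>([0,\<infinity>) \<times> \<real>\<^sup>d)\<close> is the restriction to \<open>t \<ge> 0\<close> of a smooth compactly
  supported function on \<open>\<real> \<times> \<real>\<^sup>d\<close>; it is represented by such an extension, and only its values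
  at \<open>t \<ge> 0\<close> matter below. It need not vanish at \<open>t = 0\<close>.
\<close>

definition test_functions :: "(real \<times> 'a::euclidean_space \<Rightarrow> real) set"
  where "test_functions =
    {\<phi>. (\<forall>k. C_k k \<phi>) \<and> (\<exists>K. compact K \<and> (\<forall>z. z \<notin> K \<longrightarrow> \<phi> z = 0))}"


section \<open>Extended integrals\<close>

definition ext_integral_exists :: "('a::euclidean_space \<Rightarrow> real) \<Rightarrow> bool"
  where "ext_integral_exists f \<longleftrightarrow> f \<in> borel_measurable lborel \<and>
    ((\<integral>\<^sup>+x. ennreal (f x) \<partial>lborel) < \<infinity> \<or> (\<integral>\<^sup>+x. ennreal (- f x) \<partial>lborel) < \<infinity>)"

text \<open>\<^const>\<open>ennreal\<close> truncates negative reals to 0, so these are the integrals of the positive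
  and negative parts.\<close>

definition ext_integral :: "('a::euclidean_space \<Rightarrow> real) \<Rightarrow> ereal"
  where "ext_integral f =
    enn2ereal (\<integral>\<^sup>+x. ennreal (f x) \<partial>lborel) - enn2ereal (\<integral>\<^sup>+x. ennreal (- f x) \<partial>lborel)"


section \<open>The operator and its heat semigroup\<close>

definition laplacian :: "('a::euclidean_space \<Rightarrow> real) \<Rightarrow> 'a \<Rightarrow> real"
  where "laplacian v x = (\<Sum>i\<in>Basis. (deriv ^^ 2) (\<lambda>h. v (x + h *\<^sub>R i)) 0)"

definition frac_laplacian_const :: "real \<Rightarrow> real \<Rightarrow> real"
  where "frac_laplacian_const d s =
    2 powr (2 * s - 1) * (2 * s) * Gamma ((d + 2 * s) / 2) / (pi powr (d / 2) * Gamma (1 - s))"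

definition frac_laplacian :: "real \<Rightarrow> ('a::euclidean_space \<Rightarrow> real) \<Rightarrow> 'a \<Rightarrow> real"
  where "frac_laplacian s v x =
    frac_laplacian_const (real DIM('a)) s *
    Lim (at_right 0) (\<lambda>\<epsilon>. LINT y:{y. norm (x - y) > \<epsilon>}|lborel.
      (v x - v y) / norm (x - y) powr (real DIM('a) + 2 * s))"

definition mixed_op :: "real \<Rightarrow> real \<Rightarrow> real \<Rightarrow> ('a::euclidean_space \<Rightarrow> real) \<Rightarrow> 'a \<Rightarrow> real"
  where "mixed_op a b s v x = - a * laplacian v x + b * frac_laplacian s v x"

text \<open>
  The inverse Fourier transform of the symbol. The symbol is even, so the complex integral is
  real and \<^const>\<open>Re\<close> is only a change of type.
\<close>

definition heat_kernel :: "real \<Rightarrow> real \<Rightarrow> real \<Rightarrow> real \<Rightarrow> 'a::euclidean_space \<Rightarrow> real"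
  where "heat_kernel a b s t x =
    Re (LINT \<xi>|lborel. cis (x \<bullet> \<xi>) *
          of_real (exp (- t * (a * (norm \<xi>)\<^sup>2 + b * norm \<xi> powr (2 * s))))) / (2 * pi) ^ DIM('a)"

definition heat_semigroup ::
    "real \<Rightarrow> real \<Rightarrow> real \<Rightarrow> real \<Rightarrow> ('a::euclidean_space \<Rightarrow> real) \<Rightarrow> 'a \<Rightarrow> real"
  where "heat_semigroup a b s t v x =
    (if t = 0 then v x else LINT y|lborel. heat_kernel a b s t (x - y) * v y)"


section \<open>Solutions of the Cauchy problem\<close>

text \<open>
  The space-time integrals are Lebesgue integrals over \<^term>\<open>spacetime\<close>; that they converge is
  the integrability of the integrands.
\<close>

definition global_weak_solution ::
    "real \<Rightarrow> real \<Rightarrow> real \<Rightarrow> real \<Rightarrow> ('a::euclidean_space \<Rightarrow> real) \<Rightarrow> ('a \<Rightarrow> real) \<Rightarrow>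
     (real \<times> 'a \<Rightarrow> real) \<Rightarrow> bool"
  where "global_weak_solution a b s p u0 f u \<longleftrightarrow>
    u \<in> Lp_loc_spacetime p \<and>
    (\<forall>\<phi>\<in>test_functions.
      (let src = (\<lambda>(t, x). (\<bar>u (t, x)\<bar> powr p + f x) * \<phi> (t, x));
           ini = (\<lambda>x. u0 x * \<phi> (0, x));
           adj = (\<lambda>(t, x). u (t, x) *
                   (- deriv (\<lambda>\<tau>. \<phi> (\<tau>, x)) t + mixed_op a b s (\<lambda>y. \<phi> (t, y)) x))
       in set_integrable lebesgue spacetime src \<and>
          integrable lborel ini \<and>
          set_integrable lebesgue spacetime adj \<and>
          (LINT z:spacetime|lebesgue. src z) + (LINT x|lborel. ini x) =
          (LINT z:spacetime|lebesgue. adj z)))"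

text \<open>
  The second condition is continuity of \<open>[0,\<infinity>) \<rightarrow> C\<^sub>0\<close> for the sup norm; the Duhamel integral
  is taken pointwise in \<open>x\<close>.
\<close>

definition global_mild_solution ::
    "real \<Rightarrow> real \<Rightarrow> real \<Rightarrow> real \<Rightarrow> ('a::euclidean_space \<Rightarrow> real) \<Rightarrow> ('a \<Rightarrow> real) \<Rightarrow>
     (real \<Rightarrow> 'a \<Rightarrow> real) \<Rightarrow> bool"
  where "global_mild_solution a b s p u0 f u \<longleftrightarrow>
    (\<forall>t\<ge>0. u t \<in> C0) \<and>
    (\<forall>t\<ge>0. uniform_limit UNIV u (u t) (at t within {0..})) \<and>
    (\<forall>t\<ge>0. \<forall>x.
      (let duh = (\<lambda>\<tau>. heat_semigroup a b s (t - \<tau>) (\<lambda>y. \<bar>u \<tau> y\<bar> powr p + f y) x)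
       in set_integrable lborel {0..t} duh \<and>
          u t x = heat_semigroup a b s t u0 x + (LINT \<tau>:{0..t}|lborel. duh \<tau>)))"

end

theory Submission
  imports Defs "HOL-Probability.Probability"
begin

text \<open>
  Write \<open>L\<close> for the operator \<open>mixed_op a b s\<close>.

  Nonexistence: test the equation with \<open>\<eta>(t/T) w(x/R)\<close>, where \<open>w = (1 + \<bar>x\<bar>\<^sup>2) powr (- (d + 2 s) / 2)\<close> is
  truncated by a bump. Since \<open>\<bar>L w(x/R)\<bar> \<le> C R powr (- 2 s) w(x/R)\<close> for \<open>R \<ge> 1\<close>, Young's
  inequality and \<open>T \<rightarrow> \<infinity>\<close> give \<open>\<integral> f w(x/R) dx \<le> K R powr (d - 2 s p / (p - 1))\<close>. In the subcritical case the
  exponent is negative, and \<open>R \<rightarrow> \<infinity>\<close> contradicts \<open>\<integral> f > 0\<close>. In the critical case the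
  exponent is 0, so \<open>f\<close> is integrable, while the growth condition forces \<open>\<integral> f = \<infinity>\<close>.

  Existence: the kernel is a probability density bounded by \<open>C t powr (- d / (2 s))\<close>, which gives the weak-type
  estimate \<open>weak L\<^sup>m \<rightarrow> weak L\<^sup>q\<close>, \<open>1/q = 1/m - 2 s/d\<close>, for the Duhamel integral, without any power of
  \<open>t\<close>. Picard iterates for small data therefore stay bounded in the weak space of exponent \<open>d (p - 1) / (2 s)\<close>
  for all times. Interpolating with a large exponent \<open>r\<close>, for which the recursion is linear with small
  coefficient, bounds them in weak \<open>L\<^sup>r\<close> and then uniformly on every \<open>[0, T]\<close>, and the iteration converges in
  \<open>C\<^sub>0\<close> locally uniformly in time.
\<close>

section \<open>Integrals over Euclidean space\<close>

text \<open>The fractional Laplacian of a bump does not vanish outside the support; its tail is of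
  order |x| powr (- d - 2 s). So no compactly supported bump dominates its own image under L, and
  the classical test function argument fails. The weight w has exactly this tail, but it is no test
  function, and removing its truncation needs integrability of u * w over bounded times, while u is
  only locally integrable. The sign of the nonlocal term far away (here b > 0 enters) provides it.
  For existence, f does not decay in time. With q = d (p - 1) / (2 s) and k = q / p one has 1/q =
  1/k - 2 s/d, so the smoothing bound from \<open>Lp k\<close> to \<open>Lp q\<close> is a multiple
  of 1/t, integrable neither at 0 nor at infinity: strong norms lose a logarithm. Tested against one
  fixed density, the Duhamel integrand also obeys a bound free of t, and the minimum of the two is
  integrable. The weak norm at q does not control the sup norm, hence the second exponent r; its
  bound may grow with T, because all smallness needed comes from the first.\<close>

lemma nn_integral_lborel_affine:
  fixes t :: "'a::euclidean_space"
  assumes [measurable]: "f \<in> borel_measurable borel" and c: "c \<noteq> 0"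
  shows "(\<integral>\<^sup>+x. f x \<partial>lborel) = ennreal (\<bar>c\<bar> ^ DIM('a)) * (\<integral>\<^sup>+x. f (t + c *\<^sub>R x) \<partial>lborel)"
  by (subst lborel_affine[OF c, of t]) (simp add: nn_integral_density nn_integral_distr nn_integral_cmult)

lemma nn_integral_lborel_diff:
  fixes t :: "'a::euclidean_space"
  assumes "f \<in> borel_measurable borel"
  shows "(\<integral>\<^sup>+x. f (t - x) \<partial>lborel) = (\<integral>\<^sup>+x. f x \<partial>lborel)"
  using nn_integral_lborel_affine[OF assms, of "-1" t] by simp

lemma integrable_lborel_affine:
  fixes f :: "'a::euclidean_space \<Rightarrow> 'b::{banach, second_countable_topology}"
  assumes f: "integrable lborel f" and c: "c \<noteq> 0"
  shows "integrable lborel (\<lambda>x. f (t + c *\<^sub>R x))"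
  using f f[THEN borel_measurable_integrable] c unfolding integrable_iff_bounded
  by (subst (asm) nn_integral_lborel_affine[where c=c and t=t]) (auto simp: ennreal_mult_less_top)

lemma integrable_lborel_affine_iff:
  fixes f :: "'a::euclidean_space \<Rightarrow> 'b::{banach, second_countable_topology}"
  assumes c: "c \<noteq> 0"
  shows "integrable lborel (\<lambda>x. f (t + c *\<^sub>R x)) \<longleftrightarrow> integrable lborel f"
proof
  assume "integrable lborel (\<lambda>x. f (t + c *\<^sub>R x))"
  from integrable_lborel_affine[OF this, of "1/c" "-(1/c) *\<^sub>R t"] c
  show "integrable lborel f" by (simp add: algebra_simps)
qed (rule integrable_lborel_affine[OF _ c])

lemma integral_lborel_affine:
  fixes f :: "'a::euclidean_space \<Rightarrow> 'b::{banach, second_countable_topology}"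
  assumes c: "c \<noteq> 0"
  shows "(LINT x|lborel. f x) = \<bar>c\<bar> ^ DIM('a) *\<^sub>R (LINT x|lborel. f (t + c *\<^sub>R x))"
proof (cases "integrable lborel f")
  case True
  then have [measurable]: "f \<in> borel_measurable borel" by auto
  show ?thesis
    by (subst lborel_affine[OF c, of t]) (simp add: integral_density integral_distr)
next
  case False
  then show ?thesis using integrable_lborel_affine_iff[OF c, of f t] by (simp add: not_integrable_integral_eq)
qed

lemma integrable_lborel_diff_iff:
  fixes f :: "'a::euclidean_space \<Rightarrow> 'b::{banach, second_countable_topology}"
  shows "integrable lborel (\<lambda>x. f (t - x)) \<longleftrightarrow> integrable lborel f"
  using integrable_lborel_affine_iff[of "-1" f t] by simp

lemma integral_lborel_diff:
  fixes f :: "'a::euclidean_space \<Rightarrow> 'b::{banach, second_countable_topology}"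
  shows "(LINT x|lborel. f (t - x)) = (LINT x|lborel. f x)"
  using integral_lborel_affine[of "-1" f t] by simp

lemma integrable_lborel_plus_iff:
  fixes f :: "'a::euclidean_space \<Rightarrow> 'b::{banach, second_countable_topology}"
  shows "integrable lborel (\<lambda>x. f (t + x)) \<longleftrightarrow> integrable lborel f"
  using integrable_lborel_affine_iff[of "1" f t] by simp

lemma integral_lborel_plus:
  fixes f :: "'a::euclidean_space \<Rightarrow> 'b::{banach, second_countable_topology}"
  shows "(LINT x|lborel. f (t + x)) = (LINT x|lborel. f x)"
  using integral_lborel_affine[of "1" f t] by simp

lemma integrable_lborel_minus_iff:
  fixes f :: "'a::euclidean_space \<Rightarrow> 'b::{banach, second_countable_topology}"
  shows "integrable lborel (\<lambda>x. f (- x)) \<longleftrightarrow> integrable lborel f"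
  using integrable_lborel_diff_iff[of f 0] by simp

lemma integral_lborel_minus:
  fixes f :: "'a::euclidean_space \<Rightarrow> 'b::{banach, second_countable_topology}"
  shows "(LINT x|lborel. f (- x)) = (LINT x|lborel. f x)"
  using integral_lborel_diff[of f 0] by simp

lemma nn_integral_powr_from_0:
  fixes a c :: real
  assumes "a > -1" "c \<ge> 0"
  shows "(\<integral>\<^sup>+x. ennreal (x powr a) * indicator {0..c} x \<partial>lborel) = ennreal (c powr (a + 1) / (a + 1))"
  by (rule nn_integral_has_integral_lebesgue'[OF _ has_integral_powr_from_0[OF assms]]) simp

lemma nn_integral_powr_to_inf:
  fixes a e :: real
  assumes "e < -1" "a > 0"
  shows "(\<integral>\<^sup>+x. ennreal (x powr e) * indicator {a..} x \<partial>lborel) = ennreal (- (a powr (e + 1)) / (e + 1))"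
  by (rule nn_integral_has_integral_lebesgue'[OF _ has_integral_powr_to_inf[OF assms]]) simp

text \<open>Layer-cake formula for \<open>r powr (- \<beta>)\<close>, which replaces polar coordinates.\<close>

lemma nn_integral_norm_powr_le:
  fixes A :: "'a::euclidean_space set"
  assumes [measurable]: "A \<in> sets borel" and \<beta>: "\<beta> > 0"
  shows "(\<integral>\<^sup>+x. ennreal (norm x powr - \<beta>) * indicator A x \<partial>lborel)
    \<le> (\<integral>\<^sup>+r. ennreal (\<beta> * r powr (- \<beta> - 1)) * indicator {0<..} r * emeasure lborel (A \<inter> cball 0 r) \<partial>lborel)"
proof -
  have *: "ennreal (norm x powr - \<beta>) \<le>
      (\<integral>\<^sup>+r. ennreal (\<beta> * r powr (- \<beta> - 1)) * indicator {0<..} r * (if norm x \<le> r then 1 else 0) \<partial>lborel)" for x :: 'a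
  \<comment> \<open>At the origin the left side is 0, since \<open>0 powr a = 0\<close>; the formula
    itself is only needed for a positive radius.\<close>
  proof (cases "x = 0")
    case False
    then have norm: "norm x > 0" by simp
    from False have "ennreal (norm x powr - \<beta>) = ennreal \<beta> * (\<integral>\<^sup>+r. ennreal (r powr (- \<beta> - 1)) * indicator {norm x..} r \<partial>lborel)"
      using \<beta> by (subst nn_integral_powr_to_inf) (auto simp: ennreal_mult'[symmetric])
    also have "\<dots> = (\<integral>\<^sup>+r. ennreal \<beta> * (ennreal (r powr (- \<beta> - 1)) * indicator {norm x..} r) \<partial>lborel)"
      by (subst nn_integral_cmult) auto
    also have "\<dots> \<le> (\<integral>\<^sup>+r. ennreal (\<beta> * r powr (- \<beta> - 1)) * indicator {0<..} r * (if norm x \<le> r then 1 else 0) \<partial>lborel)"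
      using norm \<beta> by (intro nn_integral_mono) (auto simp: ennreal_mult simp del: zero_less_norm_iff split: split_indicator)
    finally show ?thesis .
  qed simp
  have "(\<integral>\<^sup>+x. ennreal (norm x powr - \<beta>) * indicator A x \<partial>lborel) \<le>
    (\<integral>\<^sup>+x. (\<integral>\<^sup>+r. ennreal (\<beta> * r powr (- \<beta> - 1)) * indicator {0<..} r * (if norm x \<le> r then 1 else 0) \<partial>lborel) * indicator A x \<partial>lborel)"
    by (intro nn_integral_mono mult_right_mono *) auto
  also have "\<dots> = (\<integral>\<^sup>+x. (\<integral>\<^sup>+r. ennreal (\<beta> * r powr (- \<beta> - 1)) * indicator {0<..} r * (if norm x \<le> r then 1 else 0) * indicator A x \<partial>lborel) \<partial>lborel)"
    by (subst nn_integral_multc) auto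
  also have "\<dots> = (\<integral>\<^sup>+r. (\<integral>\<^sup>+x. ennreal (\<beta> * r powr (- \<beta> - 1)) * indicator {0<..} r * (if norm x \<le> r then 1 else 0) * indicator A x \<partial>lborel) \<partial>lborel)"
    by (rule lborel_pair.Fubini') measurable
  also have "\<dots> = (\<integral>\<^sup>+r. ennreal (\<beta> * r powr (- \<beta> - 1)) * indicator {0<..} r * emeasure lborel (A \<inter> cball 0 r) \<partial>lborel)"
  proof (rule nn_integral_cong)
    fix r :: real
    have "(\<integral>\<^sup>+x. ennreal (\<beta> * r powr (- \<beta> - 1)) * indicator {0<..} r * (if norm x \<le> r then 1 else 0) * indicator A x \<partial>lborel)
      = (\<integral>\<^sup>+x. (ennreal (\<beta> * r powr (- \<beta> - 1)) * indicator {0<..} r) * indicator (A \<inter> cball 0 r) x \<partial>lborel)"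
      by (intro nn_integral_cong) (auto simp: indicator_def)
    also have "\<dots> = ennreal (\<beta> * r powr (- \<beta> - 1)) * indicator {0<..} r * emeasure lborel (A \<inter> cball 0 r)"
      by (subst nn_integral_cmult) (measurable, auto)
    finally show "(\<integral>\<^sup>+x. ennreal (\<beta> * r powr (- \<beta> - 1)) * indicator {0<..} r * (if norm x \<le> r then 1 else 0) * indicator A x \<partial>lborel)
      = ennreal (\<beta> * r powr (- \<beta> - 1)) * indicator {0<..} r * emeasure lborel (A \<inter> cball 0 r)" .
  qed
  finally show ?thesis .
qed

text \<open>For small r the ball has measure of order r powr d, and \<beta> < d makes r powr (d -
  \<beta> - 1) integrable at 0. For r \<ge> 1 the set stays inside the unit ball, so the tail r powr
  (- \<beta> - 1) is integrable because \<beta> > 0.\<close>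

lemma nn_integral_norm_powr_ball:
  fixes \<beta> :: real
  assumes \<beta>: "0 < \<beta>" "\<beta> < DIM('a::euclidean_space)"
  shows "(\<integral>\<^sup>+x. ennreal (norm x powr - \<beta>) * indicator (cball 0 1) (x::'a) \<partial>lborel) < \<infinity>"
proof -
  define V where "V = unit_ball_vol (real DIM('a))"
  have V: "V \<ge> 0" by (simp add: V_def)
  have le: "ennreal (\<beta> * r powr (- \<beta> - 1)) * indicator {0<..} r * emeasure lborel (cball (0::'a) 1 \<inter> cball 0 r)
     \<le> ennreal (\<beta> * V) * (ennreal (r powr (DIM('a) - \<beta> - 1)) * indicator {0..1} r)
      + ennreal (\<beta> * V) * (ennreal (r powr (- \<beta> - 1)) * indicator {1..} r)" for r
  proof -
    consider "r \<le> 0" | "0 < r" "r < 1" | "1 \<le> r" by linarith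
    then show ?thesis
    proof cases
      case 2
      have "emeasure lborel (cball (0::'a) 1 \<inter> cball 0 r) \<le> emeasure lborel (cball (0::'a) r)"
        by (intro emeasure_mono) auto
      also have "\<dots> = ennreal (V * r powr DIM('a))"
        using 2 by (simp add: emeasure_cball V_def powr_realpow)
      finally have "ennreal (\<beta> * r powr (- \<beta> - 1)) * emeasure lborel (cball (0::'a) 1 \<inter> cball 0 r)
          \<le> ennreal (\<beta> * r powr (- \<beta> - 1)) * ennreal (V * r powr DIM('a))"
        by (rule mult_left_mono) simp
      also have "\<dots> = ennreal (\<beta> * V * r powr (DIM('a) - \<beta> - 1))"
        using 2 \<beta> V by (simp add: ennreal_mult[symmetric] mult_ac powr_add[symmetric] algebra_simps)
      finally show ?thesis using 2 \<beta> V by (simp add: ennreal_mult)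
    next
      case 3
      have "emeasure lborel (cball (0::'a) 1 \<inter> cball 0 r) \<le> emeasure lborel (cball (0::'a) 1)"
        by (intro emeasure_mono) auto
      also have "\<dots> = ennreal V"
        by (simp add: emeasure_cball V_def)
      finally have "ennreal (\<beta> * r powr (- \<beta> - 1)) * emeasure lborel (cball (0::'a) 1 \<inter> cball 0 r)
          \<le> ennreal (\<beta> * r powr (- \<beta> - 1)) * ennreal V"
        by (rule mult_left_mono) simp
      also have "\<dots> = ennreal (\<beta> * V) * ennreal (r powr (- \<beta> - 1))"
        using 3 \<beta> V by (simp add: ennreal_mult[symmetric] mult_ac)
      finally show ?thesis using 3 \<beta> V by (simp add: add_increasing)
    qed auto
  qed
  have "(\<integral>\<^sup>+x. ennreal (norm x powr - \<beta>) * indicator (cball 0 1) (x::'a) \<partial>lborel) \<le>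
    (\<integral>\<^sup>+r. ennreal (\<beta> * r powr (- \<beta> - 1)) * indicator {0<..} r * emeasure lborel (cball (0::'a) 1 \<inter> cball 0 r) \<partial>lborel)"
    using nn_integral_norm_powr_le[of "cball (0::'a) 1" \<beta>] \<beta> by simp
  also have "\<dots> \<le> (\<integral>\<^sup>+r. ennreal (\<beta> * V) * (ennreal (r powr (DIM('a) - \<beta> - 1)) * indicator {0..1} r)
      + ennreal (\<beta> * V) * (ennreal (r powr (- \<beta> - 1)) * indicator {1..} r) \<partial>lborel)"
    by (intro nn_integral_mono le)
  also have "\<dots> = ennreal (\<beta> * V) * ennreal (1 powr (DIM('a) - \<beta> - 1 + 1) / (DIM('a) - \<beta> - 1 + 1))
      + ennreal (\<beta> * V) * ennreal (- (1 powr (- \<beta> - 1 + 1)) / (- \<beta> - 1 + 1))"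
    using \<beta> by (subst nn_integral_add) (auto simp: nn_integral_cmult nn_integral_powr_from_0 nn_integral_powr_to_inf simp del: mult_1_left powr_one_eq_one)
  also have "\<dots> < \<infinity>" by (simp add: ennreal_mult_less_top)
  finally show ?thesis .
qed

lemma nn_integral_norm_powr_outside_ball:
  fixes \<beta> :: real
  assumes \<beta>: "\<beta> > DIM('a::euclidean_space)"
  shows "(\<integral>\<^sup>+x. ennreal (norm x powr - \<beta>) * indicator (- ball 0 1) (x::'a) \<partial>lborel) < \<infinity>"
proof -
  define V where "V = unit_ball_vol (real DIM('a))"
  have V: "V \<ge> 0" by (simp add: V_def)
  have \<beta>0: "\<beta> > 0" using \<beta> by (smt (verit) of_nat_0_le_iff)
  have le: "ennreal (\<beta> * r powr (- \<beta> - 1)) * indicator {0<..} r * emeasure lborel ((- ball (0::'a) 1) \<inter> cball 0 r)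
     \<le> ennreal (\<beta> * V) * (ennreal (r powr (DIM('a) - \<beta> - 1)) * indicator {1..} r)" for r
  proof -
    consider "r \<le> 0" | "0 < r" "r < 1" | "1 \<le> r" by linarith
    then show ?thesis
    proof cases
      case 2
      then have "(- ball (0::'a) 1) \<inter> cball 0 r = {}" by auto
      then show ?thesis by simp
    next
      case 3
      have "emeasure lborel ((- ball (0::'a) 1) \<inter> cball 0 r) \<le> emeasure lborel (cball (0::'a) r)"
        by (intro emeasure_mono) auto
      also have "\<dots> = ennreal (V * r powr DIM('a))"
        using 3 by (simp add: emeasure_cball V_def powr_realpow)
      finally have "ennreal (\<beta> * r powr (- \<beta> - 1)) * emeasure lborel ((- ball (0::'a) 1) \<inter> cball 0 r)
          \<le> ennreal (\<beta> * r powr (- \<beta> - 1)) * ennreal (V * r powr DIM('a))"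
        by (rule mult_left_mono) simp
      also have "\<dots> = ennreal (\<beta> * V * r powr (DIM('a) - \<beta> - 1))"
        using 3 \<beta>0 V by (simp add: ennreal_mult[symmetric] mult_ac powr_add[symmetric] algebra_simps)
      finally show ?thesis using 3 \<beta>0 V by (simp add: ennreal_mult)
    qed auto
  qed
  have "(\<integral>\<^sup>+x. ennreal (norm x powr - \<beta>) * indicator (- ball 0 1) (x::'a) \<partial>lborel) \<le>
    (\<integral>\<^sup>+r. ennreal (\<beta> * r powr (- \<beta> - 1)) * indicator {0<..} r * emeasure lborel ((- ball (0::'a) 1) \<inter> cball 0 r) \<partial>lborel)"
    using nn_integral_norm_powr_le[of "- ball (0::'a) 1" \<beta>] \<beta>0 by simp
  also have "\<dots> \<le> (\<integral>\<^sup>+r. ennreal (\<beta> * V) * (ennreal (r powr (DIM('a) - \<beta> - 1)) * indicator {1..} r) \<partial>lborel)"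
    by (intro nn_integral_mono le)
  also have "\<dots> = ennreal (\<beta> * V) * ennreal (- (1 powr (DIM('a) - \<beta> - 1 + 1)) / (DIM('a) - \<beta> - 1 + 1))"
    using \<beta> by (auto simp: nn_integral_cmult nn_integral_powr_to_inf simp del: mult_1_left powr_one_eq_one)
  also have "\<dots> < \<infinity>" by (simp add: ennreal_mult_less_top)
  finally show ?thesis .
qed

lemma integrable_powr_neg_weight:
  fixes m :: real
  assumes m: "2 * m > DIM('a::euclidean_space)"
  shows "integrable lborel (\<lambda>x::'a. (1 + (norm x)\<^sup>2) powr - m)"
proof (rule integrableI_bounded)
  have m0: "m > 0" using m by (smt (verit) of_nat_0_le_iff)
  have le: "ennreal (norm ((1 + (norm x)\<^sup>2) powr - m)) \<le>
      indicator (ball 0 1) x + ennreal (norm x powr - (2 * m)) * indicator (- ball 0 1) x" for x :: 'a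
  proof (cases "x \<in> ball 0 1")
    case True
    then show ?thesis using m0 
      by (auto intro!: ennreal_leI powr_le1 simp: powr_minus_divide divide_le_eq_1 ge_one_powr_ge_zero simp flip: ennreal_1)
  next
    case False
    then have n: "norm x \<ge> 1" by simp
    have "(1 + (norm x)\<^sup>2) powr - m \<le> ((norm x)\<^sup>2) powr - m"
      using n m0 by (intro powr_mono2') auto
    also have "\<dots> = norm x powr (2 * - m)"
      using n by (subst powr_powr[symmetric]) (simp add: powr_numeral)
    finally show ?thesis using n by (auto intro!: ennreal_leI)
  qed
  have "(\<integral>\<^sup>+x. ennreal (norm ((1 + (norm (x::'a))\<^sup>2) powr - m)) \<partial>lborel) \<le>
    (\<integral>\<^sup>+x. indicator (ball 0 1) (x::'a) + ennreal (norm x powr - (2 * m)) * indicator (- ball 0 1) x \<partial>lborel)"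
    by (intro nn_integral_mono le)
  also have "\<dots> = emeasure lborel (ball (0::'a) 1) + (\<integral>\<^sup>+x. ennreal (norm (x::'a) powr - (2 * m)) * indicator (- ball 0 1) x \<partial>lborel)"
    by (subst nn_integral_add) (measurable, auto)
  also have "\<dots> < \<infinity>" using nn_integral_norm_powr_outside_ball[OF m] by (simp add: emeasure_ball)
  finally show "(\<integral>\<^sup>+x. ennreal (norm ((1 + (norm (x::'a))\<^sup>2) powr - m)) \<partial>lborel) < \<infinity>" .
qed auto

section \<open>Smooth compactly supported functions\<close>

lemma C_k_const: "C_k k (\<lambda>x. c)"
  by (induction k arbitrary: c) (auto simp: frechet_derivative_const)

lemma C_k_Suc_imp: "C_k (Suc k) v \<Longrightarrow> C_k k v"
proof (induction k arbitrary: v)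
  case 0
  then show ?case
    by (auto simp: continuous_on_eq_continuous_at intro: differentiable_imp_continuous_within)
next
  case (Suc k)
  then show ?case by simp
qed

lemma C_k_Suc_I:
  fixes v :: "'b::euclidean_space \<Rightarrow> real"
  assumes "\<And>x. (v has_derivative v' x) (at x)" and "\<And>i. i \<in> Basis \<Longrightarrow> C_k k (\<lambda>x. v' x i)"
  shows "C_k (Suc k) v"
proof -
  have "frechet_derivative v (at x) = v' x" for x
    using frechet_derivative_at[OF assms(1)] by simp
  then show ?thesis using assms by (auto simp: differentiable_def)
qed

lemma C_k_bounded_linear: "bounded_linear v \<Longrightarrow> C_k k v"
proof (cases k)
  case 0
  assume "bounded_linear v" then show ?thesis using 0 by (simp add: linear_continuous_on)
next
  case (Suc n)
  assume "bounded_linear v"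
  then show ?thesis unfolding Suc
    by (intro C_k_Suc_I[where v'="\<lambda>_. v"] C_k_const) (rule bounded_linear_imp_has_derivative)
qed

lemma C_k_has_derivative:
  "C_k (Suc k) v \<Longrightarrow> (v has_derivative frechet_derivative v (at x)) (at x)"
  by (simp add: frechet_derivative_works)

lemma C_k_add: "C_k k v \<Longrightarrow> C_k k w \<Longrightarrow> C_k k (\<lambda>x. v x + w x)"
proof (induction k arbitrary: v w)
  case 0 then show ?case by (auto intro: continuous_intros)
next
  case (Suc k)
  note * = C_k_has_derivative[OF Suc.prems(1)] C_k_has_derivative[OF Suc.prems(2)]
  show ?case
    by (rule C_k_Suc_I[OF has_derivative_add[OF *]]) (use Suc in auto)
qed

lemma C_k_mult: "C_k k v \<Longrightarrow> C_k k w \<Longrightarrow> C_k k (\<lambda>x. v x * w x)"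
proof (induction k arbitrary: v w)
  case 0 then show ?case by (auto intro: continuous_intros)
next
  case (Suc k)
  note * = C_k_has_derivative[OF Suc.prems(1)] C_k_has_derivative[OF Suc.prems(2)]
  show ?case
    by (rule C_k_Suc_I[OF has_derivative_mult[OF *]])
      (use Suc C_k_Suc_imp[OF Suc.prems(1)] C_k_Suc_imp[OF Suc.prems(2)] in \<open>auto intro!: C_k_add\<close>)
qed

lemma C_k_sum: "(\<And>i. i \<in> I \<Longrightarrow> C_k k (v i)) \<Longrightarrow> C_k k (\<lambda>x. \<Sum>i\<in>I. v i x)"
  by (induction I rule: infinite_finite_induct) (auto intro: C_k_add C_k_const)

text \<open>The outer function comes with the whole sequence \<open>G\<close> of its derivatives, so
  that the induction on \<open>k\<close> can run for all \<open>n\<close> at once. Derivatives are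
  required on the range of \<open>v\<close> only, which admits real powers of positive
  functions.\<close>

lemma C_k_compose:
  fixes v :: "'b::euclidean_space \<Rightarrow> real" and G :: "nat \<Rightarrow> real \<Rightarrow> real"
  assumes "\<And>n r. r \<in> range v \<Longrightarrow> (G n has_real_derivative G (Suc n) r) (at r)"
    and "\<And>k. C_k k v"
  shows "C_k k (\<lambda>x. G n (v x))"
proof (induction k arbitrary: n)
  case 0
  have "isCont v x" for x
    using assms(2)[of 0] by (simp add: continuous_on_eq_continuous_at)
  moreover have "isCont (G n) (v x)" for x using assms(1)[of "v x" n] by (auto intro: DERIV_isCont)
  ultimately show ?case
    by (auto simp: continuous_on_eq_continuous_at intro: isCont_o2)
next
  case (Suc k)
  have dv: "(v has_derivative frechet_derivative v (at x)) (at x)" for x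
    using assms(2)[of "Suc 0"] by (rule C_k_has_derivative)
  have "((\<lambda>x. G n (v x)) has_derivative (\<lambda>h. G (Suc n) (v x) * frechet_derivative v (at x) h)) (at x)" for x
    by (rule has_derivative_compose[OF dv]) (use assms(1)[unfolded has_field_derivative_def] in auto)
  then show ?case
    by (rule C_k_Suc_I) (use Suc assms(2)[of "Suc k"] in \<open>auto intro!: C_k_mult\<close>)
qed

lemma C_k_inner_self:
  fixes L :: "'b::euclidean_space \<Rightarrow> 'a::euclidean_space"
  assumes "bounded_linear L"
  shows "C_k k (\<lambda>z. (norm (L z))\<^sup>2)"
proof -
  have *: "(\<lambda>z. (norm (L z))\<^sup>2) = (\<lambda>z. \<Sum>i\<in>Basis. (L z \<bullet> i) * (L z \<bullet> i))"
    by (simp add: power2_norm_eq_inner euclidean_inner[of "L _" "L _"])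
  show ?thesis unfolding *
    by (intro C_k_sum C_k_mult C_k_bounded_linear bounded_linear_inner_left_comp assms)
qed

text \<open>For \<open>P = 1\<close> this is the standard bump \<open>exp (- 1 / t)\<close>; differentiation only changes \<open>P\<close>.\<close>

definition bump_poly :: "real poly \<Rightarrow> real \<Rightarrow> real"
  where "bump_poly P t = (if t \<le> 0 then 0 else poly P (1 / t) * exp (- (1 / t)))"

abbreviation bump :: "real \<Rightarrow> real" where "bump \<equiv> bump_poly 1"

text \<open>With x = 1/t, the derivative of P(x) exp (- x) with respect to t is x^2 (P(x) - P'(x))
  exp (- x).\<close>

definition bump_step :: "real poly \<Rightarrow> real poly"
  where "bump_step P = [:0, 0, 1:] * (P - pderiv P)"

lemma bump_def': "bump t = (if t \<le> 0 then 0 else exp (- (1 / t)))"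
  by (simp add: bump_poly_def)

lemma poly_exp_tendsto_0: "((\<lambda>x. poly P x * exp (- x)) \<longlongrightarrow> 0) (at_top :: real filter)"
proof -
  have "((\<lambda>x. x ^ i * exp (- x)) \<longlongrightarrow> 0) (at_top :: real filter)" for i
    using tendsto_power_div_exp_0[of i] by (simp add: exp_minus divide_inverse)
  then have "((\<lambda>x. \<Sum>i\<le>degree P. coeff P i * (x ^ i * exp (- x))) \<longlongrightarrow> (\<Sum>i\<le>degree P. coeff P i * 0)) (at_top :: real filter)"
    by (intro tendsto_sum tendsto_mult tendsto_const)
  then show ?thesis by (simp add: poly_altdef sum_distrib_right mult.assoc)
qed

lemma bump_poly_tendsto_0: "(bump_poly P \<longlongrightarrow> 0) (at_right 0)"
proof -
  have "((\<lambda>t. poly P (inverse t) * exp (- inverse t)) \<longlongrightarrow> 0) (at_right (0::real))"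
    using filterlim_compose[OF poly_exp_tendsto_0 filterlim_inverse_at_top_right] .
  moreover have "eventually (\<lambda>t. poly P (inverse t) * exp (- inverse t) = bump_poly P t) (at_right (0::real))"
    by (auto simp: eventually_at_right_field bump_poly_def inverse_eq_divide intro: exI[of _ 1])
  ultimately show ?thesis by (rule Lim_transform_eventually)
qed

lemma bump_poly_has_derivative:
  "(bump_poly P has_real_derivative bump_poly (bump_step P) t) (at t)"
proof -
  consider "t < 0" | "t > 0" | "t = 0" by linarith
  then show ?thesis
  proof cases
    case 1
    have "((\<lambda>t::real. 0) has_real_derivative bump_poly (bump_step P) t) (at t)"
      using 1 by (simp add: bump_poly_def)
    then show ?thesis
      by (rule has_field_derivative_transform_within_open[of _ _ _ "{..<0}"]) (use 1 in \<open>auto simp: bump_poly_def\<close>)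
  next
    case 2
    have "((\<lambda>t. poly P (1 / t) * exp (- (1 / t))) has_real_derivative bump_poly (bump_step P) t) (at t)"
      using 2 by (auto intro!: derivative_eq_intros DERIV_chain2[OF poly_DERIV] simp: bump_poly_def bump_step_def)
        (simp add: field_simps power2_eq_square)
    then show ?thesis
      by (rule has_field_derivative_transform_within_open[of _ _ _ "{0<..}"]) (use 2 in \<open>auto simp: bump_poly_def\<close>)
  next
    case 3
    have "((\<lambda>h. bump_poly P h / h) \<longlongrightarrow> 0) (at_left 0)"
    proof (rule Lim_transform_eventually[OF tendsto_const])
      show "eventually (\<lambda>h. 0 = bump_poly P h / h) (at_left (0::real))"
        by (auto simp: eventually_at_left_field bump_poly_def intro: exI[of _ "-1"])
    qed
    \<comment> \<open>Dividing by h multiplies the polynomial by its argument 1/h, so the difference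
      quotient is again of the form \<open>bump_poly\<close>, and the limit at 0 is already
      known.\<close>
    moreover have "((\<lambda>h. bump_poly P h / h) \<longlongrightarrow> 0) (at_right 0)"
    proof (rule Lim_transform_eventually[OF bump_poly_tendsto_0[of "[:0, 1:] * P"]])
      show "eventually (\<lambda>h. bump_poly ([:0, 1:] * P) h = bump_poly P h / h) (at_right (0::real))"
        by (auto simp: eventually_at_right_field bump_poly_def intro: exI[of _ "1"])
    qed
    ultimately have "((\<lambda>h. bump_poly P h / h) \<longlongrightarrow> 0) (at 0)"
      by (rule filterlim_split_at_real)
    then show ?thesis using 3 by (simp add: DERIV_def bump_poly_def)
  qed
qed

primrec bump_deriv_poly :: "nat \<Rightarrow> real poly" where
  "bump_deriv_poly 0 = 1"
| "bump_deriv_poly (Suc n) = bump_step (bump_deriv_poly n)"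

lemma C_k_bump:
  assumes "\<And>k. C_k k v"
  shows "C_k k (\<lambda>x. bump (v x))"
  using C_k_compose[of v "\<lambda>n. bump_poly (bump_deriv_poly n)" k 0] assms bump_poly_has_derivative
  by auto

lemma C_k_powr:
  assumes "\<And>k. C_k k v" "\<And>x. v x > 0"
  shows "C_k k (\<lambda>x. v x powr a)"
proof -
  define G where "G n r = (\<Prod>i<n. a - real i) * r powr (a - real n)" for n r
  have "(G n has_real_derivative G (Suc n) r) (at r)" if "r > 0" for n r
  proof -
    have "(G n has_real_derivative (\<Prod>i<n. a - real i) * ((a - real n) * r powr (a - real n - 1))) (at r)"
      unfolding G_def by (intro DERIV_cmult has_real_derivative_powr that)
    also have "(\<Prod>i<n. a - real i) * ((a - real n) * r powr (a - real n - 1)) = G (Suc n) r"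
      by (simp add: G_def diff_diff_eq add.commute)
    finally show ?thesis .
  qed
  then have "C_k k (\<lambda>x. G 0 (v x))"
    using C_k_compose[of v G k 0] assms by auto
  then show ?thesis by (simp add: G_def)
qed

lemma bump_eq_0: "t \<le> 0 \<Longrightarrow> bump_poly P t = 0" by (simp add: bump_poly_def)

lemma bump_poly_bounded: "\<exists>B\<ge>0. \<forall>t\<le>1. \<bar>bump_poly P t\<bar> \<le> B"
proof -
  have "continuous_on UNIV (bump_poly P)"
    using bump_poly_has_derivative by (auto intro!: DERIV_continuous_on)
  then have "compact (bump_poly P ` {0..1})"
    by (intro compact_continuous_image) (auto intro: continuous_on_subset)
  then obtain B where B: "\<forall>t\<in>{0..1}. \<bar>bump_poly P t\<bar> \<le> B"
    by (auto dest!: compact_imp_bounded simp: bounded_real)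
  have "B \<ge> 0" using B[rule_format, of 0] by (simp add: bump_poly_def)
  moreover have "\<bar>bump_poly P t\<bar> \<le> B" if "t \<le> 1" for t
    using B[rule_format, of t] that \<open>B \<ge> 0\<close> by (cases "t \<le> 0") (simp_all add: bump_eq_0)
  ultimately show ?thesis by blast
qed

lemma bump_nonneg [simp]: "bump t \<ge> 0" by (simp add: bump_poly_def)
lemma bump_le_1 [simp]: "bump t \<le> 1" by (simp add: bump_poly_def)
lemma bump_pos: "t > 0 \<Longrightarrow> bump t > 0" by (simp add: bump_poly_def)
lemma bump_mono: "t \<le> t' \<Longrightarrow> bump t \<le> bump t'" by (auto simp: bump_poly_def field_simps)

lemma continuous_on_bump_poly [continuous_intros]:
  "continuous_on A v \<Longrightarrow> continuous_on A (\<lambda>x. bump_poly P (v x))"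
  by (rule continuous_on_compose2[of UNIV "bump_poly P"])
    (auto intro!: DERIV_continuous_on bump_poly_has_derivative)

lemma borel_measurable_bump_poly [measurable]: "bump_poly P \<in> borel_measurable borel"
  by (intro borel_measurable_continuous_onI continuous_intros)

text \<open>With x = 1/t the derivative is x^2 exp (- x). A fraction \<theta> = 1 - 1/p of the
  exponential absorbs x^2, by the quadratic Taylor bound that yields 2 / \<theta>^2, and exp (- x /
  p) = bump powr (1 / p) is left over. Infinite flatness thus takes the place of the usual high
  power of a cut-off function.\<close>

lemma bump_deriv_le_powr:
  fixes p :: real
  assumes "p > 1"
  shows "\<exists>B\<ge>0. \<forall>t. \<bar>bump_poly (bump_step 1) t\<bar> \<le> B * bump t powr (1 / p)"
proof (intro exI conjI allI)
  define \<theta> where "\<theta> = 1 - 1 / p"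
  have \<theta>: "\<theta> > 0" using assms by (simp add: \<theta>_def)
  show "2 / \<theta>\<^sup>2 \<ge> 0" by simp
  fix t :: real
  show "\<bar>bump_poly (bump_step 1) t\<bar> \<le> 2 / \<theta>\<^sup>2 * bump t powr (1 / p)"
  proof (cases "t \<le> 0")
    case False
    define x where "x = 1 / t"
    have x: "x > 0" using False by (simp add: x_def)
    have "1 + \<theta> * x + (\<theta> * x)\<^sup>2 / 2 \<le> exp (\<theta> * x)"
      using \<theta> x by (intro exp_lower_Taylor_quadratic) simp
    then have "(\<theta> * x)\<^sup>2 \<le> 2 * exp (\<theta> * x)" using mult_pos_pos[OF \<theta> x] by linarith
    then have *: "x\<^sup>2 \<le> 2 / \<theta>\<^sup>2 * exp (\<theta> * x)"
      using \<theta> by (simp add: field_simps power_mult_distrib)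
    have "\<bar>bump_poly (bump_step 1) t\<bar> = x\<^sup>2 * exp (- x)"
      using False by (simp add: bump_poly_def bump_step_def x_def power2_eq_square)
    also have "\<dots> \<le> (2 / \<theta>\<^sup>2 * exp (\<theta> * x)) * exp (- x)"
      by (intro mult_right_mono *) simp
    also have "\<dots> = 2 / \<theta>\<^sup>2 * exp (- x / p)"
      by (simp add: \<theta>_def mult_exp_exp left_diff_distrib)
    also have "exp (- x / p) = bump t powr (1 / p)"
      using False by (simp add: bump_poly_def x_def powr_def)
    finally show ?thesis .
  qed (simp add: bump_poly_def)
qed

section \<open>The fractional Laplacian of decaying functions\<close>

definition wgt :: "real \<Rightarrow> 'a::euclidean_space \<Rightarrow> real"
  where "wgt m x = (1 + (norm x)\<^sup>2) powr - m"

lemma one_plus_norm_sq_pos [simp]: "0 < 1 + (norm x)\<^sup>2" "1 + (norm x)\<^sup>2 \<noteq> 0"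
  by (smt (verit) zero_le_power2)+

lemma wgt_pos [simp]: "wgt m x > 0"
  by (simp add: wgt_def)

lemma wgt_nonneg [simp]: "wgt m x \<ge> 0"
  by (simp add: wgt_def)

lemma wgt_le_1: "m \<ge> 0 \<Longrightarrow> wgt m x \<le> 1"
  unfolding wgt_def powr_minus_divide by (simp add: divide_le_eq_1 ge_one_powr_ge_zero)

lemma continuous_on_wgt [continuous_intros]:
  "continuous_on A f \<Longrightarrow> continuous_on A (\<lambda>x. wgt m (f x))"
  unfolding wgt_def by (intro continuous_intros) auto

lemma borel_measurable_wgt [measurable]: "wgt m \<in> borel_measurable borel"
  unfolding wgt_def by measurable

lemma integrable_wgt: "2 * m > real DIM('a) \<Longrightarrow> integrable lborel (wgt m :: 'a::euclidean_space \<Rightarrow> real)"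
  unfolding wgt_def[abs_def] by (rule integrable_powr_neg_weight)

text \<open>Comparisons of weights are reduced by this to linear inequalities between the bases 1 +
  |x|^2.\<close>

lemma powr_neg_le_scaled:
  fixes c :: real
  assumes "m \<ge> 0" "0 < X" "0 < c" "X \<le> c * Y"
  shows "Y powr - m \<le> c powr m * X powr - m"
proof -
  have "Y > 0" using assms by (meson less_le_trans zero_less_mult_pos)
  have "Y powr - m = c powr m * (c * Y) powr - m"
    using assms \<open>Y > 0\<close> by (simp add: powr_mult powr_minus field_simps)
  also have "\<dots> \<le> c powr m * X powr - m"
    using assms by (intro mult_left_mono powr_mono2') auto
  finally show ?thesis .
qed

lemma norm_add_sq_le: "(norm (x + y))\<^sup>2 \<le> 2 * (norm x)\<^sup>2 + 2 * (norm y)\<^sup>2"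
proof -
  have "(norm (x + y))\<^sup>2 \<le> (norm x + norm y)\<^sup>2"
    by (intro power_mono norm_triangle_ineq) simp
  also have "\<dots> \<le> 2 * (norm x)\<^sup>2 + 2 * (norm y)\<^sup>2"
    using sum_squares_bound[of "norm x" "norm y"] by (simp add: power2_sum)
  finally show ?thesis .
qed

lemma wgt_shift_le:
  assumes "m \<ge> 0" "norm z \<le> 1"
  shows "wgt m (x + z) \<le> 3 powr m * wgt m x"
proof -
  have "(norm x)\<^sup>2 \<le> 2 * (norm (x + z))\<^sup>2 + 2 * (norm z)\<^sup>2"
    using norm_add_sq_le[of "x + z" "- z"] by simp
  moreover have "(norm z)\<^sup>2 \<le> 1" using assms(2) by (simp add: power_le_one)
  ultimately have "1 + (norm x)\<^sup>2 \<le> 3 * (1 + (norm (x + z))\<^sup>2)"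
    using zero_le_power2[of "norm (x+z)"] by argo
  then show ?thesis unfolding wgt_def using assms(1)
    by (intro powr_neg_le_scaled) auto
qed

text \<open>Since x = (x + z) - z, one of the two points has norm at least |x| / 2, so one of the
  two weights is already of order \<open>wgt m x\<close>; the other is kept. For integrable weights
  this makes the convolution of \<open>wgt m\<close> with itself O(\<open>wgt m\<close>).\<close>

lemma wgt_mult_le:
  assumes "m \<ge> 0"
  shows "wgt m (x + z) * wgt m z \<le> 4 powr m * wgt m x * (wgt m (x + z) + wgt m z)"
proof -
  have a: "(norm x)\<^sup>2 \<le> 2 * (norm (x + z))\<^sup>2 + 2 * (norm z)\<^sup>2"
    using norm_add_sq_le[of "x + z" "- z"] by simp
  have *: "wgt m (x + z) \<le> 4 powr m * wgt m x \<or> wgt m z \<le> 4 powr m * wgt m x"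
  proof (cases "norm (x + z) \<ge> norm z")
    case True
    then have "(norm z)\<^sup>2 \<le> (norm (x + z))\<^sup>2" by (simp add: power_mono)
    then have "1 + (norm x)\<^sup>2 \<le> 4 * (1 + (norm (x + z))\<^sup>2)" using a by argo
    then show ?thesis unfolding wgt_def using assms by (intro disjI1 powr_neg_le_scaled) auto
  next
    case False
    then have "(norm (x + z))\<^sup>2 \<le> (norm z)\<^sup>2" by (simp add: power_mono)
    then have "1 + (norm x)\<^sup>2 \<le> 4 * (1 + (norm z)\<^sup>2)" using a by argo
    then show ?thesis unfolding wgt_def using assms by (intro disjI2 powr_neg_le_scaled) auto
  qed
  then show ?thesis
  proof
    assume "wgt m (x + z) \<le> 4 powr m * wgt m x"
    then have "wgt m (x + z) * wgt m z \<le> (4 powr m * wgt m x) * wgt m z" by (rule mult_right_mono) simp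
    also have "\<dots> \<le> 4 powr m * wgt m x * (wgt m (x + z) + wgt m z)" by (intro mult_left_mono) auto
    finally show ?thesis .
  next
    assume "wgt m z \<le> 4 powr m * wgt m x"
    then have "wgt m (x + z) * wgt m z \<le> wgt m (x + z) * (4 powr m * wgt m x)" by (rule mult_left_mono) simp
    also have "\<dots> = 4 powr m * wgt m x * wgt m (x + z)" by simp
    also have "\<dots> \<le> 4 powr m * wgt m x * (wgt m (x + z) + wgt m z)" by (intro mult_left_mono) auto
    finally show ?thesis .
  qed
qed

lemma norm_powr_le_wgt:
  assumes "m \<ge> 0" "0 < e" "norm z \<ge> e"
  shows "norm z powr - (2 * m) \<le> (1 / e\<^sup>2 + 1) powr m * wgt m z"
proof -
  have z: "norm z > 0" using assms by linarith
  have "e\<^sup>2 \<le> (norm z)\<^sup>2" using assms by (intro power_mono) auto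
  then have "1 + (norm z)\<^sup>2 \<le> (1 / e\<^sup>2 + 1) * (norm z)\<^sup>2"
    using assms by (simp add: field_simps)
  then have "((norm z)\<^sup>2) powr - m \<le> (1 / e\<^sup>2 + 1) powr m * wgt m z"
    unfolding wgt_def using assms by (intro powr_neg_le_scaled) (auto intro: add_pos_pos)
  moreover have "((norm z)\<^sup>2) powr - m = norm z powr (2 * - m)"
    using z by (subst powr_powr[symmetric]) (simp add: powr_numeral)
  ultimately show ?thesis by simp
qed

text \<open>The exponent \<open>2 - d - 2 s\<close> may be positive (if \<open>d = 1\<close>), hence the detour through \<open>\<beta>\<close>.\<close>

lemma integrable_norm_powr_near_0:
  fixes s :: real
  assumes "s < 1" "s > 0"
  shows "integrable lborel (\<lambda>z::'a::euclidean_space. indicator (cball 0 1) z * ((norm z)\<^sup>2 * norm z powr - (real DIM('a) + 2 * s)))"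
proof (rule integrableI_bounded)
  define \<beta> where "\<beta> = max (real DIM('a) + 2 * s - 2) (real DIM('a) / 2)"
  have d: "real DIM('a) > 0" by simp
  have \<beta>: "0 < \<beta>" "\<beta> < real DIM('a)" "\<beta> \<ge> real DIM('a) + 2 * s - 2"
    using assms d unfolding \<beta>_def by linarith+
  have le: "ennreal (norm (indicator (cball 0 1) z * ((norm z)\<^sup>2 * norm z powr - (real DIM('a) + 2 * s))))
     \<le> ennreal (norm z powr - \<beta>) * indicator (cball 0 1) z" for z :: 'a
  proof (cases "z = 0 \<or> norm z > 1")
    case False
    then have z: "0 < norm z" "norm z \<le> 1" by auto
    have "- (real DIM('a) + 2 * s - 2) = 2 + - (real DIM('a) + 2 * s)" by simp
    then have "(norm z)\<^sup>2 * norm z powr - (real DIM('a) + 2 * s) = norm z powr - (real DIM('a) + 2 * s - 2)"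
      using z by (simp only: powr_add) simp
    also have "\<dots> \<le> norm z powr - \<beta>"
      using \<beta> z by (intro powr_mono') auto
    finally show ?thesis using z by (auto intro!: ennreal_leI)
  qed auto
  have "(\<integral>\<^sup>+z. ennreal (norm (indicator (cball 0 1) (z::'a) * ((norm z)\<^sup>2 * norm z powr - (real DIM('a) + 2 * s)))) \<partial>lborel)
    \<le> (\<integral>\<^sup>+z. ennreal (norm (z::'a) powr - \<beta>) * indicator (cball 0 1) z \<partial>lborel)"
    by (intro nn_integral_mono le)
  also have "\<dots> < \<infinity>" using nn_integral_norm_powr_ball[OF \<beta>(1,2)] .
  finally show "(\<integral>\<^sup>+z. ennreal (norm (indicator (cball 0 1) z * ((norm (z::'a))\<^sup>2 * norm z powr - (real DIM('a) + 2 * s)))) \<partial>lborel) < \<infinity>" .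
qed (intro borel_measurable_times borel_measurable_indicator, auto)

lemma abs_divide_powr: "\<bar>a / x powr D\<bar> = \<bar>a\<bar> * x powr - (D::real)"
  by (simp add: powr_minus divide_inverse abs_mult)

text \<open>Pairing z with - z in the principal value produces this expression. It is of order |z|^2
  near 0 for smooth \<open>v\<close>, so the singular integral becomes absolutely convergent. The
  sign is that of minus the second derivative.\<close>

definition second_diff :: "('a::euclidean_space \<Rightarrow> real) \<Rightarrow> 'a \<Rightarrow> 'a \<Rightarrow> real"
  where "second_diff v x z = 2 * v x - v (x + z) - v (x - z)"

lemma integrable_second_diff:
  fixes v :: "'a::euclidean_space \<Rightarrow> real" and s :: real
  assumes s: "0 < s" "s < 1"
    and v[measurable]: "v \<in> borel_measurable borel"
    and B: "\<And>y. \<bar>v y\<bar> \<le> B"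
    and A: "\<And>z. norm z \<le> 1 \<Longrightarrow> \<bar>second_diff v x z\<bar> \<le> A * (norm z)\<^sup>2"
  shows "integrable lborel (\<lambda>z. second_diff v x z / norm z powr (real DIM('a) + 2 * s))"
proof (rule Bochner_Integration.integrable_bound)
  define m where "m = (real DIM('a) + 2 * s) / 2"
  have m: "m \<ge> 0" "2 * m > real DIM('a)" "real DIM('a) + 2 * s = 2 * m" using s by (auto simp: m_def)
  show "integrable lborel (\<lambda>z::'a. A * (indicator (cball 0 1) z * ((norm z)\<^sup>2 * norm z powr - (real DIM('a) + 2 * s)))
     + 4 * B * (2 powr m * wgt m z))"
    by (intro Bochner_Integration.integrable_add integrable_mult_right integrable_norm_powr_near_0 integrable_wgt s m)
  show "(\<lambda>z. second_diff v x z / norm z powr (real DIM('a) + 2 * s)) \<in> borel_measurable lborel"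
    unfolding second_diff_def by measurable
  have B0: "B \<ge> 0" using B[of 0] by linarith
  show "AE z in lborel. norm (second_diff v x z / norm z powr (real DIM('a) + 2 * s))
    \<le> norm (A * (indicator (cball 0 1) z * ((norm z)\<^sup>2 * norm z powr - (real DIM('a) + 2 * s)))
     + 4 * B * (2 powr m * wgt m z))"
  proof (rule AE_I2)
    fix z :: 'a
    have nn: "0 \<le> 4 * B * (2 powr m * wgt m z)" using B0 by simp
    show "norm (second_diff v x z / norm z powr (real DIM('a) + 2 * s))
    \<le> norm (A * (indicator (cball 0 1) z * ((norm z)\<^sup>2 * norm z powr - (real DIM('a) + 2 * s)))
     + 4 * B * (2 powr m * wgt m z))"
    proof (cases "norm z \<le> 1")
      case True
      have "norm (second_diff v x z / norm z powr (real DIM('a) + 2 * s)) = \<bar>second_diff v x z\<bar> * norm z powr - (real DIM('a) + 2 * s)"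
        by (simp only: real_norm_def abs_divide_powr)
      also have "\<dots> \<le> (A * (norm z)\<^sup>2) * norm z powr - (real DIM('a) + 2 * s)"
        by (intro mult_right_mono A True) simp
      also have "\<dots> = A * (indicator (cball 0 1) z * ((norm z)\<^sup>2 * norm z powr - (real DIM('a) + 2 * s)))"
        using True by simp
      finally show ?thesis using nn unfolding real_norm_def by linarith
    next
      case False
      have "norm (second_diff v x z / norm z powr (real DIM('a) + 2 * s)) = \<bar>second_diff v x z\<bar> * norm z powr - (2 * m)"
        unfolding m(3) by (simp only: real_norm_def abs_divide_powr)
      also have "\<dots> \<le> (4 * B) * (2 powr m * wgt m z)"
      proof (intro mult_mono)
        show "\<bar>second_diff v x z\<bar> \<le> 4 * B"
          using B[of x] B[of "x + z"] B[of "x - z"] unfolding second_diff_def by linarith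
        show "norm z powr - (2 * m) \<le> 2 powr m * wgt m z"
          using norm_powr_le_wgt[of m 1 z] m False by simp
      qed (use B0 in auto)
      finally show ?thesis using False by simp
    qed
  qed
qed

text \<open>The domain norm z > \<epsilon> is symmetric, so after the substitution z = x - y the
  integrand may be averaged with its reflection; this gives the factor 1/2 and the second
  difference. Dominated convergence then removes \<epsilon>, which also shows that the limit in the
  definition exists.\<close>

lemma frac_laplacian_eq:
  fixes v :: "'a::euclidean_space \<Rightarrow> real" and s :: real
  assumes s: "0 < s" "s < 1"
    and v[measurable]: "v \<in> borel_measurable borel"
    and B: "\<And>y. \<bar>v y\<bar> \<le> B"
    and A: "\<And>z. norm z \<le> 1 \<Longrightarrow> \<bar>second_diff v x z\<bar> \<le> A * (norm z)\<^sup>2"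
  shows "frac_laplacian s v x = frac_laplacian_const (real DIM('a)) s / 2 *
    (LINT z|lborel. second_diff v x z / norm z powr (real DIM('a) + 2 * s))"
proof -
  define m where "m = (real DIM('a) + 2 * s) / 2"
  have m: "m \<ge> 0" "2 * m > real DIM('a)" "real DIM('a) + 2 * s = 2 * m" using s by (auto simp: m_def)
  have B0: "B \<ge> 0" using B[of 0] by linarith
  define g where "g \<epsilon> z = indicator {z. norm z > \<epsilon>} z * ((v x - v (x - z)) / norm z powr (2 * m))" for \<epsilon> and z :: 'a
  have int_g: "integrable lborel (g \<epsilon>)" if "\<epsilon> > 0" for \<epsilon>
  proof (rule Bochner_Integration.integrable_bound)
    show "integrable lborel (\<lambda>z::'a. 2 * B * ((1 / \<epsilon>\<^sup>2 + 1) powr m * wgt m z))"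
      by (intro integrable_mult_right integrable_wgt m)
    show "g \<epsilon> \<in> borel_measurable lborel" unfolding g_def by measurable
    show "AE z in lborel. norm (g \<epsilon> z) \<le> norm (2 * B * ((1 / \<epsilon>\<^sup>2 + 1) powr m * wgt m z))"
    proof (rule AE_I2)
      fix z :: 'a
      show "norm (g \<epsilon> z) \<le> norm (2 * B * ((1 / \<epsilon>\<^sup>2 + 1) powr m * wgt m z))"
      proof (cases "norm z > \<epsilon>")
        case True
        have "norm (g \<epsilon> z) = \<bar>v x - v (x - z)\<bar> * norm z powr - (2 * m)"
          using True unfolding g_def by (simp add: powr_minus divide_inverse abs_mult)
        also have "\<dots> \<le> (2 * B) * ((1 / \<epsilon>\<^sup>2 + 1) powr m * wgt m z)"
        proof (intro mult_mono)
          show "\<bar>v x - v (x - z)\<bar> \<le> 2 * B"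
            using B[of x] B[of "x - z"] by linarith
        qed (use B0 norm_powr_le_wgt[of m \<epsilon> z] m True that in auto)
        finally show ?thesis by simp
      qed (simp add: g_def)
    qed
  qed
  have eq: "(LINT y:{y. norm (x - y) > \<epsilon>}|lborel. (v x - v y) / norm (x - y) powr (2 * m)) =
     1 / 2 * (LINT z|lborel. indicator {z. norm z > \<epsilon>} z * (second_diff v x z / norm z powr (2 * m)))"
    if "\<epsilon> > 0" for \<epsilon>
  proof -
    have "(LINT y:{y. norm (x - y) > \<epsilon>}|lborel. (v x - v y) / norm (x - y) powr (2 * m)) = (LINT z|lborel. g \<epsilon> z)"
      unfolding set_lebesgue_integral_def
      by (subst integral_lborel_diff[symmetric, of _ x]) (simp add: g_def indicator_def)
    moreover have "(LINT z|lborel. g \<epsilon> z) = (LINT z|lborel. g \<epsilon> (- z))"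
      by (rule integral_lborel_minus[symmetric])
    ultimately have "(LINT y:{y. norm (x - y) > \<epsilon>}|lborel. (v x - v y) / norm (x - y) powr (2 * m)) =
      1 / 2 * ((LINT z|lborel. g \<epsilon> z) + (LINT z|lborel. g \<epsilon> (- z)))" by simp
    also have "(LINT z|lborel. g \<epsilon> z) + (LINT z|lborel. g \<epsilon> (- z)) = (LINT z|lborel. g \<epsilon> z + g \<epsilon> (- z))"
      using int_g[OF that] by (intro Bochner_Integration.integral_add[symmetric]) (simp_all add: integrable_lborel_minus_iff)
    also have "(\<lambda>z. g \<epsilon> z + g \<epsilon> (- z)) = (\<lambda>z. indicator {z. norm z > \<epsilon>} z * (second_diff v x z / norm z powr (2 * m)))"
      by (auto simp: fun_eq_iff g_def second_diff_def indicator_def add_divide_distrib[symmetric])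
    finally show ?thesis .
  qed
  have int: "integrable lborel (\<lambda>z. second_diff v x z / norm z powr (2 * m))"
    using integrable_second_diff[OF s v B A] unfolding m(3) by auto
  have lim: "((\<lambda>\<epsilon>. LINT z|lborel. indicator {z. norm z > \<epsilon>} z * (second_diff v x z / norm z powr (2 * m)))
     \<longlongrightarrow> (LINT z|lborel. second_diff v x z / norm z powr (2 * m))) (at_right 0)"
    unfolding tendsto_at_iff_sequentially comp_def
  proof (intro allI impI)
    fix X :: "nat \<Rightarrow> real" assume X: "\<forall>i. X i \<in> {0<..} - {0}" "X \<longlonglongrightarrow> 0"
    show "(\<lambda>i. LINT z|lborel. indicator {z. norm z > X i} z * (second_diff v x z / norm z powr (2 * m)))
       \<longlonglongrightarrow> (LINT z|lborel. second_diff v x z / norm z powr (2 * m))"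
    proof (rule integral_dominated_convergence[where w="\<lambda>z. norm (second_diff v x z / norm z powr (2 * m))"])
      show "AE z in lborel. (\<lambda>i. indicator {z. norm z > X i} z * (second_diff v x z / norm z powr (2 * m)))
        \<longlonglongrightarrow> second_diff v x z / norm z powr (2 * m)"
      proof (rule AE_I2)
        fix z :: 'a
        show "(\<lambda>i. indicator {z. norm z > X i} z * (second_diff v x z / norm z powr (2 * m)))
          \<longlonglongrightarrow> second_diff v x z / norm z powr (2 * m)"
        proof (cases "z = 0")
          case False
          then have "eventually (\<lambda>i. X i < norm z) sequentially"
            using X(2) by (intro order_tendstoD(2)) auto
          then have "eventually (\<lambda>i. second_diff v x z / norm z powr (2 * m) =
             indicator {z. norm z > X i} z * (second_diff v x z / norm z powr (2 * m))) sequentially"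
            by eventually_elim simp
          then show ?thesis by (rule Lim_transform_eventually[OF tendsto_const])
        qed simp
      qed
      show "integrable lborel (\<lambda>z. norm (second_diff v x z / norm z powr (2 * m)))"
        using int by (rule integrable_norm)
      show "AE z in lborel. norm (indicator {z. norm z > X i} z * (second_diff v x z / norm z powr (2 * m)))
        \<le> norm (second_diff v x z / norm z powr (2 * m))" for i
        by (auto simp: indicator_def)
    qed (simp_all add: second_diff_def)
  qed
  have "((\<lambda>\<epsilon>. LINT y:{y. norm (x - y) > \<epsilon>}|lborel. (v x - v y) / norm (x - y) powr (2 * m))
     \<longlongrightarrow> 1 / 2 * (LINT z|lborel. second_diff v x z / norm z powr (2 * m))) (at_right 0)"
    by (rule Lim_transform_eventually[OF tendsto_mult[OF tendsto_const lim]])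
      (auto simp: eventually_at_right_field eq intro: exI[of _ 1])
  then show ?thesis
    unfolding frac_laplacian_def m(3) by (subst tendsto_Lim) auto
qed

text \<open>\<open>Lim\<close> has a meaning only where the limit exists, so homogeneity is read off
  from the absolutely convergent formula, applied to both functions.\<close>

lemma frac_laplacian_cmult:
  fixes v :: "'a::euclidean_space \<Rightarrow> real" and s :: real
  assumes s: "0 < s" "s < 1"
    and v[measurable]: "v \<in> borel_measurable borel"
    and B: "\<And>y. \<bar>v y\<bar> \<le> B"
    and A: "\<And>z. norm z \<le> 1 \<Longrightarrow> \<bar>second_diff v x z\<bar> \<le> A * (norm z)\<^sup>2"
  shows "frac_laplacian s (\<lambda>y. c * v y) x = c * frac_laplacian s v x"
proof -
  have sd: "second_diff (\<lambda>y. c * v y) x z = c * second_diff v x z" for z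
    by (simp add: second_diff_def algebra_simps)
  have "frac_laplacian s (\<lambda>y. c * v y) x = frac_laplacian_const (real DIM('a)) s / 2 *
    (LINT z|lborel. second_diff (\<lambda>y. c * v y) x z / norm z powr (real DIM('a) + 2 * s))"
  proof (rule frac_laplacian_eq[OF s, where B="\<bar>c\<bar> * B" and A="\<bar>c\<bar> * A"])
    show "\<bar>c * v y\<bar> \<le> \<bar>c\<bar> * B" for y using B by (simp add: abs_mult mult_left_mono)
    show "\<bar>second_diff (\<lambda>y. c * v y) x z\<bar> \<le> \<bar>c\<bar> * A * (norm z)\<^sup>2" if "norm z \<le> 1" for z
      using mult_left_mono[OF A[OF that], of "\<bar>c\<bar>"] by (simp add: sd abs_mult mult.assoc)
  qed measurable
  also have "\<dots> = c * frac_laplacian s v x"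
    by (subst frac_laplacian_eq[OF s v B A]) (simp_all add: sd mult.assoc flip: times_divide_eq_right)
  finally show ?thesis .
qed

text \<open>The substitution z = R z' contributes R powr d from Lebesgue measure and R powr (- d - 2
  s) from the kernel. Since R \<ge> 1, stretching only flattens the function, and the bound on
  second differences survives with the same constant.\<close>

lemma frac_laplacian_scale:
  fixes v :: "'a::euclidean_space \<Rightarrow> real" and s :: real
  assumes s: "0 < s" "s < 1" and R: "R \<ge> 1"
    and v[measurable]: "v \<in> borel_measurable borel"
    and B: "\<And>y. \<bar>v y\<bar> \<le> B"
    and A: "\<And>z. norm z \<le> 1 \<Longrightarrow> \<bar>second_diff v (x /\<^sub>R R) z\<bar> \<le> A * (norm z)\<^sup>2"
  shows "frac_laplacian s (\<lambda>y. v (y /\<^sub>R R)) x = R powr - (2 * s) * frac_laplacian s v (x /\<^sub>R R)"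
    and "\<And>z. norm z \<le> 1 \<Longrightarrow> \<bar>second_diff (\<lambda>y. v (y /\<^sub>R R)) x z\<bar> \<le> A * (norm z)\<^sup>2"
proof -
  have sd: "second_diff (\<lambda>y. v (y /\<^sub>R R)) x z = second_diff v (x /\<^sub>R R) (z /\<^sub>R R)" for z
    by (simp add: second_diff_def scaleR_add_right scaleR_diff_right)
  show A': "\<bar>second_diff (\<lambda>y. v (y /\<^sub>R R)) x z\<bar> \<le> A * (norm z)\<^sup>2" if "norm z \<le> 1" for z
  proof -
    \<comment> \<open>The hypothesis at a basis vector, which has norm 1, bounds an absolute value
      by \<open>A\<close>.\<close>
    have A0: "A \<ge> 0"
    proof -
      obtain b :: 'a where "b \<in> Basis" using nonempty_Basis by blast
      then show ?thesis using A[of b] by simp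
    qed
    have le: "norm (z /\<^sub>R R) \<le> norm z" using R mult_right_mono[of 1 R "norm z"]
      by (simp add: divide_simps mult.commute)
    then have "\<bar>second_diff v (x /\<^sub>R R) (z /\<^sub>R R)\<bar> \<le> A * (norm (z /\<^sub>R R))\<^sup>2"
      using that by (intro A) linarith
    also have "\<dots> \<le> A * (norm z)\<^sup>2"
      using le A0 by (intro mult_left_mono power_mono) auto
    finally show ?thesis by (simp add: sd)
  qed
  define D where "D = real DIM('a) + 2 * s"
  have Rp: "R > 0" using R by simp
  define q where "q z = second_diff v (x /\<^sub>R R) z / norm z powr D" for z
  have h: "second_diff (\<lambda>y. v (y /\<^sub>R R)) x (R *\<^sub>R z) / norm (R *\<^sub>R z) powr D = R powr - D * q z" for z :: 'a
    unfolding sd q_def using Rp by (simp add: powr_mult powr_minus divide_simps)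
  have "(LINT z|lborel. second_diff (\<lambda>y. v (y /\<^sub>R R)) x z / norm z powr D) =
     R ^ DIM('a) * (LINT z|lborel. second_diff (\<lambda>y. v (y /\<^sub>R R)) x (R *\<^sub>R z) / norm (R *\<^sub>R z) powr D)"
    using Rp by (subst integral_lborel_affine[of R _ 0]) auto
  also have "\<dots> = R ^ DIM('a) * (R powr - D * (LINT z|lborel. q z))"
    unfolding h by simp
  also have "\<dots> = R powr - (2 * s) * (LINT z|lborel. q z)"
    using Rp by (simp add: D_def powr_realpow[symmetric] powr_add[symmetric] mult.assoc[symmetric])
  finally have eq: "(LINT z|lborel. second_diff (\<lambda>y. v (y /\<^sub>R R)) x z / norm z powr D) = R powr - (2 * s) * (LINT z|lborel. q z)" .
  have "frac_laplacian s (\<lambda>y. v (y /\<^sub>R R)) x = frac_laplacian_const (real DIM('a)) s / 2 *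
     (LINT z|lborel. second_diff (\<lambda>y. v (y /\<^sub>R R)) x z / norm z powr (real DIM('a) + 2 * s))"
    by (rule frac_laplacian_eq[OF s, where B=B and A=A]) (use B A' in auto)
  also have "\<dots> = R powr - (2 * s) * (frac_laplacian_const (real DIM('a)) s / 2 * (LINT z|lborel. q z))"
    using eq unfolding D_def by simp
  also have "frac_laplacian_const (real DIM('a)) s / 2 * (LINT z|lborel. q z) = frac_laplacian s v (x /\<^sub>R R)"
    unfolding q_def D_def by (rule frac_laplacian_eq[OF s v B A, symmetric])
  finally show "frac_laplacian s (\<lambda>y. v (y /\<^sub>R R)) x = R powr - (2 * s) * frac_laplacian s v (x /\<^sub>R R)" .
qed

lemma frac_laplacian_const_pos:
  "0 < s \<Longrightarrow> s < 1 \<Longrightarrow> d > 0 \<Longrightarrow> frac_laplacian_const d s > 0"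
  unfolding frac_laplacian_const_def by (intro divide_pos_pos mult_pos_pos Gamma_real_pos) auto

text \<open>Near z = 0 the hypothesis on second differences already carries the factor
  \<open>wgt m x\<close>. For |z| > 1 the kernel is itself of order \<open>wgt m z\<close>, because
  2 m = d + 2 s, and the products \<open>wgt m (x + z) * wgt m z\<close> return a factor
  \<open>wgt m x\<close>. The constant depends on \<open>A\<close> but not on \<open>v\<close>,
  which is what makes it uniform in the truncation.\<close>

lemma second_diff_integral_le:
  fixes A m s :: real
  assumes s: "0 < s" "s < 1" and m: "m = (real DIM('a::euclidean_space) + 2 * s) / 2" and A0: "A \<ge> 0"
  shows "\<exists>C\<ge>0. \<forall>v :: 'a \<Rightarrow> real. \<forall>x. v \<in> borel_measurable borel \<longrightarrow> (\<forall>y. \<bar>v y\<bar> \<le> wgt m y) \<longrightarrow>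
     (\<forall>z. norm z \<le> 1 \<longrightarrow> \<bar>second_diff v x z\<bar> \<le> A * wgt m x * (norm z)\<^sup>2) \<longrightarrow>
     \<bar>LINT z|lborel. second_diff v x z / norm z powr (real DIM('a) + 2 * s)\<bar> \<le> C * wgt m x"
proof -
  have m': "m \<ge> 0" "2 * m > real DIM('a)" "real DIM('a) + 2 * s = 2 * m" using s by (auto simp: m)
  define K where "K = (LINT z::'a|lborel. indicator (cball 0 1) z * ((norm z)\<^sup>2 * norm z powr - (real DIM('a) + 2 * s)))"
  define W where "W = (LINT z::'a|lborel. wgt m z)"
  have K: "K \<ge> 0" unfolding K_def by (intro Bochner_Integration.integral_nonneg) auto
  have W: "W \<ge> 0" unfolding W_def by (intro Bochner_Integration.integral_nonneg) auto
  \<comment> \<open>2 powr m compares the kernel with the weight outside the unit ball, 4 powr m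
    comes from the product inequality, and 4 W collects the integrals of two translated weights and
    of twice the weight itself.\<close>
  define C where "C = A * K + 2 powr m * (2 * W + 4 powr m * (4 * W))"
  have intW: "integrable lborel (wgt m :: 'a \<Rightarrow> real)" using m' by (intro integrable_wgt)
  have "\<bar>LINT z|lborel. second_diff v x z / norm z powr (real DIM('a) + 2 * s)\<bar> \<le> C * wgt m x"
    if [measurable]: "v \<in> borel_measurable borel" and B: "\<And>y. \<bar>v y\<bar> \<le> wgt m y"
     and A: "\<And>z. norm z \<le> 1 \<Longrightarrow> \<bar>second_diff v x z\<bar> \<le> A * wgt m x * (norm z)\<^sup>2" for v :: "'a \<Rightarrow> real" and x
  proof -
    define k where "k z = indicator (cball 0 1) z * ((norm z)\<^sup>2 * norm z powr - (real DIM('a) + 2 * s))" for z :: 'a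
    define h where "h z = A * wgt m x * k z
      + 2 powr m * wgt m x * (2 * wgt m z + 4 powr m * (wgt m (x + z) + wgt m (x - z) + 2 * wgt m z))" for z
    have int1: "integrable lborel (\<lambda>z. wgt m (x + z))" "integrable lborel (\<lambda>z. wgt m (x - z))"
      using intW by (simp_all add: integrable_lborel_plus_iff integrable_lborel_diff_iff)
    have intk: "integrable lborel k" "K = (LINT z|lborel. k z)"
      unfolding k_def K_def using integrable_norm_powr_near_0[OF s(2,1)] by auto
    note ints = Bochner_Integration.integrable_add integrable_mult_right intk intW int1
    have inth: "integrable lborel h"
      unfolding h_def by (intro ints)
    have "(LINT z|lborel. h z) = A * wgt m x * K + 2 powr m * wgt m x * (2 * W + 4 powr m * (W + W + 2 * W))"
      unfolding h_def by (simp add: Bochner_Integration.integral_add ints integral_lborel_plus integral_lborel_diff W_def)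
    also have "\<dots> = C * wgt m x" by (simp add: C_def algebra_simps)
    finally have h_eq: "(LINT z|lborel. h z) = C * wgt m x" .
    have "\<bar>LINT z|lborel. second_diff v x z / norm z powr (real DIM('a) + 2 * s)\<bar> \<le>
      (LINT z|lborel. \<bar>second_diff v x z / norm z powr (real DIM('a) + 2 * s)\<bar>)"
      by (rule integral_abs_bound)
    also have "\<dots> \<le> (LINT z|lborel. h z)"
    proof (rule integral_mono)
      have B1: "\<bar>v y\<bar> \<le> 1" for y using B[of y] wgt_le_1[OF m'(1), of y] by linarith
      show "integrable lborel (\<lambda>z. \<bar>second_diff v x z / norm z powr (real DIM('a) + 2 * s)\<bar>)"
        by (intro integrable_abs integrable_second_diff[OF s that(1) B1 A])
      fix z :: 'a
      have nn: "0 \<le> 2 powr m * wgt m x * (2 * wgt m z + 4 powr m * (wgt m (x + z) + wgt m (x - z) + 2 * wgt m z))"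
        by (intro mult_nonneg_nonneg add_nonneg_nonneg) auto
      show "\<bar>second_diff v x z / norm z powr (real DIM('a) + 2 * s)\<bar> \<le> h z"
      proof (cases "norm z \<le> 1")
        case True
        have "\<bar>second_diff v x z / norm z powr (real DIM('a) + 2 * s)\<bar> = \<bar>second_diff v x z\<bar> * norm z powr - (real DIM('a) + 2 * s)"
          by (simp only: real_norm_def abs_divide_powr)
        also have "\<dots> \<le> (A * wgt m x * (norm z)\<^sup>2) * norm z powr - (real DIM('a) + 2 * s)"
          by (intro mult_right_mono A True) simp
        also have "\<dots> = A * wgt m x * k z" using True by (simp add: k_def)
        also have "\<dots> \<le> h z" using nn unfolding h_def by linarith
        finally show ?thesis .
      next
        case False
        have "\<bar>second_diff v x z / norm z powr (real DIM('a) + 2 * s)\<bar> = \<bar>second_diff v x z\<bar> * norm z powr - (2 * m)"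
          unfolding m'(3) by (simp only: real_norm_def abs_divide_powr)
        also have "\<dots> \<le> (2 * wgt m x + wgt m (x + z) + wgt m (x - z)) * (2 powr m * wgt m z)"
        proof (intro mult_mono)
          show "\<bar>second_diff v x z\<bar> \<le> 2 * wgt m x + wgt m (x + z) + wgt m (x - z)"
            using B[of x] B[of "x + z"] B[of "x - z"] unfolding second_diff_def by linarith
          show "norm z powr - (2 * m) \<le> 2 powr m * wgt m z"
            using norm_powr_le_wgt[of m 1 z] m' False by simp
        qed (auto intro!: add_nonneg_nonneg)
        also have "\<dots> = 2 powr m * (2 * wgt m x * wgt m z + wgt m (x + z) * wgt m z + wgt m (x - z) * wgt m z)"
          by (simp add: algebra_simps)
        also have "\<dots> \<le> 2 powr m * (2 * wgt m x * wgt m z + 4 powr m * wgt m x * (wgt m (x + z) + wgt m z)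
            + 4 powr m * wgt m x * (wgt m (x - z) + wgt m z))"
          using wgt_mult_le[OF m'(1), of x z] wgt_mult_le[OF m'(1), of x "- z"]
          by (intro mult_left_mono add_mono order_refl) (auto simp: wgt_def)
        also have "\<dots> = 2 powr m * wgt m x * (2 * wgt m z + 4 powr m * (wgt m (x + z) + wgt m (x - z) + 2 * wgt m z))"
          by (simp add: algebra_simps)
        also have "\<dots> = h z" using False unfolding h_def k_def by simp
        finally show ?thesis .
      qed
    qed (rule inth)
    also have "\<dots> = C * wgt m x" by (rule h_eq)
    finally show ?thesis .
  qed
  moreover have "C \<ge> 0" unfolding C_def using A0 K W by (intro add_nonneg_nonneg mult_nonneg_nonneg) auto
  ultimately show ?thesis by blast
qed

section \<open>Truncated weights\<close>

text \<open>Test functions truncate \<open>wgt m\<close> with \<open>m = (d + 2 s) / 2\<close>: this is the decay rate of the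
  fractional Laplacian of a bump, so all the operators below map \<open>wgt m\<close> to \<open>O(wgt m)\<close>, uniformly in
  the truncation radius \<open>N\<close>.\<close>

definition psi :: "real \<Rightarrow> real \<Rightarrow> 'a::euclidean_space \<Rightarrow> real"
  where "psi m N x = bump (1 - (norm x)\<^sup>2 / N\<^sup>2) * wgt m x"

lemma psi_nonneg [simp]: "psi m N x \<ge> 0"
  by (simp add: psi_def)

lemma psi_le_wgt: "psi m N x \<le> wgt m x"
  unfolding psi_def by (rule mult_left_le_one_le) auto

lemma abs_psi_le_wgt: "\<bar>psi m N x\<bar> \<le> wgt m x"
  using psi_le_wgt[of m N x] by simp

lemma borel_measurable_psi [measurable]: "psi m N \<in> borel_measurable borel"
  unfolding psi_def by measurable

lemma integrable_psi:
  assumes "2 * m > real DIM('a)"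
  shows "integrable lborel (psi m N :: 'a::euclidean_space \<Rightarrow> real)"
  by (rule Bochner_Integration.integrable_bound[OF integrable_wgt[OF assms]]) (auto simp: psi_le_wgt)

lemma psi_eq_0: "N > 0 \<Longrightarrow> norm x \<ge> N \<Longrightarrow> psi m N x = 0"
  unfolding psi_def by (subst bump_eq_0) (auto simp: le_divide_eq power_mono)

text \<open>The factor is the value of the bump at 1; as it is not normalised away, exp (- 1)
  reappears in the energy estimate.\<close>

lemma psi_tendsto: "(\<lambda>n. psi m (real (Suc n)) x) \<longlonglongrightarrow> exp (- 1) * wgt m x"
proof -
  have "(\<lambda>n. 1 / real (Suc n)) \<longlonglongrightarrow> 0"
    using LIMSEQ_inverse_real_of_nat by (simp add: inverse_eq_divide)
  then have "(\<lambda>n. 1 - (norm x)\<^sup>2 * (1 / real (Suc n))\<^sup>2) \<longlonglongrightarrow> 1 - (norm x)\<^sup>2 * 0\<^sup>2"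
    by (intro tendsto_intros)
  moreover have "isCont bump 1" using bump_poly_has_derivative by (rule DERIV_isCont)
  ultimately have "(\<lambda>n. bump (1 - (norm x)\<^sup>2 * (1 / real (Suc n))\<^sup>2)) \<longlonglongrightarrow> bump 1"
    by (intro isCont_tendsto_compose[of 1 bump]) auto
  then show ?thesis unfolding psi_def
    by (intro tendsto_mult tendsto_const) (simp add: bump_def' power_divide)
qed

section \<open>The radial profile of the truncated weight and its derivatives\<close>

definition rad :: "real \<Rightarrow> real \<Rightarrow> real \<Rightarrow> real"
  where "rad m N q = bump (1 - q / N\<^sup>2) * (1 + q) powr - m"

definition rad' :: "real \<Rightarrow> real \<Rightarrow> real \<Rightarrow> real"
  where "rad' m N q = - (bump_poly (bump_step 1) (1 - q / N\<^sup>2) / N\<^sup>2 * (1 + q) powr - m)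
    - m * bump (1 - q / N\<^sup>2) * (1 + q) powr (- m - 1)"

definition rad'' :: "real \<Rightarrow> real \<Rightarrow> real \<Rightarrow> real"
  where "rad'' m N q = bump_poly (bump_step (bump_step 1)) (1 - q / N\<^sup>2) / N\<^sup>2 / N\<^sup>2 * (1 + q) powr - m
    + 2 * m * (bump_poly (bump_step 1) (1 - q / N\<^sup>2) / N\<^sup>2) * (1 + q) powr (- m - 1)
    + m * (m + 1) * bump (1 - q / N\<^sup>2) * (1 + q) powr (- m - 2)"

lemma bump_comp_deriv:
  "((\<lambda>q. bump_poly P (1 - q / N\<^sup>2)) has_real_derivative - (bump_poly (bump_step P) (1 - q / N\<^sup>2) / N\<^sup>2)) (at q)"
proof -
  have "((\<lambda>q. 1 - q / N\<^sup>2) has_real_derivative - (1 / N\<^sup>2)) (at q)"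
    using DERIV_diff[OF DERIV_const[of 1 "at q"] DERIV_cdivide[OF DERIV_ident, of "N\<^sup>2"]] by simp
  from DERIV_chain2[OF bump_poly_has_derivative this] show ?thesis by simp
qed

lemma powr_comp_deriv:
  assumes "q > -1"
  shows "((\<lambda>q. (1 + q) powr e) has_real_derivative e * (1 + q) powr (e - 1)) (at q)"
proof -
  have "((\<lambda>q. 1 + q) has_real_derivative 1) (at q)" by (auto intro!: derivative_eq_intros)
  from DERIV_chain2[OF has_real_derivative_powr this, of e] assms show ?thesis by simp
qed

text \<open>The profile is a function of q = |x|^2 rather than of |x|, and the derivative is taken
  on the open half-line q > -1; the chain rule then needs no exception at x = 0.\<close>

lemma rad_deriv:
  assumes "q > -1"
  shows "(rad m N has_real_derivative rad' m N q) (at q)"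
  unfolding rad_def[abs_def] rad'_def
  by (rule DERIV_cong[OF DERIV_mult[OF bump_comp_deriv[of 1 N q] powr_comp_deriv[OF assms, of "- m"]]]) (simp add: algebra_simps)

lemma rad'_deriv:
  assumes "q > -1"
  shows "(rad' m N has_real_derivative rad'' m N q) (at q)"
proof -
  define b1 where "b1 = bump_poly (bump_step 1) (1 - q / N\<^sup>2) / N\<^sup>2"
  define b2 where "b2 = bump_poly (bump_step (bump_step 1)) (1 - q / N\<^sup>2) / N\<^sup>2 / N\<^sup>2"
  have e: "- m - 1 - 1 = - m - 2" by simp
  have 1: "((\<lambda>q. bump_poly (bump_step 1) (1 - q / N\<^sup>2) / N\<^sup>2 * (1 + q) powr - m) has_real_derivative
     - b2 * (1 + q) powr - m + (- m * (1 + q) powr (- m - 1)) * b1) (at q)"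
    using DERIV_mult[OF DERIV_cdivide[OF bump_comp_deriv[of "bump_step 1" N q], of "N\<^sup>2"] powr_comp_deriv[OF assms, of "- m"]]
    by (simp add: b1_def b2_def)
  have 2: "((\<lambda>q. m * bump (1 - q / N\<^sup>2) * (1 + q) powr (- m - 1)) has_real_derivative
     - (m * b1) * (1 + q) powr (- m - 1) + ((- m - 1) * (1 + q) powr (- m - 2)) * (m * bump (1 - q / N\<^sup>2))) (at q)"
    using DERIV_mult[OF DERIV_cmult[OF bump_comp_deriv[of 1 N q], of m] powr_comp_deriv[OF assms, of "- m - 1"]]
    unfolding e by (simp add: b1_def)
  have eq: "- (- b2 * (1 + q) powr - m + (- m * (1 + q) powr (- m - 1)) * b1)
     - (- (m * b1) * (1 + q) powr (- m - 1) + ((- m - 1) * (1 + q) powr (- m - 2)) * (m * bump (1 - q / N\<^sup>2))) = rad'' m N q"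
    unfolding rad''_def b1_def[symmetric] b2_def[symmetric] by (simp add: algebra_simps)
  show ?thesis
    unfolding rad'_def[abs_def] eq[symmetric] by (rule DERIV_diff[OF DERIV_minus[OF 1] 2])
qed

text \<open>Every derivative of the cut-off costs 1 / N^2, while the cut-off lives on q \<le> N^2,
  so even q / N^4 stays below 1; every derivative of the power gains 1 / (1 + q). Hence nothing
  depends on N \<ge> 1. The second derivative is bounded together with a factor q because the chain
  rule through |x|^2 produces one.\<close>

lemma rad_bounds:
  assumes m: "m \<ge> 0"
  shows "\<exists>A\<ge>0. \<forall>N\<ge>1. \<forall>q\<ge>0. \<bar>rad' m N q\<bar> \<le> A * (1 + q) powr - m \<and> \<bar>rad'' m N q\<bar> * q \<le> A * (1 + q) powr - m"
proof -
  obtain B1 where B1: "B1 \<ge> 0" "\<And>t. t \<le> 1 \<Longrightarrow> \<bar>bump_poly (bump_step 1) t\<bar> \<le> B1"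
    using bump_poly_bounded by auto
  obtain B2 where B2: "B2 \<ge> 0" "\<And>t. t \<le> 1 \<Longrightarrow> \<bar>bump_poly (bump_step (bump_step 1)) t\<bar> \<le> B2"
    using bump_poly_bounded by auto
  define A where "A = (B1 + m) + (B2 + 2 * m * B1 + m * (m + 1))"
  have "\<bar>rad' m N q\<bar> \<le> A * (1 + q) powr - m \<and> \<bar>rad'' m N q\<bar> * q \<le> A * (1 + q) powr - m"
    if N: "N \<ge> 1" and q: "q \<ge> 0" for N q
  proof
    define P where "P = (1 + q) powr - m"
    have P: "P \<ge> 0" by (simp add: P_def)
    have t: "1 - q / N\<^sup>2 \<le> 1" using q by simp
    have N2: "N\<^sup>2 \<ge> 1" using N by simp
    have b1: "\<bar>bump_poly (bump_step 1) (1 - q / N\<^sup>2) / N\<^sup>2\<bar> \<le> B1"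
      using frac_le[OF B1(1) B1(2)[OF t] zero_less_one N2] by simp
    have b2: "\<bar>bump_poly (bump_step (bump_step 1)) (1 - q / N\<^sup>2) / N\<^sup>2 / N\<^sup>2\<bar> * q \<le> B2"
    proof (cases "q \<le> N\<^sup>2")
      case True
      have "\<bar>bump_poly (bump_step (bump_step 1)) (1 - q / N\<^sup>2) / N\<^sup>2 / N\<^sup>2\<bar> * q
        = \<bar>bump_poly (bump_step (bump_step 1)) (1 - q / N\<^sup>2)\<bar> * (q / N\<^sup>2 / N\<^sup>2)"
        by (simp add: abs_divide)
      also have "\<dots> \<le> B2 * 1"
      proof (intro mult_mono B2 t)
        have "q / N\<^sup>2 \<le> 1" using True N2 by (simp add: divide_le_eq)
        from frac_le[OF zero_le_one this zero_less_one N2] show "q / N\<^sup>2 / N\<^sup>2 \<le> 1" by simp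
      qed (use q B2 in auto)
      finally show ?thesis by simp
    next
      case False
      moreover have "N\<^sup>2 > 0" using N2 by linarith
      ultimately have "1 - q / N\<^sup>2 \<le> 0" by (simp add: pos_le_divide_eq del: zero_less_power2)
      then show ?thesis using B2 by (simp add: bump_eq_0)
    qed
    have b0: "\<bar>bump (1 - q / N\<^sup>2)\<bar> \<le> 1" by simp
    have p1: "(1 + q) powr (- m - 1) * (1 + q) = P"
      using q by (simp add: P_def powr_diff)
    have p1': "(1 + q) powr (- m - 1) \<le> P"
      unfolding P_def using q by (intro powr_mono) auto
    have p1q: "(1 + q) powr (- m - 1) * q \<le> P"
      unfolding p1[symmetric] using q by (intro mult_left_mono) auto
    have p2: "(1 + q) powr (- m - 2) \<le> (1 + q) powr (- m - 1)"
      using q by (intro powr_mono) auto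
    have p2q: "(1 + q) powr (- m - 2) * q \<le> P"
      using mult_right_mono[OF p2 q] p1q by linarith
    define c0 where "c0 = bump (1 - q / N\<^sup>2)"
    define c1 where "c1 = bump_poly (bump_step 1) (1 - q / N\<^sup>2) / N\<^sup>2"
    define c2 where "c2 = bump_poly (bump_step (bump_step 1)) (1 - q / N\<^sup>2) / N\<^sup>2 / N\<^sup>2"
    define P1 where "P1 = (1 + q) powr (- m - 1)"
    define P2 where "P2 = (1 + q) powr (- m - 2)"
    have P12: "P1 \<ge> 0" "P2 \<ge> 0" by (auto simp: P1_def P2_def)
    have "\<bar>rad' m N q\<bar> \<le> \<bar>c1\<bar> * P + m * \<bar>c0\<bar> * P1"
      unfolding rad'_def c0_def[symmetric] c1_def[symmetric] P_def[symmetric] P1_def[symmetric]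
      using abs_triangle_ineq4[of "- (c1 * P)" "m * c0 * P1"] P P12 m by (simp add: abs_mult)
    also have "\<dots> \<le> B1 * P + m * 1 * P"
      using b1 b0 p1' P P12 m B1 unfolding c1_def[symmetric] c0_def[symmetric] P1_def[symmetric]
      by (intro add_mono mult_mono order_refl) auto
    also have "\<dots> = (B1 + m) * P" by (simp add: algebra_simps)
    also have "\<dots> \<le> A * P" unfolding A_def using m B1 B2 P by (intro mult_right_mono) auto
    finally show "\<bar>rad' m N q\<bar> \<le> A * (1 + q) powr - m" by (simp add: P_def)
    have "\<bar>rad'' m N q\<bar> \<le> \<bar>c2\<bar> * P + 2 * m * \<bar>c1\<bar> * P1 + m * (m + 1) * \<bar>c0\<bar> * P2"
      unfolding rad''_def c0_def[symmetric] c1_def[symmetric] c2_def[symmetric] P_def[symmetric] P1_def[symmetric] P2_def[symmetric]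
      using P P12 m by (intro order_trans[OF abs_triangle_ineq] add_mono) (auto simp: abs_mult)
    then have "\<bar>rad'' m N q\<bar> * q \<le> (\<bar>c2\<bar> * P + 2 * m * \<bar>c1\<bar> * P1 + m * (m + 1) * \<bar>c0\<bar> * P2) * q"
      using q by (rule mult_right_mono)
    also have "\<dots> = (\<bar>c2\<bar> * q) * P + 2 * m * \<bar>c1\<bar> * (P1 * q) + m * (m + 1) * \<bar>c0\<bar> * (P2 * q)"
      by (simp add: algebra_simps)
    also have "\<dots> \<le> B2 * P + 2 * m * B1 * P + m * (m + 1) * 1 * P"
      using b0 b1 b2 p1q p2q P P12 m B1 B2 q
      unfolding c0_def[symmetric] c1_def[symmetric] c2_def[symmetric] P1_def[symmetric] P2_def[symmetric]
      by (intro add_mono mult_mono order_refl) auto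
    also have "\<dots> = (B2 + 2 * m * B1 + m * (m + 1)) * P" by (simp add: algebra_simps)
    also have "\<dots> \<le> A * P" unfolding A_def using m B1 B2 P by (intro mult_right_mono) auto
    finally show "\<bar>rad'' m N q\<bar> * q \<le> A * (1 + q) powr - m" by (simp add: P_def)
  qed
  moreover have "A \<ge> 0" unfolding A_def using m B1 B2 by (intro add_nonneg_nonneg mult_nonneg_nonneg) auto
  ultimately show ?thesis by blast
qed

context
  fixes m N :: real and x y :: "'a::euclidean_space"
begin

text \<open>First derivative of the truncated weight along the line through \<open>x\<close> in
  direction \<open>y\<close>; \<open>ln2\<close> is the second one. Restrictions to lines are all
  that the Laplacian and the second differences require.\<close>

definition ln1 :: "real \<Rightarrow> real" where
  "ln1 \<tau> = rad' m N ((norm (x + \<tau> *\<^sub>R y))\<^sup>2) * (2 * ((x + \<tau> *\<^sub>R y) \<bullet> y))"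

definition ln2 :: "real \<Rightarrow> real" where
  "ln2 \<tau> = rad'' m N ((norm (x + \<tau> *\<^sub>R y))\<^sup>2) * (2 * ((x + \<tau> *\<^sub>R y) \<bullet> y)) * (2 * ((x + \<tau> *\<^sub>R y) \<bullet> y))
     + 2 * (y \<bullet> y) * rad' m N ((norm (x + \<tau> *\<^sub>R y))\<^sup>2)"

lemma psi_eq_rad: "psi m N z = rad m N ((norm z)\<^sup>2)"
  by (simp add: psi_def rad_def wgt_def)

lemma norm_sq_line_deriv:
  "((\<lambda>\<tau>. (norm (x + \<tau> *\<^sub>R y))\<^sup>2) has_real_derivative 2 * ((x + \<tau> *\<^sub>R y) \<bullet> y)) (at \<tau>)"
proof -
  have "(\<lambda>\<tau>. (norm (x + \<tau> *\<^sub>R y))\<^sup>2) = (\<lambda>\<tau>. x \<bullet> x + 2 * \<tau> * (x \<bullet> y) + \<tau>\<^sup>2 * (y \<bullet> y))"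
    by (simp only: power2_norm_eq_inner) (simp add: fun_eq_iff inner_simps inner_commute algebra_simps power2_eq_square)
  then show ?thesis
    by (auto intro!: derivative_eq_intros simp: inner_simps algebra_simps)
qed

lemma psi_line_deriv: "((\<lambda>\<tau>. psi m N (x + \<tau> *\<^sub>R y)) has_real_derivative ln1 \<tau>) (at \<tau>)"
  unfolding psi_eq_rad ln1_def
  by (intro DERIV_chain2[OF rad_deriv norm_sq_line_deriv]) (smt (verit) zero_le_power2)

lemma psi_line_deriv2: "(ln1 has_real_derivative ln2 \<tau>) (at \<tau>)"
proof -
  have 1: "((\<lambda>\<tau>. rad' m N ((norm (x + \<tau> *\<^sub>R y))\<^sup>2)) has_real_derivative
     rad'' m N ((norm (x + \<tau> *\<^sub>R y))\<^sup>2) * (2 * ((x + \<tau> *\<^sub>R y) \<bullet> y))) (at \<tau>)"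
    by (intro DERIV_chain2[OF rad'_deriv norm_sq_line_deriv]) (smt (verit) zero_le_power2)
  have 2: "((\<lambda>\<tau>. 2 * ((x + \<tau> *\<^sub>R y) \<bullet> y)) has_real_derivative 2 * (y \<bullet> y)) (at \<tau>)"
    by (auto intro!: derivative_eq_intros simp: inner_add_left)
  show ?thesis
    unfolding ln1_def[abs_def] ln2_def by (rule DERIV_mult[OF 1 2])
qed

text \<open>The second derivative of the profile is multiplied by (z . y)^2, and by Cauchy-Schwarz
  this is at most |z|^2 |y|^2; the factor |z|^2 is the q of the hypothesis. The two terms contribute
  4 and 2 to the constant 6.\<close>

lemma ln2_bound:
  assumes A: "\<And>q. q \<ge> 0 \<Longrightarrow> \<bar>rad' m N q\<bar> \<le> A * (1 + q) powr - m \<and> \<bar>rad'' m N q\<bar> * q \<le> A * (1 + q) powr - m"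
  shows "\<bar>ln2 \<tau>\<bar> \<le> 6 * A * (norm y)\<^sup>2 * wgt m (x + \<tau> *\<^sub>R y)"
proof -
  define z where "z = x + \<tau> *\<^sub>R y"
  have "\<bar>z \<bullet> y\<bar> \<le> norm z * norm y" by (rule Cauchy_Schwarz_ineq2)
  then have "\<bar>z \<bullet> y\<bar>\<^sup>2 \<le> (norm z * norm y)\<^sup>2" by (rule power_mono) simp
  then have zy: "(z \<bullet> y)\<^sup>2 \<le> (norm z)\<^sup>2 * (norm y)\<^sup>2" by (simp add: power_mult_distrib)
  have "\<bar>ln2 \<tau>\<bar> \<le> \<bar>rad'' m N ((norm z)\<^sup>2)\<bar> * (4 * (z \<bullet> y)\<^sup>2) + 2 * (norm y)\<^sup>2 * \<bar>rad' m N ((norm z)\<^sup>2)\<bar>"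
    unfolding ln2_def z_def[symmetric]
    by (intro order_trans[OF abs_triangle_ineq] add_mono) (simp_all add: abs_mult power2_eq_square power2_norm_eq_inner flip: power2_norm_eq_inner)
  also have "\<dots> \<le> \<bar>rad'' m N ((norm z)\<^sup>2)\<bar> * (4 * ((norm z)\<^sup>2 * (norm y)\<^sup>2)) + 2 * (norm y)\<^sup>2 * \<bar>rad' m N ((norm z)\<^sup>2)\<bar>"
    by (intro add_mono mult_left_mono zy order_refl) auto
  also have "\<dots> = 4 * (norm y)\<^sup>2 * (\<bar>rad'' m N ((norm z)\<^sup>2)\<bar> * (norm z)\<^sup>2) + 2 * (norm y)\<^sup>2 * \<bar>rad' m N ((norm z)\<^sup>2)\<bar>"
    by simp
  also have "\<dots> \<le> 4 * (norm y)\<^sup>2 * (A * wgt m z) + 2 * (norm y)\<^sup>2 * (A * wgt m z)"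
    unfolding wgt_def by (intro add_mono mult_left_mono) (use A[of "(norm z)\<^sup>2"] in auto)
  also have "\<dots> = 6 * A * (norm y)\<^sup>2 * wgt m z" by (simp add: algebra_simps)
  finally show ?thesis by (simp add: z_def)
qed

end

text \<open>The mean value theorem is applied on both sides of x and then once more between the two
  intermediate points, whose distance is at most 2. The final point lies within distance |z| \<le> 1
  of x, so its weight is compared with \<open>wgt m x\<close> at the cost of 3 powr m.\<close>

lemma psi_second_diff:
  fixes x z :: "'a::euclidean_space"
  assumes A: "\<And>q. q \<ge> 0 \<Longrightarrow> \<bar>rad' m N q\<bar> \<le> A * (1 + q) powr - m \<and> \<bar>rad'' m N q\<bar> * q \<le> A * (1 + q) powr - m"
    and m: "m \<ge> 0" and z: "norm z \<le> 1" and A0: "A \<ge> 0"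
  shows "\<bar>second_diff (psi m N) x z\<bar> \<le> 12 * A * 3 powr m * wgt m x * (norm z)\<^sup>2"
proof -
  define f where "f \<tau> = psi m N (x + \<tau> *\<^sub>R z)" for \<tau>
  have df: "(f has_real_derivative ln1 m N x z \<tau>) (at \<tau>)" for \<tau>
    unfolding f_def by (rule psi_line_deriv)
  obtain \<xi> where \<xi>: "0 < \<xi>" "\<xi> < 1" "f 1 - f 0 = (1 - 0) * ln1 m N x z \<xi>"
    using MVT2[of 0 1 f "ln1 m N x z"] df by auto
  obtain \<eta> where \<eta>: "-1 < \<eta>" "\<eta> < 0" "f 0 - f (-1) = (0 - (-1)) * ln1 m N x z \<eta>"
    using MVT2[of "-1" 0 f "ln1 m N x z"] df by auto
  obtain \<zeta> where \<zeta>: "\<eta> < \<zeta>" "\<zeta> < \<xi>" "ln1 m N x z \<xi> - ln1 m N x z \<eta> = (\<xi> - \<eta>) * ln2 m N x z \<zeta>"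
    using MVT2[of \<eta> \<xi> "ln1 m N x z" "ln2 m N x z"] psi_line_deriv2 \<xi> \<eta> by (metis less_trans)
  have "second_diff (psi m N) x z = - ((\<xi> - \<eta>) * ln2 m N x z \<zeta>)"
    using \<xi> \<eta> \<zeta> unfolding second_diff_def f_def by simp
  then have "\<bar>second_diff (psi m N) x z\<bar> = (\<xi> - \<eta>) * \<bar>ln2 m N x z \<zeta>\<bar>"
    using \<xi> \<eta> by (simp add: abs_mult)
  also have "\<dots> \<le> 2 * (6 * A * (norm z)\<^sup>2 * wgt m (x + \<zeta> *\<^sub>R z))"
    using \<xi> \<eta> by (intro mult_mono ln2_bound A) auto
  also have "\<dots> \<le> 2 * (6 * A * (norm z)\<^sup>2 * (3 powr m * wgt m x))"
  proof (intro mult_left_mono wgt_shift_le m)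
    have "\<bar>\<zeta>\<bar> \<le> 1" using \<xi> \<eta> \<zeta> by linarith
    then show "norm (\<zeta> *\<^sub>R z) \<le> 1" using z by (simp add: mult_le_one)
  qed (use A0 in auto)
  finally show ?thesis by (simp add: algebra_simps)
qed

lemma laplacian_psi:
  fixes x :: "'a::euclidean_space"
  shows "laplacian (\<lambda>y. c * psi m N (y /\<^sub>R R)) x = c * (\<Sum>i\<in>Basis. ln2 m N (x /\<^sub>R R) (i /\<^sub>R R) 0)"
proof -
  have "(deriv ^^ 2) (\<lambda>h. c * psi m N ((x + h *\<^sub>R i) /\<^sub>R R)) 0 = c * ln2 m N (x /\<^sub>R R) (i /\<^sub>R R) 0" for i
  proof -
    have "(\<lambda>h. c * psi m N ((x + h *\<^sub>R i) /\<^sub>R R)) = (\<lambda>h. c * psi m N (x /\<^sub>R R + h *\<^sub>R (i /\<^sub>R R)))"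
      by (simp add: scaleR_add_right mult.commute)
    moreover have "deriv (\<lambda>h. c * psi m N (x /\<^sub>R R + h *\<^sub>R (i /\<^sub>R R))) = (\<lambda>h. c * ln1 m N (x /\<^sub>R R) (i /\<^sub>R R) h)"
      by (intro ext DERIV_imp_deriv DERIV_cmult psi_line_deriv)
    moreover have "deriv (\<lambda>h. c * ln1 m N (x /\<^sub>R R) (i /\<^sub>R R) h) 0 = c * ln2 m N (x /\<^sub>R R) (i /\<^sub>R R) 0"
      by (intro DERIV_imp_deriv DERIV_cmult psi_line_deriv2)
    ultimately show ?thesis by (simp add: numeral_2_eq_2)
  qed
  then show ?thesis unfolding laplacian_def by (simp add: sum_distrib_left)
qed

text \<open>The fractional part scales exactly like R powr (- 2 s). The Laplacian scales like 1 /
  R^2, which is no larger since R \<ge> 1 and s < 1, so the local term is dominated. The scalar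
  \<open>c\<close> is the value of the time cut-off at a fixed time.\<close>

lemma mixed_op_psi_bound:
  fixes a b s m :: real
  assumes s: "0 < s" "s < 1" and m: "m = (real DIM('a::euclidean_space) + 2 * s) / 2"
  shows "\<exists>C\<ge>0. \<forall>N\<ge>1. \<forall>R\<ge>1. \<forall>c. \<forall>x::'a.
    \<bar>mixed_op a b s (\<lambda>y. c * psi m N (y /\<^sub>R R)) x\<bar> \<le> \<bar>c\<bar> * (C * R powr - (2 * s) * wgt m (x /\<^sub>R R))"
proof -
  have m': "m \<ge> 0" "2 * m > real DIM('a)" using s by (auto simp: m)
  obtain A where A0: "A \<ge> 0" and A: "\<And>N q. N \<ge> 1 \<Longrightarrow> q \<ge> 0 \<Longrightarrow>
     \<bar>rad' m N q\<bar> \<le> A * (1 + q) powr - m \<and> \<bar>rad'' m N q\<bar> * q \<le> A * (1 + q) powr - m"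
    using rad_bounds[OF m'(1)] by blast
  define A' where "A' = 12 * A * 3 powr m"
  have A'0: "A' \<ge> 0" using A0 by (simp add: A'_def)
  obtain K where K0: "K \<ge> 0" and K: "\<And>v x::'a. v \<in> borel_measurable borel \<Longrightarrow> (\<forall>y. \<bar>v y\<bar> \<le> wgt m y) \<Longrightarrow>
     (\<forall>z. norm z \<le> 1 \<longrightarrow> \<bar>second_diff v x z\<bar> \<le> A' * wgt m x * (norm z)\<^sup>2) \<Longrightarrow>
     \<bar>LINT z|lborel. second_diff v x z / norm z powr (real DIM('a) + 2 * s)\<bar> \<le> K * wgt m x"
    using second_diff_integral_le[OF s m A'0] by blast
  define k where "k = frac_laplacian_const (real DIM('a)) s / 2"
  have k: "k \<ge> 0" using frac_laplacian_const_pos[OF s, of "real DIM('a)"] by (simp add: k_def)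
  define C where "C = \<bar>a\<bar> * (real DIM('a) * (6 * A)) + \<bar>b\<bar> * (k * K)"
  have C0: "C \<ge> 0" unfolding C_def using A0 K0 k by (intro add_nonneg_nonneg mult_nonneg_nonneg) auto
  have "\<bar>mixed_op a b s (\<lambda>y. c * psi m N (y /\<^sub>R R)) x\<bar> \<le> \<bar>c\<bar> * (C * R powr - (2 * s) * wgt m (x /\<^sub>R R))"
    if N: "N \<ge> 1" and R: "R \<ge> 1" for N R c and x :: 'a
  proof -
    define w where "w = wgt m (x /\<^sub>R R)"
    have w: "w \<ge> 0" by (simp add: w_def)
    have sd: "\<bar>second_diff (psi m N) x z\<bar> \<le> A' * wgt m x * (norm z)\<^sup>2" if "norm z \<le> 1" for z x :: 'a
      unfolding A'_def by (rule psi_second_diff[OF A[OF N] m'(1) that A0])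
    have B: "\<bar>psi m N y\<bar> \<le> 1" for y :: 'a
      using abs_psi_le_wgt[of m N y] wgt_le_1[OF m'(1), of y] by linarith
    have fl: "frac_laplacian s (\<lambda>y. c * psi m N (y /\<^sub>R R)) x = c * (R powr - (2 * s) * frac_laplacian s (psi m N) (x /\<^sub>R R))"
    proof -
      note sc = frac_laplacian_scale[OF s R borel_measurable_psi B sd]
      have "frac_laplacian s (\<lambda>y. c * psi m N (y /\<^sub>R R)) x = c * frac_laplacian s (\<lambda>y. psi m N (y /\<^sub>R R)) x"
        by (rule frac_laplacian_cmult[OF s _ B sc(2)]) measurable
      then show ?thesis by (simp only: sc(1))
    qed
    have "\<bar>frac_laplacian s (psi m N) (x /\<^sub>R R)\<bar> = k * \<bar>LINT z|lborel. second_diff (psi m N) (x /\<^sub>R R) z / norm z powr (real DIM('a) + 2 * s)\<bar>"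
      using k by (subst frac_laplacian_eq[OF s borel_measurable_psi B sd]) (auto simp: k_def abs_mult)
    also have "\<dots> \<le> k * (K * w)"
      unfolding w_def by (intro mult_left_mono K k) (auto simp: psi_le_wgt sd)
    finally have fl2: "\<bar>frac_laplacian s (\<lambda>y. c * psi m N (y /\<^sub>R R)) x\<bar> \<le> \<bar>c\<bar> * (R powr - (2 * s) * (k * (K * w)))"
      unfolding fl by (simp add: abs_mult mult_left_mono)
    have "\<bar>\<Sum>i\<in>Basis. ln2 m N (x /\<^sub>R R) (i /\<^sub>R R) 0\<bar> \<le> (\<Sum>i\<in>(Basis::'a set). 6 * A * (R powr - (2 * s)) * w)"
    proof (intro order_trans[OF sum_abs] sum_mono)
      fix i :: 'a assume i: "i \<in> Basis"
      have "\<bar>ln2 m N (x /\<^sub>R R) (i /\<^sub>R R) 0\<bar> \<le> 6 * A * (norm (i /\<^sub>R R))\<^sup>2 * wgt m (x /\<^sub>R R + 0 *\<^sub>R (i /\<^sub>R R))"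
        by (rule ln2_bound[OF A[OF N]])
      also have "\<dots> = 6 * A * R powr - 2 * w"
        using i R by (simp add: w_def power_divide powr_minus powr_numeral field_simps)
      also have "\<dots> \<le> 6 * A * (R powr - (2 * s)) * w"
        using A0 R s w by (intro mult_right_mono mult_left_mono powr_mono) auto
      finally show "\<bar>ln2 m N (x /\<^sub>R R) (i /\<^sub>R R) 0\<bar> \<le> 6 * A * (R powr - (2 * s)) * w" .
    qed
    then have lap: "\<bar>laplacian (\<lambda>y. c * psi m N (y /\<^sub>R R)) x\<bar> \<le> \<bar>c\<bar> * (real DIM('a) * (6 * A * (R powr - (2 * s)) * w))"
      unfolding laplacian_psi by (simp add: abs_mult mult_left_mono)
    have "\<bar>mixed_op a b s (\<lambda>y. c * psi m N (y /\<^sub>R R)) x\<bar> \<le>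
      \<bar>a\<bar> * \<bar>laplacian (\<lambda>y. c * psi m N (y /\<^sub>R R)) x\<bar> + \<bar>b\<bar> * \<bar>frac_laplacian s (\<lambda>y. c * psi m N (y /\<^sub>R R)) x\<bar>"
      unfolding mixed_op_def by (intro order_trans[OF abs_triangle_ineq]) (simp add: abs_mult)
    also have "\<dots> \<le> \<bar>a\<bar> * (\<bar>c\<bar> * (real DIM('a) * (6 * A * (R powr - (2 * s)) * w))) + \<bar>b\<bar> * (\<bar>c\<bar> * (R powr - (2 * s) * (k * (K * w))))"
      by (intro add_mono mult_left_mono lap fl2) auto
    also have "\<dots> = \<bar>c\<bar> * (C * R powr - (2 * s) * w)"
      by (simp add: C_def algebra_simps)
    finally show ?thesis by (simp add: w_def)
  qed
  then show ?thesis using C0 by blast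
qed

lemma integral_psi_pos:
  assumes "2 * m > real DIM('a::euclidean_space)" "m \<ge> 0"
  shows "(LINT x::'a|lborel. psi m 1 x) > 0"
proof -
  define c where "c = bump (3 / 4) * 2 powr - m"
  have c: "c > 0" by (simp add: c_def bump_pos)
  have "0 < c * measure lborel (cball (0::'a) (1 / 2))" using c by simp
  also have "\<dots> = (LINT x::'a|lborel. c * indicator (cball 0 (1/2)) x)" by simp
  also have "\<dots> \<le> (LINT x::'a|lborel. psi m 1 x)"
  proof (rule integral_mono)
    show "integrable lborel (\<lambda>x::'a. c * indicator (cball 0 (1/2)) x)"
      by (intro integrable_mult_right) (auto simp: emeasure_cball)
    show "integrable lborel (psi m 1 :: 'a \<Rightarrow> real)" by (intro integrable_psi assms)
    fix x :: 'a
    show "c * indicator (cball 0 (1/2)) x \<le> psi m 1 x"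
    proof (cases "norm x \<le> 1 / 2")
      case True
      then have "(norm x)\<^sup>2 \<le> (1 / 2)\<^sup>2" by (intro power_mono) auto
      then have n: "(norm x)\<^sup>2 \<le> 1 / 4" by (simp add: power2_eq_square)
      have "bump (3 / 4) * 2 powr - m \<le> bump (1 - (norm x)\<^sup>2 / 1\<^sup>2) * wgt m x"
        unfolding wgt_def using n assms(2) by (intro mult_mono bump_mono powr_mono2') auto
      then show ?thesis using True by (simp add: psi_def c_def)
    qed simp
  qed
  finally show ?thesis .
qed

text \<open>Away from the unit ball the function and its Laplacian vanish, and only the nonlocal
  term is left: minus the integral of psi(y) |x - y| powr (- d - 2 s). As y is confined to the unit
  ball, the kernel is comparable to \<open>wgt m x\<close>, and the remaining integral of psi is a
  positive constant.\<close>

lemma mixed_op_psi_far: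
  fixes a b s m :: real
  assumes s: "0 < s" "s < 1" and m: "m = (real DIM('a::euclidean_space) + 2 * s) / 2" and b: "b > 0"
  shows "\<exists>\<kappa>>0. \<forall>c\<ge>0. \<forall>x::'a. norm x \<ge> 2 \<longrightarrow> mixed_op a b s (\<lambda>y. c * psi m 1 y) x \<le> - (c * (\<kappa> * wgt m x))"
proof -
  have m': "m \<ge> 0" "2 * m > real DIM('a)" using s by (auto simp: m)
  obtain A where A0: "A \<ge> 0" and A: "\<And>q. q \<ge> 0 \<Longrightarrow>
     \<bar>rad' m 1 q\<bar> \<le> A * (1 + q) powr - m \<and> \<bar>rad'' m 1 q\<bar> * q \<le> A * (1 + q) powr - m"
    using rad_bounds[OF m'(1)] by blast
  define I where "I = (LINT x::'a|lborel. psi m 1 x)"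
  have I: "I > 0" unfolding I_def by (rule integral_psi_pos) (use m' in auto)
  define k where "k = frac_laplacian_const (real DIM('a)) s / 2"
  have k: "k > 0" using frac_laplacian_const_pos[OF s, of "real DIM('a)"] by (simp add: k_def)
  define \<kappa> where "\<kappa> = b * k * 2 powr - m * I"
  have "mixed_op a b s (\<lambda>y. c * psi m 1 y) x \<le> - (c * (\<kappa> * wgt m x))"
    if c: "c \<ge> 0" and x: "norm x \<ge> 2" for c and x :: 'a
  proof -
    have sd: "\<bar>second_diff (psi m 1) x z\<bar> \<le> (12 * A * 3 powr m * wgt m x) * (norm z)\<^sup>2" if "norm z \<le> 1" for z x :: 'a
      by (rule psi_second_diff[OF A m'(1) that A0])
    have B: "\<bar>psi m 1 y\<bar> \<le> 1" for y :: 'a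
      using abs_psi_le_wgt[of m 1 y] wgt_le_1[OF m'(1), of y] by linarith
    have "2\<^sup>2 \<le> (norm x)\<^sup>2" using x by (intro power_mono) auto
    then have far: "1 - (norm x)\<^sup>2 / 1\<^sup>2 \<le> 0" by simp
    have lap: "laplacian (\<lambda>y. c * psi m 1 y) x = 0"
      using laplacian_psi[of c m 1 1 x] far by (simp add: ln2_def rad'_def rad''_def bump_eq_0)
    have fl: "frac_laplacian s (\<lambda>y. c * psi m 1 y) x = c * frac_laplacian s (psi m 1) x"
      by (rule frac_laplacian_cmult[OF s borel_measurable_psi B sd])
    have "(LINT z|lborel. second_diff (psi m 1) x z / norm z powr (real DIM('a) + 2 * s)) \<le>
      (LINT z|lborel. - (2 powr - m * wgt m x * psi m 1 (x + z)))"
    proof (rule integral_mono)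
      show "integrable lborel (\<lambda>z. second_diff (psi m 1) x z / norm z powr (real DIM('a) + 2 * s))"
        by (rule integrable_second_diff[OF s borel_measurable_psi B sd])
      show "integrable lborel (\<lambda>z. - (2 powr - m * wgt m x * psi m 1 (x + z)))"
        using integrable_psi[OF m'(2), of 1] by (simp add: integrable_lborel_plus_iff)
      fix z :: 'a
      have p0: "psi m 1 x = 0" using x by (intro psi_eq_0) auto
      have *: "psi m 1 (x + z) * (2 powr - m * wgt m x) \<le> psi m 1 (x + z) * norm z powr - (2 * m)"
      proof (cases "norm (x + z) \<ge> 1")
        case True
        then show ?thesis by (simp add: psi_eq_0)
      next
        case False
        have z: "norm z > 0" using x False by auto
        have "(norm z)\<^sup>2 \<le> 2 * (norm (x + z))\<^sup>2 + 2 * (norm x)\<^sup>2"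
          using norm_add_sq_le[of "x + z" "- x"] by simp
        moreover have "(norm (x + z))\<^sup>2 \<le> 1" using False by (simp add: power_le_one)
        ultimately have "(norm z)\<^sup>2 \<le> 2 * (1 + (norm x)\<^sup>2)" by argo
        then have "wgt m x \<le> 2 powr m * ((norm z)\<^sup>2) powr - m"
          unfolding wgt_def using z m' by (intro powr_neg_le_scaled) auto
        moreover have "((norm z)\<^sup>2) powr - m = norm z powr (2 * - m)"
          using z by (subst powr_powr[symmetric]) (simp add: powr_numeral)
        ultimately have "2 powr - m * wgt m x \<le> norm z powr - (2 * m)"
          by (simp add: powr_minus field_simps)
        then show ?thesis by (rule mult_left_mono) simp
      qed
      have "second_diff (psi m 1) x z / norm z powr (real DIM('a) + 2 * s) =
        - ((psi m 1 (x + z) + psi m 1 (x - z)) * norm z powr - (2 * m))"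
      proof -
        have D: "real DIM('a) + 2 * s = 2 * m" by (simp add: m)
        show ?thesis unfolding second_diff_def p0 D
          by (simp add: powr_minus_divide add_divide_distrib diff_divide_distrib)
      qed
      \<comment> \<open>The reflected term has the same sign and is dropped; this halves the
        constant but leaves a single translated integral.\<close>
      also have "\<dots> \<le> - (psi m 1 (x + z) * norm z powr - (2 * m))"
        by (simp add: distrib_right)
      finally show "second_diff (psi m 1) x z / norm z powr (real DIM('a) + 2 * s) \<le> - (2 powr - m * wgt m x * psi m 1 (x + z))"
        using * by (simp add: mult.commute)
    qed
    also have "\<dots> = - (2 powr - m * wgt m x * I)"
      by (simp add: integral_lborel_plus I_def)
    finally have "k * (LINT z|lborel. second_diff (psi m 1) x z / norm z powr (real DIM('a) + 2 * s)) \<le> k * - (2 powr - m * wgt m x * I)"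
      using k by (intro mult_left_mono) auto
    then have "frac_laplacian s (psi m 1) x \<le> k * - (2 powr - m * wgt m x * I)"
      by (subst frac_laplacian_eq[OF s borel_measurable_psi B sd]) (auto simp: k_def)
    then have "b * (c * frac_laplacian s (psi m 1) x) \<le> b * (c * (k * - (2 powr - m * wgt m x * I)))"
      using b c by (intro mult_left_mono) auto
    then show ?thesis
      unfolding mixed_op_def lap fl \<kappa>_def by (simp add: mult_ac)
  qed
  moreover have "\<kappa> > 0" using b k I by (simp add: \<kappa>_def)
  ultimately show ?thesis by blast
qed

section \<open>Admissible test functions in space-time\<close>

lemma C_k_psi:
  fixes L :: "'b::euclidean_space \<Rightarrow> 'a::euclidean_space"
  assumes L: "bounded_linear L"
  shows "C_k k (\<lambda>z. psi m N (L z))"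
proof -
  have *: "C_k k (\<lambda>z. (norm (L z))\<^sup>2)" for k by (rule C_k_inner_self[OF L])
  have "C_k k (\<lambda>z. 1 + - (1 / N\<^sup>2) * (norm (L z))\<^sup>2)" for k
    by (intro C_k_add C_k_mult C_k_const *)
  then have "C_k k (\<lambda>z. bump (1 + - (1 / N\<^sup>2) * (norm (L z))\<^sup>2))" for k
    by (rule C_k_bump)
  moreover have "C_k k (\<lambda>z. (1 + (norm (L z))\<^sup>2) powr - m)" for k
    by (rule C_k_powr) (auto intro: C_k_add C_k_const *)
  ultimately show ?thesis
    unfolding psi_def wgt_def using C_k_mult[of k "\<lambda>z. bump (1 + - (1 / N\<^sup>2) * (norm (L z))\<^sup>2)"] by simp
qed

text \<open>The time factor depends on t^2, which provides a smooth extension to negative times with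
  compact support. At t = 0 it equals \<open>bump 1\<close>, so the initial datum stays in the weak
  identity.\<close>

definition testfn :: "real \<Rightarrow> real \<Rightarrow> real \<Rightarrow> real \<Rightarrow> real \<times> 'a::euclidean_space \<Rightarrow> real"
  where "testfn m T N R = (\<lambda>(t, x). bump (1 - t\<^sup>2 / T\<^sup>2) * psi m N (x /\<^sub>R R))"

lemma testfn_test_function:
  assumes T: "T > 0" and N: "N > 0" and R: "R > 0"
  shows "(testfn m T N R :: real \<times> 'a::euclidean_space \<Rightarrow> real) \<in> test_functions"
proof -
  have "C_k k (testfn m T N R :: real \<times> 'a \<Rightarrow> real)" for k
  proof -
    have "C_k k (\<lambda>z::real \<times> 'a. 1 + - (1 / T\<^sup>2) * (norm (fst z))\<^sup>2)" for k
      by (intro C_k_add C_k_mult C_k_const C_k_inner_self bounded_linear_fst)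
    then have "C_k k (\<lambda>z::real \<times> 'a. bump (1 + - (1 / T\<^sup>2) * (norm (fst z))\<^sup>2))"
      by (rule C_k_bump)
    moreover have "C_k k (\<lambda>z::real \<times> 'a. psi m N (snd z /\<^sub>R R))"
      by (intro C_k_psi bounded_linear_compose[OF bounded_linear_scaleR_right bounded_linear_snd])
    ultimately have "C_k k (\<lambda>z::real \<times> 'a. bump (1 + - (1 / T\<^sup>2) * (norm (fst z))\<^sup>2) * psi m N (snd z /\<^sub>R R))"
      by (rule C_k_mult)
    then show ?thesis by (simp add: testfn_def case_prod_unfold)
  qed
  moreover have "testfn m T N R z = 0" if z: "z \<notin> {-T..T} \<times> cball 0 (N * R)" for z :: "real \<times> 'a"
  proof (cases z)
    case (Pair t x)
    consider "\<bar>t\<bar> > T" | "norm x > N * R" using z Pair by force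
    then show ?thesis
    proof cases
      case 1
      then have "T\<^sup>2 \<le> \<bar>t\<bar>\<^sup>2" using T by (intro power_mono) auto
      then have "1 - t\<^sup>2 / T\<^sup>2 \<le> 0" using T by (simp add: le_divide_eq)
      then show ?thesis by (simp add: Pair testfn_def bump_eq_0)
    next
      case 2
      then have "psi m N (x /\<^sub>R R) = 0"
        using N R by (intro psi_eq_0) (auto simp: field_simps)
      then show ?thesis by (simp add: Pair testfn_def)
    qed
  qed
  moreover have "compact ({-T..T} \<times> cball (0::'a) (N * R))" by (intro compact_Times) auto
  ultimately show ?thesis unfolding test_functions_def by blast
qed

section \<open>Nonexistence of global weak solutions\<close>

lemma
  fixes g :: "'a::euclidean_space \<Rightarrow> real" and h :: "'b::euclidean_space \<Rightarrow> real"
  assumes g: "integrable lborel g" and h: "integrable lborel h"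
  shows integrable_lborel_prod: "integrable lborel (\<lambda>(t, x). g t * h x)"
    and integral_lborel_prod: "(LINT z|lborel. (case z of (t, x) \<Rightarrow> g t * h x)) = (LINT t|lborel. g t) * (LINT x|lborel. h x)"
proof -
  have [measurable]: "g \<in> borel_measurable borel" "h \<in> borel_measurable borel" using g h by auto
  have *: "integrable (lborel \<Otimes>\<^sub>M lborel) (\<lambda>(t, x). g t * h x)"
  proof (rule lborel_pair.Fubini_integrable)
    show "integrable lborel (\<lambda>t. LINT x|lborel. norm (case (t, x) of (t, x) \<Rightarrow> g t * h x))"
      using g by (simp add: abs_mult)
    show "AE t in lborel. integrable lborel (\<lambda>x. case (t, x) of (t, x) \<Rightarrow> g t * h x)"
      using h by simp
  qed measurable
  then show "integrable lborel (\<lambda>(t, x). g t * h x)" by (simp add: lborel_prod)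
  have "(LINT z|(lborel \<Otimes>\<^sub>M lborel). (case z of (t, x) \<Rightarrow> g t * h x)) = (LINT t|lborel. LINT x|lborel. g t * h x)"
    using lborel_pair.integral_fst'[OF *] by simp
  then show "(LINT z|lborel. (case z of (t, x) \<Rightarrow> g t * h x)) = (LINT t|lborel. g t) * (LINT x|lborel. h x)"
    by (simp add: lborel_prod)
qed

text \<open>The weak formulation integrates against \<open>lebesgue\<close>, Fubini is applied to
  \<open>lborel\<close>; the two integrals agree on Borel functions.\<close>

lemma
  fixes g :: "'a::euclidean_space \<Rightarrow> real" and h :: "'b::euclidean_space \<Rightarrow> real"
  assumes g: "integrable lborel g" and h: "integrable lborel h"
  shows integrable_lebesgue_prod: "integrable lebesgue (\<lambda>(t, x). g t * h x)"
    and integral_lebesgue_prod: "(LINT z|lebesgue. (case z of (t, x) \<Rightarrow> g t * h x)) = (LINT t|lborel. g t) * (LINT x|lborel. h x)"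
proof -
  have m: "(\<lambda>(t, x). g t * h x) \<in> borel_measurable lborel"
    using integrable_lborel_prod[OF g h] by auto
  show "integrable lebesgue (\<lambda>(t, x). g t * h x)"
    using integrable_lborel_prod[OF g h] m by (simp add: integrable_completion)
  show "(LINT z|lebesgue. (case z of (t, x) \<Rightarrow> g t * h x)) = (LINT t|lborel. g t) * (LINT x|lborel. h x)"
    using integral_lborel_prod[OF g h] m by (simp add: integral_completion)
qed

lemma C0_bounded:
  fixes f :: "'a::euclidean_space \<Rightarrow> real"
  assumes "f \<in> C0"
  shows "\<exists>B\<ge>0. \<forall>x. \<bar>f x\<bar> \<le> B"
proof -
  have c: "continuous_on UNIV f" and l: "(f \<longlongrightarrow> 0) at_infinity" using assms by (auto simp: C0_def)
  have "eventually (\<lambda>x. dist (f x) 0 < 1) at_infinity" using l by (rule tendstoD) simp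
  then obtain r where r: "\<And>x. r \<le> norm x \<Longrightarrow> \<bar>f x\<bar> < 1" by (auto simp: eventually_at_infinity)
  have "compact (f ` cball 0 r)" by (intro compact_continuous_image continuous_on_subset[OF c]) auto
  then obtain B where B: "\<forall>x\<in>cball 0 r. \<bar>f x\<bar> \<le> B"
    by (auto dest!: compact_imp_bounded simp: bounded_real)
  have "\<bar>f x\<bar> \<le> max 1 B" for x
  proof (cases "norm x \<le> r")
    case True
    then have "\<bar>f x\<bar> \<le> B" using B by simp
    then show ?thesis by simp
  qed (use r[of x] in simp)
  then show ?thesis by (intro exI[of _ "max 1 B"]) auto
qed

lemma C0_borel: "f \<in> C0 \<Longrightarrow> f \<in> borel_measurable borel"
  by (auto simp: C0_def intro: borel_measurable_continuous_onI)

text \<open>Splitting at A = e Y powr (p - 1) replaces the optimal form of Young's inequality: below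
  it the first summand alone suffices, above it Y is at most (A / e) powr (1 / (p - 1)) and the
  second summand alone suffices.\<close>

lemma young_absorb:
  fixes p e A Y :: real
  assumes p: "p > 1" and e: "e > 0" and A: "A \<ge> 0" and Y: "Y \<ge> 0"
  shows "A * Y \<le> e * Y powr p + (1 / e) powr (1 / (p - 1)) * A powr (p / (p - 1))"
proof (cases "A \<le> e * Y powr (p - 1)")
  case True
  have "A * Y \<le> (e * Y powr (p - 1)) * Y" using True Y by (rule mult_right_mono)
  also have "\<dots> = e * Y powr p" using Y by (cases "Y = 0") (auto simp: powr_diff)
  also have "\<dots> \<le> e * Y powr p + (1 / e) powr (1 / (p - 1)) * A powr (p / (p - 1))" by simp
  finally show ?thesis .
next
  case False
  then have A0: "A > 0" using e A by (smt (verit) mult_nonneg_nonneg powr_ge_zero)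
  have "Y powr (p - 1) \<le> (1 / e) * A" using False e by (simp add: field_simps)
  then have "(Y powr (p - 1)) powr (1 / (p - 1)) \<le> ((1 / e) * A) powr (1 / (p - 1))"
    using p by (intro powr_mono2) auto
  moreover have "(Y powr (p - 1)) powr (1 / (p - 1)) = Y"
    using p Y by (simp add: powr_powr)
  ultimately have "Y \<le> (1 / e) powr (1 / (p - 1)) * A powr (1 / (p - 1))"
    by (simp only: powr_mult)
  then have "A * Y \<le> A * ((1 / e) powr (1 / (p - 1)) * A powr (1 / (p - 1)))"
    using A by (rule mult_left_mono)
  also have "\<dots> = (1 / e) powr (1 / (p - 1)) * (A powr 1 * A powr (1 / (p - 1)))"
    using A0 by simp
  also have "A powr 1 * A powr (1 / (p - 1)) = A powr (p / (p - 1))"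
    unfolding powr_add[symmetric] using p by (simp add: field_simps)
  finally show ?thesis using e by (simp add: add_increasing)
qed

section \<open>The cut-off in time\<close>

definition eta :: "real \<Rightarrow> real \<Rightarrow> real" where "eta T t = bump (1 - t\<^sup>2 / T\<^sup>2)"

definition eta' :: "real \<Rightarrow> real \<Rightarrow> real"
  where "eta' T t = bump_poly (bump_step 1) (1 - t\<^sup>2 / T\<^sup>2) * (- (2 * t / T\<^sup>2))"

lemma eta_deriv: "(eta T has_real_derivative eta' T t) (at t)"
proof -
  have "((\<lambda>t. 1 - t\<^sup>2 / T\<^sup>2) has_real_derivative - (2 * t / T\<^sup>2)) (at t)"
    using DERIV_diff[OF DERIV_const[of 1 "at t"] DERIV_cdivide[OF DERIV_power[OF DERIV_ident, of 2], of "T\<^sup>2"]] by simp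
  from DERIV_chain2[OF bump_poly_has_derivative this] show ?thesis
    unfolding eta_def[abs_def] eta'_def .
qed

lemma eta_nonneg [simp]: "eta T t \<ge> 0" and eta_le_1 [simp]: "eta T t \<le> 1"
  by (simp_all add: eta_def)

lemma eta_outside: "T > 0 \<Longrightarrow> \<bar>t\<bar> \<ge> T \<Longrightarrow> eta T t = 0"
  and eta'_outside: "T > 0 \<Longrightarrow> \<bar>t\<bar> \<ge> T \<Longrightarrow> eta' T t = 0"
proof -
  assume "T > 0" "\<bar>t\<bar> \<ge> T"
  then have "T\<^sup>2 \<le> \<bar>t\<bar>\<^sup>2" by (intro power_mono) auto
  then have "1 - t\<^sup>2 / T\<^sup>2 \<le> 0" using \<open>T > 0\<close> by (simp add: le_divide_eq)
  then show "eta T t = 0" "eta' T t = 0" by (simp_all add: eta_def eta'_def bump_eq_0)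
qed

lemma borel_measurable_eta [measurable]: "eta T \<in> borel_measurable borel" "eta' T \<in> borel_measurable borel"
  unfolding eta_def[abs_def] eta'_def[abs_def] by measurable

text \<open>The inner derivative 2 t / T^2 is at most 2 / T on the support. Keeping the power 1/p of
  the cut-off is essential: after multiplication by |u| it is exactly what the p-th power turns into
  one factor \<open>eta T t\<close>.\<close>

lemma eta'_le:
  assumes B: "B \<ge> 0" "\<And>t. \<bar>bump_poly (bump_step 1) t\<bar> \<le> B * bump t powr (1 / p)" and T: "T > 0"
  shows "\<bar>eta' T t\<bar> \<le> 2 * B / T * eta T t powr (1 / p)"
proof (cases "\<bar>t\<bar> \<ge> T")
  case False
  have "\<bar>eta' T t\<bar> = \<bar>bump_poly (bump_step 1) (1 - t\<^sup>2 / T\<^sup>2)\<bar> * (2 * \<bar>t\<bar> / T\<^sup>2)"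
    by (simp add: eta'_def abs_mult abs_divide)
  also have "\<dots> \<le> (B * eta T t powr (1 / p)) * (2 * T / T\<^sup>2)"
    unfolding eta_def using False B T by (intro mult_mono divide_right_mono) auto
  also have "\<dots> = 2 * B / T * eta T t powr (1 / p)" using T by (simp add: power2_eq_square)
  finally show ?thesis .
qed (use T eta'_outside[of T t] B in auto)

lemma integrable_indicator_Icc: "integrable lborel (indicator {a..b::real} :: real \<Rightarrow> real)"
  by (rule integrable_real_indicator[OF _ emeasure_bounded_finite]) auto

lemma integral_eta:
  assumes T: "T > 0"
  shows "integrable lborel (\<lambda>t. indicator {0..} t * eta T t)"
    and "(LINT t|lborel. indicator {0..} t * eta T t) = T * (LINT t|lborel. indicator {0..} t * eta 1 t)"
    and "(LINT t|lborel. indicator {0..} t * eta 1 t) > 0"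
proof -
  have int: "integrable lborel (\<lambda>t. indicator {0..} t * eta T t)" if "T > 0" for T
  proof (rule Bochner_Integration.integrable_bound)
    show "integrable lborel (indicator {0..T} :: real \<Rightarrow> real)"
      by (rule integrable_indicator_Icc)
    show "AE t in lborel. norm (indicator {0..} t * eta T t) \<le> norm (indicator {0..T} t :: real)"
      using that by (intro AE_I2) (auto simp: indicator_def eta_outside)
  qed measurable
  then show "integrable lborel (\<lambda>t. indicator {0..} t * eta T t)" using T .
  have "(LINT t|lborel. indicator {0..} t * eta T t) = T * (LINT t|lborel. indicator {0..} (0 + T * t) * eta T (0 + T * t))"
    using T by (subst lborel_integral_real_affine[of T _ 0]) auto
  also have "(\<lambda>t. indicator {0..} (0 + T * t) * eta T (0 + T * t)) = (\<lambda>t. indicator {0..} t * eta 1 t)"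
    using T by (auto simp: fun_eq_iff eta_def indicator_def power_mult_distrib zero_le_mult_iff)
  finally show "(LINT t|lborel. indicator {0..} t * eta T t) = T * (LINT t|lborel. indicator {0..} t * eta 1 t)" .
  have "0 < (LINT t|lborel. bump (3 / 4) * indicator {0..1/2::real} t)" by (simp add: bump_pos)
  also have "\<dots> \<le> (LINT t|lborel. indicator {0..} t * eta 1 t)"
  proof (rule integral_mono)
    fix t :: real
    show "bump (3 / 4) * indicator {0..1/2} t \<le> indicator {0..} t * eta 1 t"
    proof (cases "t \<in> {0..1/2}")
      case True
      then have "t\<^sup>2 \<le> (1/2)\<^sup>2" by (intro power_mono) auto
      then have "3 / 4 \<le> 1 - t\<^sup>2 / 1\<^sup>2" by (simp add: power2_eq_square)
      then have "bump (3 / 4) \<le> eta 1 t" unfolding eta_def by (rule bump_mono)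
      then show ?thesis using True by simp
    qed (auto simp: indicator_def)
  qed (use int[of 1] in \<open>auto intro!: integrable_mult_right integrable_indicator_Icc\<close>)
  finally show "(LINT t|lborel. indicator {0..} t * eta 1 t) > 0" .
qed

lemma wgt_scale_le:
  assumes "m \<ge> 0" "R \<ge> 1"
  shows "wgt m (x /\<^sub>R R) \<le> (R\<^sup>2) powr m * wgt m x"
proof -
  have R: "R > 0" using assms by simp
  have n: "norm (x /\<^sub>R R) = norm x / R" using R by (simp add: divide_inverse mult.commute)
  have "R\<^sup>2 * (1 + (norm (x /\<^sub>R R))\<^sup>2) = R\<^sup>2 + (norm x)\<^sup>2"
    unfolding n power_divide using R by (simp add: distrib_left)
  moreover have "R\<^sup>2 \<ge> 1" using assms by simp
  ultimately have "1 + (norm x)\<^sup>2 \<le> R\<^sup>2 * (1 + (norm (x /\<^sub>R R))\<^sup>2)" by linarith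
  then show ?thesis unfolding wgt_def using assms R by (intro powr_neg_le_scaled) auto
qed

lemma integral_wgt_scale:
  assumes "R > 0" "2 * m > real DIM('a::euclidean_space)"
  shows "integrable lborel (\<lambda>x::'a. wgt m (x /\<^sub>R R))"
    and "(LINT x::'a|lborel. wgt m (x /\<^sub>R R)) = R ^ DIM('a) * (LINT x::'a|lborel. wgt m x)"
proof -
  show "integrable lborel (\<lambda>x::'a. wgt m (x /\<^sub>R R))"
    using integrable_lborel_affine[OF integrable_wgt[OF assms(2)], of "inverse R" 0] assms by simp
  show "(LINT x::'a|lborel. wgt m (x /\<^sub>R R)) = R ^ DIM('a) * (LINT x::'a|lborel. wgt m x)"
    using assms by (subst integral_lborel_affine[of R _ 0]) auto
qed

section \<open>Estimates for a hypothetical weak solution\<close>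

locale weak_sol =
  fixes a b s p m :: real and u0 f :: "'a::euclidean_space \<Rightarrow> real" and u :: "real \<times> 'a \<Rightarrow> real"
  assumes s: "0 < s" "s < 1" and b: "b > 0" and p: "p > 1"
    and m: "m = (real DIM('a) + 2 * s) / 2"
    and u0: "u0 \<in> Lp 1" "u0 \<in> C0" and f: "f \<in> C0"
    and sol: "global_weak_solution a b s p u0 f u"
begin

lemma m': "m \<ge> 0" "2 * m > real DIM('a)" using s by (auto simp: m)

lemma u_meas: "A \<subseteq> spacetime \<Longrightarrow> A \<in> sets lebesgue \<Longrightarrow> set_borel_measurable lebesgue A u"
  using sol unfolding global_weak_solution_def Lp_loc_spacetime_def by (auto intro: set_borel_measurable_subset)

lemma u_loc: "compact K \<Longrightarrow> K \<subseteq> spacetime \<Longrightarrow> set_integrable lebesgue K (\<lambda>z. \<bar>u z\<bar> powr p)"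
  using sol unfolding global_weak_solution_def Lp_loc_spacetime_def by auto

abbreviation S :: "(real \<times> 'a) set" where "S \<equiv> {0..} \<times> UNIV"

definition adj :: "real \<Rightarrow> real \<Rightarrow> real \<Rightarrow> real \<times> 'a \<Rightarrow> real" where
  "adj T N R = (\<lambda>(t, x). u (t, x) * (- (eta' T t * psi m N (x /\<^sub>R R)) + mixed_op a b s (\<lambda>y. eta T t * psi m N (y /\<^sub>R R)) x))"

definition src :: "real \<Rightarrow> real \<Rightarrow> real \<Rightarrow> real \<times> 'a \<Rightarrow> real" where
  "src T N R = (\<lambda>(t, x). (\<bar>u (t, x)\<bar> powr p + f x) * (eta T t * psi m N (x /\<^sub>R R)))"

lemma weak_identity:
  assumes "T > 0" "N > 0" "R > 0"
  shows "set_integrable lebesgue S (src T N R)" "set_integrable lebesgue S (adj T N R)"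
    "(LINT z:S|lebesgue. src T N R z) + (LINT x|lborel. u0 x * (bump 1 * psi m N (x /\<^sub>R R))) = (LINT z:S|lebesgue. adj T N R z)"
proof -
  have d: "deriv (\<lambda>\<tau>. eta T \<tau> * c) t = eta' T t * c" for c t
    by (intro DERIV_imp_deriv DERIV_cmult_right eta_deriv)
  have t: "testfn m T N R = (\<lambda>(t, x::'a). eta T t * psi m N (x /\<^sub>R R))"
    by (simp add: testfn_def eta_def)
  have e0: "eta T 0 = bump 1" by (simp add: eta_def)
  note sol[unfolded global_weak_solution_def, THEN conjunct2, rule_format, OF testfn_test_function[OF assms, of m], unfolded t Let_def prod.case d e0]
  then show "set_integrable lebesgue S (src T N R)" "set_integrable lebesgue S (adj T N R)"
    "(LINT z:S|lebesgue. src T N R z) + (LINT x|lborel. u0 x * (bump 1 * psi m N (x /\<^sub>R R))) = (LINT z:S|lebesgue. adj T N R z)"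
    unfolding src_def adj_def by auto
qed

lemma strip_sets: "{0..T::real} \<times> (UNIV::'a set) \<in> sets lebesgue"
proof -
  have "{0..T::real} \<times> (UNIV::'a set) \<in> sets (borel :: (real \<times> 'a) measure)" by (intro borel_closed closed_Times) auto
  then show ?thesis by simp
qed

lemma strip_sub: "{0..T} \<times> UNIV \<subseteq> S"
  by auto

text \<open>A weak solution is only locally integrable a priori. Outside the support of \<open>psi m 1\<close> the fractional
  Laplacian of that function is comparable to \<open>- wgt m\<close>, so integrability of the right-hand side of
  the weak identity for this one test function yields decay of \<open>u\<close>.\<close>

lemma integrable_u_wgt:
  assumes T: "T > 0"
  shows "set_integrable lebesgue ({0..T} \<times> UNIV) (\<lambda>(t, x). u (t, x) * wgt m x)"
proof -
  obtain \<kappa> where \<kappa>: "\<kappa> > 0" "\<And>c x::'a. c \<ge> 0 \<Longrightarrow> norm x \<ge> 2 \<Longrightarrow> mixed_op a b s (\<lambda>y. c * psi m 1 y) x \<le> - (c * (\<kappa> * wgt m x))"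
    using mixed_op_psi_far[OF s m b] by blast
  \<comment> \<open>The test function lives on the longer interval up to 2 T. For t \<le> T one has
    t^2 / (2 T)^2 \<le> 1/4, so the time cut-off is at least \<open>e\<close> there.\<close>
  define e where "e = bump (3 / 4)"
  have e: "e > 0" by (simp add: e_def bump_pos)
  \<comment> \<open>On this compact set |u| \<le> 1 + |u| powr p is locally integrable by
    assumption; outside of it the lower bound on |L psi| turns integrability of the adjoint term
    into decay of u.\<close>
  let ?K = "{0..T} \<times> cball (0::'a) 2"
  have K: "compact ?K" "?K \<subseteq> S" by (auto intro: compact_Times)
  have Kb: "?K \<in> sets lebesgue" using K by (intro lmeasurable_compact fmeasurableD) 
  have i1: "integrable lebesgue (\<lambda>z. indicator ?K z *\<^sub>R 1 + indicator ?K z *\<^sub>R (\<bar>u z\<bar> powr p))"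
  proof (rule Bochner_Integration.integrable_add)
    show "integrable lebesgue (\<lambda>z. indicator ?K z *\<^sub>R (1::real))"
      using lmeasurable_compact[OF K(1)] by (auto intro!: integrable_real_indicator simp: fmeasurable_def)
  qed (use u_loc[OF K] in \<open>simp add: set_integrable_def\<close>)
  have i2: "integrable lebesgue (\<lambda>z. 1 / (e * \<kappa>) * \<bar>indicator S z *\<^sub>R adj (2 * T) 1 1 z\<bar>)"
    using weak_identity(2)[of "2 * T" 1 1] T by (intro integrable_mult_right integrable_abs) (simp add: set_integrable_def)
  show ?thesis unfolding set_integrable_def
  proof (rule Bochner_Integration.integrable_bound[OF Bochner_Integration.integrable_add[OF i1 i2]])
    have "(\<lambda>z. indicator ({0..T} \<times> UNIV) z *\<^sub>R u z) \<in> borel_measurable lebesgue"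
      using u_meas[OF strip_sub strip_sets[of T]] unfolding set_borel_measurable_def .
    moreover have "(\<lambda>(t, x::'a). wgt m x) \<in> borel_measurable (lborel :: (real \<times> 'a) measure)"
      by (simp add: borel_prod[symmetric])
    then have "(\<lambda>(t, x::'a). wgt m x) \<in> borel_measurable (lebesgue :: (real \<times> 'a) measure)"
      by (rule measurable_completion)
    ultimately have "(\<lambda>z. (indicator ({0..T} \<times> UNIV) z *\<^sub>R u z) * (case z of (t, x) \<Rightarrow> wgt m x)) \<in> borel_measurable lebesgue"
      by (rule borel_measurable_times)
    then show "(\<lambda>z. indicator ({0..T} \<times> UNIV) z *\<^sub>R (case z of (t, x) \<Rightarrow> u (t, x) * wgt m x)) \<in> borel_measurable lebesgue"
      by (simp add: case_prod_unfold mult.assoc)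
    show "AE z in lebesgue. norm (indicator ({0..T} \<times> UNIV) z *\<^sub>R (case z of (t, x) \<Rightarrow> u (t, x) * wgt m x)) \<le>
      norm (indicator ?K z *\<^sub>R 1 + indicator ?K z *\<^sub>R (\<bar>u z\<bar> powr p) + 1 / (e * \<kappa>) * \<bar>indicator S z *\<^sub>R adj (2 * T) 1 1 z\<bar>)"
    proof (rule AE_I2)
      fix z :: "real \<times> 'a"
      obtain t x where z: "z = (t, x)" by (cases z)
      have nn: "0 \<le> indicator ?K z *\<^sub>R 1 + indicator ?K z *\<^sub>R (\<bar>u z\<bar> powr p)" "0 \<le> 1 / (e * \<kappa>) * \<bar>indicator S z *\<^sub>R adj (2 * T) 1 1 z\<bar>"
        using e \<kappa> by (auto simp: indicator_def)
      show "norm (indicator ({0..T} \<times> UNIV) z *\<^sub>R (case z of (t, x) \<Rightarrow> u (t, x) * wgt m x)) \<le>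
        norm (indicator ?K z *\<^sub>R 1 + indicator ?K z *\<^sub>R (\<bar>u z\<bar> powr p) + 1 / (e * \<kappa>) * \<bar>indicator S z *\<^sub>R adj (2 * T) 1 1 z\<bar>)"
      proof (cases "t \<in> {0..T}")
        case t: True
        have L: "norm (indicator ({0..T} \<times> UNIV) z *\<^sub>R (case z of (t, x) \<Rightarrow> u (t, x) * wgt m x)) = \<bar>u z\<bar> * wgt m x"
          using t by (simp add: z abs_mult)
        show ?thesis
        proof (cases "norm x \<le> 2")
          case True
          have "\<bar>u z\<bar> * wgt m x \<le> \<bar>u z\<bar> * 1" by (intro mult_left_mono wgt_le_1 m') auto
          also have "\<dots> \<le> 1 + \<bar>u z\<bar> powr p"
          proof (cases "\<bar>u z\<bar> \<le> 1")
            case False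
            then have "\<bar>u z\<bar> powr 1 \<le> \<bar>u z\<bar> powr p" using p by (intro powr_mono) auto
            then show ?thesis using False by simp
          qed (use powr_ge_zero[of "\<bar>u z\<bar>" p] in linarith)
          also have "\<dots> = indicator ?K z *\<^sub>R 1 + indicator ?K z *\<^sub>R (\<bar>u z\<bar> powr p)"
            using t True by (simp add: z)
          finally show ?thesis unfolding L using nn unfolding real_norm_def by linarith
        next
          case False
          have ps: "psi m 1 x = 0" using False by (intro psi_eq_0) auto
          have "t\<^sup>2 \<le> T\<^sup>2" using t by (intro power_mono) auto
          then have "3 / 4 \<le> 1 - t\<^sup>2 / (2 * T)\<^sup>2" using T by (simp add: field_simps)
          then have "e \<le> eta (2 * T) t" unfolding eta_def e_def by (rule bump_mono)
          moreover have "\<kappa> * wgt m x \<ge> 0" using \<kappa> by simp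
          ultimately have "e * (\<kappa> * wgt m x) \<le> eta (2 * T) t * (\<kappa> * wgt m x)" by (rule mult_right_mono)
          also have "\<dots> \<le> \<bar>mixed_op a b s (\<lambda>y. eta (2 * T) t * psi m 1 y) x\<bar>"
            using \<kappa>(2)[of "eta (2 * T) t" x] False by simp
          finally have "\<bar>u z\<bar> * (e * (\<kappa> * wgt m x)) \<le> \<bar>u z\<bar> * \<bar>mixed_op a b s (\<lambda>y. eta (2 * T) t * psi m 1 y) x\<bar>"
            by (rule mult_left_mono) simp
          also have "\<dots> = \<bar>adj (2 * T) 1 1 z\<bar>"
            by (simp add: adj_def z ps abs_mult)
          finally have "\<bar>u z\<bar> * wgt m x \<le> 1 / (e * \<kappa>) * \<bar>adj (2 * T) 1 1 z\<bar>"
            using e \<kappa> by (simp add: field_simps)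
          also have "\<dots> = 1 / (e * \<kappa>) * \<bar>indicator S z *\<^sub>R adj (2 * T) 1 1 z\<bar>"
            using t by (simp add: z)
          finally show ?thesis unfolding L using nn unfolding real_norm_def by linarith
        qed
      qed (simp add: z)
    qed
  qed
qed

lemma integral_f_psi:
  assumes T: "T > 0" and g: "integrable lborel g"
  shows "set_integrable lebesgue S (\<lambda>(t, x). eta T t * g x)"
    and "(LINT z:S|lebesgue. (case z of (t, x) \<Rightarrow> eta T t * g x)) = T * (LINT t|lborel. indicator {0..} t * eta 1 t) * (LINT x|lborel. g x)"
proof -
  have eq: "(\<lambda>z. indicator S z *\<^sub>R (case z of (t, x) \<Rightarrow> eta T t * g x)) = (\<lambda>(t, x). (indicator {0..} t * eta T t) * g x)"
    by (auto simp: fun_eq_iff indicator_def)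
  show "set_integrable lebesgue S (\<lambda>(t, x). eta T t * g x)"
    unfolding set_integrable_def eq by (rule integrable_lebesgue_prod[OF integral_eta(1)[OF T] g])
  show "(LINT z:S|lebesgue. (case z of (t, x) \<Rightarrow> eta T t * g x)) = T * (LINT t|lborel. indicator {0..} t * eta 1 t) * (LINT x|lborel. g x)"
    unfolding set_lebesgue_integral_def eq integral_lebesgue_prod[OF integral_eta(1)[OF T] g] integral_eta(2)[OF T] ..
qed

text \<open>Young's inequality absorbs the terms with \<open>u\<close> into \<open>\<bar>u\<bar>\<^sup>p\<close>; the bump satisfies
  \<open>\<bar>bump'\<bar> \<le> B * bump powr (1 / p)\<close>, which makes this possible for the time derivative.\<close>

lemma energy_estimate:
  assumes B: "B \<ge> 0" "\<And>t. \<bar>bump_poly (bump_step 1) t\<bar> \<le> B * bump t powr (1 / p)"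
    and C: "C \<ge> 0" "\<And>N R c x. N \<ge> 1 \<Longrightarrow> R \<ge> 1 \<Longrightarrow>
      \<bar>mixed_op a b s (\<lambda>y::'a. c * psi m N (y /\<^sub>R R)) x\<bar> \<le> \<bar>c\<bar> * (C * R powr - (2 * s) * wgt m (x /\<^sub>R R))"
    and T: "T > 0" and R: "R \<ge> 1"
  shows "exp (- 1) * (T * (LINT t|lborel. indicator {0..} t * eta 1 t) * (LINT x|lborel. f x * wgt m (x /\<^sub>R R))
      + bump 1 * (LINT x|lborel. u0 x * wgt m (x /\<^sub>R R)))
    \<le> (1 / exp (- 1)) powr (1 / (p - 1)) * (2 * B / T + C * R powr - (2 * s)) powr (p / (p - 1)) *
       (T * (R ^ DIM('a) * (LINT x::'a|lborel. wgt m x)))"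
proof -
  define w where "w x = wgt m (x /\<^sub>R R)" for x :: 'a
  define \<psi> where "\<psi> n x = psi m (real (Suc n)) (x /\<^sub>R R)" for n and x :: 'a
  define A where "A = 2 * B / T + C * R powr - (2 * s)"
  define h where "h = (LINT t|lborel. indicator {0..} t * eta 1 t)"
  define M where "M = (1 / exp (- 1)) powr (1 / (p - 1)) * A powr (p / (p - 1))"
  have Rp: "R > 0" using R by simp
  have A0: "A \<ge> 0" unfolding A_def using B C T by (intro add_nonneg_nonneg mult_nonneg_nonneg divide_nonneg_nonneg) auto
  have w0: "w x > 0" for x by (simp add: w_def)
  have w1: "w x \<le> 1" for x unfolding w_def by (rule wgt_le_1[OF m'(1)])
  have [measurable]: "w \<in> borel_measurable borel" unfolding w_def[abs_def] by measurable
  have [measurable]: "\<psi> n \<in> borel_measurable borel" for n unfolding \<psi>_def[abs_def] by measurable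
  have int_w: "integrable lborel w" "(LINT x|lborel. w x) = R ^ DIM('a) * (LINT x::'a|lborel. wgt m x)"
    unfolding w_def using integral_wgt_scale[OF Rp m'(2)] by auto
  have \<psi>: "0 \<le> \<psi> n x" "\<psi> n x \<le> w x" for n x
    by (simp_all add: \<psi>_def w_def psi_le_wgt)
  have \<psi>lim: "(\<lambda>n. \<psi> n x) \<longlonglongrightarrow> exp (- 1) * w x" for x
    unfolding \<psi>_def w_def by (rule psi_tendsto)
  have dom: "integrable lborel (\<lambda>x. g x * w x)" "\<And>n. integrable lborel (\<lambda>x. g x * \<psi> n x)"
    "(\<lambda>n. LINT x|lborel. g x * \<psi> n x) \<longlonglongrightarrow> exp (- 1) * (LINT x|lborel. g x * w x)"
    if g: "g \<in> C0" for g :: "'a \<Rightarrow> real"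
  proof -
    obtain Bg where Bg: "\<And>x. \<bar>g x\<bar> \<le> Bg" using C0_bounded[OF g] by blast
    have [measurable]: "g \<in> borel_measurable borel" using g by (rule C0_borel)
    have Bg0: "Bg \<ge> 0" using Bg[of 0] by linarith
    have iw: "integrable lborel (\<lambda>x. Bg * w x)" using int_w by simp
    have le: "\<bar>g x\<bar> * w x \<le> Bg * w x" for x using Bg w0[of x] by (intro mult_right_mono) auto
    have le2: "\<bar>g x\<bar> * \<psi> n x \<le> Bg * w x" for n x using Bg \<psi>[of n x] Bg0 by (intro mult_mono) auto
    show "integrable lborel (\<lambda>x. g x * w x)"
      by (rule Bochner_Integration.integrable_bound[OF iw]) (use le w0 Bg0 in \<open>auto simp: abs_mult less_imp_le\<close>)
    show "\<And>n. integrable lborel (\<lambda>x. g x * \<psi> n x)"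
      by (rule Bochner_Integration.integrable_bound[OF iw]) (use le2 w0 Bg0 \<psi> in \<open>auto simp: abs_mult less_imp_le\<close>)
    have "(\<lambda>n. LINT x|lborel. g x * \<psi> n x) \<longlonglongrightarrow> (LINT x|lborel. g x * (exp (- 1) * w x))"
      by (rule integral_dominated_convergence[OF _ _ iw])
        (use le2 \<psi> in \<open>auto simp: abs_mult intro!: tendsto_mult tendsto_const \<psi>lim\<close>)
    also have "(LINT x|lborel. g x * (exp (- 1) * w x)) = exp (- 1) * (LINT x|lborel. g x * w x)"
    proof -
      have "(\<lambda>x. g x * (exp (- 1) * w x)) = (\<lambda>x. exp (- 1) * (g x * w x))" by (simp add: fun_eq_iff)
      then show ?thesis by simp
    qed
    finally show "(\<lambda>n. LINT x|lborel. g x * \<psi> n x) \<longlonglongrightarrow> exp (- 1) * (LINT x|lborel. g x * w x)" .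
  qed
  \<comment> \<open>A majorant of the adjoint term for every truncation radius at once. It is
    integrable by the decay of u, which allows the truncation to be removed.\<close>
  define G where "G z = indicator S z * (A * (\<bar>u z\<bar> * eta T (fst z) powr (1 / p)) * w (snd z))" for z
  \<comment> \<open>\<open>X n\<close> is the term with |u| powr p in the truncated identity and
    \<open>Y\<close> is its pointwise limit; the factor exp (- 1) is the limit of the
    cut-off.\<close>
  define X where "X n z = indicator S z * (\<bar>u z\<bar> powr p * (eta T (fst z) * \<psi> n (snd z)))" for n z
  define Y where "Y z = indicator S z * (\<bar>u z\<bar> powr p * (eta T (fst z) * (exp (- 1) * w (snd z))))" for z
  have G0: "G z \<ge> 0" for z unfolding G_def using A0 w0[of "snd z"] by simp
  have X0: "X n z \<ge> 0" for n z unfolding X_def using \<psi>[of n "snd z"] by simp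
  have Y0: "Y z \<ge> 0" for z unfolding Y_def using w0[of "snd z"] by simp
  have eta_p: "eta T t \<le> eta T t powr (1 / p)" for t
    using powr_mono'[of "1 / p" 1 "eta T t"] p by simp
  have eta_p1: "eta T t powr (1 / p) \<le> 1" for t
    using p by (intro powr_le1) auto
  have int_G: "integrable lebesgue G"
  proof (rule Bochner_Integration.integrable_bound)
    have uw: "integrable lebesgue (\<lambda>z. indicator ({0..T} \<times> UNIV) z *\<^sub>R (case z of (t, x) \<Rightarrow> u (t, x) * wgt m x))"
      using integrable_u_wgt[OF T] by (simp add: set_integrable_def)
    then show "integrable lebesgue (\<lambda>z. A * (R\<^sup>2) powr m * \<bar>indicator ({0..T} \<times> UNIV) z *\<^sub>R (case z of (t, x) \<Rightarrow> u (t, x) * wgt m x)\<bar>)"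
      by (intro integrable_mult_right integrable_abs)
    have eq: "G = (\<lambda>z. \<bar>indicator ({0..T} \<times> UNIV) z *\<^sub>R (case z of (t, x) \<Rightarrow> u (t, x) * wgt m x)\<bar> *
       (A * eta T (fst z) powr (1 / p) * w (snd z) / wgt m (snd z)))"
    proof
      fix z show "G z = \<bar>indicator ({0..T} \<times> UNIV) z *\<^sub>R (case z of (t, x) \<Rightarrow> u (t, x) * wgt m x)\<bar> *
       (A * eta T (fst z) powr (1 / p) * w (snd z) / wgt m (snd z))"
        using T wgt_pos[of m "snd z"] by (cases z) (auto simp: G_def indicator_def abs_mult eta_outside less_imp_neq[symmetric])
    qed
    have "(\<lambda>z. A * eta T (fst z) powr (1 / p) * w (snd z) / wgt m (snd z)) \<in> borel_measurable (lborel :: (real \<times> 'a) measure)"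
      by (simp add: borel_prod[symmetric])
    then have "(\<lambda>z. A * eta T (fst z) powr (1 / p) * w (snd z) / wgt m (snd z)) \<in> borel_measurable (lebesgue :: (real \<times> 'a) measure)"
      by (rule measurable_completion)
    moreover have "(\<lambda>z. \<bar>indicator ({0..T} \<times> UNIV) z *\<^sub>R (case z of (t, x) \<Rightarrow> u (t, x) * wgt m x)\<bar>) \<in> borel_measurable lebesgue"
      using integrable_abs[OF uw] by (rule borel_measurable_integrable)
    ultimately show "G \<in> borel_measurable lebesgue" unfolding eq by (intro borel_measurable_times)
    show "AE z in lebesgue. norm (G z) \<le> norm (A * (R\<^sup>2) powr m * \<bar>indicator ({0..T} \<times> UNIV) z *\<^sub>R (case z of (t, x) \<Rightarrow> u (t, x) * wgt m x)\<bar>)"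
    proof (rule AE_I2)
      fix z :: "real \<times> 'a"
      obtain t x where z: "z = (t, x)" by (cases z)
      show "norm (G z) \<le> norm (A * (R\<^sup>2) powr m * \<bar>indicator ({0..T} \<times> UNIV) z *\<^sub>R (case z of (t, x) \<Rightarrow> u (t, x) * wgt m x)\<bar>)"
      proof (cases "t \<in> {0..T}")
        case True
        have "A * (\<bar>u z\<bar> * eta T t powr (1 / p)) * w x \<le> A * (\<bar>u z\<bar> * 1) * ((R\<^sup>2) powr m * wgt m x)"
          unfolding w_def using A0 eta_p1 by (intro mult_mono wgt_scale_le m' R order_refl) (auto intro!: mult_nonneg_nonneg)
        then show ?thesis using True G0[of z] A0 by (simp add: z G_def abs_mult mult_ac)
      next
        case False
        then have "G z = 0" using T by (auto simp: G_def z indicator_def eta_outside)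
        then show ?thesis using A0 by simp
      qed
    qed
  qed
  have adj_le: "\<bar>indicator S z *\<^sub>R adj T (real (Suc n)) R z\<bar> \<le> G z" for n z
  proof (cases "z \<in> S")
    case True
    obtain t x where z: "z = (t, x)" by (cases z)
    have "\<bar>- (eta' T t * psi m (real (Suc n)) (x /\<^sub>R R)) + mixed_op a b s (\<lambda>y. eta T t * psi m (real (Suc n)) (y /\<^sub>R R)) x\<bar> \<le>
       \<bar>eta' T t\<bar> * \<psi> n x + \<bar>mixed_op a b s (\<lambda>y. eta T t * psi m (real (Suc n)) (y /\<^sub>R R)) x\<bar>"
      using \<psi>(1)[of n x] unfolding \<psi>_def by (intro order_trans[OF abs_triangle_ineq]) (simp add: abs_mult)
    also have "\<dots> \<le> (2 * B / T * eta T t powr (1 / p)) * w x + eta T t powr (1 / p) * (C * R powr - (2 * s) * w x)"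
    proof (intro add_mono mult_mono eta'_le B T \<psi>)
      have "\<bar>mixed_op a b s (\<lambda>y. eta T t * psi m (real (Suc n)) (y /\<^sub>R R)) x\<bar> \<le> \<bar>eta T t\<bar> * (C * R powr - (2 * s) * w x)"
        unfolding w_def by (rule C(2)) (use R in auto)
      also have "\<dots> \<le> eta T t powr (1 / p) * (C * R powr - (2 * s) * w x)"
        using eta_p C w0[of x] by (intro mult_right_mono) auto
      finally show "\<bar>mixed_op a b s (\<lambda>y. eta T t * psi m (real (Suc n)) (y /\<^sub>R R)) x\<bar> \<le> eta T t powr (1 / p) * (C * R powr - (2 * s) * w x)" .
    qed (use B T \<psi> in auto)
    also have "\<dots> = A * eta T t powr (1 / p) * w x" by (simp add: A_def algebra_simps)
    finally have "\<bar>u z\<bar> * \<bar>- (eta' T t * psi m (real (Suc n)) (x /\<^sub>R R)) + mixed_op a b s (\<lambda>y. eta T t * psi m (real (Suc n)) (y /\<^sub>R R)) x\<bar>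
       \<le> \<bar>u z\<bar> * (A * eta T t powr (1 / p) * w x)"
      by (rule mult_left_mono) simp
    then show ?thesis using True by (simp add: z adj_def G_def abs_mult mult_ac)
  qed (simp add: G_def)
  have X_int: "integrable lebesgue (X n)" and X_le: "(LINT z|lebesgue. X n z) \<le>
     (LINT z|lebesgue. G z) - T * h * (LINT x|lborel. f x * \<psi> n x) - bump 1 * (LINT x|lborel. u0 x * \<psi> n x)" for n
  proof -
    have N: "real (Suc n) > 0" by simp
    note wk = weak_identity[OF T N Rp]
    note fp = integral_f_psi[OF T dom(2)[OF f, of n]]
    have X_eq: "X n = (\<lambda>z. indicator S z *\<^sub>R src T (real (Suc n)) R z - indicator S z *\<^sub>R (case z of (t, x) \<Rightarrow> eta T t * (f x * \<psi> n x)))"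
      by (auto simp: fun_eq_iff X_def src_def \<psi>_def indicator_def algebra_simps)
    show "integrable lebesgue (X n)"
      unfolding X_eq using wk(1) fp(1) by (intro Bochner_Integration.integrable_diff) (simp_all add: set_integrable_def)
    have "(LINT z|lebesgue. X n z) = (LINT z:S|lebesgue. src T (real (Suc n)) R z) - T * h * (LINT x|lborel. f x * \<psi> n x)"
      unfolding X_eq using wk(1) fp by (subst Bochner_Integration.integral_diff) (simp_all add: set_integrable_def set_lebesgue_integral_def h_def)
    also have "(LINT z:S|lebesgue. src T (real (Suc n)) R z) = (LINT z:S|lebesgue. adj T (real (Suc n)) R z) - bump 1 * (LINT x|lborel. u0 x * \<psi> n x)"
    proof -
      have "(\<lambda>x. u0 x * (bump 1 * \<psi> n x)) = (\<lambda>x. bump 1 * (u0 x * \<psi> n x))" by (simp add: fun_eq_iff)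
      then show ?thesis using wk(3) unfolding \<psi>_def[symmetric] by simp
    qed
    also have "(LINT z:S|lebesgue. adj T (real (Suc n)) R z) \<le> (LINT z|lebesgue. G z)"
      unfolding set_lebesgue_integral_def
    proof (rule integral_mono)
      show "integrable lebesgue (\<lambda>z. indicator S z *\<^sub>R adj T (real (Suc n)) R z)"
        using wk(2) by (simp add: set_integrable_def)
      show "indicator S z *\<^sub>R adj T (real (Suc n)) R z \<le> G z" for z
        using adj_le[of z n] by linarith
    qed (rule int_G)
    finally show "(LINT z|lebesgue. X n z) \<le>
     (LINT z|lebesgue. G z) - T * h * (LINT x|lborel. f x * \<psi> n x) - bump 1 * (LINT x|lborel. u0 x * \<psi> n x)" by simp
  qed
  \<comment> \<open>The bounds for the integrals of \<open>X n\<close> converge to \<open>K\<close>,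
    so Fatou bounds the integral of \<open>Y\<close> by \<open>K\<close>. Only then is |u| powr p
    known to be integrable against the untruncated weight.\<close>
  define K where "K = (LINT z|lebesgue. G z) - T * h * (exp (- 1) * (LINT x|lborel. f x * w x)) - bump 1 * (exp (- 1) * (LINT x|lborel. u0 x * w x))"
  have Klim: "(\<lambda>n. (LINT z|lebesgue. G z) - T * h * (LINT x|lborel. f x * \<psi> n x) - bump 1 * (LINT x|lborel. u0 x * \<psi> n x)) \<longlonglongrightarrow> K"
    unfolding K_def by (intro tendsto_diff tendsto_mult tendsto_const dom(3) f u0)
  have "0 \<le> (LINT z|lebesgue. X n z)" for n using X0 by (intro Bochner_Integration.integral_nonneg)
  then have K0: "K \<ge> 0"
    using X_le by (intro LIMSEQ_le_const[OF Klim]) (meson order_trans)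
  have XY: "(\<lambda>n. X n z) \<longlonglongrightarrow> Y z" for z
    unfolding X_def Y_def by (intro tendsto_mult tendsto_const \<psi>lim)
  have [measurable]: "X n \<in> borel_measurable lebesgue" for n using X_int by auto
  have Y_meas [measurable]: "Y \<in> borel_measurable lebesgue"
    by (rule borel_measurable_LIMSEQ_real[OF XY]) measurable
  have "(\<integral>\<^sup>+z. ennreal (Y z) \<partial>lebesgue) = (\<integral>\<^sup>+z. liminf (\<lambda>n. ennreal (X n z)) \<partial>lebesgue)"
    by (intro nn_integral_cong lim_imp_Liminf[symmetric] tendsto_ennrealI XY) simp
  also have "\<dots> \<le> liminf (\<lambda>n. \<integral>\<^sup>+z. ennreal (X n z) \<partial>lebesgue)"
    by (rule nn_integral_liminf) measurable
  also have "\<dots> \<le> liminf (\<lambda>n. ennreal ((LINT z|lebesgue. G z) - T * h * (LINT x|lborel. f x * \<psi> n x) - bump 1 * (LINT x|lborel. u0 x * \<psi> n x)))"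
    using X0 X_int X_le by (intro Liminf_mono always_eventually allI) (simp add: nn_integral_eq_integral ennreal_leI)
  also have "\<dots> = ennreal K"
    by (intro lim_imp_Liminf tendsto_ennrealI Klim) simp
  finally have Y_nn: "(\<integral>\<^sup>+z. ennreal (Y z) \<partial>lebesgue) \<le> ennreal K" .
  have Y_int: "integrable lebesgue Y"
    by (rule integrableI_bounded) (use Y_nn Y0 in \<open>auto intro: le_less_trans\<close>)
  have Y_le: "(LINT z|lebesgue. Y z) \<le> K"
    using Y_nn Y0 K0 by (simp add: nn_integral_eq_integral[OF Y_int])
  have strip: "integrable lebesgue (\<lambda>(t, x). indicator {0..T} t * w x)"
    "(LINT z|lebesgue. (case z of (t, x) \<Rightarrow> indicator {0..T} t * w x)) = T * (LINT x|lborel. w x)"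
  proof -
    have i: "integrable lborel (indicator {0..T} :: real \<Rightarrow> real)"
      by (rule integrable_indicator_Icc)
    show "integrable lebesgue (\<lambda>(t, x). indicator {0..T} t * w x)"
      by (rule integrable_lebesgue_prod[OF i int_w(1)])
    show "(LINT z|lebesgue. (case z of (t, x) \<Rightarrow> indicator {0..T} t * w x)) = T * (LINT x|lborel. w x)"
      using T by (simp add: integral_lebesgue_prod[OF i int_w(1)])
  qed
  have "(LINT z|lebesgue. G z) \<le> (LINT z|lebesgue. Y z + M * (case z of (t, x) \<Rightarrow> indicator {0..T} t * w x))"
  proof (rule integral_mono)
    show "integrable lebesgue (\<lambda>z. Y z + M * (case z of (t, x) \<Rightarrow> indicator {0..T} t * w x))"
      using Y_int strip(1) by (intro Bochner_Integration.integrable_add integrable_mult_right)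
    fix z :: "real \<times> 'a"
    obtain t x where z: "z = (t, x)" by (cases z)
    have M0: "M \<ge> 0" by (simp add: M_def)
    show "G z \<le> Y z + M * (case z of (t, x) \<Rightarrow> indicator {0..T} t * w x)"
    proof (cases "t \<in> {0..T}")
      case True
      \<comment> \<open>V powr p contains exactly one factor of the time cut-off. Young's inequality
        is used with e = exp (- 1), so that the absorbed term is \<open>Y\<close> itself.\<close>
      define V where "V = \<bar>u z\<bar> * eta T t powr (1 / p)"
      have Vp: "V powr p = \<bar>u z\<bar> powr p * eta T t"
        using p unfolding V_def by (simp add: powr_mult powr_powr)
      have "A * V \<le> exp (- 1) * V powr p + M"
        unfolding M_def V_def by (rule young_absorb) (use p A0 in auto)
      then have "A * V * w x \<le> (exp (- 1) * V powr p + M) * w x"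
        using w0[of x] by (intro mult_right_mono) auto
      also have "\<dots> = Y z + M * w x"
        unfolding Vp using True by (simp add: Y_def z algebra_simps)
      finally show ?thesis using True by (simp add: z G_def V_def)
    next
      case False
      then have "G z = 0" using T by (auto simp: G_def z indicator_def eta_outside)
      then show ?thesis using Y0[of z] M0 w0[of x] by (simp add: z False)
    qed
  qed (rule int_G)
  also have "\<dots> = (LINT z|lebesgue. Y z) + M * (T * (LINT x|lborel. w x))"
    using Y_int strip by (subst Bochner_Integration.integral_add) auto
  \<comment> \<open>\<open>K\<close> is the integral of \<open>G\<close> minus the data terms. That
    integral is finite and cancels, which leaves a bound on the data alone.\<close>
  finally have "(LINT z|lebesgue. G z) \<le> K + M * (T * (LINT x|lborel. w x))" using Y_le by linarith
  then have "exp (- 1) * (T * h * (LINT x|lborel. f x * w x) + bump 1 * (LINT x|lborel. u0 x * w x)) \<le> M * (T * (LINT x|lborel. w x))"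
    unfolding K_def by (simp add: algebra_simps)
  then have "exp (- 1) * (T * h * (LINT x|lborel. f x * w x) + bump 1 * (LINT x|lborel. u0 x * w x)) \<le>
      M * (T * (R ^ DIM('a) * (LINT x::'a|lborel. wgt m x)))"
    unfolding int_w(2) .
  then show ?thesis unfolding M_def A_def h_def w_def .
qed

text \<open>After division by T, the limit along the positive integers removes both the initial
  datum and the contribution of the time derivative. What is left on the right is (R powr (- 2 s))
  powr (p / (p - 1)) times the mass R powr d of the scaled weight.\<close>

lemma weighted_integral_bound:
  "\<exists>K. \<forall>R\<ge>1. (LINT x|lborel. f x * wgt m (x /\<^sub>R R)) \<le> K * R powr (real DIM('a) - 2 * s * (p / (p - 1)))"
proof -
  obtain B where B: "B \<ge> 0" "\<And>t. \<bar>bump_poly (bump_step 1) t\<bar> \<le> B * bump t powr (1 / p)"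
    using bump_deriv_le_powr[OF p] by blast
  obtain C where C: "C \<ge> 0" "\<And>N R c x. N \<ge> 1 \<Longrightarrow> R \<ge> 1 \<Longrightarrow>
      \<bar>mixed_op a b s (\<lambda>y::'a. c * psi m N (y /\<^sub>R R)) x\<bar> \<le> \<bar>c\<bar> * (C * R powr - (2 * s) * wgt m (x /\<^sub>R R))"
    using mixed_op_psi_bound[OF s m, of a b] by blast
  define h where "h = (LINT t|lborel. indicator {0..} t * eta 1 t)"
  have h: "h > 0" unfolding h_def by (rule integral_eta(3)[of 1]) simp
  define M where "M = (1 / exp (- 1 :: real)) powr (1 / (p - 1))"
  define W where "W = (LINT x::'a|lborel. wgt m x)"
  define K where "K = M * C powr (p / (p - 1)) * W / (exp (- 1) * h)"
  have "(LINT x|lborel. f x * wgt m (x /\<^sub>R R)) \<le> K * R powr (real DIM('a) - 2 * s * (p / (p - 1)))" if R: "R \<ge> 1" for R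
  proof -
    define F where "F = (LINT x|lborel. f x * wgt m (x /\<^sub>R R))"
    define U where "U = (LINT x|lborel. u0 x * wgt m (x /\<^sub>R R))"
    define q where "q = p / (p - 1)"
    have q: "q > 0" using p by (simp add: q_def)
    have Rp: "R > 0" using R by simp
    have le: "exp (- 1) * (h * F + bump 1 * U * (1 / real (Suc n)))
      \<le> M * (2 * B * (1 / real (Suc n)) + C * R powr - (2 * s)) powr q * (R ^ DIM('a) * W)" for n
    proof -
      have T: "real (Suc n) > 0" by simp
      have "exp (- 1) * (real (Suc n) * h * F + bump 1 * U)
        \<le> M * (2 * B / real (Suc n) + C * R powr - (2 * s)) powr q * (real (Suc n) * (R ^ DIM('a) * W))"
        using energy_estimate[OF B C T R] unfolding F_def U_def M_def q_def W_def h_def by simp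
      then have "exp (- 1) * (real (Suc n) * h * F + bump 1 * U) / real (Suc n)
        \<le> M * (2 * B / real (Suc n) + C * R powr - (2 * s)) powr q * (real (Suc n) * (R ^ DIM('a) * W)) / real (Suc n)"
        by (rule divide_right_mono) simp
      moreover have "exp (- 1) * (k * h * F + bump 1 * U) / k = exp (- 1) * (h * F + bump 1 * U * (1 / k))"
        "M * X * (k * Z) / k = M * X * Z" "2 * B / k = 2 * B * (1 / k)" if "k > 0" for k X Z
        using that by (simp_all add: add_divide_distrib distrib_left)
      ultimately show ?thesis using T by metis
    qed
    have lim0: "(\<lambda>n. 1 / real (Suc n)) \<longlonglongrightarrow> 0"
      using LIMSEQ_inverse_real_of_nat by (simp add: inverse_eq_divide)
    have l1: "(\<lambda>n. exp (- 1) * (h * F + bump 1 * U * (1 / real (Suc n)))) \<longlonglongrightarrow> exp (- 1) * (h * F + bump 1 * U * 0)"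
      by (intro tendsto_intros lim0)
    have l2: "(\<lambda>n. M * (2 * B * (1 / real (Suc n)) + C * R powr - (2 * s)) powr q * (R ^ DIM('a) * W))
       \<longlonglongrightarrow> M * (2 * B * 0 + C * R powr - (2 * s)) powr q * (R ^ DIM('a) * W)"
    proof (intro tendsto_mult tendsto_const tendsto_powr' tendsto_add lim0)
      show "2 * B * 0 + C * R powr - (2 * s) \<noteq> 0 \<or> 0 < q \<and> (\<forall>\<^sub>F n in sequentially. 0 \<le> 2 * B * (1 / real (Suc n)) + C * R powr - (2 * s))"
        using q B C by (intro disjI2 conjI always_eventually allI add_nonneg_nonneg mult_nonneg_nonneg) auto
    qed
    have "exp (- 1) * (h * F + bump 1 * U * 0) \<le> M * (2 * B * 0 + C * R powr - (2 * s)) powr q * (R ^ DIM('a) * W)"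
      using le by (intro LIMSEQ_le[OF l1 l2]) auto
    then have "exp (- 1) * h * F \<le> M * (C * R powr - (2 * s)) powr q * (R ^ DIM('a) * W)" by simp
    also have "\<dots> = M * C powr q * W * (R powr (- (2 * s) * q) * R powr real DIM('a))"
      using C Rp by (simp add: powr_mult powr_powr powr_realpow)
    also have "R powr (- (2 * s) * q) * R powr real DIM('a) = R powr (real DIM('a) - 2 * s * q)"
      by (simp add: powr_add[symmetric] algebra_simps)
    finally have "F \<le> M * C powr q * W * R powr (real DIM('a) - 2 * s * q) / (exp (- 1) * h)"
      using h by (simp add: pos_le_divide_eq mult_ac)
    then show ?thesis by (simp add: K_def F_def q_def)
  qed
  then show ?thesis by blast
qed

end

section \<open>From the weighted bound to integrability of the source\<close>

lemma wgt_scale_tendsto: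
  fixes x :: "'a::euclidean_space"
  shows "(\<lambda>n. wgt m (x /\<^sub>R real (Suc n))) \<longlonglongrightarrow> 1"
proof -
  have "(\<lambda>n. inverse (real (Suc n)) *\<^sub>R x) \<longlonglongrightarrow> 0 *\<^sub>R x"
    by (intro tendsto_scaleR tendsto_const LIMSEQ_inverse_real_of_nat)
  moreover have "isCont (wgt m) (0::'a)"
    using continuous_on_wgt[of UNIV "\<lambda>x::'a. x" m] by (simp add: continuous_on_eq_continuous_at)
  ultimately have "(\<lambda>n. wgt m (inverse (real (Suc n)) *\<^sub>R x)) \<longlonglongrightarrow> wgt m (0::'a)"
    by (intro isCont_tendsto_compose[of "0::'a" "wgt m"]) auto
  then show ?thesis by (simp add: wgt_def)
qed

text \<open>A positive extended integral rules out an infinite negative part: with the positive part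
  then finite, the value would be minus infinity. Once the negative part is integrable, the weighted
  bound controls the weighted positive parts, and Fatou passes to the limit R to infinity.\<close>

lemma integrable_of_weighted_bound:
  fixes f :: "'a::euclidean_space \<Rightarrow> real"
  assumes f: "f \<in> C0" and ex: "ext_integral_exists f" and pos: "ext_integral f > 0"
    and m: "m \<ge> 0" "2 * m > real DIM('a)"
    and bd: "\<And>R. R \<ge> 1 \<Longrightarrow> (LINT x|lborel. f x * wgt m (x /\<^sub>R R)) \<le> K"
  shows "integrable lborel f" "(LINT x|lborel. f x) > 0"
    "(\<lambda>n. LINT x|lborel. f x * wgt m (x /\<^sub>R real (Suc n))) \<longlonglongrightarrow> (LINT x|lborel. f x)"
proof -
  have [measurable]: "f \<in> borel_measurable borel" using f by (rule C0_borel)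
  obtain Bf where Bf: "\<And>x. \<bar>f x\<bar> \<le> Bf" using C0_bounded[OF f] by blast
  define w where "w n x = wgt m (x /\<^sub>R real (Suc n))" for n and x :: 'a
  have w: "0 \<le> w n x" "w n x \<le> 1" for n x by (simp_all add: w_def wgt_le_1[OF m(1)])
  have [measurable]: "w n \<in> borel_measurable borel" for n unfolding w_def[abs_def] by measurable
  have int_w: "integrable lborel (w n)" for n unfolding w_def by (rule integral_wgt_scale) (use m in auto)
  have wlim: "(\<lambda>n. w n x) \<longlonglongrightarrow> 1" for x unfolding w_def by (rule wgt_scale_tendsto)
  let ?P = "\<integral>\<^sup>+x. ennreal (f x) \<partial>lborel" and ?N = "\<integral>\<^sup>+x. ennreal (- f x) \<partial>lborel"
  have N: "?N < \<infinity>"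
  proof (rule ccontr)
    assume "\<not> ?N < \<infinity>"
    then have Ninf: "?N = \<infinity>" by (metis infinity_ennreal_def top.not_eq_extremum)
    then have "?P < \<infinity>" using ex by (auto simp: ext_integral_exists_def)
    then have "ext_integral f = - \<infinity>" unfolding ext_integral_def Ninf by (cases ?P) auto
    then show False using pos by simp
  qed
  have intw: "integrable lborel (\<lambda>x. max 0 (f x) * w n x)" "integrable lborel (\<lambda>x. max 0 (- f x) * w n x)" for n
  proof -
    have i: "integrable lborel (\<lambda>x. Bf * w n x)" using int_w by simp
    show "integrable lborel (\<lambda>x. max 0 (f x) * w n x)"
      by (rule Bochner_Integration.integrable_bound[OF i]) (use Bf w in \<open>auto simp: abs_mult intro!: mult_mono AE_I2\<close>, smt (verit) Bf)
    show "integrable lborel (\<lambda>x. max 0 (- f x) * w n x)"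
      by (rule Bochner_Integration.integrable_bound[OF i]) (use Bf w in \<open>auto simp: abs_mult intro!: mult_mono AE_I2\<close>, smt (verit) Bf)
  qed
  have int_neg: "integrable lborel (\<lambda>x. max 0 (- f x))"
    by (rule integrableI_bounded) (use N in \<open>auto simp: max_def ennreal_neg cong: if_cong elim!: order.strict_trans1[rotated] intro!: nn_integral_mono\<close>)
  have "(\<integral>\<^sup>+x. ennreal (max 0 (f x)) \<partial>lborel) = (\<integral>\<^sup>+x. liminf (\<lambda>n. ennreal (max 0 (f x) * w n x)) \<partial>lborel)"
    using tendsto_mult[OF tendsto_const wlim]
    by (intro nn_integral_cong lim_imp_Liminf[symmetric] tendsto_ennrealI) auto
  also have "\<dots> \<le> liminf (\<lambda>n. \<integral>\<^sup>+x. ennreal (max 0 (f x) * w n x) \<partial>lborel)"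
    by (rule nn_integral_liminf) measurable
  also have "\<dots> \<le> liminf (\<lambda>n. ennreal (K + (LINT x|lborel. max 0 (- f x))))"
  proof (intro Liminf_mono always_eventually allI)
    fix n
    have "(LINT x|lborel. max 0 (f x) * w n x) - (LINT x|lborel. max 0 (- f x) * w n x) = (LINT x|lborel. max 0 (f x) * w n x - max 0 (- f x) * w n x)"
      using intw by (intro Bochner_Integration.integral_diff[symmetric])
    also have "\<dots> = (LINT x|lborel. f x * w n x)"
      by (intro Bochner_Integration.integral_cong) (auto simp: max_def)
    also have "\<dots> \<le> K" unfolding w_def by (rule bd) simp
    finally have "(LINT x|lborel. max 0 (f x) * w n x) \<le> K + (LINT x|lborel. max 0 (- f x) * w n x)" by simp
    also have "(LINT x|lborel. max 0 (- f x) * w n x) \<le> (LINT x|lborel. max 0 (- f x))"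
      using w by (intro integral_mono intw int_neg) (simp add: mult_left_le)
    finally have "(LINT x|lborel. max 0 (f x) * w n x) \<le> K + (LINT x|lborel. max 0 (- f x))" by simp
    then show "(\<integral>\<^sup>+x. ennreal (max 0 (f x) * w n x) \<partial>lborel) \<le> ennreal (K + (LINT x|lborel. max 0 (- f x)))"
      using w by (subst nn_integral_eq_integral[OF intw(1)]) (auto intro: ennreal_leI)
  qed
  also have "\<dots> = ennreal (K + (LINT x|lborel. max 0 (- f x)))"
    by (intro lim_imp_Liminf tendsto_const) simp
  finally have P: "(\<integral>\<^sup>+x. ennreal (max 0 (f x)) \<partial>lborel) < \<infinity>"
    by (rule le_less_trans) simp
  have int_pos: "integrable lborel (\<lambda>x. max 0 (f x))"
    by (rule integrableI_bounded) (use P in auto)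
  have "integrable lborel (\<lambda>x. max 0 (f x) - max 0 (- f x))"
    by (intro Bochner_Integration.integrable_diff int_pos int_neg)
  moreover have fdec: "(\<lambda>x. max 0 (f x) - max 0 (- f x)) = f" by (auto simp: max_def)
  ultimately show int_f: "integrable lborel f" by simp
  have "(LINT x|lborel. f x) = (LINT x|lborel. max 0 (f x)) - (LINT x|lborel. max 0 (- f x))"
    unfolding Bochner_Integration.integral_diff[OF int_pos int_neg, symmetric] fdec ..
  moreover have "?P = ennreal (LINT x|lborel. max 0 (f x))" "?N = ennreal (LINT x|lborel. max 0 (- f x))"
    by (subst nn_integral_eq_integral[symmetric], use int_pos int_neg in \<open>auto simp: max_def ennreal_neg intro!: nn_integral_cong\<close>)+
  moreover have "(LINT x|lborel. max 0 (f x)) \<ge> 0" "(LINT x|lborel. max 0 (- f x)) \<ge> 0"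
    by (intro Bochner_Integration.integral_nonneg; simp)+
  ultimately have "ext_integral f = ereal (LINT x|lborel. f x)"
    by (simp add: ext_integral_def)
  then show "(LINT x|lborel. f x) > 0" using pos by simp
  have "(\<lambda>n. LINT x|lborel. f x * w n x) \<longlonglongrightarrow> (LINT x|lborel. f x)"
  proof (rule integral_dominated_convergence[where w="\<lambda>x. \<bar>f x\<bar>"])
    show "integrable lborel (\<lambda>x. \<bar>f x\<bar>)" using int_f by simp
    show "AE x in lborel. (\<lambda>n. f x * w n x) \<longlonglongrightarrow> f x"
      using tendsto_mult[OF tendsto_const wlim] by (intro AE_I2) auto
    show "\<And>n. AE x in lborel. norm (f x * w n x) \<le> \<bar>f x\<bar>"
      using w by (intro AE_I2) (auto simp: abs_mult intro!: mult_left_le)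
  qed measurable
  then show "(\<lambda>n. LINT x|lborel. f x * wgt m (x /\<^sub>R real (Suc n))) \<longlonglongrightarrow> (LINT x|lborel. f x)" by (simp add: w_def)
qed

theorem nonexistence_subcritical:
  fixes u0 f :: "'a::euclidean_space \<Rightarrow> real"
  assumes s: "0 < s" "s < 1" "real DIM('a) > 2 * s" and p: "1 < p" "p < real DIM('a) / (real DIM('a) - 2 * s)" and b: "b > 0"
    and u0: "u0 \<in> Lp 1 \<inter> C0" and f: "f \<in> C0" and ex: "ext_integral_exists f" and pos: "ext_integral f > 0"
  shows "\<not> global_weak_solution a b s p u0 f u"
proof
  assume sol: "global_weak_solution a b s p u0 f u"
  define d where "d = real DIM('a)"
  define m where "m = (d + 2 * s) / 2"
  have ds: "d - 2 * s > 0" using s by (simp add: d_def)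
  have "p < d / (d - 2 * s)" using p by (simp add: d_def)
  then have pd: "p * (d - 2 * s) < d" using ds by (simp add: pos_less_divide_eq)
  interpret weak_sol a b s p m u0 f u
    using s p b u0 f sol by unfold_locales (auto simp: m_def d_def)
  define e where "e = d - 2 * s * (p / (p - 1))"
  from pd have "d * (p - 1) < 2 * s * p" by (simp add: algebra_simps)
  then have e: "e < 0" using p by (simp add: e_def field_simps)
  obtain K where K: "\<And>R. R \<ge> 1 \<Longrightarrow> (LINT x|lborel. f x * wgt m (x /\<^sub>R R)) \<le> K * R powr e"
    using weighted_integral_bound unfolding e_def d_def by blast
  have K': "(LINT x|lborel. f x * wgt m (x /\<^sub>R R)) \<le> \<bar>K\<bar>" if "R \<ge> 1" for R
  proof -
    have "R powr e \<le> 1" using powr_mono[of e 0 R] that e by simp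
    then have "K * R powr e \<le> \<bar>K\<bar> * 1" by (intro mult_mono) auto
    then show ?thesis using K[OF that] by simp
  qed
  note I = integrable_of_weighted_bound[OF f ex pos m' K']
  have "((\<lambda>R. K * R powr e) \<longlongrightarrow> K * 0) at_top"
    using e by (intro tendsto_mult tendsto_const tendsto_neg_powr filterlim_ident)
  then have lim: "(\<lambda>n. K * (real (Suc n)) powr e) \<longlonglongrightarrow> K * 0"
    by (rule filterlim_compose) (rule filterlim_compose[OF filterlim_real_sequentially filterlim_Suc])
  have "(LINT x|lborel. f x) \<le> K * 0"
    by (rule LIMSEQ_le[OF I(3) lim]) (use K in auto)
  then show False using I(2) by simp
qed

theorem nonexistence_critical:
  fixes u0 f :: "'a::euclidean_space \<Rightarrow> real"
  assumes s: "0 < s" "s < 1" "real DIM('a) > 2 * s" and p: "1 < p" "p = real DIM('a) / (real DIM('a) - 2 * s)" and b: "b > 0"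
    and u0: "u0 \<in> Lp 1 \<inter> C0" and f: "f \<in> C0" and ex: "ext_integral_exists f" and pos: "ext_integral f > 0"
    and \<sigma>: "\<sigma> > 0" "Limsup at_top (\<lambda>R. ereal (R powr (- \<sigma>) * (LINT x:ball 0 R|lborel. f x))) > 0"
  shows "\<not> global_weak_solution a b s p u0 f u"
proof
  assume sol: "global_weak_solution a b s p u0 f u"
  define d where "d = real DIM('a)"
  define m where "m = (d + 2 * s) / 2"
  have ds: "d - 2 * s > 0" using s by (simp add: d_def)
  have "p = d / (d - 2 * s)" using p by (simp add: d_def)
  then have pd: "p * (d - 2 * s) = d" using ds by (simp only: nonzero_eq_divide_eq)
  interpret weak_sol a b s p m u0 f u
    using s p b u0 f sol by unfold_locales (auto simp: m_def d_def)
  from pd have "d * (p - 1) = 2 * s * p" by (simp add: algebra_simps)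
  then have e: "d - 2 * s * (p / (p - 1)) = 0" using p by (simp add: field_simps)
  obtain K where K: "\<And>R. R \<ge> 1 \<Longrightarrow> (LINT x|lborel. f x * wgt m (x /\<^sub>R R)) \<le> K * R powr (d - 2 * s * (p / (p - 1)))"
    using weighted_integral_bound unfolding d_def by blast
  have K': "(LINT x|lborel. f x * wgt m (x /\<^sub>R R)) \<le> K" if "R \<ge> 1" for R
    using K[OF that] that unfolding e by simp
  note I = integrable_of_weighted_bound[OF f ex pos m' K']
  define J where "J = (LINT x|lborel. \<bar>f x\<bar>)"
  have le: "(LINT x:ball 0 R|lborel. f x) \<le> J" for R
    unfolding J_def set_lebesgue_integral_def using I(1)
    by (intro integral_mono integrable_mult_indicator integrable_abs) (auto simp: indicator_def)
  have "Limsup at_top (\<lambda>R. ereal (R powr (- \<sigma>) * (LINT x:ball 0 R|lborel. f x))) \<le> Limsup at_top (\<lambda>R. ereal (R powr (- \<sigma>) * J))"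
    by (intro Limsup_mono always_eventually allI) (simp add: mult_left_mono le)
  also have "((\<lambda>R. R powr (- \<sigma>) * J) \<longlongrightarrow> 0 * J) at_top"
    using \<sigma> by (intro tendsto_mult tendsto_const tendsto_neg_powr filterlim_ident) auto
  then have "((\<lambda>R. ereal (R powr (- \<sigma>) * J)) \<longlongrightarrow> ereal (0 * J)) at_top" by simp
  then have "Limsup at_top (\<lambda>R. ereal (R powr (- \<sigma>) * J)) = ereal (0 * J)"
    by (intro lim_imp_Limsup) auto
  finally have "Limsup at_top (\<lambda>R. ereal (R powr (- \<sigma>) * (LINT x:ball 0 R|lborel. f x))) \<le> 0"
    by (simp add: zero_ereal_def)
  then show False using \<sigma>(2) by (meson leD)
qed

section \<open>The heat kernel\<close>

lemma integrable_gauss_1d: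
  fixes r :: real
  assumes r: "r > 0"
  shows "integrable lborel (\<lambda>y. cis (x * y) * complex_of_real (exp (- r * y\<^sup>2)))"
    and "(LINT y|lborel. cis (x * y) * complex_of_real (exp (- r * y\<^sup>2))) = complex_of_real (sqrt (pi / r) * exp (- x\<^sup>2 / (4 * r)))"
proof -
  \<comment> \<open>This scale turns exp (- r y^2) into exp (- y^2 / 2), so that the integral is the
    characteristic function of the standard normal distribution.\<close>
  define c where "c = 1 / sqrt (2 * r)"
  have c: "c > 0" "c\<^sup>2 = 1 / (2 * r)" using r by (auto simp: c_def power_divide)
  have eq: "cis (x * (0 + c * y)) * complex_of_real (exp (- r * (0 + c * y)\<^sup>2)) =
     complex_of_real (sqrt (2 * pi)) * (std_normal_density y *\<^sub>R iexp ((x * c) * y))" for y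
  proof -
    have "- r * (0 + c * y)\<^sup>2 = - y\<^sup>2 / 2" using r c(2) by (simp add: power_mult_distrib field_simps)
    then show ?thesis unfolding std_normal_density_def by (simp add: scaleR_conv_of_real cis_conv_exp mult_ac)
  qed
  have ch: "char std_normal_distribution (x * c) = complex_of_real (exp (- ((x * c)\<^sup>2) / 2))"
    by (simp add: char_std_normal_distribution)
  have int1: "integrable lborel (\<lambda>y. std_normal_density y *\<^sub>R iexp ((x * c) * y))"
  proof (rule Bochner_Integration.integrable_bound)
    show "integrable lborel std_normal_density" by simp
  qed (auto simp: norm_mult)
  have ch2: "char std_normal_distribution (x * c) = (LINT y|lborel. std_normal_density y *\<^sub>R iexp ((x * c) * y))"
    unfolding char_def by (subst integral_density) (auto simp: normal_density_nonneg)
  have "integrable lborel (\<lambda>y. cis (x * (0 + c * y)) * complex_of_real (exp (- r * (0 + c * y)\<^sup>2)))"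
    unfolding eq using int1 by (rule integrable_mult_right)
  then show "integrable lborel (\<lambda>y. cis (x * y) * complex_of_real (exp (- r * y\<^sup>2)))"
    using lborel_integrable_real_affine_iff[of c "\<lambda>y. cis (x * y) * complex_of_real (exp (- r * y\<^sup>2))" 0] c by simp
  have "(LINT y|lborel. cis (x * y) * complex_of_real (exp (- r * y\<^sup>2))) =
    c *\<^sub>R (LINT y|lborel. cis (x * (0 + c * y)) * complex_of_real (exp (- r * (0 + c * y)\<^sup>2)))"
    using c by (subst lborel_integral_real_affine[of c _ 0]) auto
  also have "\<dots> = c *\<^sub>R (complex_of_real (sqrt (2 * pi)) * complex_of_real (exp (- ((x * c)\<^sup>2) / 2)))"
    unfolding eq integral_mult_right_zero ch2[symmetric] ch ..
  also have "\<dots> = complex_of_real (sqrt (pi / r) * exp (- x\<^sup>2 / (4 * r)))"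
  proof -
    have "c * sqrt (2 * pi) = sqrt ((2 * pi) / (2 * r))" unfolding c_def real_sqrt_divide by simp
    then have "c * sqrt (2 * pi) = sqrt (pi / r)" by simp
    moreover have "- ((x * c)\<^sup>2) / 2 = - x\<^sup>2 / (4 * r)" using r by (simp add: power_mult_distrib c(2))
    ultimately show ?thesis by (simp add: scaleR_conv_of_real mult.assoc[symmetric] flip: of_real_mult)
  qed
  finally show "(LINT y|lborel. cis (x * y) * complex_of_real (exp (- r * y\<^sup>2))) = complex_of_real (sqrt (pi / r) * exp (- x\<^sup>2 / (4 * r)))" .
qed

lemma cis_sum: "finite I \<Longrightarrow> cis (sum f I) = (\<Prod>i\<in>I. cis (f i))"
  by (induction I rule: finite_induct) (auto simp: cis_mult[symmetric])

text \<open>In coordinates both the character and the Gaussian factorise, and the integral becomes a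
  product of one-dimensional ones.\<close>

lemma
  fixes x :: "'a::euclidean_space"
  assumes r: "r > 0"
  shows integrable_cis_gauss: "integrable lborel (\<lambda>\<xi>. cis (x \<bullet> \<xi>) * complex_of_real (exp (- r * (norm \<xi>)\<^sup>2)))" (is ?i)
    and integral_cis_gauss: "(LINT \<xi>|lborel. cis (x \<bullet> \<xi>) * complex_of_real (exp (- r * (norm \<xi>)\<^sup>2))) =
     complex_of_real (sqrt (pi / r) ^ DIM('a) * exp (- (norm x)\<^sup>2 / (4 * r)))" (is ?e)
proof -
  interpret product_sigma_finite "\<lambda>_::'a. lborel :: real measure" by unfold_locales
  let ?f = "\<lambda>\<xi>::'a. cis (x \<bullet> \<xi>) * complex_of_real (exp (- r * (norm \<xi>)\<^sup>2))"
  let ?T = "\<lambda>f::'a \<Rightarrow> real. \<Sum>b\<in>Basis. f b *\<^sub>R b"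
  have eq: "?f (?T f) = (\<Prod>b\<in>Basis. cis ((x \<bullet> b) * f b) * complex_of_real (exp (- r * (f b)\<^sup>2)))" for f
  proof -
    have "x \<bullet> ?T f = (\<Sum>b\<in>Basis. (x \<bullet> b) * f b)"
      by (simp add: inner_sum_right mult.commute)
    moreover have "(norm (?T f))\<^sup>2 = (\<Sum>b\<in>Basis. (f b)\<^sup>2)"
      by (simp only: power2_norm_eq_inner euclidean_inner[of "?T f" "?T f"]) (simp add: power2_eq_square)
    ultimately show ?thesis
      by (simp add: cis_sum prod.distrib sum_distrib_left exp_sum flip: of_real_prod)
  qed
  have T: "?T \<in> Pi\<^sub>M Basis (\<lambda>_. lborel) \<rightarrow>\<^sub>M borel" by measurable
  have f: "?f \<in> borel_measurable borel"
    by (intro borel_measurable_continuous_onI continuous_intros)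
  have ip: "integrable (Pi\<^sub>M Basis (\<lambda>_. lborel)) (\<lambda>f. ?f (?T f))"
    unfolding eq by (rule product_integrable_prod) (simp, rule integrable_gauss_1d(1)[OF r])
  show ?i
    by (subst lborel_eq, subst integrable_distr_eq[OF T]) (use f ip in auto)
  have "(LINT \<xi>|lborel. ?f \<xi>) = (LINT f|Pi\<^sub>M Basis (\<lambda>_. lborel). ?f (?T f))"
    by (subst lborel_eq, subst integral_distr[OF T]) (use f in auto)
  also have "\<dots> = (\<Prod>b\<in>Basis. LINT y|lborel. cis ((x \<bullet> b) * y) * complex_of_real (exp (- r * y\<^sup>2)))"
    unfolding eq by (rule product_integral_prod) (simp, rule integrable_gauss_1d(1)[OF r])
  also have "\<dots> = complex_of_real (\<Prod>b\<in>Basis. sqrt (pi / r) * exp (- (x \<bullet> b)\<^sup>2 / (4 * r)))"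
    by (simp only: integrable_gauss_1d(2)[OF r] of_real_prod)
  also have "(\<Prod>b\<in>Basis. sqrt (pi / r) * exp (- (x \<bullet> b)\<^sup>2 / (4 * r))) = sqrt (pi / r) ^ DIM('a) * exp (- (norm x)\<^sup>2 / (4 * r))"
  proof -
    have "(norm x)\<^sup>2 = (\<Sum>b\<in>Basis. (x \<bullet> b)\<^sup>2)"
      by (simp only: power2_norm_eq_inner euclidean_inner[of x x]) (simp add: power2_eq_square)
    then show ?thesis
      by (simp add: prod.distrib exp_sum[symmetric] sum_negf sum_divide_distrib)
  qed
  finally show ?e .
qed

lemma integrable_gauss: "r > 0 \<Longrightarrow> integrable lborel (\<lambda>\<xi>::'a::euclidean_space. exp (- r * (norm \<xi>)\<^sup>2))"
  using integrable_norm[OF integrable_cis_gauss[of r "0::'a"]] by (simp add: norm_mult)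

lemma integral_cos_gauss:
  assumes "r > 0"
  shows "(LINT \<xi>|lborel. cos ((x::'a::euclidean_space) \<bullet> \<xi>) * exp (- r * (norm \<xi>)\<^sup>2)) = sqrt (pi / r) ^ DIM('a) * exp (- (norm x)\<^sup>2 / (4 * r))"
proof -
  have "(LINT \<xi>|lborel. Re (cis (x \<bullet> \<xi>) * complex_of_real (exp (- r * (norm \<xi>)\<^sup>2)))) = sqrt (pi / r) ^ DIM('a) * exp (- (norm x)\<^sup>2 / (4 * r))"
    using integral_Re[OF integrable_cis_gauss[OF assms, of x]] integral_cis_gauss[OF assms, of x] by simp
  then show ?thesis by simp
qed

lemma abs_cos_mult_le: "0 \<le> g \<Longrightarrow> \<bar>cos y * g\<bar> \<le> (g::real)"
  using mult_right_mono[of "\<bar>cos y\<bar>" 1 g] by (simp add: abs_mult)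

lemma integrable_cos_mult:
  fixes g :: "'a::euclidean_space \<Rightarrow> real"
  assumes "integrable lborel g"
  shows "integrable lborel (\<lambda>\<xi>. cos (x \<bullet> \<xi>) * g \<xi>)"
proof (rule Bochner_Integration.integrable_bound[OF assms])
  have [measurable]: "g \<in> borel_measurable borel" using assms by auto
  show "(\<lambda>\<xi>. cos (x \<bullet> \<xi>) * g \<xi>) \<in> borel_measurable lborel" by measurable
qed (auto simp: abs_mult intro!: AE_I2 mult_left_le_one_le)

lemma integrable_lborel_prod':
  fixes g :: "'a::euclidean_space \<Rightarrow> real" and h :: "'b::euclidean_space \<Rightarrow> real"
  assumes g: "integrable lborel g" and h: "integrable lborel h"
  shows "integrable (lborel \<Otimes>\<^sub>M lborel) (\<lambda>(t, x). g t * h x)"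
proof (rule lborel_pair.Fubini_integrable)
  have [measurable]: "g \<in> borel_measurable borel" "h \<in> borel_measurable borel" using g h by auto
  show "(\<lambda>(t, x). g t * h x) \<in> borel_measurable (lborel \<Otimes>\<^sub>M lborel)" by measurable
  show "integrable lborel (\<lambda>t. LINT x|lborel. norm (case (t, x) of (t, x) \<Rightarrow> g t * h x))"
    using g by (simp add: abs_mult)
  show "AE t in lborel. integrable lborel (\<lambda>x. case (t, x) of (t, x) \<Rightarrow> g t * h x)"
    using h by simp
qed

text \<open>The kernel is positive because \<open>\<bar>\<xi>\<bar> powr (2 s)\<close> is a mixture of the functions \<open>1 - exp (- y \<bar>\<xi>\<bar>\<^sup>2)\<close>, so that
  \<open>exp (- t \<bar>\<xi>\<bar> powr (2 s))\<close> is a limit of mixtures of Gaussians.\<close>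

definition levy :: "real \<Rightarrow> real \<Rightarrow> real \<Rightarrow> real" where
  "levy s \<epsilon> y = indicator {\<epsilon>..} y * y powr (- 1 - s)"

text \<open>Laplace transform of the truncated Levy measure. The measure is finite because of the
  truncation, and \<open>levy_exp s \<epsilon> 0 - levy_exp s \<epsilon> q\<close> is the exponent
  of a compound Poisson subordinator.\<close>

definition levy_exp :: "real \<Rightarrow> real \<Rightarrow> real \<Rightarrow> real" where
  "levy_exp s \<epsilon> q = (LINT y|lborel. levy s \<epsilon> y * exp (- y * q))"

lemma levy_nonneg [simp]: "levy s \<epsilon> y \<ge> 0" by (simp add: levy_def)

lemma borel_measurable_levy [measurable]: "levy s \<epsilon> \<in> borel_measurable borel"
  unfolding levy_def[abs_def] by measurable

lemma integrable_levy: "s > 0 \<Longrightarrow> \<epsilon> > 0 \<Longrightarrow> integrable lborel (levy s \<epsilon>)"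
proof (rule integrableI_bounded)
  assume s: "s > 0" "\<epsilon> > 0"
  have "(\<integral>\<^sup>+y. ennreal (norm (levy s \<epsilon> y)) \<partial>lborel) = (\<integral>\<^sup>+y. ennreal (y powr (- 1 - s)) * indicator {\<epsilon>..} y \<partial>lborel)"
    by (intro nn_integral_cong) (auto simp: levy_def indicator_def)
  also have "\<dots> < \<infinity>" using s by (subst nn_integral_powr_to_inf) auto
  finally show "(\<integral>\<^sup>+y. ennreal (norm (levy s \<epsilon> y)) \<partial>lborel) < \<infinity>" .
qed auto

lemma levy_times_exp_le: "\<epsilon> > 0 \<Longrightarrow> q \<ge> 0 \<Longrightarrow> levy s \<epsilon> y * exp (- y * q) \<le> levy s \<epsilon> y"
  by (auto simp: levy_def indicator_def intro!: mult_left_le)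

lemma integrable_levy_exp: "s > 0 \<Longrightarrow> \<epsilon> > 0 \<Longrightarrow> q \<ge> 0 \<Longrightarrow> integrable lborel (\<lambda>y. levy s \<epsilon> y * exp (- y * q))"
  by (rule Bochner_Integration.integrable_bound[OF integrable_levy[of s \<epsilon>]]) (use levy_times_exp_le[of \<epsilon> q s] in auto)

lemma levy_exp_bounds:
  assumes "s > 0" "\<epsilon> > 0" "q \<ge> 0"
  shows "0 \<le> levy_exp s \<epsilon> q" "levy_exp s \<epsilon> q \<le> levy_exp s \<epsilon> 0"
  unfolding levy_exp_def
  using integral_mono[OF integrable_levy_exp[OF assms] integrable_levy_exp[of s \<epsilon> 0]] assms levy_times_exp_le[of \<epsilon> q s]
  by (auto intro!: Bochner_Integration.integral_nonneg)

lemma borel_measurable_levy_exp [measurable]: "levy_exp s \<epsilon> \<in> borel_measurable borel"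
  unfolding levy_exp_def[abs_def] by measurable

text \<open>Writing one factor \<open>levy_exp\<close> as an integral over y and exchanging
  integrals replaces the Gaussian parameter r by r + y. The induction hypothesis must therefore hold
  for every r; the base case is the explicit positive transform of a Gaussian.\<close>

lemma cos_levy_power_nonneg:
  fixes x :: "'a::euclidean_space"
  assumes s: "s > 0" "\<epsilon> > 0"
  shows "r > 0 \<Longrightarrow> integrable lborel (\<lambda>\<xi>::'a. exp (- r * (norm \<xi>)\<^sup>2) * levy_exp s \<epsilon> ((norm \<xi>)\<^sup>2) ^ n) \<and>
    0 \<le> (LINT \<xi>|lborel. cos (x \<bullet> \<xi>) * (exp (- r * (norm \<xi>)\<^sup>2) * levy_exp s \<epsilon> ((norm \<xi>)\<^sup>2) ^ n))"
proof (induction n arbitrary: r)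
  case 0
  then show ?case using integrable_gauss[of r] integral_cos_gauss[of r x] by simp
next
  case (Suc n)
  let ?L = "\<lambda>\<xi>::'a. levy_exp s \<epsilon> ((norm \<xi>)\<^sup>2)"
  let ?g = "\<lambda>r (\<xi>::'a). exp (- r * (norm \<xi>)\<^sup>2) * ?L \<xi> ^ n"
  note L = levy_exp_bounds[OF s zero_le_power2]
  have int: "integrable lborel (\<lambda>\<xi>. ?g r \<xi> * ?L \<xi>)"
  proof (rule Bochner_Integration.integrable_bound)
    show "integrable lborel (\<lambda>\<xi>. levy_exp s \<epsilon> 0 * ?g r \<xi>)"
      using Suc by (intro integrable_mult_right) auto
    show "AE \<xi> in lborel. norm (?g r \<xi> * ?L \<xi>) \<le> norm (levy_exp s \<epsilon> 0 * ?g r \<xi>)"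
    proof (rule AE_I2)
      fix \<xi> :: 'a
      have "?g r \<xi> * ?L \<xi> \<le> ?g r \<xi> * levy_exp s \<epsilon> 0" using L[of "norm \<xi>"] by (intro mult_left_mono) auto
      then show "norm (?g r \<xi> * ?L \<xi>) \<le> norm (levy_exp s \<epsilon> 0 * ?g r \<xi>)"
        using L[of "norm \<xi>"] levy_exp_bounds(1)[OF s, of 0] by (simp add: abs_mult mult.commute)
    qed
  qed measurable
  have P: "integrable (lborel \<Otimes>\<^sub>M lborel) (\<lambda>(y, \<xi>). levy s \<epsilon> y * exp (- y * (norm \<xi>)\<^sup>2) * (cos (x \<bullet> \<xi>) * ?g r \<xi>))"
  proof (rule Bochner_Integration.integrable_bound)
    show "integrable (lborel \<Otimes>\<^sub>M lborel) (\<lambda>(y, \<xi>). levy s \<epsilon> y * ?g r \<xi>)"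
      using Suc s by (intro integrable_lborel_prod' integrable_levy) auto
    show "AE z in lborel \<Otimes>\<^sub>M lborel. norm (case z of (y, \<xi>) \<Rightarrow> levy s \<epsilon> y * exp (- y * (norm \<xi>)\<^sup>2) * (cos (x \<bullet> \<xi>) * ?g r \<xi>))
      \<le> norm (case z of (y, \<xi>) \<Rightarrow> levy s \<epsilon> y * ?g r \<xi>)"
    proof (rule AE_I2, clarify)
      fix y and \<xi> :: 'a
      have g: "0 \<le> ?g r \<xi>" using L[of "norm \<xi>"] by simp
      have "\<bar>cos (x \<bullet> \<xi>) * ?g r \<xi>\<bar> \<le> ?g r \<xi>" using g by (rule abs_cos_mult_le)
      moreover have "\<bar>levy s \<epsilon> y * exp (- y * (norm \<xi>)\<^sup>2)\<bar> \<le> levy s \<epsilon> y"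
        using levy_times_exp_le[of \<epsilon> "(norm \<xi>)\<^sup>2" s y] s by simp
      ultimately have "\<bar>levy s \<epsilon> y * exp (- y * (norm \<xi>)\<^sup>2)\<bar> * \<bar>cos (x \<bullet> \<xi>) * ?g r \<xi>\<bar> \<le> levy s \<epsilon> y * ?g r \<xi>"
        by (intro mult_mono) auto
      then show "norm (levy s \<epsilon> y * exp (- y * (norm \<xi>)\<^sup>2) * (cos (x \<bullet> \<xi>) * ?g r \<xi>)) \<le> norm (levy s \<epsilon> y * ?g r \<xi>)"
        unfolding real_norm_def abs_mult[symmetric] by linarith
    qed
  qed measurable
  have "(LINT \<xi>|lborel. cos (x \<bullet> \<xi>) * (?g r \<xi> * ?L \<xi>)) =
    (LINT \<xi>|lborel. LINT y|lborel. levy s \<epsilon> y * exp (- y * (norm \<xi>)\<^sup>2) * (cos (x \<bullet> \<xi>) * ?g r \<xi>))"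
  proof -
    have "(LINT y|lborel. levy s \<epsilon> y * exp (- y * (norm \<xi>)\<^sup>2) * (cos (x \<bullet> \<xi>) * ?g r \<xi>)) = ?L \<xi> * (cos (x \<bullet> \<xi>) * ?g r \<xi>)" for \<xi>
      unfolding levy_exp_def by (rule integral_mult_left_zero)
    then show ?thesis by (simp only: mult_ac)
  qed
  also have "\<dots> = (LINT y|lborel. LINT \<xi>|lborel. levy s \<epsilon> y * exp (- y * (norm \<xi>)\<^sup>2) * (cos (x \<bullet> \<xi>) * ?g r \<xi>))"
    by (rule lborel_pair.Fubini_integral[OF P])
  also have "\<dots> \<ge> 0"
  proof (rule Bochner_Integration.integral_nonneg)
    fix y
    have eq: "levy s \<epsilon> y * exp (- y * (norm \<xi>)\<^sup>2) * (cos (x \<bullet> \<xi>) * ?g r \<xi>) = levy s \<epsilon> y * (cos (x \<bullet> \<xi>) * ?g (r + y) \<xi>)" for \<xi>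
      by (simp add: distrib_right exp_add mult_exp_exp[symmetric] exp_diff exp_minus field_simps)
    show "0 \<le> (LINT \<xi>|lborel. levy s \<epsilon> y * exp (- y * (norm \<xi>)\<^sup>2) * (cos (x \<bullet> \<xi>) * ?g r \<xi>))"
    proof (cases "y \<ge> \<epsilon>")
      case True
      then have "r + y > 0" using Suc.prems s by linarith
      then show ?thesis unfolding eq using Suc.IH[of "r + y"] by simp
    qed (simp add: levy_def)
  qed
  finally show ?case using int by (simp add: mult_ac)
qed

text \<open>The constant exp (- c * levy_exp s \<epsilon> 0) factors out, and the power series of
  the remaining exponential has nonnegative coefficients, so each partial sum is covered by the
  result for powers.\<close>

lemma cos_exp_levy_nonneg:
  fixes x :: "'a::euclidean_space"
  assumes s: "s > 0" "\<epsilon> > 0" and r: "r > 0" and c: "c \<ge> 0"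
  shows "0 \<le> (LINT \<xi>|lborel. cos (x \<bullet> \<xi>) * (exp (- r * (norm \<xi>)\<^sup>2) * exp (- c * (levy_exp s \<epsilon> 0 - levy_exp s \<epsilon> ((norm \<xi>)\<^sup>2)))))"
proof -
  let ?L = "\<lambda>\<xi>::'a. levy_exp s \<epsilon> ((norm \<xi>)\<^sup>2)"
  note L = levy_exp_bounds[OF s zero_le_power2]
  let ?t = "\<lambda>n \<xi>. cos (x \<bullet> \<xi>) * (exp (- r * (norm \<xi>)\<^sup>2) * (\<Sum>k<n. (c * ?L \<xi>) ^ k / fact k))"
  have lim: "(\<lambda>n. LINT \<xi>|lborel. ?t n \<xi>) \<longlonglongrightarrow> (LINT \<xi>|lborel. cos (x \<bullet> \<xi>) * (exp (- r * (norm \<xi>)\<^sup>2) * exp (c * ?L \<xi>)))"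
  proof (rule integral_dominated_convergence)
    show "integrable lborel (\<lambda>\<xi>::'a. exp (c * levy_exp s \<epsilon> 0) * exp (- r * (norm \<xi>)\<^sup>2))"
      using r by (intro integrable_mult_right integrable_gauss)
    show "AE \<xi> in lborel. (\<lambda>n. ?t n \<xi>) \<longlonglongrightarrow> cos (x \<bullet> \<xi>) * (exp (- r * (norm \<xi>)\<^sup>2) * exp (c * ?L \<xi>))"
    proof (intro AE_I2 tendsto_mult tendsto_const)
      fix \<xi>
      show "(\<lambda>n. \<Sum>k<n. (c * ?L \<xi>) ^ k / fact k) \<longlonglongrightarrow> exp (c * ?L \<xi>)"
        using exp_converges[of "c * ?L \<xi>"] by (simp add: sums_def divide_inverse mult.commute)
    qed
    show "AE \<xi> in lborel. norm (?t n \<xi>) \<le> exp (c * levy_exp s \<epsilon> 0) * exp (- r * (norm \<xi>)\<^sup>2)" for n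
    proof (rule AE_I2)
      fix \<xi> :: 'a
      have nn: "0 \<le> (\<Sum>k<n. (c * ?L \<xi>) ^ k / fact k)" using L c by (intro sum_nonneg) auto
      have "(\<Sum>k<n. (c * ?L \<xi>) ^ k / fact k) \<le> exp (c * ?L \<xi>)"
        unfolding exp_def using L c
        by (intro order_trans[OF _ sum_le_suminf[OF summable_exp_generic, of "{..<n}"]]) (auto simp: divide_inverse mult.commute intro!: sum_mono)
      also have "\<dots> \<le> exp (c * levy_exp s \<epsilon> 0)" using L c by (simp add: mult_left_mono)
      finally have "\<bar>cos (x \<bullet> \<xi>)\<bar> * (exp (- r * (norm \<xi>)\<^sup>2) * \<bar>\<Sum>k<n. (c * ?L \<xi>) ^ k / fact k\<bar>) \<le> 1 * (exp (- r * (norm \<xi>)\<^sup>2) * exp (c * levy_exp s \<epsilon> 0))"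
        using nn by (intro mult_mono) auto
      then show "norm (?t n \<xi>) \<le> exp (c * levy_exp s \<epsilon> 0) * exp (- r * (norm \<xi>)\<^sup>2)"
        by (simp add: abs_mult mult.commute)
    qed
  qed measurable
  have nn: "0 \<le> (LINT \<xi>|lborel. ?t n \<xi>)" for n
  proof -
    have i: "integrable lborel (\<lambda>\<xi>. c ^ k / fact k * (cos (x \<bullet> \<xi>) * (exp (- r * (norm \<xi>)\<^sup>2) * ?L \<xi> ^ k)))" for k
      using cos_levy_power_nonneg[OF s r] by (intro integrable_mult_right integrable_cos_mult) auto
    have "?t n = (\<lambda>\<xi>. \<Sum>k<n. c ^ k / fact k * (cos (x \<bullet> \<xi>) * (exp (- r * (norm \<xi>)\<^sup>2) * ?L \<xi> ^ k)))"
      by (simp add: fun_eq_iff sum_distrib_left power_mult_distrib mult_ac)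
    then have "(LINT \<xi>|lborel. ?t n \<xi>) = (\<Sum>k<n. LINT \<xi>|lborel. c ^ k / fact k * (cos (x \<bullet> \<xi>) * (exp (- r * (norm \<xi>)\<^sup>2) * ?L \<xi> ^ k)))"
      using i by simp
    also have "\<dots> \<ge> 0"
      unfolding integral_mult_right_zero
      using cos_levy_power_nonneg[OF s r, where x=x] c by (intro sum_nonneg mult_nonneg_nonneg) auto
    finally show ?thesis .
  qed
  have "0 \<le> (LINT \<xi>|lborel. cos (x \<bullet> \<xi>) * (exp (- r * (norm \<xi>)\<^sup>2) * exp (c * ?L \<xi>)))"
    by (rule LIMSEQ_le_const[OF lim]) (use nn in auto)
  then have "0 \<le> exp (- c * levy_exp s \<epsilon> 0) * (LINT \<xi>|lborel. cos (x \<bullet> \<xi>) * (exp (- r * (norm \<xi>)\<^sup>2) * exp (c * ?L \<xi>)))"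
    by simp
  also have "\<dots> = (LINT \<xi>|lborel. exp (- c * levy_exp s \<epsilon> 0) * (cos (x \<bullet> \<xi>) * (exp (- r * (norm \<xi>)\<^sup>2) * exp (c * ?L \<xi>))))"
    by simp
  also have "(\<lambda>\<xi>. exp (- c * levy_exp s \<epsilon> 0) * (cos (x \<bullet> \<xi>) * (exp (- r * (norm \<xi>)\<^sup>2) * exp (c * ?L \<xi>)))) =
     (\<lambda>\<xi>. cos (x \<bullet> \<xi>) * (exp (- r * (norm \<xi>)\<^sup>2) * exp (- c * (levy_exp s \<epsilon> 0 - ?L \<xi>))))"
    by (simp add: fun_eq_iff right_diff_distrib exp_diff exp_minus field_simps)
  finally show ?thesis .
qed

text \<open>The exponent of the stable subordinator, that is, the limit of the truncated exponents.
  By scaling it is a positive multiple of q powr s.\<close>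

definition levy_int :: "real \<Rightarrow> real \<Rightarrow> real" where
  "levy_int s q = (LINT y|lborel. indicator {0<..} y * (y powr (- 1 - s) * (1 - exp (- y * q))))"

lemma borel_measurable_levy_int [measurable]: "levy_int s \<in> borel_measurable borel"
  unfolding levy_int_def[abs_def] by measurable

lemma levy_int_integrable:
  fixes s q :: real
  assumes s: "0 < s" "s < 1" and q: "q \<ge> 0"
  shows "integrable lborel (\<lambda>y. indicator {0<..} y * (y powr (- 1 - s) * (1 - exp (- y * q))))"
proof (rule integrableI_bounded)
  have le: "ennreal (norm (indicator {0<..} y * (y powr (- 1 - s) * (1 - exp (- y * q))))) \<le>
    ennreal q * (ennreal (y powr (- s)) * indicator {0..1} y) + ennreal (y powr (- 1 - s)) * indicator {1..} y" for y
  proof -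
    consider "y \<le> 0" | "0 < y" "y < 1" | "1 \<le> y" by linarith
    then show ?thesis
    proof cases
      case 2
      have "1 - exp (- y * q) \<le> y * q" using exp_ge_add_one_self[of "- y * q"] by linarith
      then have "y powr (- 1 - s) * (1 - exp (- y * q)) \<le> y powr (- 1 - s) * (y * q)" by (rule mult_left_mono) simp
      also have "\<dots> = q * y powr (- s)" using 2 by (simp add: powr_diff powr_minus divide_simps)
      finally have "ennreal (y powr (- 1 - s) * (1 - exp (- y * q))) \<le> ennreal (q * y powr (- s))" by (rule ennreal_leI)
      moreover have "0 \<le> 1 - exp (- y * q)" using 2 q by simp
      ultimately show ?thesis using 2 q by (simp add: ennreal_mult abs_mult)
    next
      case 3
      have "y powr (- 1 - s) * (1 - exp (- y * q)) \<le> y powr (- 1 - s) * 1" by (rule mult_left_mono) auto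
      then have "ennreal (y powr (- 1 - s) * (1 - exp (- y * q))) \<le> ennreal (y powr (- 1 - s))" by (intro ennreal_leI) simp
      moreover have "0 \<le> 1 - exp (- y * q)" using 3 q by simp
      ultimately show ?thesis using 3 q by (simp add: abs_mult add_increasing)
    qed auto
  qed
  have "(\<integral>\<^sup>+y. ennreal (norm (indicator {0<..} y * (y powr (- 1 - s) * (1 - exp (- y * q))))) \<partial>lborel) \<le>
    (\<integral>\<^sup>+y. ennreal q * (ennreal (y powr (- s)) * indicator {0..1} y) + ennreal (y powr (- 1 - s)) * indicator {1..} y \<partial>lborel)"
    by (intro nn_integral_mono le)
  also have "\<dots> = ennreal q * ennreal (1 powr (- s + 1) / (- s + 1)) + ennreal (- (1 powr (- 1 - s + 1)) / (- 1 - s + 1))"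
    using s by (subst nn_integral_add) (auto simp: nn_integral_cmult nn_integral_powr_from_0 nn_integral_powr_to_inf simp del: powr_one_eq_one)
  also have "\<dots> < \<infinity>" by (simp add: ennreal_mult_less_top)
  finally show "(\<integral>\<^sup>+y. ennreal (norm (indicator {0<..} y * (y powr (- 1 - s) * (1 - exp (- y * q))))) \<partial>lborel) < \<infinity>" .
qed measurable

lemma levy_int_scale:
  fixes s q :: real
  assumes s: "0 < s" "s < 1" and q: "q \<ge> 0"
  shows "levy_int s q = q powr s * levy_int s 1"
proof (cases "q = 0")
  case False
  then have q: "q > 0" using q by simp
  have "levy_int s q = (1 / q) * (LINT y|lborel. indicator {0<..} (0 + (1 / q) * y) * ((0 + (1 / q) * y) powr (- 1 - s) * (1 - exp (- (0 + (1 / q) * y) * q))))"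
    unfolding levy_int_def using q by (subst lborel_integral_real_affine[of "1 / q" _ 0]) auto
  also have "(\<lambda>y. indicator {0<..} (0 + (1 / q) * y) * ((0 + (1 / q) * y) powr (- 1 - s) * (1 - exp (- (0 + (1 / q) * y) * q)))) =
    (\<lambda>y. q powr (1 + s) * (indicator {0<..} y * (y powr (- 1 - s) * (1 - exp (- y * 1)))))"
  proof
    fix y :: real
    show "indicator {0<..} (0 + (1 / q) * y) * ((0 + (1 / q) * y) powr (- 1 - s) * (1 - exp (- (0 + (1 / q) * y) * q))) =
      q powr (1 + s) * (indicator {0<..} y * (y powr (- 1 - s) * (1 - exp (- y * 1))))"
    proof (cases "y > 0")
      case True
      have "((1 / q) * y) powr (- 1 - s) = q powr (1 + s) * y powr (- 1 - s)"
      proof -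
        have "(1 / q) powr (- 1 - s) = 1 / q powr (- 1 - s)" using q by (simp add: powr_divide)
        also have "\<dots> = q powr - (- 1 - s)" by (simp only: powr_minus_divide)
        finally have "(1 / q) powr (- 1 - s) = q powr (1 + s)" by (simp add: add.commute)
        then show ?thesis by (simp only: powr_mult)
      qed
      then show ?thesis using True q by (simp add: zero_less_divide_iff)
    qed (use q in \<open>simp add: zero_less_divide_iff\<close>)
  qed
  also have "(1 / q) * (LINT y|lborel. q powr (1 + s) * (indicator {0<..} y * (y powr (- 1 - s) * (1 - exp (- y * 1))))) = q powr s * levy_int s 1"
    using q by (simp add: levy_int_def powr_add)
  finally show ?thesis .
qed (simp add: levy_int_def)

lemma levy_int_1_pos:
  assumes s: "0 < s" "s < 1"
  shows "levy_int s 1 > 0"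
proof -
  have "0 < (2 powr (- 1 - s) * (1 - exp (- 1))) * (LINT y|lborel. indicator {1..2::real} y)" by simp
  also have "\<dots> = (LINT y|lborel. (2 powr (- 1 - s) * (1 - exp (- 1))) * indicator {1..2::real} y)" by simp
  also have "\<dots> \<le> levy_int s 1"
    unfolding levy_int_def
  proof (rule integral_mono)
    show "integrable lborel (\<lambda>y. (2 powr (- 1 - s) * (1 - exp (- 1))) * indicator {1..2::real} y)"
      by (intro integrable_mult_right integrable_real_indicator emeasure_bounded_finite) auto
    show "integrable lborel (\<lambda>y. indicator {0<..} y * (y powr (- 1 - s) * (1 - exp (- y * 1))))"
      by (rule levy_int_integrable[OF s]) simp
    fix y :: real
    show "(2 powr (- 1 - s) * (1 - exp (- 1))) * indicator {1..2::real} y \<le> indicator {0<..} y * (y powr (- 1 - s) * (1 - exp (- y * 1)))"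
    proof (cases "y \<in> {1..2}")
      case True
      then have "2 powr (- 1 - s) * (1 - exp (- 1)) \<le> y powr (- 1 - s) * (1 - exp (- y * 1))"
        using s by (intro mult_mono powr_mono2') auto
      then show ?thesis using True by simp
    qed (auto simp: indicator_def)
  qed
  finally show ?thesis .
qed

lemma levy_exp_tendsto:
  fixes s q :: real
  assumes s: "0 < s" "s < 1" and q: "q \<ge> 0"
  shows "(\<lambda>n. levy_exp s (1 / real (Suc n)) 0 - levy_exp s (1 / real (Suc n)) q) \<longlonglongrightarrow> levy_int s q"
proof -
  have e: "1 / real (Suc n) > 0" for n by simp
  have lim0: "(\<lambda>n. 1 / real (Suc n)) \<longlonglongrightarrow> 0"
    using LIMSEQ_inverse_real_of_nat by (simp add: inverse_eq_divide)
  let ?f = "\<lambda>n y. indicator {1 / real (Suc n)..} y * (y powr (- 1 - s) * (1 - exp (- y * q)))"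
  have "levy_exp s (1 / real (Suc n)) 0 - levy_exp s (1 / real (Suc n)) q = (LINT y|lborel. ?f n y)" for n
    unfolding levy_exp_def
    by (subst Bochner_Integration.integral_diff[symmetric])
      (use integrable_levy_exp[OF s(1) e, of 0] integrable_levy_exp[OF s(1) e q] in \<open>auto simp: levy_def algebra_simps\<close>)
  moreover have "(\<lambda>n. LINT y|lborel. ?f n y) \<longlonglongrightarrow> levy_int s q"
    unfolding levy_int_def
  proof (rule integral_dominated_convergence)
    show "integrable lborel (\<lambda>y. norm (indicator {0<..} y * (y powr (- 1 - s) * (1 - exp (- y * q)))))"
      by (intro integrable_norm levy_int_integrable s q)
    show "AE y in lborel. (\<lambda>n. ?f n y) \<longlonglongrightarrow> indicator {0<..} y * (y powr (- 1 - s) * (1 - exp (- y * q)))"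
    proof (rule AE_I2)
      fix y :: real
      show "(\<lambda>n. ?f n y) \<longlonglongrightarrow> indicator {0<..} y * (y powr (- 1 - s) * (1 - exp (- y * q)))"
      proof (cases "y > 0")
        case True
        then have "eventually (\<lambda>n. 1 / real (Suc n) < y) sequentially"
          using lim0 by (intro order_tendstoD(2)) auto
        then have "eventually (\<lambda>n. indicator {0<..} y * (y powr (- 1 - s) * (1 - exp (- y * q))) = ?f n y) sequentially"
          by eventually_elim (use True in auto)
        then show ?thesis by (rule Lim_transform_eventually[OF tendsto_const])
      next
        case False
        then have "\<not> 1 / real (Suc n) \<le> y" for n using e[of n] by linarith
        then show ?thesis using False by (simp add: indicator_def)
      qed
    qed
    show "AE y in lborel. norm (?f n y) \<le> norm (indicator {0<..} y * (y powr (- 1 - s) * (1 - exp (- y * q))))" for n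
    proof (rule AE_I2)
      fix y :: real
      have "1 / real (Suc n) \<le> y \<Longrightarrow> y > 0" using e[of n] by linarith
      then show "norm (?f n y) \<le> norm (indicator {0<..} y * (y powr (- 1 - s) * (1 - exp (- y * q))))"
        by (auto simp: indicator_def)
    qed
  qed measurable
  ultimately show ?thesis by simp
qed

text \<open>With q = |\<xi>|^2 and t divided by \<open>levy_int s 1\<close>, the truncated exponents
  tend to t |\<xi>| powr (2 s). The Gaussian factor serves as the integrable majorant for this
  limit; for the mixed operator it is the local part of the symbol, with r = t.\<close>

lemma cos_stable_nonneg:
  fixes x :: "'a::euclidean_space"
  assumes s: "0 < s" "s < 1" and r: "r > 0" and t: "t \<ge> 0"
  shows "0 \<le> (LINT \<xi>|lborel. cos (x \<bullet> \<xi>) * (exp (- r * (norm \<xi>)\<^sup>2) * exp (- t * norm \<xi> powr (2 * s))))"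
proof -
  define \<kappa> where "\<kappa> = levy_int s 1"
  have \<kappa>: "\<kappa> > 0" unfolding \<kappa>_def by (rule levy_int_1_pos[OF s])
  have q: "levy_int s ((norm \<xi>)\<^sup>2) = \<kappa> * norm \<xi> powr (2 * s)" for \<xi> :: 'a
  proof -
    have "((norm \<xi>)\<^sup>2) powr s = norm \<xi> powr (2 * s)"
      by (cases "\<xi> = 0") (auto simp: powr_powr[symmetric] powr_numeral)
    then show ?thesis by (subst levy_int_scale[OF s]) (simp_all add: \<kappa>_def)
  qed
  let ?e = "\<lambda>n::nat. 1 / real (Suc n)"
  let ?f = "\<lambda>n \<xi>. cos (x \<bullet> \<xi>) * (exp (- r * (norm \<xi>)\<^sup>2) * exp (- (t / \<kappa>) * (levy_exp s (?e n) 0 - levy_exp s (?e n) ((norm \<xi>)\<^sup>2))))"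
  have "(\<lambda>n. LINT \<xi>|lborel. ?f n \<xi>) \<longlonglongrightarrow> (LINT \<xi>|lborel. cos (x \<bullet> \<xi>) * (exp (- r * (norm \<xi>)\<^sup>2) * exp (- (t / \<kappa>) * levy_int s ((norm \<xi>)\<^sup>2))))"
  proof (rule integral_dominated_convergence)
    show "integrable lborel (\<lambda>\<xi>::'a. exp (- r * (norm \<xi>)\<^sup>2))" using r by (rule integrable_gauss)
    show "AE \<xi> in lborel. (\<lambda>n. ?f n \<xi>) \<longlonglongrightarrow> cos (x \<bullet> \<xi>) * (exp (- r * (norm \<xi>)\<^sup>2) * exp (- (t / \<kappa>) * levy_int s ((norm \<xi>)\<^sup>2)))"
      by (intro AE_I2 tendsto_mult tendsto_const tendsto_exp levy_exp_tendsto s) simp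
    show "AE \<xi> in lborel. norm (?f n \<xi>) \<le> exp (- r * (norm \<xi>)\<^sup>2)" for n
    proof (rule AE_I2)
      fix \<xi> :: 'a
      have "levy_exp s (?e n) ((norm \<xi>)\<^sup>2) \<le> levy_exp s (?e n) 0" by (rule levy_exp_bounds) (use s in auto)
      then have "(t / \<kappa>) * (levy_exp s (?e n) 0 - levy_exp s (?e n) ((norm \<xi>)\<^sup>2)) \<ge> 0" using t \<kappa> by simp
      then have "exp (- (t / \<kappa>) * (levy_exp s (?e n) 0 - levy_exp s (?e n) ((norm \<xi>)\<^sup>2))) \<le> 1" by simp
      then have "\<bar>cos (x \<bullet> \<xi>)\<bar> * (exp (- r * (norm \<xi>)\<^sup>2) * exp (- (t / \<kappa>) * (levy_exp s (?e n) 0 - levy_exp s (?e n) ((norm \<xi>)\<^sup>2)))) \<le> 1 * (exp (- r * (norm \<xi>)\<^sup>2) * 1)"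
        by (intro mult_mono) auto
      then show "norm (?f n \<xi>) \<le> exp (- r * (norm \<xi>)\<^sup>2)" by (simp add: abs_mult)
    qed
  qed (measurable)
  moreover have "0 \<le> (LINT \<xi>|lborel. ?f n \<xi>)" for n
    by (rule cos_exp_levy_nonneg) (use s r t \<kappa> in auto)
  ultimately have "0 \<le> (LINT \<xi>|lborel. cos (x \<bullet> \<xi>) * (exp (- r * (norm \<xi>)\<^sup>2) * exp (- (t / \<kappa>) * levy_int s ((norm \<xi>)\<^sup>2))))"
    by (intro LIMSEQ_le_const) auto
  then show ?thesis unfolding q using \<kappa> by simp
qed

section \<open>The kernel of the semigroup with both coefficients equal to 1\<close>

locale mixed_heat =
  fixes s :: real and ty :: "'a::euclidean_space itself"
  assumes s: "0 < s" "s < 1"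
begin

text \<open>The factors 1 keep the expression literally equal to the symbol in
  \<open>heat_kernel 1 1 s\<close>.\<close>

definition Msym :: "real \<Rightarrow> 'a \<Rightarrow> real" where
  "Msym t \<xi> = exp (- t * (1 * (norm \<xi>)\<^sup>2 + 1 * norm \<xi> powr (2 * s)))"

definition P :: "real \<Rightarrow> 'a \<Rightarrow> real" where
  "P t x = heat_kernel 1 1 s t x"

lemma Msym_split: "Msym t \<xi> = exp (- t * (norm \<xi>)\<^sup>2) * exp (- t * norm \<xi> powr (2 * s))"
  by (simp add: Msym_def exp_add[symmetric] algebra_simps)

lemma Msym_pos [simp]: "Msym t \<xi> > 0" "Msym t \<xi> \<ge> 0" by (simp_all add: Msym_def)

lemma Msym_le_1: "t \<ge> 0 \<Longrightarrow> Msym t \<xi> \<le> 1" by (simp add: Msym_def)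

lemma Msym_le_gauss: "t \<ge> 0 \<Longrightarrow> Msym t \<xi> \<le> exp (- t * (norm \<xi>)\<^sup>2)"
  unfolding Msym_split by (rule mult_left_le) auto

lemma Msym_le_stable: "t \<ge> 0 \<Longrightarrow> Msym t \<xi> \<le> exp (- t * norm \<xi> powr (2 * s))"
  unfolding Msym_split by (rule mult_left_le_one_le) auto

lemma Msym_antimono: "t \<le> t' \<Longrightarrow> Msym t' \<xi> \<le> Msym t \<xi>"
  unfolding Msym_def by (auto intro!: mult_right_mono)

lemma borel_measurable_Msym [measurable]: "(\<lambda>z. Msym (fst z) (snd z)) \<in> borel_measurable (borel \<Otimes>\<^sub>M borel)"
  "Msym t \<in> borel_measurable borel"
  unfolding Msym_def[abs_def] by measurable

lemma integrable_Msym: "t > 0 \<Longrightarrow> integrable lborel (Msym t)"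
  by (rule Bochner_Integration.integrable_bound[OF integrable_gauss[of t]]) (use Msym_le_gauss[of t] in auto)

lemma P_eq: 
  assumes "t > 0"
  shows "P t x = (LINT \<xi>|lborel. cos (x \<bullet> \<xi>) * Msym t \<xi>) / (2 * pi) ^ DIM('a)"
proof -
  have i: "integrable lborel (\<lambda>\<xi>. cis (x \<bullet> \<xi>) * complex_of_real (Msym t \<xi>))"
  proof (rule Bochner_Integration.integrable_bound[OF integrable_Msym[OF assms]])
    have "(\<lambda>\<xi>. cis (x \<bullet> \<xi>)) \<in> borel_measurable borel"
      by (intro borel_measurable_continuous_onI continuous_intros)
    then show "(\<lambda>\<xi>. cis (x \<bullet> \<xi>) * complex_of_real (Msym t \<xi>)) \<in> borel_measurable lborel" by simp
  qed (simp add: norm_mult)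
  have "Re (LINT \<xi>|lborel. cis (x \<bullet> \<xi>) * complex_of_real (Msym t \<xi>)) = (LINT \<xi>|lborel. cos (x \<bullet> \<xi>) * Msym t \<xi>)"
    using integral_Re[OF i] by simp
  then show ?thesis unfolding P_def heat_kernel_def Msym_def by simp
qed

lemma P_nonneg: "t > 0 \<Longrightarrow> P t x \<ge> 0"
  by (simp only: P_eq Msym_split) (use cos_stable_nonneg[OF s, of t t x] in simp)

lemma P_minus: "P t (- x) = P t x"
proof -
  have "(LINT \<xi>|lborel. cis ((- x) \<bullet> \<xi>) * complex_of_real (Msym t \<xi>)) =
    (LINT \<xi>|lborel. cis ((- x) \<bullet> (- \<xi>)) * complex_of_real (Msym t (- \<xi>)))"
    by (rule integral_lborel_minus[symmetric])
  then show ?thesis unfolding P_def heat_kernel_def Msym_def by simp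
qed

lemma borel_measurable_P [measurable]: "(\<lambda>z. P (fst z) (snd z)) \<in> borel_measurable (borel \<Otimes>\<^sub>M borel)"
proof -
  have [measurable]: "cis \<in> borel_measurable borel"
    by (intro borel_measurable_continuous_onI continuous_intros)
  have "(\<lambda>z. P (fst z) (snd z)) = (\<lambda>z. Re (LINT \<xi>|lborel. cis (snd z \<bullet> \<xi>) * complex_of_real (Msym (fst z) \<xi>)) / (2 * pi) ^ DIM('a))"
    by (simp add: P_def heat_kernel_def Msym_def)
  also have "\<dots> \<in> borel_measurable (borel \<Otimes>\<^sub>M borel)"
    unfolding Msym_def by measurable
  finally show ?thesis .
qed

lemma borel_measurable_P_comp [measurable (raw)]:
  assumes "g \<in> borel_measurable N" "h \<in> borel_measurable N"
  shows "(\<lambda>z. P (g z) (h z)) \<in> borel_measurable N"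
  using measurable_compose[OF measurable_Pair[OF assms] borel_measurable_P] by simp

text \<open>The inequality (y / \<kappa>) powr \<kappa> \<le> exp y with y = |\<xi>| powr (2 s) and
  \<kappa> = d / s bounds the function by a multiple of |\<xi>| powr (- 2 d) outside the unit
  ball.\<close>

lemma integrable_stable: "integrable lborel (\<lambda>\<xi>::'a. exp (- (norm \<xi> powr (2 * s))))"
proof -
  define m where "m = real DIM('a)"
  have m: "m > 0" "2 * m > real DIM('a)" by (auto simp: m_def)
  define \<kappa> where "\<kappa> = m / s"
  have \<kappa>: "\<kappa> > 0" using m s by (simp add: \<kappa>_def)
  show ?thesis
  proof (rule Bochner_Integration.integrable_bound)
    show "integrable lborel (\<lambda>\<xi>::'a. (1 + \<kappa> powr \<kappa>) * 2 powr m * wgt m \<xi>)"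
      by (intro integrable_mult_right integrable_wgt m)
    show "AE \<xi>::'a in lborel. norm (exp (- (norm \<xi> powr (2 * s)))) \<le> norm ((1 + \<kappa> powr \<kappa>) * 2 powr m * wgt m \<xi>)"
    proof (rule AE_I2)
      fix \<xi> :: 'a
      have K: "0 \<le> \<kappa> powr \<kappa>" by simp
      have "exp (- (norm \<xi> powr (2 * s))) \<le> (1 + \<kappa> powr \<kappa>) * (2 powr m * wgt m \<xi>)"
      proof (cases "norm \<xi> \<ge> 1")
        case True
        define y where "y = norm \<xi> powr (2 * s)"
        have y: "y > 0" using True by (auto simp: y_def)
        have "y / \<kappa> \<le> exp (y / \<kappa>)" using exp_ge_add_one_self[of "y / \<kappa>"] by linarith
        then have "(y / \<kappa>) powr \<kappa> \<le> exp (y / \<kappa>) powr \<kappa>" using y \<kappa> by (intro powr_mono2) auto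
        also have "exp (y / \<kappa>) powr \<kappa> = exp y" using \<kappa> by (simp add: powr_def)
        finally have "y powr \<kappa> \<le> \<kappa> powr \<kappa> * exp y" using y \<kappa> by (simp add: powr_divide field_simps)
        then have "exp (- y) \<le> \<kappa> powr \<kappa> * y powr - \<kappa>"
          using y by (simp add: exp_minus powr_minus field_simps)
        also have "y powr - \<kappa> = norm \<xi> powr - (2 * m)"
          unfolding y_def powr_powr using s by (simp add: \<kappa>_def)
        also have "\<dots> \<le> 2 powr m * wgt m \<xi>"
          using norm_powr_le_wgt[of m 1 \<xi>] m True by simp
        finally have "exp (- y) \<le> \<kappa> powr \<kappa> * (2 powr m * wgt m \<xi>)" by (simp add: mult_left_mono)
        also have "\<dots> \<le> (1 + \<kappa> powr \<kappa>) * (2 powr m * wgt m \<xi>)" by (intro mult_right_mono) auto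
        finally show ?thesis by (simp add: y_def)
      next
        case False
        then have "(norm \<xi>)\<^sup>2 \<le> 1" by (simp add: power_le_one)
        then have "2 powr - m \<le> wgt m \<xi>" unfolding wgt_def using m by (intro powr_mono2') auto
        then have "1 \<le> 2 powr m * wgt m \<xi>" by (simp add: powr_minus field_simps)
        moreover have "1 * (2 powr m * wgt m \<xi>) \<le> (1 + \<kappa> powr \<kappa>) * (2 powr m * wgt m \<xi>)"
          using K by (intro mult_right_mono) auto
        moreover have "exp (- (norm \<xi> powr (2 * s))) \<le> 1" by simp
        ultimately show ?thesis by linarith
      qed
      then show "norm (exp (- (norm \<xi> powr (2 * s)))) \<le> norm ((1 + \<kappa> powr \<kappa>) * 2 powr m * wgt m \<xi>)"
        using K by (simp add: mult.assoc)
    qed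
  qed measurable
qed

text \<open>The summand 1 gives positivity without a lower bound for the integral.\<close>

definition CP :: real where
  "CP = (LINT \<xi>::'a|lborel. exp (- (norm \<xi> powr (2 * s)))) / (2 * pi) ^ DIM('a) + 1"

lemma CP_pos: "CP > 0"
  unfolding CP_def by (intro add_nonneg_pos divide_nonneg_nonneg Bochner_Integration.integral_nonneg) auto

text \<open>Only the factor exp (- t |\<xi>| powr (2 s)) of the symbol is retained, and \<xi> is
  rescaled by t powr (- 1 / (2 s)). The Gaussian factor is at most 1, so one power of t is valid for
  short and for long times alike.\<close>

lemma P_sup:
  assumes t: "t > 0"
  shows "P t x \<le> CP * t powr - (real DIM('a) / (2 * s))"
proof -
  define c where "c = t powr - (1 / (2 * s))"
  have c: "c > 0" using t by (simp add: c_def)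
  have cs: "t * norm (c *\<^sub>R \<xi>) powr (2 * s) = norm \<xi> powr (2 * s)" for \<xi> :: 'a
  proof -
    have "norm (c *\<^sub>R \<xi>) powr (2 * s) = c powr (2 * s) * norm \<xi> powr (2 * s)"
      using c by (simp add: powr_mult)
    also have "c powr (2 * s) = 1 / t"
    proof -
      have "- (1 / (2 * s)) * (2 * s) = - 1" using s by simp
      then show ?thesis unfolding c_def powr_powr by (simp only: powr_neg_one[OF t])
    qed
    finally show ?thesis using t by simp
  qed
  have I: "integrable lborel (\<lambda>\<xi>::'a. exp (- t * norm \<xi> powr (2 * s)))"
    using integrable_stable cs integrable_lborel_affine_iff[of c "\<lambda>\<xi>::'a. exp (- t * norm \<xi> powr (2 * s))" 0] c by simp
  have "(LINT \<xi>|lborel. cos (x \<bullet> \<xi>) * Msym t \<xi>) \<le> (LINT \<xi>::'a|lborel. exp (- t * norm \<xi> powr (2 * s)))"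
  proof (rule integral_mono[OF integrable_cos_mult[OF integrable_Msym[OF t]] I])
    fix \<xi> :: 'a
    have "cos (x \<bullet> \<xi>) * Msym t \<xi> \<le> \<bar>cos (x \<bullet> \<xi>) * Msym t \<xi>\<bar>" by (rule abs_ge_self)
    also have "\<dots> \<le> Msym t \<xi>" by (rule abs_cos_mult_le) simp
    also have "\<dots> \<le> exp (- t * norm \<xi> powr (2 * s))" by (rule Msym_le_stable) (use t in simp)
    finally show "cos (x \<bullet> \<xi>) * Msym t \<xi> \<le> exp (- t * norm \<xi> powr (2 * s))" .
  qed
  also have "\<dots> = c ^ DIM('a) * (LINT \<xi>::'a|lborel. exp (- (norm \<xi> powr (2 * s))))"
    using c cs by (subst integral_lborel_affine[of c _ 0]) auto
  finally have "P t x \<le> c ^ DIM('a) * (LINT \<xi>::'a|lborel. exp (- (norm \<xi> powr (2 * s)))) / (2 * pi) ^ DIM('a)"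
    unfolding P_eq[OF t] by (rule divide_right_mono) simp
  also have "\<dots> = c ^ DIM('a) * (CP - 1)" by (simp add: CP_def)
  also have "\<dots> \<le> c ^ DIM('a) * CP" using c by simp
  also have "c ^ DIM('a) = t powr - (real DIM('a) / (2 * s))"
    unfolding c_def using t by (simp add: powr_power)
  finally show ?thesis by (simp add: mult.commute)
qed

text \<open>Normal density with variance 1/2 in each coordinate: what remains of the transform of
  exp (- \<delta> |x|^2) after \<xi> = 2 sqrt \<delta> \<eta>.\<close>

definition N0 :: "'a \<Rightarrow> real" where
  "N0 \<eta> = (1 / sqrt pi) ^ DIM('a) * exp (- 1 * (norm \<eta>)\<^sup>2)"

lemma N0_nonneg [simp]: "N0 \<eta> \<ge> 0" by (simp add: N0_def)

lemma borel_measurable_N0 [measurable]: "N0 \<in> borel_measurable borel"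
  unfolding N0_def[abs_def] by measurable

lemma integrable_N0: "integrable lborel N0"
  unfolding N0_def[abs_def] by (intro integrable_mult_right integrable_gauss) simp

lemma integral_N0: "(LINT \<eta>|lborel. N0 \<eta>) = 1"
  using integral_cos_gauss[of 1 "0::'a"] by (simp add: N0_def power_one_over)

text \<open>\<open>G t \<delta>\<close> will turn out to be the integral of the kernel against \<open>exp (- \<delta> \<bar>x\<bar>\<^sup>2)\<close>; it gives the mass of the
  kernel as \<open>\<delta> \<rightarrow> 0\<close> and its tails as \<open>t \<rightarrow> 0\<close>.\<close>

definition G :: "real \<Rightarrow> real \<Rightarrow> real" where
  "G t \<delta> = (LINT \<eta>|lborel. Msym t ((2 * sqrt \<delta>) *\<^sub>R \<eta>) * N0 \<eta>)"

lemma integrable_Msym_N0: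
  assumes "t \<ge> 0" shows "integrable lborel (\<lambda>\<eta>. Msym t (c *\<^sub>R \<eta>) * N0 \<eta>)"
  by (rule Bochner_Integration.integrable_bound[OF integrable_N0])
    (use assms in \<open>auto simp: abs_mult Msym_le_1 intro!: mult_left_le_one_le\<close>)

lemma G_le_1: "t \<ge> 0 \<Longrightarrow> G t \<delta> \<le> 1"
  unfolding G_def integral_N0[symmetric]
  by (intro integral_mono integrable_Msym_N0 integrable_N0) (auto simp: Msym_le_1 intro!: mult_left_le_one_le)

lemma G_tendsto:
  assumes "\<And>n. t n \<ge> 0" and lim: "\<And>\<eta>. (\<lambda>n. Msym (t n) ((2 * sqrt (\<delta> n)) *\<^sub>R \<eta>)) \<longlonglongrightarrow> 1"
  shows "(\<lambda>n. G (t n) (\<delta> n)) \<longlonglongrightarrow> 1"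
proof -
  have "(\<lambda>n. G (t n) (\<delta> n)) \<longlonglongrightarrow> (LINT \<eta>|lborel. 1 * N0 \<eta>)"
    unfolding G_def
  proof (rule integral_dominated_convergence[OF _ _ integrable_N0])
    show "AE \<eta> in lborel. (\<lambda>n. Msym (t n) ((2 * sqrt (\<delta> n)) *\<^sub>R \<eta>) * N0 \<eta>) \<longlonglongrightarrow> 1 * N0 \<eta>"
      by (intro AE_I2 tendsto_mult tendsto_const lim)
    show "AE \<eta> in lborel. norm (Msym (t n) ((2 * sqrt (\<delta> n)) *\<^sub>R \<eta>) * N0 \<eta>) \<le> N0 \<eta>" for n
      using assms(1) by (intro AE_I2) (auto simp: abs_mult Msym_le_1 intro!: mult_left_le_one_le)
  qed measurable
  then show ?thesis by (simp add: integral_N0)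
qed

lemma Msym_tendsto:
  assumes "(t \<longlongrightarrow> t0) F" "(X \<longlongrightarrow> \<xi>) F"
  shows "((\<lambda>n. Msym (t n) (X n)) \<longlongrightarrow> Msym t0 \<xi>) F"
proof -
  have h: "((\<lambda>n. norm (X n) powr (2 * s)) \<longlongrightarrow> norm \<xi> powr (2 * s)) F"
    by (rule tendsto_powr'[OF tendsto_norm[OF assms(2)] tendsto_const]) (use s in simp)
  show ?thesis unfolding Msym_def
    by (intro tendsto_exp tendsto_mult tendsto_minus tendsto_add tendsto_power tendsto_norm tendsto_const assms h)
qed

lemma integrable_gauss_P:
  assumes t: "t > 0" and \<delta>: "\<delta> > 0"
  shows "integrable lborel (\<lambda>x. exp (- \<delta> * (norm x)\<^sup>2) * P t x)"
proof (rule Bochner_Integration.integrable_bound)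
  show "integrable lborel (\<lambda>x::'a. CP * t powr - (real DIM('a) / (2 * s)) * exp (- \<delta> * (norm x)\<^sup>2))"
    using \<delta> by (intro integrable_mult_right integrable_gauss)
  show "AE x in lborel. norm (exp (- \<delta> * (norm x)\<^sup>2) * P t x) \<le> norm (CP * t powr - (real DIM('a) / (2 * s)) * exp (- \<delta> * (norm x)\<^sup>2))"
    using P_nonneg[OF t] P_sup[OF t] CP_pos by (intro AE_I2) (auto simp: abs_mult mult.commute intro!: mult_left_mono)
qed measurable

text \<open>Fubini moves the Fourier transform from the symbol to the Gaussian, where it is
  explicit. The Gaussian in x makes the double integral absolutely convergent before the kernel is
  known to be integrable.\<close>

lemma integral_gauss_P:
  assumes t: "t > 0" and \<delta>: "\<delta> > 0"
  shows "(LINT x|lborel. exp (- \<delta> * (norm x)\<^sup>2) * P t x) = G t \<delta>"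
proof -
  have prod: "integrable (lborel \<Otimes>\<^sub>M lborel) (\<lambda>(x::'a, \<xi>). exp (- \<delta> * (norm x)\<^sup>2) * (cos (x \<bullet> \<xi>) * Msym t \<xi>))"
  proof (rule Bochner_Integration.integrable_bound[OF integrable_lborel_prod'[OF integrable_gauss[OF \<delta>] integrable_Msym[OF t]]])
    show "AE z in lborel \<Otimes>\<^sub>M lborel. norm (case z of (x::'a, \<xi>) \<Rightarrow> exp (- \<delta> * (norm x)\<^sup>2) * (cos (x \<bullet> \<xi>) * Msym t \<xi>))
      \<le> norm (case z of (x, \<xi>) \<Rightarrow> exp (- \<delta> * (norm x)\<^sup>2) * Msym t \<xi>)"
      by (intro AE_I2) (auto simp: abs_mult split: prod.split intro!: mult_left_le_one_le)
  qed measurable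
  define K where "K = sqrt (pi / \<delta>) ^ DIM('a)"
  have "(LINT x|lborel. exp (- \<delta> * (norm x)\<^sup>2) * P t x) =
    (LINT x|lborel. (LINT \<xi>|lborel. exp (- \<delta> * (norm x)\<^sup>2) * (cos (x \<bullet> \<xi>) * Msym t \<xi>)) / (2 * pi) ^ DIM('a))"
    by (intro Bochner_Integration.integral_cong) (auto simp: P_eq[OF t])
  also have "\<dots> = (LINT x|lborel. LINT \<xi>|lborel. exp (- \<delta> * (norm x)\<^sup>2) * (cos (x \<bullet> \<xi>) * Msym t \<xi>)) / (2 * pi) ^ DIM('a)"
    by (rule integral_divide_zero)
  also have "(LINT x|lborel. LINT \<xi>|lborel. exp (- \<delta> * (norm x)\<^sup>2) * (cos (x \<bullet> \<xi>) * Msym t \<xi>)) =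
     (LINT \<xi>|lborel. LINT x|lborel. exp (- \<delta> * (norm x)\<^sup>2) * (cos (x \<bullet> \<xi>) * Msym t \<xi>))"
    using lborel_pair.Fubini_integral[OF prod] by simp
  also have "\<dots> = (LINT \<xi>|lborel. Msym t \<xi> * (K * exp (- (norm \<xi>)\<^sup>2 / (4 * \<delta>))))"
  proof (intro Bochner_Integration.integral_cong refl)
    fix \<xi> :: 'a
    have "(LINT x|lborel. exp (- \<delta> * (norm x)\<^sup>2) * (cos (x \<bullet> \<xi>) * Msym t \<xi>)) = (LINT x|lborel. Msym t \<xi> * (cos (\<xi> \<bullet> x) * exp (- \<delta> * (norm x)\<^sup>2)))"
      by (simp only: mult_ac inner_commute)
    also have "\<dots> = Msym t \<xi> * (LINT x|lborel. cos (\<xi> \<bullet> x) * exp (- \<delta> * (norm x)\<^sup>2))" by (rule integral_mult_right_zero)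
    finally show "(LINT x|lborel. exp (- \<delta> * (norm x)\<^sup>2) * (cos (x \<bullet> \<xi>) * Msym t \<xi>)) = Msym t \<xi> * (K * exp (- (norm \<xi>)\<^sup>2 / (4 * \<delta>)))"
      unfolding integral_cos_gauss[OF \<delta>] K_def .
  qed
  also have "\<dots> = (2 * sqrt \<delta>) ^ DIM('a) * (LINT \<eta>|lborel. Msym t ((2 * sqrt \<delta>) *\<^sub>R \<eta>) * (K * exp (- (norm ((2 * sqrt \<delta>) *\<^sub>R \<eta>))\<^sup>2 / (4 * \<delta>))))"
    using \<delta> by (subst integral_lborel_affine[of "2 * sqrt \<delta>" _ 0]) auto
  also have "(\<lambda>\<eta>. Msym t ((2 * sqrt \<delta>) *\<^sub>R \<eta>) * (K * exp (- (norm ((2 * sqrt \<delta>) *\<^sub>R \<eta>))\<^sup>2 / (4 * \<delta>)))) =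
     (\<lambda>\<eta>::'a. (K * sqrt pi ^ DIM('a)) * (Msym t ((2 * sqrt \<delta>) *\<^sub>R \<eta>) * N0 \<eta>))"
  proof
    fix \<eta> :: 'a
    have "(norm ((2 * sqrt \<delta>) *\<^sub>R \<eta>))\<^sup>2 / (4 * \<delta>) = (norm \<eta>)\<^sup>2"
      using \<delta> by (simp add: power_mult_distrib)
    then have e: "- (norm ((2 * sqrt \<delta>) *\<^sub>R \<eta>))\<^sup>2 / (4 * \<delta>) = - 1 * (norm \<eta>)\<^sup>2" by simp
    have h: "sqrt pi ^ DIM('a) * N0 \<eta> = exp (- 1 * (norm \<eta>)\<^sup>2)"
      by (simp add: N0_def power_one_over)
    show "Msym t ((2 * sqrt \<delta>) *\<^sub>R \<eta>) * (K * exp (- (norm ((2 * sqrt \<delta>) *\<^sub>R \<eta>))\<^sup>2 / (4 * \<delta>))) =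
      (K * sqrt pi ^ DIM('a)) * (Msym t ((2 * sqrt \<delta>) *\<^sub>R \<eta>) * N0 \<eta>)"
      unfolding e h[symmetric] by (simp only: mult_ac)
  qed
  also have "(2 * sqrt \<delta>) ^ DIM('a) * (LINT \<eta>|lborel. (K * sqrt pi ^ DIM('a)) * (Msym t ((2 * sqrt \<delta>) *\<^sub>R \<eta>) * N0 \<eta>)) / (2 * pi) ^ DIM('a)
     = ((2 * sqrt \<delta>) * sqrt (pi / \<delta>) * sqrt pi / (2 * pi)) ^ DIM('a) * G t \<delta>"
    unfolding integral_mult_right_zero G_def K_def by (simp add: power_mult_distrib power_divide)
  also have "(2 * sqrt \<delta>) * sqrt (pi / \<delta>) * sqrt pi / (2 * pi) = 1"
    using \<delta> by (simp add: real_sqrt_divide)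
  finally show ?thesis by simp
qed

text \<open>The mass is obtained without Fourier inversion. As \<delta> tends to 0, Fatou and
  \<open>G t \<delta>\<close> \<le> 1 first give integrability; dominated convergence then
  identifies the integral with the limit of \<open>G\<close>, which is the value 1 of the symbol at
  0.\<close>

lemma P_mass:
  assumes t: "t > 0"
  shows "integrable lborel (P t)" "(LINT x|lborel. P t x) = 1"
proof -
  let ?\<delta> = "\<lambda>n::nat. 1 / real (Suc n)"
  have \<delta>: "?\<delta> n > 0" for n by simp
  have \<delta>lim: "?\<delta> \<longlonglongrightarrow> 0" using LIMSEQ_inverse_real_of_nat by (simp add: inverse_eq_divide)
  have lim: "(\<lambda>n. exp (- ?\<delta> n * (norm x)\<^sup>2) * P t x) \<longlonglongrightarrow> P t x" for x
  proof -
    have "(\<lambda>n. exp (- ?\<delta> n * (norm x)\<^sup>2) * P t x) \<longlonglongrightarrow> exp (- 0 * (norm x)\<^sup>2) * P t x"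
      by (intro tendsto_intros \<delta>lim)
    then show ?thesis by simp
  qed
  have nn: "0 \<le> exp (- ?\<delta> n * (norm x)\<^sup>2) * P t x" for n x using P_nonneg[OF t] by simp
  have "(\<integral>\<^sup>+x. ennreal (P t x) \<partial>lborel) = (\<integral>\<^sup>+x. liminf (\<lambda>n. ennreal (exp (- ?\<delta> n * (norm x)\<^sup>2) * P t x)) \<partial>lborel)"
    by (intro nn_integral_cong lim_imp_Liminf[symmetric] tendsto_ennrealI lim) simp
  also have "\<dots> \<le> liminf (\<lambda>n. \<integral>\<^sup>+x. ennreal (exp (- ?\<delta> n * (norm x)\<^sup>2) * P t x) \<partial>lborel)"
    by (rule nn_integral_liminf) measurable
  also have "\<dots> \<le> liminf (\<lambda>n. (1::ennreal))"
  proof (intro Liminf_mono always_eventually allI)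
    fix n
    have "(\<integral>\<^sup>+x. ennreal (exp (- ?\<delta> n * (norm x)\<^sup>2) * P t x) \<partial>lborel) = ennreal (G t (?\<delta> n))"
      unfolding integral_gauss_P[OF t \<delta>, symmetric]
      by (rule nn_integral_eq_integral[OF integrable_gauss_P[OF t \<delta>]]) (use nn in auto)
    then show "(\<integral>\<^sup>+x. ennreal (exp (- ?\<delta> n * (norm x)\<^sup>2) * P t x) \<partial>lborel) \<le> 1"
      using G_le_1[of t "?\<delta> n"] t by simp
  qed
  also have "\<dots> = 1" by (intro lim_imp_Liminf tendsto_const) simp
  finally have le: "(\<integral>\<^sup>+x. ennreal (P t x) \<partial>lborel) \<le> 1" .
  show int: "integrable lborel (P t)"
    by (rule integrableI_bounded) (use le P_nonneg[OF t] in \<open>auto simp: order.strict_trans1\<close>)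
  have "(\<lambda>n. LINT x|lborel. exp (- ?\<delta> n * (norm x)\<^sup>2) * P t x) \<longlonglongrightarrow> (LINT x|lborel. P t x)"
  proof (rule integral_dominated_convergence[OF _ _ int])
    show "AE x in lborel. norm (exp (- ?\<delta> n * (norm x)\<^sup>2) * P t x) \<le> P t x" for n
      using P_nonneg[OF t] by (intro AE_I2) (auto simp: abs_mult intro!: mult_left_le_one_le)
  qed (use lim in auto)
  moreover have "(\<lambda>n. G t (?\<delta> n)) \<longlonglongrightarrow> 1"
  proof (rule G_tendsto)
    fix \<eta> :: 'a
    have "(\<lambda>n. (2 * sqrt (?\<delta> n)) *\<^sub>R \<eta>) \<longlonglongrightarrow> (2 * sqrt 0) *\<^sub>R \<eta>"
      by (intro tendsto_intros \<delta>lim)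
    from Msym_tendsto[OF tendsto_const[of t] this] show "(\<lambda>n. Msym t ((2 * sqrt (?\<delta> n)) *\<^sub>R \<eta>)) \<longlonglongrightarrow> 1"
      by (simp add: Msym_def)
  qed (use t in simp)
  ultimately show "(LINT x|lborel. P t x) = 1"
    unfolding integral_gauss_P[OF t \<delta>] by (rule LIMSEQ_unique)
qed

text \<open>A Chebyshev argument with 1 - exp (- |x|^2) in place of a moment: this function is
  bounded, so it is integrable against the kernel although higher moments may be infinite.\<close>

lemma P_tail:
  assumes t: "t > 0" and r: "r > 0"
  shows "(LINT x|lborel. indicator {x. norm x \<ge> r} x * P t x) \<le> (1 - G t 1) / (1 - exp (- r\<^sup>2))"
proof -
  have e: "1 - exp (- r\<^sup>2) > 0" using r by simp
  have i: "integrable lborel (\<lambda>x. P t x - exp (- 1 * (norm x)\<^sup>2) * P t x)"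
    by (intro Bochner_Integration.integrable_diff P_mass integrable_gauss_P t) simp
  have "(1 - exp (- r\<^sup>2)) * (LINT x|lborel. indicator {x. norm x \<ge> r} x * P t x) =
    (LINT x|lborel. (1 - exp (- r\<^sup>2)) * (indicator {x. norm x \<ge> r} x * P t x))" by simp
  also have "\<dots> \<le> (LINT x|lborel. P t x - exp (- 1 * (norm x)\<^sup>2) * P t x)"
  proof (rule integral_mono[OF _ i])
    show "integrable lborel (\<lambda>x. (1 - exp (- r\<^sup>2)) * (indicator {x. norm x \<ge> r} x * P t x))"
      using integrable_real_mult_indicator[OF _ P_mass(1)[OF t], of "{x. norm x \<ge> r}"]
      by (intro integrable_mult_right) (simp add: mult.commute)
    fix x :: 'a
    show "(1 - exp (- r\<^sup>2)) * (indicator {x. norm x \<ge> r} x * P t x) \<le> P t x - exp (- 1 * (norm x)\<^sup>2) * P t x"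
    proof (cases "norm x \<ge> r")
      case True
      then have "r\<^sup>2 \<le> (norm x)\<^sup>2" using r by (intro power_mono) auto
      then have "(1 - exp (- r\<^sup>2)) * P t x \<le> (1 - exp (- 1 * (norm x)\<^sup>2)) * P t x"
        using P_nonneg[OF t] by (intro mult_right_mono) auto
      then show ?thesis using True by (simp add: algebra_simps)
    next
      case False
      have "exp (- 1 * (norm x)\<^sup>2) * P t x \<le> P t x" using P_nonneg[OF t] by (intro mult_left_le_one_le) auto
      then show ?thesis using False by simp
    qed
  qed
  also have "\<dots> = 1 - G t 1"
    using integral_gauss_P[OF t, of 1] P_mass[OF t] integrable_gauss_P[OF t, of 1]
    by (subst Bochner_Integration.integral_diff) auto
  finally show ?thesis using e by (simp add: pos_le_divide_eq mult.commute)
qed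

lemma G_tendsto_0:
  assumes "\<And>n. t n \<ge> 0" "t \<longlonglongrightarrow> 0"
  shows "(\<lambda>n. G (t n) 1) \<longlonglongrightarrow> 1"
proof (rule G_tendsto)
  show "(\<lambda>n. Msym (t n) ((2 * sqrt 1) *\<^sub>R \<eta>)) \<longlonglongrightarrow> 1" for \<eta>
    using Msym_tendsto[OF assms(2) tendsto_const[of "(2 * sqrt 1) *\<^sub>R \<eta>"]] by (simp add: Msym_def)
qed (use assms in auto)

text \<open>Scheffe: pointwise convergence of probability densities implies convergence in L1. The
  pointwise limit is dominated by the symbol at time t0 / 2.\<close>

lemma P_L1_tendsto:
  assumes t: "\<And>n. t n > 0" "t \<longlonglongrightarrow> t0" and t0: "t0 > 0"
  shows "(\<lambda>n. LINT x|lborel. \<bar>P (t n) x - P t0 x\<bar>) \<longlonglongrightarrow> 0"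
proof -
  have "eventually (\<lambda>n. t n > t0 / 2) sequentially" using t t0 by (intro order_tendstoD(1)) auto
  then obtain N where N: "\<And>n. n \<ge> N \<Longrightarrow> t n > t0 / 2" by (auto simp: eventually_sequentially)
  have lim: "(\<lambda>n. P (t n) x) \<longlonglongrightarrow> P t0 x" for x
  proof (rule LIMSEQ_offset[of _ N])
    have "(\<lambda>n. LINT \<xi>|lborel. cos (x \<bullet> \<xi>) * Msym (t (n + N)) \<xi>) \<longlonglongrightarrow> (LINT \<xi>|lborel. cos (x \<bullet> \<xi>) * Msym t0 \<xi>)"
    proof (rule integral_dominated_convergence[OF _ _ integrable_Msym[of "t0 / 2"]])
      show "AE \<xi> in lborel. (\<lambda>n. cos (x \<bullet> \<xi>) * Msym (t (n + N)) \<xi>) \<longlonglongrightarrow> cos (x \<bullet> \<xi>) * Msym t0 \<xi>"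
        using LIMSEQ_ignore_initial_segment[OF t(2), of N] by (intro AE_I2 tendsto_mult tendsto_const Msym_tendsto)
      show "AE \<xi> in lborel. norm (cos (x \<bullet> \<xi>) * Msym (t (n + N)) \<xi>) \<le> Msym (t0 / 2) \<xi>" for n
      proof (rule AE_I2)
        fix \<xi> :: 'a
        have "\<bar>cos (x \<bullet> \<xi>) * Msym (t (n + N)) \<xi>\<bar> \<le> Msym (t (n + N)) \<xi>" by (rule abs_cos_mult_le) simp
        also have "\<dots> \<le> Msym (t0 / 2) \<xi>" using N[of "n + N"] by (intro Msym_antimono) simp
        finally show "norm (cos (x \<bullet> \<xi>) * Msym (t (n + N)) \<xi>) \<le> Msym (t0 / 2) \<xi>" by simp
      qed
    qed (use t0 in auto)
    then have "(\<lambda>n. (LINT \<xi>|lborel. cos (x \<bullet> \<xi>) * Msym (t (n + N)) \<xi>) / (2 * pi) ^ DIM('a)) \<longlonglongrightarrow> (LINT \<xi>|lborel. cos (x \<bullet> \<xi>) * Msym t0 \<xi>) / (2 * pi) ^ DIM('a)"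
      by (rule tendsto_divide[OF _ tendsto_const]) simp
    then show "(\<lambda>n. P (t (n + N)) x) \<longlonglongrightarrow> P t0 x" by (simp only: P_eq[OF t(1)] P_eq[OF t0])
  qed
  have nn1: "(\<integral>\<^sup>+x. ennreal (norm (P t x)) \<partial>lborel) = 1" if "t > 0" for t
    using nn_integral_eq_integral[OF P_mass(1)[OF that]] P_nonneg[OF that] P_mass(2)[OF that] by simp
  have "(\<lambda>n. \<integral>\<^sup>+x. ennreal (norm (P (t n) x - P t0 x)) \<partial>lborel) \<longlonglongrightarrow> 0"
    by (rule Scheffe_lemma2) (use P_mass(1)[OF t0] lim t t0 nn1 in auto)
  moreover have "(\<integral>\<^sup>+x. ennreal (norm (P (t n) x - P t0 x)) \<partial>lborel) = ennreal (LINT x|lborel. \<bar>P (t n) x - P t0 x\<bar>)" for n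
    using P_mass(1)[OF t(1)[of n]] P_mass(1)[OF t0] by (subst nn_integral_eq_integral) auto
  ultimately have "(\<lambda>n. ennreal (LINT x|lborel. \<bar>P (t n) x - P t0 x\<bar>)) \<longlonglongrightarrow> ennreal 0" by simp
  then show ?thesis by (subst (asm) tendsto_ennreal_iff) auto
qed

end

section \<open>Weak Lebesgue norms in dual form\<close>

text \<open>Relaxed indicator functions. Unlike indicators, they are preserved by convolution with a
  probability density, and bounded integrable nonnegative functions enter the class after division
  by a bound.\<close>

definition adm :: "('a::euclidean_space \<Rightarrow> real) \<Rightarrow> bool" where
  "adm h \<longleftrightarrow> integrable lborel h \<and> (\<forall>x. 0 \<le> h x \<and> h x \<le> 1)"

text \<open>\<open>weak q M g\<close> says that the norm of \<open>g\<close> in weak-\<open>L\<^sup>q\<close> is at most \<open>M\<close>, up to a constant that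
  depends on \<open>q\<close> only. In this form the semigroup is a contraction by symmetry of its kernel.\<close>

definition weak :: "real \<Rightarrow> real \<Rightarrow> ('a::euclidean_space \<Rightarrow> real) \<Rightarrow> bool" where
  "weak q M g \<longleftrightarrow> g \<in> borel_measurable borel \<and>
    (\<forall>h. adm h \<longrightarrow> (\<integral>\<^sup>+x. ennreal (\<bar>g x\<bar> * h x) \<partial>lborel) \<le> ennreal (M * (LINT x|lborel. h x) powr (1 - 1 / q)))"

lemma admD:
  assumes "adm h"
  shows "integrable lborel h" "h \<in> borel_measurable borel" "0 \<le> h x" "h x \<le> 1" "0 \<le> (LINT x|lborel. h x)"
  using assms by (auto simp: adm_def intro: Bochner_Integration.integral_nonneg)

lemma weak_measurable: "weak q M g \<Longrightarrow> g \<in> borel_measurable borel"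
  by (simp add: weak_def)

lemma weakD: "weak q M g \<Longrightarrow> adm h \<Longrightarrow>
    (\<integral>\<^sup>+x. ennreal (\<bar>g x\<bar> * h x) \<partial>lborel) \<le> ennreal (M * (LINT x|lborel. h x) powr (1 - 1 / q))"
  by (simp add: weak_def)

text \<open>A density of mass 0 vanishes almost everywhere, so both sides are 0 in that case and the
  laws of real powers may be used freely in the other.\<close>

lemma weakI:
  fixes g :: "'a::euclidean_space \<Rightarrow> real"
  assumes "g \<in> borel_measurable borel"
    and "\<And>h. adm h \<Longrightarrow> (LINT x|lborel. h x) > 0 \<Longrightarrow>
      (\<integral>\<^sup>+x. ennreal (\<bar>g x\<bar> * h x) \<partial>lborel) \<le> ennreal (M * (LINT x|lborel. h x) powr (1 - 1 / q))"
  shows "weak q M g"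
  unfolding weak_def
proof (intro conjI allI impI)
  fix h :: "'a \<Rightarrow> real" assume h: "adm h"
  show "(\<integral>\<^sup>+x. ennreal (\<bar>g x\<bar> * h x) \<partial>lborel) \<le> ennreal (M * (LINT x|lborel. h x) powr (1 - 1 / q))"
  proof (cases "(LINT x|lborel. h x) = 0")
    case True
    have "AE x in lborel. h x = 0"
      using True integral_nonneg_eq_0_iff_AE[OF admD(1)[OF h]] admD(3)[OF h] by auto
    then have "(\<integral>\<^sup>+x. ennreal (\<bar>g x\<bar> * h x) \<partial>lborel) = (\<integral>\<^sup>+(x::'a). 0 \<partial>lborel)"
      by (intro nn_integral_cong_AE) auto
    then show ?thesis by simp
  next
    case False
    then show ?thesis using assms(2)[OF h] admD(5)[OF h] by linarith
  qed
qed fact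

lemma weak_mono: "weak q M g \<Longrightarrow> M \<le> M' \<Longrightarrow> weak q M' g"
  unfolding weak_def by (meson ennreal_leI mult_right_mono order_trans powr_ge_zero)

lemma weak_add:
  assumes w: "weak q M g" "weak q M' g'" and M: "M \<ge> 0" "M' \<ge> 0"
    and f: "f \<in> borel_measurable borel" "\<And>x. \<bar>f x\<bar> \<le> \<bar>g x\<bar> + \<bar>g' x\<bar>"
  shows "weak q (M + M') f"
proof (rule weakI[OF f(1)])
  fix h :: "'a \<Rightarrow> real" assume h: "adm h"
  have [measurable]: "g \<in> borel_measurable borel" "g' \<in> borel_measurable borel" "h \<in> borel_measurable borel"
    using w weak_measurable admD[OF h] by auto
  define H where "H = (LINT x|lborel. h x) powr (1 - 1 / q)"
  have "(\<integral>\<^sup>+x. ennreal (\<bar>f x\<bar> * h x) \<partial>lborel) \<le> (\<integral>\<^sup>+x. ennreal (\<bar>g x\<bar> * h x) + ennreal (\<bar>g' x\<bar> * h x) \<partial>lborel)"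
  proof (rule nn_integral_mono)
    fix x
    have "\<bar>f x\<bar> * h x \<le> (\<bar>g x\<bar> + \<bar>g' x\<bar>) * h x" using f admD[OF h] by (intro mult_right_mono) auto
    then show "ennreal (\<bar>f x\<bar> * h x) \<le> ennreal (\<bar>g x\<bar> * h x) + ennreal (\<bar>g' x\<bar> * h x)"
      using admD(3)[OF h, of x] by (simp add: ennreal_plus[symmetric] distrib_right ennreal_leI del: ennreal_plus)
  qed
  also have "\<dots> = (\<integral>\<^sup>+x. ennreal (\<bar>g x\<bar> * h x) \<partial>lborel) + (\<integral>\<^sup>+x. ennreal (\<bar>g' x\<bar> * h x) \<partial>lborel)"
    by (rule nn_integral_add) measurable
  also have "\<dots> \<le> ennreal (M * H) + ennreal (M' * H)"
    unfolding H_def by (intro add_mono weakD w h)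
  also have "\<dots> = ennreal ((M + M') * H)"
    using M by (simp add: H_def distrib_right)
  finally show "(\<integral>\<^sup>+x. ennreal (\<bar>f x\<bar> * h x) \<partial>lborel) \<le> ennreal ((M + M') * (LINT x|lborel. h x) powr (1 - 1 / q))"
    by (simp add: H_def)
qed

section \<open>Interpolation, embeddings and powers for weak norms\<close>

lemma min_le_powr_interp:
  fixes X Y \<theta> :: real
  assumes "X \<ge> 0" "Y \<ge> 0" "0 \<le> \<theta>" "\<theta> \<le> 1"
  shows "min X Y \<le> X powr (1 - \<theta>) * Y powr \<theta>"
proof (cases "X = 0 \<or> Y = 0")
  case False
  then have pos: "X > 0" "Y > 0" using assms by auto
  define Z where "Z = min X Y"
  have Z: "Z > 0" "Z \<le> X" "Z \<le> Y" using pos by (auto simp: Z_def)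
  have "Z = Z powr (1 - \<theta>) * Z powr \<theta>" using Z by (simp add: powr_add[symmetric])
  also have "\<dots> \<le> X powr (1 - \<theta>) * Y powr \<theta>"
    using Z assms by (intro mult_mono powr_mono2) auto
  finally show ?thesis by (simp add: Z_def)
qed (use assms in auto)

text \<open>Both hypotheses bound the same integral against \<open>h\<close>. The smaller bound lies
  below the weighted geometric mean, whose power of the mass has the interpolated exponent, with
  constant 1.\<close>

lemma weak_interp:
  fixes g :: "'a::euclidean_space \<Rightarrow> real"
  assumes w: "weak q1 A g" "weak q2 B g" and AB: "A \<ge> 0" "B \<ge> 0" and \<theta>: "0 \<le> \<theta>" "\<theta> \<le> 1"
    and q: "1 / q = (1 - \<theta>) / q1 + \<theta> / q2"
  shows "weak q (A powr (1 - \<theta>) * B powr \<theta>) g"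
proof (rule weakI[OF weak_measurable[OF w(1)]])
  fix h :: "'a \<Rightarrow> real" assume h: "adm h" and Hp: "(LINT x|lborel. h x) > 0"
  define H where "H = (LINT x|lborel. h x)"
  define X where "X = A * H powr (1 - 1 / q1)"
  define Y where "Y = B * H powr (1 - 1 / q2)"
  have XY: "X \<ge> 0" "Y \<ge> 0" using AB by (auto simp: X_def Y_def)
  have "(\<integral>\<^sup>+x. ennreal (\<bar>g x\<bar> * h x) \<partial>lborel) \<le> ennreal (min X Y)"
    using weakD[OF w(1) h] weakD[OF w(2) h] by (simp add: X_def Y_def H_def min_def)
  also have "\<dots> \<le> ennreal (X powr (1 - \<theta>) * Y powr \<theta>)"
    by (intro ennreal_leI min_le_powr_interp XY \<theta>)
  also have "X powr (1 - \<theta>) * Y powr \<theta> = (A powr (1 - \<theta>) * B powr \<theta>) * (H powr ((1 - 1 / q1) * (1 - \<theta>)) * H powr ((1 - 1 / q2) * \<theta>))"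
    by (simp only: X_def Y_def powr_mult powr_powr mult_ac)
  also have "H powr ((1 - 1 / q1) * (1 - \<theta>)) * H powr ((1 - 1 / q2) * \<theta>) = H powr (1 - 1 / q)"
  proof -
    have "(1 - 1 / q1) * (1 - \<theta>) + (1 - 1 / q2) * \<theta> = 1 - 1 / q"
      unfolding q by (simp add: algebra_simps diff_divide_distrib)
    then show ?thesis by (simp only: powr_add[symmetric])
  qed
  finally show "(\<integral>\<^sup>+x. ennreal (\<bar>g x\<bar> * h x) \<partial>lborel) \<le> ennreal (A powr (1 - \<theta>) * B powr \<theta> * (LINT x|lborel. h x) powr (1 - 1 / q))"
    by (simp add: H_def)
qed

text \<open>|g| is split at the height l = N H powr (- 1/q): below it |g| h \<le> l h, above it |g|
  \<le> l powr (1 - q) |g| powr q. At this height the two bounds coincide, which explains the factor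
  2.\<close>

lemma weak_of_Lp:
  fixes g :: "'a::euclidean_space \<Rightarrow> real"
  assumes [measurable]: "g \<in> borel_measurable borel" and int: "integrable lborel (\<lambda>x. \<bar>g x\<bar> powr q)"
    and q: "q > 1" and N: "N > 0" "(LINT x|lborel. \<bar>g x\<bar> powr q) \<le> N powr q"
  shows "weak q (2 * N) g"
proof (rule weakI)
  fix h :: "'a \<Rightarrow> real" assume h: "adm h" and Hp: "(LINT x|lborel. h x) > 0"
  define H where "H = (LINT x|lborel. h x)"
  have H: "H > 0" using Hp by (simp add: H_def)
  define l where "l = N * H powr - (1 / q)"
  have l: "l > 0" using N H by (simp add: l_def)
  have [measurable]: "h \<in> borel_measurable borel" using admD[OF h] by auto
  have le: "\<bar>g x\<bar> * h x \<le> l * h x + l powr (1 - q) * \<bar>g x\<bar> powr q" for x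
  proof (cases "\<bar>g x\<bar> \<le> l")
    case True
    then have "\<bar>g x\<bar> * h x \<le> l * h x" using admD[OF h] by (intro mult_right_mono) auto
    then show ?thesis by (simp add: add_increasing2)
  next
    case False
    then have g: "\<bar>g x\<bar> > 0" using l by linarith
    have "\<bar>g x\<bar> * h x \<le> \<bar>g x\<bar> * 1" using admD[OF h] by (intro mult_left_mono) auto
    also have "\<dots> = \<bar>g x\<bar> powr (1 - q) * \<bar>g x\<bar> powr q" using g by (simp add: powr_add[symmetric])
    also have "\<dots> \<le> l powr (1 - q) * \<bar>g x\<bar> powr q"
      using False l q by (intro mult_right_mono powr_mono2') auto
    finally show ?thesis using l admD(3)[OF h, of x] by (simp add: add_increasing)
  qed
  have ih: "integrable lborel (\<lambda>x. l * h x + l powr (1 - q) * \<bar>g x\<bar> powr q)"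
    using admD(1)[OF h] int by (intro Bochner_Integration.integrable_add integrable_mult_right)
  have "(\<integral>\<^sup>+x. ennreal (\<bar>g x\<bar> * h x) \<partial>lborel) \<le> (\<integral>\<^sup>+x. ennreal (l * h x + l powr (1 - q) * \<bar>g x\<bar> powr q) \<partial>lborel)"
    by (intro nn_integral_mono ennreal_leI le)
  also have "\<dots> = ennreal (LINT x|lborel. l * h x + l powr (1 - q) * \<bar>g x\<bar> powr q)"
    by (rule nn_integral_eq_integral[OF ih]) (use l admD[OF h] in auto)
  also have "(LINT x|lborel. l * h x + l powr (1 - q) * \<bar>g x\<bar> powr q) = l * H + l powr (1 - q) * (LINT x|lborel. \<bar>g x\<bar> powr q)"
    using admD(1)[OF h] int by (subst Bochner_Integration.integral_add) (auto simp: H_def)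
  also have "ennreal \<dots> \<le> ennreal (l * H + l powr (1 - q) * N powr q)"
    using N by (intro ennreal_leI add_left_mono mult_left_mono) auto
  also have "l * H = N * H powr (1 - 1 / q)"
    unfolding l_def using H by (simp add: powr_diff powr_minus field_simps)
  also have "l powr (1 - q) * N powr q = N * H powr (1 - 1 / q)"
  proof -
    have "l powr (1 - q) * N powr q = (N powr (1 - q) * N powr q) * H powr (- (1 / q) * (1 - q))"
      unfolding l_def by (simp only: powr_mult powr_powr mult_ac)
    also have "N powr (1 - q) * N powr q = N" using N by (simp add: powr_add[symmetric])
    also have "- (1 / q) * (1 - q) = 1 - 1 / q" using q by (simp add: field_simps)
    finally show ?thesis .
  qed
  also have "N * H powr (1 - 1 / q) + N * H powr (1 - 1 / q) = 2 * N * H powr (1 - 1 / q)" by simp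
  finally show "(\<integral>\<^sup>+x. ennreal (\<bar>g x\<bar> * h x) \<partial>lborel) \<le> ennreal (2 * N * (LINT x|lborel. h x) powr (1 - 1 / q))"
    by (simp only: H_def)
qed simp

text \<open>Cutting \<open>h\<close> down to the level set yields an admissible density of some mass
  K, and testing with it gives l K \<le> M K powr (1 - 1/q). This recovers the distributional form
  of the weak norm, relative to \<open>h\<close>.\<close>

lemma weak_level_set:
  fixes g :: "'a::euclidean_space \<Rightarrow> real"
  assumes w: "weak q M g" and q: "q > 0" and M: "M \<ge> 0" and h: "adm h" and l: "l > 0"
  shows "(\<integral>\<^sup>+x. ennreal (h x) * (if l \<le> \<bar>g x\<bar> then 1 else 0) \<partial>lborel) \<le> ennreal ((M / l) powr q)"
proof -
  have [measurable]: "g \<in> borel_measurable borel" "h \<in> borel_measurable borel"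
    using weak_measurable[OF w] admD[OF h] by auto
  define k where "k x = (if l \<le> \<bar>g x\<bar> then h x else 0)" for x
  have km[measurable]: "k \<in> borel_measurable borel" unfolding k_def[abs_def] by measurable
  have k: "adm k" unfolding adm_def
  proof
    show "integrable lborel k"
      by (rule Bochner_Integration.integrable_bound[OF admD(1)[OF h]]) (use admD(3)[OF h] in \<open>auto simp: k_def\<close>)
  qed (use admD[OF h] in \<open>auto simp: k_def\<close>)
  define K where "K = (LINT x|lborel. k x)"
  have K0: "K \<ge> 0" unfolding K_def by (rule admD(5)[OF k])
  have "(\<integral>\<^sup>+x. ennreal (h x) * (if l \<le> \<bar>g x\<bar> then 1 else 0) \<partial>lborel) = (\<integral>\<^sup>+x. ennreal (k x) \<partial>lborel)"
    by (intro nn_integral_cong) (auto simp: k_def)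
  also have "\<dots> = ennreal K"
    unfolding K_def by (rule nn_integral_eq_integral[OF admD(1)[OF k]]) (use admD(3)[OF k] in auto)
  also have "\<dots> \<le> ennreal ((M / l) powr q)"
  proof (cases "K = 0")
    case False
    then have K: "K > 0" using K0 by simp
    have "ennreal (l * K) = (\<integral>\<^sup>+x. ennreal (l * k x) \<partial>lborel)"
      unfolding K_def using admD(1,3)[OF k] l
      by (subst nn_integral_eq_integral) auto
    also have "\<dots> \<le> (\<integral>\<^sup>+x. ennreal (\<bar>g x\<bar> * k x) \<partial>lborel)"
      using admD(3)[OF h] by (intro nn_integral_mono ennreal_leI) (auto simp: k_def intro!: mult_right_mono)
    also have "\<dots> \<le> ennreal (M * K powr (1 - 1 / q))"
      unfolding K_def by (rule weakD[OF w k])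
    finally have "l * K \<le> M * K powr (1 - 1 / q)"
      using M by (simp add: ennreal_le_iff)
    also have "K powr (1 - 1 / q) = K / K powr (1 / q)" using K by (simp add: powr_diff)
    finally have "l * K powr (1 / q) \<le> M" using K by (simp add: field_simps)
    then have "K powr (1 / q) \<le> M / l" using l by (simp add: field_simps)
    then have "(K powr (1 / q)) powr q \<le> (M / l) powr q" using q by (intro powr_mono2) auto
    then show ?thesis using K q by (simp add: powr_powr ennreal_leI)
  qed simp
  finally show ?thesis .
qed

text \<open>Layer cake for |g| powr p above the height l0 = M H powr (- 1/q). The level sets have
  mass at most (M / l) powr q, and p < q makes the integral over l converge. Heights below l0
  contribute 1 to the constant, those above p / (q - p).\<close>

lemma weak_power:
  fixes g :: "'a::euclidean_space \<Rightarrow> real"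
  assumes w: "weak q M g" and p: "0 < p" "p < q" and M: "M > 0"
  shows "weak (q / p) ((1 + p / (q - p)) * M powr p) (\<lambda>x. \<bar>g x\<bar> powr p)"
proof (rule weakI)
  have [measurable]: "g \<in> borel_measurable borel" using weak_measurable[OF w] by auto
  show "(\<lambda>x. \<bar>g x\<bar> powr p) \<in> borel_measurable borel" by measurable
  fix h :: "'a \<Rightarrow> real" assume h: "adm h" and Hp: "(LINT x|lborel. h x) > 0"
  have [measurable]: "h \<in> borel_measurable borel" using admD[OF h] by auto
  define H where "H = (LINT x|lborel. h x)"
  have H: "H > 0" using Hp by (simp add: H_def)
  define l0 where "l0 = M * H powr - (1 / q)"
  have l0: "l0 > 0" using M H by (simp add: l0_def)
  let ?i = "\<lambda>l x. if l \<le> \<bar>g x\<bar> then 1 else (0::ennreal)"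
  have pw: "ennreal (\<bar>g x\<bar> powr p) \<le> ennreal (l0 powr p) + (\<integral>\<^sup>+l. ennreal (p * l powr (p - 1)) * indicator {l0..} l * ?i l x \<partial>lborel)" for x
  proof (cases "\<bar>g x\<bar> \<le> l0")
    case True
    then have "\<bar>g x\<bar> powr p \<le> l0 powr p" using p by (intro powr_mono2) auto
    then show ?thesis by (simp add: add_increasing2 ennreal_leI)
  next
    case False
    have "(\<integral>\<^sup>+l. ennreal (p * l powr (p - 1)) * indicator {l0..\<bar>g x\<bar>} l \<partial>lborel) = ennreal (\<bar>g x\<bar> powr p - l0 powr p)"
    proof (rule nn_integral_FTC_Icc)
      fix l assume "l \<in> {l0..\<bar>g x\<bar>}"
      then have "l > 0" using l0 by auto
      then show "((\<lambda>l. l powr p) has_real_derivative p * l powr (p - 1)) (at l)" by (rule has_real_derivative_powr)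
      show "0 \<le> p * l powr (p - 1)" using p by simp
    qed (use False in auto)
    then have "ennreal (\<bar>g x\<bar> powr p) = ennreal (l0 powr p) + (\<integral>\<^sup>+l. ennreal (p * l powr (p - 1)) * indicator {l0..\<bar>g x\<bar>} l \<partial>lborel)"
      using False p l0 by (simp add: ennreal_plus[symmetric] powr_mono2 del: ennreal_plus)
    also have "(\<integral>\<^sup>+l. ennreal (p * l powr (p - 1)) * indicator {l0..\<bar>g x\<bar>} l \<partial>lborel)
      \<le> (\<integral>\<^sup>+l. ennreal (p * l powr (p - 1)) * indicator {l0..} l * ?i l x \<partial>lborel)"
      by (intro nn_integral_mono) (auto simp: indicator_def)
    finally show ?thesis by (simp add: add_left_mono)
  qed
  have "(\<integral>\<^sup>+x. ennreal (\<bar>\<bar>g x\<bar> powr p\<bar> * h x) \<partial>lborel) = (\<integral>\<^sup>+x. ennreal (\<bar>g x\<bar> powr p) * ennreal (h x) \<partial>lborel)"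
    using admD(3)[OF h] by (intro nn_integral_cong) (simp add: ennreal_mult)
  also have "\<dots> \<le> (\<integral>\<^sup>+x. (ennreal (l0 powr p) + (\<integral>\<^sup>+l. ennreal (p * l powr (p - 1)) * indicator {l0..} l * ?i l x \<partial>lborel)) * ennreal (h x) \<partial>lborel)"
    by (intro nn_integral_mono mult_right_mono pw) auto
  also have "\<dots> = (\<integral>\<^sup>+x. ennreal (l0 powr p) * ennreal (h x) + (\<integral>\<^sup>+l. ennreal (p * l powr (p - 1)) * indicator {l0..} l * ?i l x * ennreal (h x) \<partial>lborel) \<partial>lborel)"
    by (intro nn_integral_cong, subst nn_integral_multc) (auto simp: distrib_right)
  also have "\<dots> = (\<integral>\<^sup>+x. ennreal (l0 powr p) * ennreal (h x) \<partial>lborel) + (\<integral>\<^sup>+x. \<integral>\<^sup>+l. ennreal (p * l powr (p - 1)) * indicator {l0..} l * ?i l x * ennreal (h x) \<partial>lborel \<partial>lborel)"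
    by (rule nn_integral_add) measurable
  also have "(\<integral>\<^sup>+x. ennreal (l0 powr p) * ennreal (h x) \<partial>lborel) = ennreal (l0 powr p * H)"
  proof -
    have "(\<integral>\<^sup>+x. ennreal (h x) \<partial>lborel) = ennreal H"
      unfolding H_def by (rule nn_integral_eq_integral[OF admD(1)[OF h]]) (use admD(3)[OF h] in auto)
    then show ?thesis using H by (simp add: nn_integral_cmult ennreal_mult)
  qed
  also have "(\<integral>\<^sup>+x. \<integral>\<^sup>+l. ennreal (p * l powr (p - 1)) * indicator {l0..} l * ?i l x * ennreal (h x) \<partial>lborel \<partial>lborel)
     = (\<integral>\<^sup>+l. \<integral>\<^sup>+x. ennreal (p * l powr (p - 1)) * indicator {l0..} l * ?i l x * ennreal (h x) \<partial>lborel \<partial>lborel)"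
    by (rule lborel_pair.Fubini') measurable
  also have "\<dots> \<le> (\<integral>\<^sup>+l. ennreal (p * M powr q) * (ennreal (l powr (p - 1 - q)) * indicator {l0..} l) \<partial>lborel)"
  proof (rule nn_integral_mono)
    fix l
    show "(\<integral>\<^sup>+x. ennreal (p * l powr (p - 1)) * indicator {l0..} l * ?i l x * ennreal (h x) \<partial>lborel)
      \<le> ennreal (p * M powr q) * (ennreal (l powr (p - 1 - q)) * indicator {l0..} l)"
    proof (cases "l \<ge> l0")
      case True
      then have l: "l > 0" using l0 by linarith
      have "(\<integral>\<^sup>+x. ennreal (p * l powr (p - 1)) * indicator {l0..} l * ?i l x * ennreal (h x) \<partial>lborel)
        = (\<integral>\<^sup>+x. ennreal (p * l powr (p - 1)) * (ennreal (h x) * ?i l x) \<partial>lborel)"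
        using True by (intro nn_integral_cong) (auto simp: mult_ac)
      also have "\<dots> = ennreal (p * l powr (p - 1)) * (\<integral>\<^sup>+x. ennreal (h x) * ?i l x \<partial>lborel)"
        by (rule nn_integral_cmult) measurable
      also have "\<dots> \<le> ennreal (p * l powr (p - 1)) * ennreal ((M / l) powr q)"
        by (intro mult_left_mono weak_level_set[OF w _ _ h l]) (use p M in auto)
      also have "\<dots> = ennreal (p * M powr q) * ennreal (l powr (p - 1 - q))"
      proof -
        have "(M / l) powr q = M powr q / l powr q" using M l by (simp add: powr_divide)
        then have "p * l powr (p - 1) * (M / l) powr q = p * M powr q * l powr (p - 1 - q)"
          unfolding powr_diff[of l "p - 1" q] by simp
        then show ?thesis using p by (simp add: ennreal_mult[symmetric])
      qed
      finally show ?thesis using True by simp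
    qed simp
  qed
  also have "\<dots> = ennreal (p * M powr q) * ennreal (- (l0 powr (p - 1 - q + 1)) / (p - 1 - q + 1))"
    using p l0 by (subst nn_integral_cmult) (auto simp: nn_integral_powr_to_inf)
  also have "\<dots> = ennreal (p / (q - p) * (M powr q * l0 powr (p - q)))"
  proof -
    have e: "- (l0 powr (p - 1 - q + 1)) / (p - 1 - q + 1) = l0 powr (p - q) / (q - p)"
      using p by (simp add: field_simps)
    show ?thesis unfolding e using p by (simp add: ennreal_mult[symmetric] field_simps)
  qed
  also have "M powr q * l0 powr (p - q) = M powr p * H powr (1 - 1 / (q / p))"
  proof -
    have "M powr q * l0 powr (p - q) = (M powr q * M powr (p - q)) * H powr (- (1 / q) * (p - q))"
      unfolding l0_def by (simp only: powr_mult powr_powr mult_ac)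
    also have "M powr q * M powr (p - q) = M powr p" using M by (simp add: powr_add[symmetric])
    also have "- (1 / q) * (p - q) = 1 - 1 / (q / p)" using p by (simp add: field_simps)
    finally show ?thesis .
  qed
  also have "l0 powr p * H = M powr p * H powr (1 - 1 / (q / p))"
  proof -
    have "l0 powr p * H = M powr p * (H powr (- (1 / q) * p) * H powr 1)"
      unfolding l0_def using H by (simp add: powr_mult powr_powr)
    also have "H powr (- (1 / q) * p) * H powr 1 = H powr (1 - 1 / (q / p))"
    proof -
      have "- (1 / q) * p + 1 = 1 - 1 / (q / p)" by simp
      then show ?thesis by (simp only: powr_add[symmetric])
    qed
    finally show ?thesis .
  qed
  also have "ennreal (M powr p * H powr (1 - 1 / (q / p))) + ennreal (p / (q - p) * (M powr p * H powr (1 - 1 / (q / p))))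
     = ennreal ((1 + p / (q - p)) * M powr p * H powr (1 - 1 / (q / p)))"
    using p by (simp add: ennreal_plus[symmetric] distrib_right mult.assoc del: ennreal_plus)
  finally show "(\<integral>\<^sup>+x. ennreal (\<bar>\<bar>g x\<bar> powr p\<bar> * h x) \<partial>lborel) \<le> ennreal ((1 + p / (q - p)) * M powr p * (LINT x|lborel. h x) powr (1 - 1 / (q / p)))"
    by (simp add: H_def add_left_mono)
qed

section \<open>Convolution and Duhamel bounds in weak norms\<close>

context mixed_heat
begin

text \<open>A majorant of the semigroup with values in the extended nonnegative reals, so that
  Tonelli applies before any integrability is known.\<close>

definition Cv :: "real \<Rightarrow> ('a \<Rightarrow> real) \<Rightarrow> 'a \<Rightarrow> ennreal" where
  "Cv \<sigma> g x = (\<integral>\<^sup>+y. ennreal (P \<sigma> (x - y) * \<bar>g y\<bar>) \<partial>lborel)"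

lemma integral_P_shift: "t > 0 \<Longrightarrow> integrable lborel (\<lambda>y. P t (x - y))" "t > 0 \<Longrightarrow> (LINT y|lborel. P t (x - y)) = 1"
  using P_mass[of t] by (simp_all add: integrable_lborel_diff_iff integral_lborel_diff)

lemma nn_integral_P: "t > 0 \<Longrightarrow> (\<integral>\<^sup>+y. ennreal (P t (x - y)) \<partial>lborel) = 1" "t > 0 \<Longrightarrow> (\<integral>\<^sup>+y. ennreal (P t (y - x)) \<partial>lborel) = 1"
proof -
  assume t: "t > 0"
  show 1: "(\<integral>\<^sup>+y. ennreal (P t (x - y)) \<partial>lborel) = 1"
    using integral_P_shift[OF t] P_nonneg[OF t] by (subst nn_integral_eq_integral) auto
  have "P t (y - x) = P t (x - y)" for y using P_minus[of t "x - y"] by simp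
  then show "(\<integral>\<^sup>+y. ennreal (P t (y - x)) \<partial>lborel) = 1" using 1 by simp
qed

text \<open>The kernel is even, nonnegative and of mass 1, so convolution keeps the bounds 0 and 1
  as well as the total mass, while the sup bound of the kernel yields a second, decaying bound.
  Duality estimates only need these facts about the convolved density.\<close>

lemma adm_conv:
  assumes h: "adm h" and t: "t > 0"
  defines "k \<equiv> \<lambda>y. LINT x|lborel. P t (x - y) * h x"
  shows "adm k" "(LINT y|lborel. k y) = (LINT x|lborel. h x)"
    "k y \<le> CP * t powr - (real DIM('a) / (2 * s)) * (LINT x|lborel. h x)"
    "(\<integral>\<^sup>+x. ennreal (P t (x - y) * h x) \<partial>lborel) = ennreal (k y)"
proof -
  have [measurable]: "h \<in> borel_measurable borel" using admD[OF h] by auto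
  have sym: "P t (x - y) = P t (y - x)" for x y using P_minus[of t "y - x"] by simp
  have int: "integrable lborel (\<lambda>x. P t (x - y) * h x)" for y
    by (rule Bochner_Integration.integrable_bound[OF integral_P_shift(1)[OF t, of y]])
      (use admD[OF h] P_nonneg[OF t] in \<open>auto simp: abs_mult sym[of _ y] intro!: AE_I2 mult_left_le\<close>)
  have nn: "0 \<le> P t (x - y) * h x" for x y using P_nonneg[OF t] admD(3)[OF h] by simp
  show eq: "(\<integral>\<^sup>+x. ennreal (P t (x - y) * h x) \<partial>lborel) = ennreal (k y)" for y
    unfolding k_def by (rule nn_integral_eq_integral[OF int]) (use nn in auto)
  have [measurable]: "k \<in> borel_measurable borel" unfolding k_def by measurable
  have k0: "k y \<ge> 0" for y unfolding k_def by (intro Bochner_Integration.integral_nonneg nn)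
  have k1: "k y \<le> 1" for y
    unfolding k_def integral_P_shift(2)[OF t, of y, symmetric]
    by (rule integral_mono[OF int integral_P_shift(1)[OF t]]) (use admD[OF h] P_nonneg[OF t] in \<open>auto simp: sym[of _ y] intro!: mult_left_le\<close>)
  show "k y \<le> CP * t powr - (real DIM('a) / (2 * s)) * (LINT x|lborel. h x)" for y
  proof -
    have "k y \<le> (LINT x|lborel. (CP * t powr - (real DIM('a) / (2 * s))) * h x)"
      unfolding k_def
      by (rule integral_mono[OF int integrable_mult_right[OF admD(1)[OF h]]]) (use P_sup[OF t] admD(3)[OF h] in \<open>auto intro!: mult_right_mono\<close>)
    then show ?thesis by simp
  qed
  have hH: "(\<integral>\<^sup>+x. ennreal (h x) \<partial>lborel) = ennreal (LINT x|lborel. h x)"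
    by (rule nn_integral_eq_integral[OF admD(1)[OF h]]) (use admD(3)[OF h] in auto)
  have "(\<integral>\<^sup>+y. ennreal (k y) \<partial>lborel) = (\<integral>\<^sup>+y. \<integral>\<^sup>+x. ennreal (P t (x - y) * h x) \<partial>lborel \<partial>lborel)"
    by (simp add: eq)
  also have "\<dots> = (\<integral>\<^sup>+x. \<integral>\<^sup>+y. ennreal (P t (x - y) * h x) \<partial>lborel \<partial>lborel)"
    by (rule lborel_pair.Fubini') measurable
  also have "\<dots> = (\<integral>\<^sup>+x. ennreal (h x) \<partial>lborel)"
  proof (intro nn_integral_cong)
    fix x
    have "(\<integral>\<^sup>+y. ennreal (P t (x - y) * h x) \<partial>lborel) = (\<integral>\<^sup>+y. ennreal (P t (x - y)) * ennreal (h x) \<partial>lborel)"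
      using admD(3)[OF h] P_nonneg[OF t] by (intro nn_integral_cong) (simp add: ennreal_mult)
    also have "\<dots> = ennreal (h x)" by (subst nn_integral_multc) (auto simp: nn_integral_P[OF t])
    finally show "(\<integral>\<^sup>+y. ennreal (P t (x - y) * h x) \<partial>lborel) = ennreal (h x)" .
  qed
  finally have kk: "(\<integral>\<^sup>+y. ennreal (k y) \<partial>lborel) = ennreal (LINT x|lborel. h x)" unfolding hH .
  have ik: "integrable lborel k"
    by (rule integrableI_bounded) (use kk k0 in auto)
  then show "adm k" using k0 k1 by (simp add: adm_def)
  show "(LINT y|lborel. k y) = (LINT x|lborel. h x)"
    using kk nn_integral_eq_integral[OF ik] k0 admD(5)[OF h] Bochner_Integration.integral_nonneg[of lborel k]
    by (simp add: ennreal_inj)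
qed

lemma Cv_measurable [measurable (raw)]:
  assumes "(\<lambda>z. \<sigma> z) \<in> borel_measurable N" "(\<lambda>(z, y). g z y) \<in> borel_measurable (N \<Otimes>\<^sub>M borel)" "x \<in> borel_measurable N"
  shows "(\<lambda>z. Cv (\<sigma> z) (g z) (x z)) \<in> borel_measurable N"
proof -
  note [measurable] = assms
  show ?thesis unfolding Cv_def by measurable
qed

text \<open>Tonelli shifts the convolution onto \<open>h\<close>. The first bound uses that mass is
  preserved. For the second, the convolved density is at most l = CP t powr (- d / (2 s)) H; divided
  by l it is admissible with the small mass H / l, and l (H / l) powr (1 - 1/q) contains the decay
  in time.\<close>

lemma Cv_dual:
  assumes w: "weak q M g" and q: "q > 1" and M: "M \<ge> 0" and h: "adm h" and H: "(LINT x|lborel. h x) > 0" and t: "t > 0"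
  shows "(\<integral>\<^sup>+x. Cv t g x * ennreal (h x) \<partial>lborel) \<le> ennreal (M * (LINT x|lborel. h x) powr (1 - 1 / q))" (is ?a)
    and "(\<integral>\<^sup>+x. Cv t g x * ennreal (h x) \<partial>lborel) \<le>
      ennreal (M * (CP powr (1 / q) * t powr - (real DIM('a) / (2 * s * q))) * (LINT x|lborel. h x))" (is ?b)
proof -
  have [measurable]: "g \<in> borel_measurable borel" "h \<in> borel_measurable borel"
    using weak_measurable[OF w] admD[OF h] by auto
  define k where "k y = (LINT x|lborel. P t (x - y) * h x)" for y
  note k = adm_conv[OF h t, folded k_def]
  define H where "H = (LINT x|lborel. h x)"
  have Hp: "H > 0" using H by (simp add: H_def)
  have "(\<integral>\<^sup>+x. Cv t g x * ennreal (h x) \<partial>lborel) = (\<integral>\<^sup>+x. \<integral>\<^sup>+y. ennreal (P t (x - y) * \<bar>g y\<bar>) * ennreal (h x) \<partial>lborel \<partial>lborel)"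
    unfolding Cv_def by (intro nn_integral_cong, subst nn_integral_multc) auto
  also have "\<dots> = (\<integral>\<^sup>+y. \<integral>\<^sup>+x. ennreal (P t (x - y) * \<bar>g y\<bar>) * ennreal (h x) \<partial>lborel \<partial>lborel)"
    by (rule lborel_pair.Fubini') measurable
  also have "\<dots> = (\<integral>\<^sup>+y. ennreal (\<bar>g y\<bar> * k y) \<partial>lborel)"
  proof (intro nn_integral_cong)
    fix y
    have "(\<integral>\<^sup>+x. ennreal (P t (x - y) * \<bar>g y\<bar>) * ennreal (h x) \<partial>lborel) = (\<integral>\<^sup>+x. ennreal \<bar>g y\<bar> * ennreal (P t (x - y) * h x) \<partial>lborel)"
      using admD(3)[OF h] P_nonneg[OF t] by (intro nn_integral_cong) (simp add: ennreal_mult mult_ac)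
    also have "\<dots> = ennreal \<bar>g y\<bar> * ennreal (k y)"
      by (subst nn_integral_cmult) (auto simp: k(4))
    finally show "(\<integral>\<^sup>+x. ennreal (P t (x - y) * \<bar>g y\<bar>) * ennreal (h x) \<partial>lborel) = ennreal (\<bar>g y\<bar> * k y)"
      using admD(3)[OF k(1)] by (simp add: ennreal_mult)
  qed
  finally have eq: "(\<integral>\<^sup>+x. Cv t g x * ennreal (h x) \<partial>lborel) = (\<integral>\<^sup>+y. ennreal (\<bar>g y\<bar> * k y) \<partial>lborel)" .
  show ?a using weakD[OF w k(1)] unfolding eq k(2) .
  define l where "l = CP * t powr - (real DIM('a) / (2 * s)) * H"
  have l: "l > 0" using CP_pos t Hp by (simp add: l_def)
  have kl: "adm (\<lambda>y. k y / l)" unfolding adm_def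
    using admD[OF k(1)] k(3) l by (auto simp: l_def H_def divide_le_eq)
  have "(\<integral>\<^sup>+y. ennreal (\<bar>g y\<bar> * k y) \<partial>lborel) = (\<integral>\<^sup>+y. ennreal l * ennreal (\<bar>g y\<bar> * (k y / l)) \<partial>lborel)"
    using l by (intro nn_integral_cong) (simp add: ennreal_mult'[symmetric])
  also have "\<dots> = ennreal l * (\<integral>\<^sup>+y. ennreal (\<bar>g y\<bar> * (k y / l)) \<partial>lborel)"
    using admD(2)[OF k(1)] by (intro nn_integral_cmult) auto
  also have "\<dots> \<le> ennreal l * ennreal (M * (LINT y|lborel. k y / l) powr (1 - 1 / q))"
    by (intro mult_left_mono weakD[OF w kl]) simp
  also have "(LINT y|lborel. k y / l) = H / l" using k(2) by (simp add: H_def)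
  also have "ennreal l * ennreal (M * (H / l) powr (1 - 1 / q)) = ennreal (M * (l * (H / l) powr (1 - 1 / q)))"
    using l M by (simp add: ennreal_mult'[symmetric] mult_ac)
  also have "l * (H / l) powr (1 - 1 / q) = (CP powr (1 / q) * t powr - (real DIM('a) / (2 * s * q))) * H"
  proof -
    have "l * (H / l) powr (1 - 1 / q) = H * (l / H) powr (1 / q)"
      using l Hp by (simp add: powr_divide powr_diff field_simps)
    also have "l / H = CP * t powr - (real DIM('a) / (2 * s))" using Hp by (simp add: l_def)
    also have "\<dots> powr (1 / q) = CP powr (1 / q) * t powr - (real DIM('a) / (2 * s * q))"
      by (simp add: powr_mult powr_powr)
    finally show ?thesis by (simp add: mult_ac)
  qed
  finally show ?b unfolding eq H_def by (simp add: mult_ac)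
qed

text \<open>The translated kernel divided by its sup bound is itself an admissible density, of mass
  1 / l.\<close>

lemma Cv_pointwise:
  assumes w: "weak q M g" and M: "M \<ge> 0" and t: "t > 0"
  shows "Cv t g x \<le> ennreal (M * (CP powr (1 / q) * t powr - (real DIM('a) / (2 * s * q))))"
proof -
  have [measurable]: "g \<in> borel_measurable borel" using weak_measurable[OF w] by auto
  define l where "l = CP * t powr - (real DIM('a) / (2 * s))"
  have l: "l > 0" using CP_pos t by (simp add: l_def)
  have a: "adm (\<lambda>y. P t (x - y) / l)" unfolding adm_def
    using integral_P_shift(1)[OF t] P_nonneg[OF t] P_sup[OF t] l by (auto simp: l_def divide_le_eq)
  have "Cv t g x = (\<integral>\<^sup>+y. ennreal l * ennreal (\<bar>g y\<bar> * (P t (x - y) / l)) \<partial>lborel)"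
    unfolding Cv_def using l by (intro nn_integral_cong) (simp add: ennreal_mult'[symmetric] mult.commute)
  also have "\<dots> = ennreal l * (\<integral>\<^sup>+y. ennreal (\<bar>g y\<bar> * (P t (x - y) / l)) \<partial>lborel)"
    by (rule nn_integral_cmult) measurable
  also have "\<dots> \<le> ennreal l * ennreal (M * (LINT y|lborel. P t (x - y) / l) powr (1 - 1 / q))"
    by (intro mult_left_mono weakD[OF w a]) simp
  also have "(LINT y|lborel. P t (x - y) / l) = 1 / l" using integral_P_shift(2)[OF t] by simp
  also have "ennreal l * ennreal (M * (1 / l) powr (1 - 1 / q)) = ennreal (M * (l * (1 / l) powr (1 - 1 / q)))"
    using l M by (simp add: ennreal_mult'[symmetric] mult_ac)
  also have "l * (1 / l) powr (1 - 1 / q) = l powr (1 / q)"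
    using l by (simp add: powr_divide powr_diff)
  also have "l powr (1 / q) = CP powr (1 / q) * t powr - (real DIM('a) / (2 * s * q))"
    by (simp add: l_def powr_mult powr_powr)
  finally show ?thesis .
qed

lemma weak_Cv:
  assumes w: "weak q M g" and q: "q > 1" and M: "M \<ge> 0" and t: "t > 0"
    and D: "D \<in> borel_measurable borel" "\<And>x. ennreal \<bar>D x\<bar> \<le> Cv t g x"
  shows "weak q M D"
proof (rule weakI[OF D(1)])
  fix h :: "'a \<Rightarrow> real" assume h: "adm h" and H: "(LINT x|lborel. h x) > 0"
  have "(\<integral>\<^sup>+x. ennreal (\<bar>D x\<bar> * h x) \<partial>lborel) \<le> (\<integral>\<^sup>+x. Cv t g x * ennreal (h x) \<partial>lborel)"
    using admD(3)[OF h] D by (intro nn_integral_mono) (simp add: ennreal_mult mult_right_mono)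
  also have "\<dots> \<le> ennreal (M * (LINT x|lborel. h x) powr (1 - 1 / q))"
    by (rule Cv_dual(1)[OF w q M h H t])
  finally show "(\<integral>\<^sup>+x. ennreal (\<bar>D x\<bar> * h x) \<partial>lborel) \<le> ennreal (M * (LINT x|lborel. h x) powr (1 - 1 / q))" .
qed

text \<open>Here \<sigma> is the time elapsed since the source acted, so the singularity of the
  kernel sits at \<sigma> = 0; this endpoint is left out because the kernel bounds are stated for
  positive times.\<close>

definition Du :: "real \<Rightarrow> (real \<Rightarrow> 'a \<Rightarrow> real) \<Rightarrow> 'a \<Rightarrow> ennreal" where
  "Du t g x = (\<integral>\<^sup>+\<sigma>. indicator {0<..t} \<sigma> * Cv \<sigma> (g (t - \<sigma>)) x \<partial>lborel)"

lemma Du_dual: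
  assumes gm: "(\<lambda>(\<tau>, x). g \<tau> x) \<in> borel_measurable (borel \<Otimes>\<^sub>M borel)" and h: "adm h"
  shows "(\<integral>\<^sup>+x. Du t g x * ennreal (h x) \<partial>lborel) =
    (\<integral>\<^sup>+\<sigma>. indicator {0<..t} \<sigma> * (\<integral>\<^sup>+x. Cv \<sigma> (g (t - \<sigma>)) x * ennreal (h x) \<partial>lborel) \<partial>lborel)"
proof -
  have [measurable]: "h \<in> borel_measurable borel" using admD[OF h] by auto
  have gm'[measurable]: "(\<lambda>z. g (a z) (b z)) \<in> borel_measurable N" if "a \<in> borel_measurable N" "b \<in> borel_measurable N" for a b and N :: "'z measure"
    using measurable_compose[OF measurable_Pair[OF that] gm] by simp
  have cm[measurable]: "(\<lambda>z. Cv (snd z) (g (t - snd z)) (fst z)) \<in> borel_measurable (borel \<Otimes>\<^sub>M borel)"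
    by (intro Cv_measurable) (auto simp: case_prod_unfold intro!: measurable_compose[OF measurable_Pair gm, simplified])
  have "(\<integral>\<^sup>+x. Du t g x * ennreal (h x) \<partial>lborel) =
    (\<integral>\<^sup>+x. \<integral>\<^sup>+\<sigma>. indicator {0<..t} \<sigma> * Cv \<sigma> (g (t - \<sigma>)) x * ennreal (h x) \<partial>lborel \<partial>lborel)"
    unfolding Du_def
    by (intro nn_integral_cong, subst nn_integral_multc) (auto intro!: borel_measurable_times_ennreal measurable_compose[OF _ cm, of "\<lambda>\<sigma>. (_, \<sigma>)", simplified])
  also have "\<dots> = (\<integral>\<^sup>+\<sigma>. \<integral>\<^sup>+x. indicator {0<..t} \<sigma> * Cv \<sigma> (g (t - \<sigma>)) x * ennreal (h x) \<partial>lborel \<partial>lborel)"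
    by (rule lborel_pair.Fubini') (use cm in \<open>simp add: case_prod_unfold\<close>)
  also have "\<dots> = (\<integral>\<^sup>+\<sigma>. indicator {0<..t} \<sigma> * (\<integral>\<^sup>+x. Cv \<sigma> (g (t - \<sigma>)) x * ennreal (h x) \<partial>lborel) \<partial>lborel)"
    by (intro nn_integral_cong, subst nn_integral_cmult[symmetric])
      (auto simp: mult.assoc intro!: borel_measurable_times_ennreal measurable_compose[OF _ cm, of "\<lambda>x. (x, _)", simplified])
  finally show ?thesis .
qed

text \<open>Contraction at each elapsed time, integrated over an interval of length t. It keeps the
  exponent, at the price of growth in time.\<close>

lemma weak_Du_trivial:
  assumes gm: "(\<lambda>(\<tau>, x). g \<tau> x) \<in> borel_measurable (borel \<Otimes>\<^sub>M borel)"
    and w: "\<And>\<tau>. 0 \<le> \<tau> \<Longrightarrow> \<tau> < t \<Longrightarrow> weak q M (g \<tau>)" and q: "q > 1" and M: "M \<ge> 0" and t: "t \<ge> 0"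
    and D: "D \<in> borel_measurable borel" "\<And>x. ennreal \<bar>D x\<bar> \<le> Du t g x"
  shows "weak q (t * M) D"
proof (rule weakI[OF D(1)])
  fix h :: "'a \<Rightarrow> real" assume h: "adm h" and H: "(LINT x|lborel. h x) > 0"
  define X where "X = M * (LINT x|lborel. h x) powr (1 - 1 / q)"
  have X: "X \<ge> 0" using M by (simp add: X_def)
  have "(\<integral>\<^sup>+x. ennreal (\<bar>D x\<bar> * h x) \<partial>lborel) \<le> (\<integral>\<^sup>+x. Du t g x * ennreal (h x) \<partial>lborel)"
    using admD(3)[OF h] D by (intro nn_integral_mono) (simp add: ennreal_mult mult_right_mono)
  also have "\<dots> = (\<integral>\<^sup>+\<sigma>. indicator {0<..t} \<sigma> * (\<integral>\<^sup>+x. Cv \<sigma> (g (t - \<sigma>)) x * ennreal (h x) \<partial>lborel) \<partial>lborel)"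
    by (rule Du_dual[OF gm h])
  also have "\<dots> \<le> (\<integral>\<^sup>+\<sigma>. ennreal X * indicator {0<..t} \<sigma> \<partial>lborel)"
  proof (rule nn_integral_mono)
    fix \<sigma>
    show "indicator {0<..t} \<sigma> * (\<integral>\<^sup>+x. Cv \<sigma> (g (t - \<sigma>)) x * ennreal (h x) \<partial>lborel) \<le> ennreal X * indicator {0<..t} \<sigma>"
    proof (cases "\<sigma> \<in> {0<..t}")
      case True
      then have "(\<integral>\<^sup>+x. Cv \<sigma> (g (t - \<sigma>)) x * ennreal (h x) \<partial>lborel) \<le> ennreal X"
        unfolding X_def by (intro Cv_dual(1) w q M h H) auto
      then show ?thesis using True by simp
    qed simp
  qed
  also have "\<dots> = ennreal (t * X)"
    using t X by (simp add: nn_integral_cmult_indicator ennreal_mult'[symmetric] mult.commute)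
  finally show "(\<integral>\<^sup>+x. ennreal (\<bar>D x\<bar> * h x) \<partial>lborel) \<le> ennreal (t * M * (LINT x|lborel. h x) powr (1 - 1 / q))"
    by (simp add: X_def mult.assoc)
qed

text \<open>Constant of the weak-type Hardy--Littlewood--Sobolev inequality. By duality the inequality reduces to
  \<open>\<integral> min (H powr (1 - 1/m)) (H \<sigma> powr (- \<alpha>)) d\<sigma>\<close>, split at \<open>\<sigma> = H powr (2 s / d)\<close>.\<close>

definition HLS :: "real \<Rightarrow> real" where
  "HLS m = 1 + CP powr (1 / m) / (real DIM('a) / (2 * s * m) - 1)"

lemma weak_Du:
  assumes gm: "(\<lambda>(\<tau>, x). g \<tau> x) \<in> borel_measurable (borel \<Otimes>\<^sub>M borel)"
    and w: "\<And>\<tau>. 0 \<le> \<tau> \<Longrightarrow> \<tau> < t \<Longrightarrow> weak m M (g \<tau>)" and m: "m > 1" and M: "M \<ge> 0"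
    and \<alpha>: "real DIM('a) / (2 * s * m) > 1" and q: "1 / q = 1 / m - 2 * s / real DIM('a)"
    and D: "D \<in> borel_measurable borel" "\<And>x. ennreal \<bar>D x\<bar> \<le> Du t g x"
  shows "weak q (HLS m * M) D"
proof (rule weakI[OF D(1)])
  fix h :: "'a \<Rightarrow> real" assume h: "adm h" and H: "(LINT x|lborel. h x) > 0"
  define H where "H = (LINT x|lborel. h x)"
  have Hp: "H > 0" using H by (simp add: H_def)
  define \<alpha> where "\<alpha> = real DIM('a) / (2 * s * m)"
  have a1: "\<alpha> > 1" using \<alpha> by (simp add: \<alpha>_def)
  define A where "A = H powr (2 * s / real DIM('a))"
  have A: "A > 0" using Hp by (simp add: A_def)
  define C where "C = CP powr (1 / m)"
  have C: "C > 0" using CP_pos by (simp add: C_def)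
  have "(\<integral>\<^sup>+x. ennreal (\<bar>D x\<bar> * h x) \<partial>lborel) \<le> (\<integral>\<^sup>+x. Du t g x * ennreal (h x) \<partial>lborel)"
    using admD(3)[OF h] D by (intro nn_integral_mono) (simp add: ennreal_mult mult_right_mono)
  also have "\<dots> = (\<integral>\<^sup>+\<sigma>. indicator {0<..t} \<sigma> * (\<integral>\<^sup>+x. Cv \<sigma> (g (t - \<sigma>)) x * ennreal (h x) \<partial>lborel) \<partial>lborel)"
    by (rule Du_dual[OF gm h])
  also have "\<dots> \<le> (\<integral>\<^sup>+\<sigma>. ennreal (M * H powr (1 - 1 / m)) * indicator {0..A} \<sigma> +
      ennreal (M * C * H) * (ennreal (\<sigma> powr - \<alpha>) * indicator {A..} \<sigma>) \<partial>lborel)"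
  proof (rule nn_integral_mono)
    fix \<sigma>
    show "indicator {0<..t} \<sigma> * (\<integral>\<^sup>+x. Cv \<sigma> (g (t - \<sigma>)) x * ennreal (h x) \<partial>lborel) \<le>
      ennreal (M * H powr (1 - 1 / m)) * indicator {0..A} \<sigma> + ennreal (M * C * H) * (ennreal (\<sigma> powr - \<alpha>) * indicator {A..} \<sigma>)"
    proof (cases "\<sigma> \<in> {0<..t}")
      case True
      then have b: "(\<integral>\<^sup>+x. Cv \<sigma> (g (t - \<sigma>)) x * ennreal (h x) \<partial>lborel) \<le> ennreal (M * H powr (1 - 1 / m))"
        "(\<integral>\<^sup>+x. Cv \<sigma> (g (t - \<sigma>)) x * ennreal (h x) \<partial>lborel) \<le> ennreal (M * (C * \<sigma> powr - \<alpha>) * H)"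
        using Cv_dual[OF w m M h H, of "t - \<sigma>" \<sigma>] unfolding H_def C_def \<alpha>_def by auto
      show ?thesis
      proof (cases "\<sigma> \<le> A")
        case True
        then show ?thesis using b(1) \<open>\<sigma> \<in> {0<..t}\<close> by (simp add: add_increasing2)
      next
        case False
        have "ennreal (M * (C * \<sigma> powr - \<alpha>) * H) = ennreal (M * C * H) * ennreal (\<sigma> powr - \<alpha>)"
          using M C Hp by (simp add: ennreal_mult[symmetric] mult_ac)
        then show ?thesis using b(2) False \<open>\<sigma> \<in> {0<..t}\<close> by simp
      qed
    qed simp
  qed
  also have "\<dots> = ennreal (M * H powr (1 - 1 / m)) * ennreal A + ennreal (M * C * H) * ennreal (- (A powr (- \<alpha> + 1)) / (- \<alpha> + 1))"
    using A a1 by (subst nn_integral_add) (auto simp: nn_integral_cmult nn_integral_powr_to_inf nn_integral_cmult_indicator)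
  also have "\<dots> = ennreal (M * (H powr (1 - 1 / m) * A + C / (\<alpha> - 1) * (H * A powr (1 - \<alpha>))))"
  proof -
    have e: "- (A powr (- \<alpha> + 1)) / (- \<alpha> + 1) = A powr (1 - \<alpha>) / (\<alpha> - 1)"
      using a1 by (simp add: field_simps)
    have 1: "ennreal (M * H powr (1 - 1 / m)) * ennreal A = ennreal (M * (H powr (1 - 1 / m) * A))"
      using M A by (simp add: ennreal_mult'[symmetric] mult_ac)
    have 2: "ennreal (M * C * H) * ennreal (A powr (1 - \<alpha>) / (\<alpha> - 1)) = ennreal (M * (C / (\<alpha> - 1) * (H * A powr (1 - \<alpha>))))"
      using M C Hp a1 by (simp add: ennreal_mult'[symmetric] mult_ac)
    show ?thesis unfolding e 1 2 using M C A Hp a1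
      by (subst ennreal_plus[symmetric]) (auto simp: distrib_left)
  qed
  also have "H powr (1 - 1 / m) * A = H powr (1 - 1 / q)"
    unfolding A_def q by (simp add: powr_add[symmetric] algebra_simps)
  \<comment> \<open>The choice of \<open>A\<close> balances the two ranges: both contribute the same
    power of H, and 2 s / d is the resulting shift from 1/m to 1/q.\<close>
  also have "H * A powr (1 - \<alpha>) = H powr (1 - 1 / q)"
  proof -
    have "H * A powr (1 - \<alpha>) = H powr 1 * H powr (2 * s / real DIM('a) * (1 - \<alpha>))"
      unfolding A_def using Hp by (simp add: powr_powr)
    also have "\<dots> = H powr (1 + 2 * s / real DIM('a) * (1 - \<alpha>))" by (rule powr_add[symmetric])
    also have "1 + 2 * s / real DIM('a) * (1 - \<alpha>) = 1 - 1 / q"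
      unfolding q \<alpha>_def using s m by (simp add: field_simps)
    finally show ?thesis .
  qed
  also have "M * (H powr (1 - 1 / q) + C / (\<alpha> - 1) * H powr (1 - 1 / q)) = HLS m * M * H powr (1 - 1 / q)"
    by (simp add: HLS_def C_def \<alpha>_def algebra_simps)
  finally show "(\<integral>\<^sup>+x. ennreal (\<bar>D x\<bar> * h x) \<partial>lborel) \<le> ennreal (HLS m * M * (LINT x|lborel. h x) powr (1 - 1 / q))"
    by (simp add: H_def)
qed

lemma HLS_pos: "real DIM('a) / (2 * s * m) > 1 \<Longrightarrow> HLS m > 0"
  unfolding HLS_def by (intro add_pos_nonneg) auto

text \<open>In contrast to the weak-type bound, the exponent is so large that the smoothing bound is
  integrable at \<sigma> = 0; the result is a sup bound on bounded time intervals.\<close>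

lemma Du_pointwise:
  assumes w: "\<And>\<tau>. 0 \<le> \<tau> \<Longrightarrow> \<tau> < t \<Longrightarrow> weak q M (g \<tau>)" and M: "M \<ge> 0" and t: "t \<ge> 0"
    and \<beta>: "real DIM('a) / (2 * s * q) < 1"
  shows "Du t g x \<le> ennreal (M * CP powr (1 / q) * (t powr (1 - real DIM('a) / (2 * s * q)) / (1 - real DIM('a) / (2 * s * q))))"
proof -
  define \<beta> where "\<beta> = real DIM('a) / (2 * s * q)"
  have b1: "\<beta> < 1" using \<beta> by (simp add: \<beta>_def)
  have "Du t g x \<le> (\<integral>\<^sup>+\<sigma>. ennreal (M * CP powr (1 / q)) * (ennreal (\<sigma> powr - \<beta>) * indicator {0..t} \<sigma>) \<partial>lborel)"
    unfolding Du_def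
  proof (rule nn_integral_mono)
    fix \<sigma>
    show "indicator {0<..t} \<sigma> * Cv \<sigma> (g (t - \<sigma>)) x \<le> ennreal (M * CP powr (1 / q)) * (ennreal (\<sigma> powr - \<beta>) * indicator {0..t} \<sigma>)"
    proof (cases "\<sigma> \<in> {0<..t}")
      case True
      then have "Cv \<sigma> (g (t - \<sigma>)) x \<le> ennreal (M * (CP powr (1 / q) * \<sigma> powr - \<beta>))"
        unfolding \<beta>_def by (intro Cv_pointwise w M) auto
      also have "\<dots> = ennreal (M * CP powr (1 / q)) * ennreal (\<sigma> powr - \<beta>)"
        using M by (simp add: ennreal_mult[symmetric] mult_ac)
      finally show ?thesis using True by simp
    qed simp
  qed
  also have "\<dots> = ennreal (M * CP powr (1 / q)) * ennreal (t powr (- \<beta> + 1) / (- \<beta> + 1))"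
    using b1 t by (subst nn_integral_cmult) (auto simp: nn_integral_powr_from_0)
  also have "\<dots> = ennreal (M * CP powr (1 / q) * (t powr (1 - \<beta>) / (1 - \<beta>)))"
    using M b1 by (simp add: ennreal_mult[symmetric] add.commute)
  finally show ?thesis by (simp add: \<beta>_def)
qed

end

section \<open>The semigroup on bounded continuous functions\<close>

text \<open>Completeness of the sup norm underlies the Banach-valued Duhamel integral and the
  Weierstrass test for the iterates.\<close>

instance bcontfun :: (metric_space, banach) banach ..

text \<open>Riemann sums are linear combinations of values in V and come arbitrarily close to the
  integral. In this way the Duhamel integral inherits vanishing at infinity.\<close>

lemma integral_in_closed_subspace:
  fixes f :: "'b::euclidean_space \<Rightarrow> 'c::real_normed_vector"
  assumes int: "(f has_integral y) (cbox a b)" and V: "closed V" "subspace V" and f: "\<And>x. x \<in> cbox a b \<Longrightarrow> f x \<in> V"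
  shows "y \<in> V"
proof (rule ccontr)
  assume "y \<notin> V"
  then obtain e where e: "e > 0" "\<And>z. dist z y < e \<Longrightarrow> z \<notin> V"
    using V(1) unfolding closed_def open_dist Compl_iff by (metis ComplI)
  have "\<exists>\<gamma>. gauge \<gamma> \<and> (\<forall>D. D tagged_division_of cbox a b \<and> \<gamma> fine D \<longrightarrow>
      norm ((\<Sum>(x, k)\<in>D. measure lborel k *\<^sub>R f x) - y) < e)"
    by (rule int[unfolded has_integral, THEN spec, THEN mp, OF e(1)])
  then obtain \<gamma> where \<gamma>: "gauge \<gamma>"
    "\<And>D. D tagged_division_of cbox a b \<Longrightarrow> \<gamma> fine D \<Longrightarrow> norm ((\<Sum>(x, k)\<in>D. measure lborel k *\<^sub>R f x) - y) < e"
    by metis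
  obtain D where D: "D tagged_division_of cbox a b" "\<gamma> fine D"
    using fine_division_exists[OF \<gamma>(1)] by blast
  have "(\<Sum>(x, k)\<in>D. measure lborel k *\<^sub>R f x) \<in> V"
    using D(1) by (intro subspace_sum[OF V(2)]) (auto intro!: subspace_scale[OF V(2)] f tag_in_interval)
  moreover have "dist (\<Sum>(x, k)\<in>D. measure lborel k *\<^sub>R f x) y < e"
    using \<gamma>(2)[OF D] by (simp add: dist_norm)
  ultimately show False using e(2) by blast
qed

text \<open>Dominated convergence is a statement about sequences; this reduction makes it applicable
  to limits at infinity.\<close>

lemma tendsto_at_infinity_seqI:
  fixes f :: "'a::real_normed_vector \<Rightarrow> real"
  assumes "\<And>X. filterlim X at_infinity sequentially \<Longrightarrow> (\<lambda>n. f (X n)) \<longlonglongrightarrow> l"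
  shows "(f \<longlongrightarrow> l) at_infinity"
proof (rule ccontr)
  assume "\<not> (f \<longlongrightarrow> l) at_infinity"
  then obtain e where e: "e > 0" "\<not> eventually (\<lambda>x. dist (f x) l < e) at_infinity"
    by (auto simp: tendsto_iff)
  then have "\<forall>n::nat. \<exists>x. real n \<le> norm x \<and> \<not> dist (f x) l < e"
    by (auto simp: eventually_at_infinity)
  then obtain X where X: "\<And>n. real n \<le> norm (X n)" "\<And>n. \<not> dist (f (X n)) l < e" by metis
  have "filterlim X at_infinity sequentially"
    unfolding filterlim_at_infinity_conv_norm_at_top
    by (rule filterlim_at_top_mono[OF filterlim_real_sequentially]) (use X(1) in auto)
  from tendstoD[OF assms[OF this] e(1)] have "eventually (\<lambda>n. dist (f (X n)) l < e) sequentially" .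
  then show False using X(2) by auto
qed

text \<open>Shifts of length below 1 leave two cases: both points lie in the region where v is
  small, or both lie in a ball of radius r0 + 1, where compactness applies.\<close>

lemma C0_uniformly_continuous:
  fixes v :: "'a::euclidean_space \<Rightarrow> real"
  assumes v: "v \<in> C0" and e: "e > 0"
  shows "\<exists>r>0. \<forall>x z. norm z < r \<longrightarrow> \<bar>v (x - z) - v x\<bar> < e"
proof -
  have c: "continuous_on UNIV v" and l: "(v \<longlongrightarrow> 0) at_infinity" using v by (auto simp: C0_def)
  have "eventually (\<lambda>x. dist (v x) 0 < e / 2) at_infinity" using l by (rule tendstoD) (use e in simp)
  then obtain r0 where r0: "\<And>x. r0 \<le> norm x \<Longrightarrow> \<bar>v x\<bar> < e / 2" by (auto simp: eventually_at_infinity)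
  have "uniformly_continuous_on (cball 0 (r0 + 1)) v"
    by (intro compact_uniformly_continuous continuous_on_subset[OF c]) auto
  then obtain d where d: "d > 0" "\<And>x y. x \<in> cball 0 (r0 + 1) \<Longrightarrow> y \<in> cball 0 (r0 + 1) \<Longrightarrow> dist y x < d \<Longrightarrow> dist (v y) (v x) < e"
    unfolding uniformly_continuous_on_def using e by metis
  have "\<bar>v (x - z) - v x\<bar> < e" if z: "norm z < min 1 d" for x z
  proof (cases "norm x \<ge> r0 \<and> norm (x - z) \<ge> r0")
    case True
    then show ?thesis using r0[of x] r0[of "x - z"] by linarith
  next
    case False
    have "norm x \<le> norm (x - z) + norm z" "norm (x - z) \<le> norm x + norm z"
      using norm_triangle_ineq[of "x - z" z] norm_triangle_ineq4[of x z] by auto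
    then have "x \<in> cball 0 (r0 + 1)" "x - z \<in> cball 0 (r0 + 1)" using False z by auto
    moreover have "dist (x - z) x < d" using z by (simp add: dist_norm)
    ultimately show ?thesis using d(2)[of x "x - z"] by (simp add: dist_real_def)
  qed
  then show ?thesis using d(1) by (intro exI[of _ "min 1 d"]) auto
qed

lemma bcontfun_norm_le: "norm (apply_bcontfun f x) \<le> norm f"
  using dist_bounded[of f x 0] by (simp add: dist_norm)

lemma bcontfun_norm_leI: "(\<And>x. norm (apply_bcontfun f x) \<le> B) \<Longrightarrow> norm f \<le> B"
  using dist_bound[of f 0 B] by (simp add: dist_norm)

lemma bounded_linear_apply_bcontfun: "bounded_linear (\<lambda>f::'b::topological_space \<Rightarrow>\<^sub>C 'c::real_normed_vector. apply_bcontfun f x)"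
  by (rule bounded_linear_intro[of _ 1]) (auto simp: bcontfun_norm_le)

lemma apply_bcontfun_borel [measurable]: "apply_bcontfun (f::'a::euclidean_space \<Rightarrow>\<^sub>C real) \<in> borel_measurable borel"
  by (intro borel_measurable_continuous_onI) simp

section \<open>Functions vanishing at infinity as a closed subspace\<close>

definition C0b :: "('a::euclidean_space \<Rightarrow>\<^sub>C real) set" where
  "C0b = {f. apply_bcontfun f \<in> C0}"

lemma C0b_iff: "f \<in> C0b \<longleftrightarrow> (apply_bcontfun f \<longlongrightarrow> 0) at_infinity"
  by (simp add: C0b_def C0_def)

lemma subspace_C0b: "subspace C0b"
proof (rule subspaceI)
  fix x y :: "'a \<Rightarrow>\<^sub>C real" and c :: real
  show "(0::'a \<Rightarrow>\<^sub>C real) \<in> C0b" by (simp add: C0b_iff)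
  show "x + y \<in> C0b" if "x \<in> C0b" "y \<in> C0b"
  proof -
    have "((\<lambda>z. x z + y z) \<longlongrightarrow> 0 + 0) at_infinity" using that by (intro tendsto_add) (auto simp: C0b_iff)
    then show ?thesis by (simp add: C0b_iff plus_bcontfun.rep_eq)
  qed
  show "c *\<^sub>R x \<in> C0b" if "x \<in> C0b"
  proof -
    have "((\<lambda>z. c * x z) \<longlongrightarrow> c * 0) at_infinity" using that by (intro tendsto_mult tendsto_const) (auto simp: C0b_iff)
    then show ?thesis by (simp add: C0b_iff scaleR_bcontfun.rep_eq)
  qed
qed

lemma closed_C0b: "closed C0b"
  unfolding closed_sequential_limits
proof (intro allI impI, elim conjE)
  fix F and f :: "'a \<Rightarrow>\<^sub>C real" assume F: "\<forall>n. F n \<in> C0b" "F \<longlonglongrightarrow> f"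
  show "f \<in> C0b" unfolding C0b_iff
  proof (rule tendstoI)
    fix e :: real assume e: "e > 0"
    have "eventually (\<lambda>n. dist (F n) f < e / 2) sequentially" using F(2) by (rule tendstoD) (use e in simp)
    then obtain n where n: "dist (F n) f < e / 2" by (auto simp: eventually_sequentially)
    have "eventually (\<lambda>x. dist (F n x) 0 < e / 2) at_infinity"
      using F(1)[rule_format, of n] e by (intro tendstoD) (auto simp: C0b_iff)
    then show "eventually (\<lambda>x. dist (f x) 0 < e) at_infinity"
    proof eventually_elim
      case (elim x)
      have "dist (F n x) (f x) \<le> dist (F n) f" by (rule dist_bounded)
      then show ?case using elim n dist_triangle2[of "f x" 0 "F n x"] by (simp add: dist_real_def)
    qed
  qed
qed

definition b_of :: "('a::euclidean_space \<Rightarrow> real) \<Rightarrow> ('a \<Rightarrow>\<^sub>C real)" where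
  "b_of v = Bcontfun v"

lemma apply_b_of:
  assumes "continuous_on UNIV v" "\<And>x. \<bar>v x\<bar> \<le> B"
  shows "apply_bcontfun (b_of v) = v"
  unfolding b_of_def using assms
  by (intro Bcontfun_inverse) (auto simp: bcontfun_def bounded_iff)

lemma apply_b_of_C0: "v \<in> C0 \<Longrightarrow> apply_bcontfun (b_of v) = v"
  using C0_bounded[of v] by (auto simp: C0_def intro: apply_b_of)

lemma b_of_C0b: "v \<in> C0 \<Longrightarrow> b_of v \<in> C0b"
  by (simp add: C0b_def apply_b_of_C0)

section \<open>Mapping properties and strong continuity of the semigroup\<close>

context mixed_heat
begin

text \<open>The convolution is written with the translate on \<open>v\<close>, so that regularity of
  \<open>v\<close> passes to the result by dominated convergence against a fixed kernel.\<close>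

definition S :: "real \<Rightarrow> ('a \<Rightarrow> real) \<Rightarrow> 'a \<Rightarrow> real" where
  "S t v x = (if t = 0 then v x else LINT z|lborel. P t z * v (x - z))"

lemma heat_semigroup_eq: "heat_semigroup 1 1 s t v x = S t v x"
proof -
  have "(LINT y|lborel. P t (x - y) * v y) = (LINT z|lborel. P t z * v (x - z))"
    using integral_lborel_diff[of "\<lambda>y. P t (x - y) * v y" x] by simp
  then show ?thesis unfolding heat_semigroup_def S_def P_def[symmetric] by simp
qed

context
  fixes v :: "'a \<Rightarrow> real" and B :: real
  assumes v: "continuous_on UNIV v" and B: "\<And>x. \<bar>v x\<bar> \<le> B"
begin

lemma v_measurable [measurable]: "v \<in> borel_measurable borel"
  using v by (rule borel_measurable_continuous_onI)

lemma S_integrable: "t > 0 \<Longrightarrow> integrable lborel (\<lambda>z. P t z * v (x - z))"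
proof (rule Bochner_Integration.integrable_bound)
  assume t: "t > 0"
  show "integrable lborel (\<lambda>z. P t z * B)" using P_mass(1)[OF t] by simp
  show "AE z in lborel. norm (P t z * v (x - z)) \<le> norm (P t z * B)"
  proof (rule AE_I2)
    fix z
    have "P t z * \<bar>v (x - z)\<bar> \<le> P t z * B" using P_nonneg[OF t] B by (intro mult_left_mono) auto
    moreover have "B \<ge> 0" using B[of 0] by linarith
    ultimately show "norm (P t z * v (x - z)) \<le> norm (P t z * B)" using P_nonneg[OF t] by (simp add: abs_mult)
  qed
qed measurable

lemma S_le: "t \<ge> 0 \<Longrightarrow> \<bar>S t v x\<bar> \<le> B"
proof (cases "t = 0")
  case False
  assume "t \<ge> 0"
  then have t: "t > 0" using False by simp
  have "\<bar>LINT z|lborel. P t z * v (x - z)\<bar> \<le> (LINT z|lborel. \<bar>P t z * v (x - z)\<bar>)" by (rule integral_abs_bound)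
  also have "\<dots> \<le> (LINT z|lborel. P t z * B)"
  proof (rule integral_mono)
    show "\<bar>P t z * v (x - z)\<bar> \<le> P t z * B" for z
      using P_nonneg[OF t] B by (simp add: abs_mult mult_left_mono)
  qed (use S_integrable[OF t] P_mass(1)[OF t] in auto)
  also have "\<dots> = B" using P_mass[OF t] by simp
  finally show ?thesis using False by (simp add: S_def)
qed (use B in \<open>simp add: S_def\<close>)

text \<open>One dominated convergence with majorant \<open>P t z * B\<close> serves twice: for
  continuity, with w the translate of v, and for vanishing at infinity, with w = 0.\<close>

lemma S_seq_lim:
  assumes t: "t > 0" and X: "\<And>z. (\<lambda>n. v (X n - z)) \<longlonglongrightarrow> w z" and w: "w \<in> borel_measurable borel"
  shows "(\<lambda>n. S t v (X n)) \<longlonglongrightarrow> (LINT z|lborel. P t z * w z)"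
proof -
  have "(\<lambda>n. LINT z|lborel. P t z * v (X n - z)) \<longlonglongrightarrow> (LINT z|lborel. P t z * w z)"
  proof (rule integral_dominated_convergence)
    show "integrable lborel (\<lambda>z. P t z * B)" using P_mass(1)[OF t] by simp
    show "AE z in lborel. (\<lambda>n. P t z * v (X n - z)) \<longlonglongrightarrow> P t z * w z"
      by (intro AE_I2 tendsto_mult tendsto_const X)
    show "AE z in lborel. norm (P t z * v (X n - z)) \<le> P t z * B" for n
      using P_nonneg[OF t] B by (intro AE_I2) (simp add: abs_mult mult_left_mono)
  qed (use w in measurable)
  then show ?thesis using t by (simp add: S_def)
qed

lemma S_continuous: "t \<ge> 0 \<Longrightarrow> continuous_on UNIV (S t v)"
proof (cases "t = 0")
  case True
  then show ?thesis using v by (simp add: S_def[abs_def])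
next
  case False
  assume "t \<ge> 0"
  then have t: "t > 0" using False by simp
  show ?thesis unfolding continuous_on_sequentially comp_def
  proof (intro ballI allI impI, elim conjE)
    fix x and X :: "nat \<Rightarrow> 'a" assume X: "X \<longlonglongrightarrow> x"
    have "(\<lambda>n. S t v (X n)) \<longlonglongrightarrow> (LINT z|lborel. P t z * v (x - z))"
    proof (rule S_seq_lim[OF t])
      fix z
      have "isCont v (x - z)" using v by (simp add: continuous_on_eq_continuous_at)
      then show "(\<lambda>n. v (X n - z)) \<longlonglongrightarrow> v (x - z)"
        by (rule isCont_tendsto_compose) (intro tendsto_diff X tendsto_const)
    qed measurable
    then show "(\<lambda>n. S t v (X n)) \<longlonglongrightarrow> S t v x" using t by (simp add: S_def)
  qed
qed

lemma S_vanish: "t \<ge> 0 \<Longrightarrow> (v \<longlongrightarrow> 0) at_infinity \<Longrightarrow> (S t v \<longlongrightarrow> 0) at_infinity"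
proof (cases "t = 0")
  case True
  then show "(v \<longlongrightarrow> 0) at_infinity \<Longrightarrow> ?thesis" by (simp add: S_def[abs_def])
next
  case False
  assume "t \<ge> 0" and l: "(v \<longlongrightarrow> 0) at_infinity"
  then have t: "t > 0" using False by simp
  show ?thesis
  proof (rule tendsto_at_infinity_seqI)
    fix X :: "nat \<Rightarrow> 'a" assume X: "filterlim X at_infinity sequentially"
    have "(\<lambda>n. S t v (X n)) \<longlonglongrightarrow> (LINT z|lborel. P t z * 0)"
    proof (rule S_seq_lim[OF t])
      fix z
      have "filterlim (\<lambda>n. X n + (- z)) at_infinity sequentially"
        by (rule tendsto_add_filterlim_at_infinity'[OF X tendsto_const])
      then show "(\<lambda>n. v (X n - z)) \<longlonglongrightarrow> 0" using filterlim_compose[OF l] by simp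
    qed simp
    then show "(\<lambda>n. S t v (X n)) \<longlonglongrightarrow> 0" by simp
  qed
qed

lemma S_le_Cv: "t > 0 \<Longrightarrow> ennreal \<bar>S t v x\<bar> \<le> Cv t v x"
proof -
  assume t: "t > 0"
  have "\<bar>S t v x\<bar> \<le> (LINT z|lborel. \<bar>P t z * v (x - z)\<bar>)" using t by (simp add: S_def integral_abs_bound)
  then have "ennreal \<bar>S t v x\<bar> \<le> ennreal (LINT z|lborel. \<bar>P t z * v (x - z)\<bar>)" by (rule ennreal_leI)
  also have "\<dots> = (\<integral>\<^sup>+z. ennreal \<bar>P t z * v (x - z)\<bar> \<partial>lborel)"
    using S_integrable[OF t] by (subst nn_integral_eq_integral) auto
  also have "\<dots> = (\<integral>\<^sup>+y. ennreal \<bar>P t (x - y) * v y\<bar> \<partial>lborel)"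
    by (subst nn_integral_lborel_diff[symmetric, of _ x]) auto
  also have "\<dots> = Cv t v x"
    unfolding Cv_def using P_nonneg[OF t] by (simp add: abs_mult)
  finally show ?thesis .
qed

end

lemma S_diff_add:
  assumes "continuous_on UNIV v" "\<And>x. \<bar>v x\<bar> \<le> B" "continuous_on UNIV w" "\<And>x. \<bar>w x\<bar> \<le> B'" "t \<ge> 0"
  shows "S t (\<lambda>x. v x - w x) x = S t v x - S t w x" "S t (\<lambda>x. v x + w x) x = S t v x + S t w x"
  using S_integrable[OF assms(1,2), of t x] S_integrable[OF assms(3,4), of t x] assms(5)
  by (auto simp: S_def right_diff_distrib distrib_left)

definition Sb :: "real \<Rightarrow> ('a \<Rightarrow>\<^sub>C real) \<Rightarrow> ('a \<Rightarrow>\<^sub>C real)" where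
  "Sb t f = b_of (S t (apply_bcontfun f))"

lemma apply_bcontfun_bounds: "continuous_on UNIV (apply_bcontfun f)" "\<bar>apply_bcontfun (f::'a \<Rightarrow>\<^sub>C real) x\<bar> \<le> norm f"
  using bcontfun_norm_le[of f x] by auto

lemma apply_Sb: "t \<ge> 0 \<Longrightarrow> apply_bcontfun (Sb t f) x = S t (apply_bcontfun f) x"
  unfolding Sb_def by (subst apply_b_of[OF S_continuous[OF apply_bcontfun_bounds] S_le[OF apply_bcontfun_bounds]]) auto

lemma Sb_norm: "t \<ge> 0 \<Longrightarrow> norm (Sb t f) \<le> norm f"
  by (intro bcontfun_norm_leI) (simp add: apply_Sb S_le[OF apply_bcontfun_bounds])

lemma Sb_diff: "t \<ge> 0 \<Longrightarrow> Sb t (f - g) = Sb t f - Sb t g"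
  and Sb_add: "t \<ge> 0 \<Longrightarrow> Sb t (f + g) = Sb t f + Sb t g"
  using S_diff_add[OF apply_bcontfun_bounds[of f] apply_bcontfun_bounds[of g]] by (auto intro!: bcontfun_eqI simp: apply_Sb minus_bcontfun.rep_eq plus_bcontfun.rep_eq)

lemma Sb_C0b: "t \<ge> 0 \<Longrightarrow> f \<in> C0b \<Longrightarrow> Sb t f \<in> C0b"
proof -
  assume t: "t \<ge> 0" and f: "f \<in> C0b"
  have "apply_bcontfun (Sb t f) = S t (apply_bcontfun f)" using apply_Sb[OF t] by (simp add: fun_eq_iff)
  then show ?thesis using S_vanish[OF apply_bcontfun_bounds[of f] t] f by (simp add: C0b_iff)
qed

text \<open>Away from t = 0 continuity in time holds in operator norm, because the kernels converge
  in L1.\<close>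

lemma Sb_tendsto_at_pos:
  assumes t: "\<And>n. t n > 0" "t \<longlonglongrightarrow> t0" "t0 > 0"
  shows "(\<lambda>n. Sb (t n) f) \<longlonglongrightarrow> Sb t0 f"
proof (rule metric_tendsto_imp_tendsto)
  have "(\<lambda>n. norm f * (LINT z|lborel. \<bar>P (t n) z - P t0 z\<bar>)) \<longlonglongrightarrow> norm f * 0"
    by (intro tendsto_mult tendsto_const P_L1_tendsto t)
  then show "(\<lambda>n. norm f * (LINT z|lborel. \<bar>P (t n) z - P t0 z\<bar>)) \<longlonglongrightarrow> 0" by simp
  show "eventually (\<lambda>n. dist (Sb (t n) f) (Sb t0 f) \<le> dist (norm f * (LINT z|lborel. \<bar>P (t n) z - P t0 z\<bar>)) 0) sequentially"
  proof (intro always_eventually allI)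
    fix n
    define J where "J = (LINT z|lborel. \<bar>P (t n) z - P t0 z\<bar>)"
    have J: "J \<ge> 0" unfolding J_def by (intro Bochner_Integration.integral_nonneg) auto
    have "dist (Sb (t n) f) (Sb t0 f) \<le> norm f * J"
    proof (rule dist_bound)
      fix x
      note i = S_integrable[OF apply_bcontfun_bounds[of f] t(1)[of n], of x] S_integrable[OF apply_bcontfun_bounds[of f] t(3), of x]
      have tn: "t n \<noteq> 0" "t n \<ge> 0" "t0 \<noteq> 0" "t0 \<ge> 0" using t(1)[of n] t(3) by auto
      have "Sb (t n) f x - Sb t0 f x = (LINT z|lborel. P (t n) z * f (x - z) - P t0 z * f (x - z))"
        using i tn by (simp add: apply_Sb S_def)
      also have "\<bar>\<dots>\<bar> \<le> (LINT z|lborel. \<bar>P (t n) z * f (x - z) - P t0 z * f (x - z)\<bar>)" by (rule integral_abs_bound)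
      also have "\<dots> \<le> (LINT z|lborel. norm f * \<bar>P (t n) z - P t0 z\<bar>)"
      proof (rule integral_mono)
        show "integrable lborel (\<lambda>z. norm f * \<bar>P (t n) z - P t0 z\<bar>)"
          using P_mass(1)[OF t(1)[of n]] P_mass(1)[OF t(3)] by (intro integrable_mult_right integrable_abs Bochner_Integration.integrable_diff)
        fix z
        have "\<bar>P (t n) z * f (x - z) - P t0 z * f (x - z)\<bar> = \<bar>f (x - z)\<bar> * \<bar>P (t n) z - P t0 z\<bar>"
          by (simp add: abs_mult[symmetric] algebra_simps)
        then show "\<bar>P (t n) z * f (x - z) - P t0 z * f (x - z)\<bar> \<le> norm f * \<bar>P (t n) z - P t0 z\<bar>"
          using apply_bcontfun_bounds(2)[of f "x - z"] by (simp add: mult_right_mono)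
      qed (use i in auto)
      finally show "dist (Sb (t n) f x) (Sb t0 f x) \<le> norm f * J" by (simp add: dist_real_def J_def)
    qed
    then show "dist (Sb (t n) f) (Sb t0 f) \<le> dist (norm f * (LINT z|lborel. \<bar>P (t n) z - P t0 z\<bar>)) 0"
      using J by (simp add: J_def[symmetric])
  qed
qed

text \<open>At t = 0 convergence is only strong. Shifts below r are controlled by uniform
  continuity, available on \<open>C0b\<close>, and the longer ones by the tail of the kernel, which
  tends to 0 with t.\<close>

lemma Sb_tendsto_at_0:
  assumes f: "f \<in> C0b" and t: "\<And>n. t n \<ge> 0" "t \<longlonglongrightarrow> 0"
  shows "(\<lambda>n. Sb (t n) f) \<longlonglongrightarrow> f"
proof (rule tendstoI)
  fix e :: real assume e: "e > 0"
  obtain r where r: "r > 0" "\<And>x z. norm z < r \<Longrightarrow> \<bar>f (x - z) - f x\<bar> < e / 3"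
    using C0_uniformly_continuous[of "apply_bcontfun f" "e / 3"] f e by (auto simp: C0b_def)
  define k where "k = 2 * norm f / (1 - exp (- r\<^sup>2))"
  have k: "k \<ge> 0" using r by (simp add: k_def)
  have "(\<lambda>n. k * (1 - G (t n) 1)) \<longlonglongrightarrow> k * (1 - 1)"
    by (intro tendsto_mult tendsto_const tendsto_diff G_tendsto_0 t)
  then have "eventually (\<lambda>n. k * (1 - G (t n) 1) < e / 3) sequentially"
    using e by (intro order_tendstoD(2)) auto
  then show "eventually (\<lambda>n. dist (Sb (t n) f) f < e) sequentially"
  proof eventually_elim
    case (elim n)
    have "dist (Sb (t n) f) f \<le> e / 3 + e / 3"
    proof (rule dist_bound)
      fix x
      show "dist (Sb (t n) f x) (f x) \<le> e / 3 + e / 3"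
      proof (cases "t n = 0")
        case True
        then show ?thesis using e by (simp add: apply_Sb S_def)
      next
        case False
        then have tn: "t n > 0" using t(1)[of n] by simp
        note i = S_integrable[OF apply_bcontfun_bounds[of f] tn, of x]
        have m: "(\<lambda>z. f (x - z)) \<in> borel_measurable borel" by measurable
        have "Sb (t n) f x - f x = (LINT z|lborel. P (t n) z * f (x - z)) - (LINT z|lborel. P (t n) z * f x)"
          using P_mass[OF tn] tn by (simp add: apply_Sb S_def)
        also have "\<dots> = (LINT z|lborel. P (t n) z * f (x - z) - P (t n) z * f x)"
          using i P_mass(1)[OF tn] by (intro Bochner_Integration.integral_diff[symmetric]) auto
        also have "\<bar>\<dots>\<bar> \<le> (LINT z|lborel. \<bar>P (t n) z * f (x - z) - P (t n) z * f x\<bar>)" by (rule integral_abs_bound)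
        also have "\<dots> \<le> (LINT z|lborel. e / 3 * P (t n) z + 2 * norm f * (indicator {z. norm z \<ge> r} z * P (t n) z))"
        proof (rule integral_mono)
          show "integrable lborel (\<lambda>z. \<bar>P (t n) z * f (x - z) - P (t n) z * f x\<bar>)"
            using i P_mass(1)[OF tn] by (intro integrable_abs Bochner_Integration.integrable_diff) auto
          show "integrable lborel (\<lambda>z. e / 3 * P (t n) z + 2 * norm f * (indicator {z. norm z \<ge> r} z * P (t n) z))"
            using P_mass(1)[OF tn] integrable_real_mult_indicator[OF _ P_mass(1)[OF tn], of "{z. norm z \<ge> r}"]
            by (intro Bochner_Integration.integrable_add integrable_mult_right) (simp_all add: mult.commute)
          fix z
          have "\<bar>P (t n) z * f (x - z) - P (t n) z * f x\<bar> = P (t n) z * \<bar>f (x - z) - f x\<bar>"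
            using P_nonneg[OF tn, of z] by (simp add: abs_mult right_diff_distrib[symmetric])
          also have "\<dots> \<le> P (t n) z * (e / 3 + 2 * norm f * indicator {z. norm z \<ge> r} z)"
          proof (rule mult_left_mono[OF _ P_nonneg[OF tn]])
            show "\<bar>f (x - z) - f x\<bar> \<le> e / 3 + 2 * norm f * indicator {z. norm z \<ge> r} z"
              using r(2)[of z x] apply_bcontfun_bounds(2)[of f x] apply_bcontfun_bounds(2)[of f "x - z"] e by (cases "norm z < r") auto
          qed
          finally show "\<bar>P (t n) z * f (x - z) - P (t n) z * f x\<bar> \<le> e / 3 * P (t n) z + 2 * norm f * (indicator {z. norm z \<ge> r} z * P (t n) z)"
            by (simp add: algebra_simps)
        qed
        also have "\<dots> = e / 3 + 2 * norm f * (LINT z|lborel. indicator {z. norm z \<ge> r} z * P (t n) z)"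
          using P_mass[OF tn] integrable_real_mult_indicator[OF _ P_mass(1)[OF tn], of "{z. norm z \<ge> r}"]
          by (subst Bochner_Integration.integral_add) (auto simp: mult.commute)
        also have "\<dots> \<le> e / 3 + 2 * norm f * ((1 - G (t n) 1) / (1 - exp (- r\<^sup>2)))"
          by (intro add_left_mono mult_left_mono P_tail tn r) simp
        also have "\<dots> = e / 3 + k * (1 - G (t n) 1)" by (simp add: k_def)
        finally show ?thesis using elim by (simp add: dist_real_def)
      qed
    qed
    then show ?case using e by linarith
  qed
qed

lemma Sb_tendsto:
  assumes t: "\<And>n. t n \<ge> 0" "t \<longlonglongrightarrow> t0" "t0 \<ge> 0" and F: "F \<longlonglongrightarrow> f" "f \<in> C0b"
  shows "(\<lambda>n. Sb (t n) (F n)) \<longlonglongrightarrow> Sb t0 f"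
proof -
  have 1: "(\<lambda>n. Sb (t n) f) \<longlonglongrightarrow> Sb t0 f"
  proof (cases "t0 = 0")
    case True
    have "Sb 0 f = f" by (intro bcontfun_eqI) (simp add: apply_Sb S_def)
    then show ?thesis using Sb_tendsto_at_0[OF F(2) t(1)] t(2) True by simp
  next
    case False
    then have t0: "t0 > 0" using t(3) by simp
    then obtain N where N: "\<And>n. n \<ge> N \<Longrightarrow> t n > 0"
      using order_tendstoD(1)[OF t(2)] by (auto simp: eventually_sequentially)
    show ?thesis
      by (rule LIMSEQ_offset[of _ N], rule Sb_tendsto_at_pos) (use N t0 LIMSEQ_ignore_initial_segment[OF t(2)] in auto)
  qed
  have 2: "(\<lambda>n. Sb (t n) (F n - f)) \<longlonglongrightarrow> 0"
  proof (rule Lim_null_comparison)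
    show "(\<lambda>n. norm (F n - f)) \<longlonglongrightarrow> 0" using F(1) by (simp add: LIM_zero tendsto_norm_zero)
    show "eventually (\<lambda>n. norm (Sb (t n) (F n - f)) \<le> norm (F n - f)) sequentially"
      using Sb_norm t by simp
  qed
  have "(\<lambda>n. Sb (t n) (F n - f) + Sb (t n) f) \<longlonglongrightarrow> 0 + Sb t0 f" by (rule tendsto_add[OF 2 1])
  then show ?thesis using t by (simp add: Sb_diff)
qed

lemma Sb_continuous:
  assumes "continuous_on A \<tau>" "continuous_on A F" "\<And>z. z \<in> A \<Longrightarrow> \<tau> z \<ge> 0" "\<And>z. z \<in> A \<Longrightarrow> F z \<in> C0b"
  shows "continuous_on (A::'z::first_countable_topology set) (\<lambda>z. Sb (\<tau> z) (F z))"
proof -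
  have "continuous_on ({0..} \<times> C0b) (\<lambda>(t, f). Sb t f)"
    unfolding continuous_on_sequentially
  proof (intro ballI allI impI, elim conjE)
    fix z and X :: "nat \<Rightarrow> real \<times> ('a \<Rightarrow>\<^sub>C real)"
    assume z: "z \<in> {0..} \<times> C0b" and X: "\<forall>n. X n \<in> {0..} \<times> C0b" "X \<longlonglongrightarrow> z"
    have "(\<lambda>n. Sb (fst (X n)) (snd (X n))) \<longlonglongrightarrow> Sb (fst z) (snd z)"
      using z X by (intro Sb_tendsto tendsto_fst tendsto_snd) (auto simp: mem_Times_iff)
    then show "((\<lambda>(t, f). Sb t f) \<circ> X) \<longlonglongrightarrow> (case z of (t, f) \<Rightarrow> Sb t f)"
      by (simp add: comp_def case_prod_unfold)
  qed
  from continuous_on_compose2[OF this continuous_on_Pair[OF assms(1,2)]] assms(3,4)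
  show ?thesis by auto
qed

section \<open>The Duhamel integral\<close>

text \<open>The integral is taken in the Banach space of bounded continuous functions, so that
  continuity, norm bounds and membership in \<open>C0b\<close> follow from general facts about
  vector-valued integrals.\<close>

definition Dm :: "(real \<Rightarrow> 'a \<Rightarrow>\<^sub>C real) \<Rightarrow> real \<Rightarrow> 'a \<Rightarrow>\<^sub>C real" where
  "Dm g t = integral {0..t} (\<lambda>\<tau>. Sb (t - \<tau>) (g \<tau>))"

context
  fixes g :: "real \<Rightarrow> 'a \<Rightarrow>\<^sub>C real"
  assumes g: "continuous_on {0..} g" and gC: "\<And>t. t \<ge> 0 \<Longrightarrow> g t \<in> C0b"
begin

lemma Dm_cont: "continuous_on {0..t} (\<lambda>\<tau>. Sb (t - \<tau>) (g \<tau>))"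
  by (intro Sb_continuous continuous_intros continuous_on_subset[OF g]) (auto intro: gC)

lemma Dm_integrable: "(\<lambda>\<tau>. Sb (t - \<tau>) (g \<tau>)) integrable_on {0..t}"
  by (rule integrable_continuous_interval[OF Dm_cont])

lemma Dm_C0b: "Dm g t \<in> C0b"
proof -
  have "((\<lambda>\<tau>. Sb (t - \<tau>) (g \<tau>)) has_integral Dm g t) (cbox 0 t)"
    unfolding Dm_def using integrable_integral[OF Dm_integrable[of t]] by simp
  then show ?thesis
    by (rule integral_in_closed_subspace[OF _ closed_C0b subspace_C0b]) (auto intro!: Sb_C0b gC)
qed

text \<open>Rescaling to a fixed interval makes continuity in \<open>t\<close> that of an integral with a parameter.\<close>

lemma Dm_scaled:
  assumes t: "t \<ge> 0"
  shows "Dm g t = t *\<^sub>R integral (cbox 0 1) (\<lambda>\<theta>. Sb (t * \<theta>) (g (t - t * \<theta>)))"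
proof (cases "t = 0")
  case False
  then have t: "t > 0" using t by simp
  have "((\<lambda>\<tau>. Sb (t - \<tau>) (g \<tau>)) has_integral Dm g t) (cbox 0 t)"
    unfolding Dm_def using integrable_integral[OF Dm_integrable[of t]] by simp
  from has_integral_affinity[OF this, of "- t" t]
  have "((\<lambda>\<theta>. Sb (t - (- t * \<theta> + t)) (g (- t * \<theta> + t))) has_integral (1 / t) *\<^sub>R Dm g t) ((\<lambda>x. (1 / - t) *\<^sub>R x + - ((1 / - t) *\<^sub>R t)) ` cbox 0 t)"
    using t by simp
  moreover have "(\<lambda>x. (1 / - t) *\<^sub>R x + - ((1 / - t) *\<^sub>R t)) ` cbox 0 t = cbox 0 1"
  proof -
    have "(\<lambda>x. (1 / - t) *\<^sub>R x + - ((1 / - t) *\<^sub>R t)) ` cbox 0 t = (\<lambda>x. (- (1 / t)) * x + 1) ` {0..t}"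
      using t by simp
    also have "\<dots> = {0..1}"
      using t by (subst image_affinity_atLeastAtMost) auto
    finally show ?thesis by simp
  qed
  ultimately have "((\<lambda>\<theta>. Sb (t * \<theta>) (g (t - t * \<theta>))) has_integral (1 / t) *\<^sub>R Dm g t) (cbox 0 1)"
    by simp
  from integral_unique[OF this] show ?thesis using t by simp
qed (simp add: Dm_def)

lemma Dm_continuous: "continuous_on {0..} (Dm g)"
proof -
  have "continuous_on {0..} (\<lambda>t. t *\<^sub>R integral (cbox 0 1) (\<lambda>\<theta>. Sb (t * \<theta>) (g (t - t * \<theta>))))"
  proof (intro continuous_on_scaleR continuous_on_id integral_continuous_on_param)
    show "continuous_on ({0..} \<times> cbox 0 1) (\<lambda>(t, \<theta>::real). Sb (t * \<theta>) (g (t - t * \<theta>)))"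
      unfolding case_prod_unfold
    proof (rule Sb_continuous)
      have le: "fst z * snd z \<le> fst z" "0 \<le> fst z * snd z" if "z \<in> {0..} \<times> cbox 0 1" for z :: "real \<times> real"
        using that by (auto intro: mult_left_le)
      show "continuous_on ({0..} \<times> cbox 0 1) (\<lambda>z::real \<times> real. fst z * snd z)" by (intro continuous_intros)
      show "continuous_on ({0..} \<times> cbox 0 1) (\<lambda>z::real \<times> real. g (fst z - fst z * snd z))"
        by (rule continuous_on_compose2[OF g]) (use le in \<open>auto intro!: continuous_intros\<close>)
      show "\<And>z::real \<times> real. z \<in> {0..} \<times> cbox 0 1 \<Longrightarrow> 0 \<le> fst z * snd z" by (rule le(2))
      show "\<And>z::real \<times> real. z \<in> {0..} \<times> cbox 0 1 \<Longrightarrow> g (fst z - fst z * snd z) \<in> C0b" using le by (intro gC) simp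
    qed
  qed
  then show ?thesis by (rule continuous_on_eq) (simp add: Dm_scaled)
qed

text \<open>Evaluation at a point is a bounded linear functional and commutes with the integral.
  This links the Banach-valued integral to the pointwise one in the definition of mild
  solutions.\<close>

lemma Dm_apply:
  "set_integrable lborel {0..t} (\<lambda>\<tau>. S (t - \<tau>) (g \<tau>) x)"
  "apply_bcontfun (Dm g t) x = (LINT \<tau>:{0..t}|lborel. S (t - \<tau>) (g \<tau>) x)"
proof -
  have eq: "apply_bcontfun (Sb (t - \<tau>) (g \<tau>)) x = S (t - \<tau>) (g \<tau>) x" if "\<tau> \<in> {0..t}" for \<tau>
    using that by (intro apply_Sb) auto
  have c: "continuous_on {0..t} (\<lambda>\<tau>. S (t - \<tau>) (g \<tau>) x)"
    by (rule continuous_on_eq[OF bounded_linear.continuous_on[OF bounded_linear_apply_bcontfun Dm_cont]]) (rule eq)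
  show i: "set_integrable lborel {0..t} (\<lambda>\<tau>. S (t - \<tau>) (g \<tau>) x)"
    using borel_integrable_atLeastAtMost'[OF c] .
  have "apply_bcontfun (Dm g t) x = integral {0..t} (\<lambda>\<tau>. apply_bcontfun (Sb (t - \<tau>) (g \<tau>)) x)"
    unfolding Dm_def
    using integral_linear[OF Dm_integrable[of t] bounded_linear_apply_bcontfun[of x]] by (simp add: comp_def)
  also have "\<dots> = integral {0..t} (\<lambda>\<tau>. S (t - \<tau>) (g \<tau>) x)"
    by (rule integral_cong) (rule eq)
  also have "\<dots> = (LINT \<tau>:{0..t}|lborel. S (t - \<tau>) (g \<tau>) x)"
    using set_borel_integral_eq_integral(2)[OF i] by simp
  finally show "apply_bcontfun (Dm g t) x = (LINT \<tau>:{0..t}|lborel. S (t - \<tau>) (g \<tau>) x)" .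
qed

lemma Dm_le_Du:
  "ennreal \<bar>apply_bcontfun (Dm g t) x\<bar> \<le> Du t (\<lambda>\<tau>. apply_bcontfun (g \<tau>)) x"
proof -
  let ?k = "\<lambda>\<tau>. indicator {0..t} \<tau> *\<^sub>R S (t - \<tau>) (g \<tau>) x"
  have i: "integrable lborel ?k" using Dm_apply(1)[of t x] by (simp add: set_integrable_def)
  have "\<bar>apply_bcontfun (Dm g t) x\<bar> \<le> (LINT \<tau>|lborel. \<bar>?k \<tau>\<bar>)"
    unfolding Dm_apply(2) set_lebesgue_integral_def by (rule integral_abs_bound)
  then have "ennreal \<bar>apply_bcontfun (Dm g t) x\<bar> \<le> ennreal (LINT \<tau>|lborel. \<bar>?k \<tau>\<bar>)" by (rule ennreal_leI)
  also have "\<dots> = (\<integral>\<^sup>+\<tau>. ennreal \<bar>?k \<tau>\<bar> \<partial>lborel)"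
    using i by (subst nn_integral_eq_integral) auto
  also have "\<dots> = (\<integral>\<^sup>+\<sigma>. ennreal \<bar>?k (t - \<sigma>)\<bar> \<partial>lborel)"
    using i by (intro nn_integral_lborel_diff[symmetric]) auto
  also have "\<dots> \<le> Du t (\<lambda>\<tau>. apply_bcontfun (g \<tau>)) x"
    unfolding Du_def
  proof (rule nn_integral_mono_AE)
    show "AE \<sigma> in lborel. ennreal \<bar>?k (t - \<sigma>)\<bar> \<le> indicator {0<..t} \<sigma> * Cv \<sigma> (apply_bcontfun (g (t - \<sigma>))) x"
    \<comment> \<open>At elapsed time 0 the semigroup is the identity by definition and not an
      integral against the kernel, but a single point is negligible.\<close>
    proof (rule AE_mp[OF AE_lborel_singleton[of "0::real"]], intro AE_I2 impI)
      fix \<sigma> :: real assume "\<sigma> \<noteq> 0"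
      then consider "\<sigma> \<in> {0<..t}" | "t - \<sigma> \<notin> {0..t}" by fastforce
      then show "ennreal \<bar>?k (t - \<sigma>)\<bar> \<le> indicator {0<..t} \<sigma> * Cv \<sigma> (apply_bcontfun (g (t - \<sigma>))) x"
      proof cases
        case 1
        then show ?thesis using S_le_Cv[OF apply_bcontfun_bounds[of "g (t - \<sigma>)"], of \<sigma> x] by simp
      qed simp
    qed
  qed
  finally show ?thesis .
qed

lemma Dm_norm_le:
  assumes "t \<ge> 0" "h integrable_on {0..t}" "\<And>\<tau>. 0 \<le> \<tau> \<Longrightarrow> \<tau> \<le> t \<Longrightarrow> norm (g \<tau>) \<le> h \<tau>"
  shows "norm (Dm g t) \<le> integral {0..t} h"
  unfolding Dm_def
proof (rule integral_norm_bound_integral[OF Dm_integrable assms(2)])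
  fix \<tau> assume "\<tau> \<in> {0..t}"
  then show "norm (Sb (t - \<tau>) (g \<tau>)) \<le> h \<tau>"
    using Sb_norm[of "t - \<tau>" "g \<tau>"] assms(3)[of \<tau>] by auto
qed

end

lemma Dm_diff:
  assumes "continuous_on {0..} g" "\<And>t. t \<ge> 0 \<Longrightarrow> g t \<in> C0b" "continuous_on {0..} h" "\<And>t. t \<ge> 0 \<Longrightarrow> h t \<in> C0b"
  shows "Dm (\<lambda>t. g t - h t) t = Dm g t - Dm h t" "Dm (\<lambda>t. g t + h t) t = Dm g t + Dm h t"
proof -
  have "integral {0..t} (\<lambda>\<tau>. Sb (t - \<tau>) (g \<tau> - h \<tau>)) = integral {0..t} (\<lambda>\<tau>. Sb (t - \<tau>) (g \<tau>) - Sb (t - \<tau>) (h \<tau>))"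
    "integral {0..t} (\<lambda>\<tau>. Sb (t - \<tau>) (g \<tau> + h \<tau>)) = integral {0..t} (\<lambda>\<tau>. Sb (t - \<tau>) (g \<tau>) + Sb (t - \<tau>) (h \<tau>))"
    by (auto intro!: integral_cong simp: Sb_diff Sb_add)
  then show "Dm (\<lambda>t. g t - h t) t = Dm g t - Dm h t" "Dm (\<lambda>t. g t + h t) t = Dm g t + Dm h t"
    unfolding Dm_def
    by (simp_all add: Henstock_Kurzweil_Integration.integral_diff Henstock_Kurzweil_Integration.integral_add Dm_integrable assms)
qed

end

section \<open>The Picard iteration\<close>

text \<open>The mean value theorem is applied to nonnegative arguments and needs the derivative only
  in the open interval, so an endpoint 0 causes no difficulty.\<close>

lemma abs_powr_diff_le:
  fixes a b B p :: real
  assumes p: "p > 1" and B: "\<bar>a\<bar> \<le> B" "\<bar>b\<bar> \<le> B"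
  shows "\<bar>\<bar>a\<bar> powr p - \<bar>b\<bar> powr p\<bar> \<le> p * B powr (p - 1) * \<bar>a - b\<bar>"
proof -
  have *: "y powr p - x powr p \<le> p * B powr (p - 1) * (y - x)" if xy: "0 \<le> x" "x < y" "y \<le> B" for x y :: real
  proof -
    have D: "((\<lambda>x. x powr p) has_real_derivative p * z powr (p - 1)) (at z)" if "z > 0" for z
      using that by (auto intro!: derivative_eq_intros simp: powr_diff)
    have "\<exists>l z. x < z \<and> z < y \<and> DERIV (\<lambda>x. x powr p) z :> l \<and> y powr p - x powr p = (y - x) * l"
    proof (rule MVT[OF xy(2)])
      show "continuous_on {x..y} (\<lambda>x. x powr p)"
        using p xy by (intro continuous_on_powr' continuous_intros) auto
      show "(\<lambda>x. x powr p) differentiable (at z)" if "x < z" for z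
        using D[of z] xy that by (auto simp: real_differentiable_def)
    qed
    then obtain l z where z: "x < z" "z < y" "DERIV (\<lambda>x. x powr p) z :> l" "y powr p - x powr p = (y - x) * l" by metis
    have "l = p * z powr (p - 1)" using DERIV_unique[OF z(3) D] z(1) xy(1) by simp
    moreover have "z powr (p - 1) \<le> B powr (p - 1)" using z xy p by (intro powr_mono2) auto
    ultimately show ?thesis using z(4) xy(2) p by (simp add: mult.commute mult_left_mono mult_right_mono)
  qed
  have "\<bar>\<bar>a\<bar> powr p - \<bar>b\<bar> powr p\<bar> \<le> p * B powr (p - 1) * \<bar>\<bar>a\<bar> - \<bar>b\<bar>\<bar>"
  proof (cases "\<bar>a\<bar>" "\<bar>b\<bar>" rule: linorder_cases)
    case less
    have "\<bar>a\<bar> powr p \<le> \<bar>b\<bar> powr p" using less p by (intro powr_mono2) auto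
    then show ?thesis using *[of "\<bar>a\<bar>" "\<bar>b\<bar>"] less B by simp
  next
    case greater
    have "\<bar>b\<bar> powr p \<le> \<bar>a\<bar> powr p" using greater p by (intro powr_mono2) auto
    then show ?thesis using *[of "\<bar>b\<bar>" "\<bar>a\<bar>"] greater B by simp
  qed simp
  also have "\<dots> \<le> p * B powr (p - 1) * \<bar>a - b\<bar>"
    using p by (intro mult_left_mono abs_triangle_ineq3) auto
  finally show ?thesis .
qed

definition Fb :: "real \<Rightarrow> ('a::euclidean_space \<Rightarrow>\<^sub>C real) \<Rightarrow> ('a \<Rightarrow>\<^sub>C real)" where
  "Fb p f = b_of (\<lambda>x. \<bar>f x\<bar> powr p)"

context
  fixes p :: real
  assumes p: "p > 1"
begin

lemma Fb_eq: "apply_bcontfun (Fb p f) = (\<lambda>x. \<bar>f x\<bar> powr p)"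
  unfolding Fb_def
proof (rule apply_b_of)
  show "continuous_on UNIV (\<lambda>x. \<bar>apply_bcontfun f x\<bar> powr p)"
    using p by (intro continuous_on_powr' continuous_intros) auto
  fix x
  have "\<bar>apply_bcontfun f x\<bar> powr p \<le> norm f powr p"
    using p bcontfun_norm_le[of f x] by (intro powr_mono2) auto
  then show "\<bar>\<bar>apply_bcontfun f x\<bar> powr p\<bar> \<le> norm f powr p" by simp
qed

lemma apply_Fb: "apply_bcontfun (Fb p f) x = \<bar>f x\<bar> powr p"
  by (simp add: Fb_eq)

lemma Fb_C0b: "f \<in> C0b \<Longrightarrow> Fb p f \<in> C0b"
  unfolding C0b_iff apply_Fb using p
  by (intro tendsto_zero_powrI[where b = p]) (auto intro: tendsto_rabs_zero)

lemma Fb_diff: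
  assumes "norm f \<le> B" "norm g \<le> B"
  shows "norm (Fb p f - Fb p g) \<le> p * B powr (p - 1) * norm (f - g)"
proof (rule bcontfun_norm_leI)
  fix x
  have "\<bar>\<bar>f x\<bar> powr p - \<bar>g x\<bar> powr p\<bar> \<le> p * B powr (p - 1) * \<bar>f x - g x\<bar>"
    using bcontfun_norm_le[of f x] bcontfun_norm_le[of g x] assms by (intro abs_powr_diff_le p) auto
  also have "\<dots> \<le> p * B powr (p - 1) * norm (f - g)"
    using bcontfun_norm_le[of "f - g" x] p by (intro mult_left_mono) (auto simp: minus_bcontfun.rep_eq)
  finally show "norm (apply_bcontfun (Fb p f - Fb p g) x) \<le> p * B powr (p - 1) * norm (f - g)"
    by (simp add: minus_bcontfun.rep_eq apply_Fb)
qed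

lemma Fb_continuous:
  fixes u :: "'t::topological_space \<Rightarrow> 'a::euclidean_space \<Rightarrow>\<^sub>C real"
  shows "continuous_on A u \<Longrightarrow> continuous_on A (\<lambda>t. Fb p (u t))"
proof (rule continuous_on_compose2[of UNIV "Fb p"])
  show "continuous_on UNIV (Fb p :: ('a \<Rightarrow>\<^sub>C real) \<Rightarrow> _)"
    unfolding continuous_on_sequentially comp_def
  proof (intro ballI allI impI, elim conjE)
    fix f :: "'a \<Rightarrow>\<^sub>C real" and F assume F: "F \<longlonglongrightarrow> f"
    let ?K = "p * (norm f + 1) powr (p - 1)"
    have "(\<lambda>n. Fb p (F n) - Fb p f) \<longlonglongrightarrow> 0"
    proof (rule Lim_null_comparison)
      have "(\<lambda>n. ?K * norm (F n - f)) \<longlonglongrightarrow> ?K * 0"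
        using F by (intro tendsto_mult tendsto_const tendsto_norm_zero LIM_zero)
      then show "(\<lambda>n. ?K * norm (F n - f)) \<longlonglongrightarrow> 0" by simp
      have "eventually (\<lambda>n. norm (F n) < norm f + 1) sequentially"
        using tendsto_norm[OF F] by (rule order_tendstoD(2)) simp
      then show "eventually (\<lambda>n. norm (Fb p (F n) - Fb p f) \<le> ?K * norm (F n - f)) sequentially"
        by eventually_elim (rule Fb_diff; simp)
    qed
    then show "(\<lambda>n. Fb p (F n)) \<longlonglongrightarrow> Fb p f" by (rule LIM_zero_cancel)
  qed
qed auto

end

text \<open>Joint continuity provides the joint measurability in time and space on which Tonelli in
  the Duhamel estimates relies.\<close>

lemma apply_bcontfun_jointly_continuous:
  fixes g :: "real \<Rightarrow> 'a::euclidean_space \<Rightarrow>\<^sub>C real"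
  assumes g: "continuous_on UNIV g"
  shows "continuous_on UNIV (\<lambda>(\<tau>, x). apply_bcontfun (g \<tau>) x)"
  unfolding continuous_on_sequentially comp_def case_prod_unfold
proof (intro ballI allI impI, elim conjE)
  fix z :: "real \<times> 'a" and X assume X: "X \<longlonglongrightarrow> z"
  have 1: "(\<lambda>n. g (fst (X n))) \<longlonglongrightarrow> g (fst z)"
    using g by (intro isCont_tendsto_compose[OF _ tendsto_fst[OF X]]) (simp add: continuous_on_eq_continuous_at)
  have "continuous_on UNIV (apply_bcontfun (g (fst z)))" by simp
  then have "isCont (apply_bcontfun (g (fst z))) (snd z)"
    by (metis UNIV_I continuous_on_eq_continuous_at open_UNIV)
  then have 2: "(\<lambda>n. apply_bcontfun (g (fst z)) (snd (X n))) \<longlonglongrightarrow> apply_bcontfun (g (fst z)) (snd z)"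
    by (rule isCont_tendsto_compose[OF _ tendsto_snd[OF X]])
  have 3: "(\<lambda>n. apply_bcontfun (g (fst (X n)) - g (fst z)) (snd (X n))) \<longlonglongrightarrow> 0"
  proof (rule Lim_null_comparison)
    show "(\<lambda>n. norm (g (fst (X n)) - g (fst z))) \<longlonglongrightarrow> 0" using 1 by (intro tendsto_norm_zero LIM_zero)
    show "eventually (\<lambda>n. norm (apply_bcontfun (g (fst (X n)) - g (fst z)) (snd (X n))) \<le> norm (g (fst (X n)) - g (fst z))) sequentially"
      using bcontfun_norm_le by (intro always_eventually allI)
  qed
  from tendsto_add[OF 3 2] show "(\<lambda>n. apply_bcontfun (g (fst (X n))) (snd (X n))) \<longlonglongrightarrow> apply_bcontfun (g (fst z)) (snd z)"
    by (simp add: minus_bcontfun.rep_eq)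
qed

lemma weak_zero: "M \<ge> 0 \<Longrightarrow> weak q M (\<lambda>x. 0)"
  by (simp add: weak_def)

lemma Lp_norm_le_weak:
  assumes v: "v \<in> Lp q" and q: "q > 1" and \<delta>: "\<delta> > 0" "Lp_norm q v \<le> \<delta>"
  shows "weak q (2 * \<delta>) v"
proof (rule weak_of_Lp)
  let ?I = "LINT x|lborel. \<bar>v x\<bar> powr q"
  have I: "?I \<ge> 0" by (intro Bochner_Integration.integral_nonneg) auto
  have "?I = (?I powr (1 / q)) powr q" using I q by (simp add: powr_powr)
  also have "\<dots> \<le> \<delta> powr q" using \<delta>(2) q by (intro powr_mono2) (auto simp: Lp_norm_def)
  finally show "?I \<le> \<delta> powr q" .
qed (use v q \<delta> in \<open>auto simp: Lp_def\<close>)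

text \<open>A bounded function in \<open>Lp q\<close> lies in every \<open>Lp r\<close> with r \<ge>
  q. The resulting constant is finite but not small; adding 1 to the integral keeps it
  positive.\<close>

lemma weak_of_bounded_Lp:
  assumes v: "v \<in> Lp q" and B: "\<And>x. \<bar>v x\<bar> \<le> B" and q: "q > 0" "q \<le> r" "r > 1"
  shows "\<exists>A>0. weak r A v"
proof -
  have m [measurable]: "v \<in> borel_measurable borel" using v by (simp add: Lp_def)
  have i: "integrable lborel (\<lambda>x. \<bar>v x\<bar> powr r)"
  proof (rule Bochner_Integration.integrable_bound)
    show "integrable lborel (\<lambda>x. B powr (r - q) * \<bar>v x\<bar> powr q)" using v by (simp add: Lp_def)
    have "\<bar>v x\<bar> powr r \<le> B powr (r - q) * \<bar>v x\<bar> powr q" for x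
    proof -
      have "\<bar>v x\<bar> powr r = \<bar>v x\<bar> powr (r - q) * \<bar>v x\<bar> powr q" by (simp add: powr_add[symmetric])
      also have "\<dots> \<le> B powr (r - q) * \<bar>v x\<bar> powr q" using B q by (intro mult_right_mono powr_mono2) auto
      finally show ?thesis .
    qed
    then show "AE x in lborel. norm (\<bar>v x\<bar> powr r) \<le> norm (B powr (r - q) * \<bar>v x\<bar> powr q)"
      by (intro AE_I2) (simp add: abs_mult)
  qed measurable
  let ?N = "((LINT x|lborel. \<bar>v x\<bar> powr r) + 1) powr (1 / r)"
  have I: "(LINT x|lborel. \<bar>v x\<bar> powr r) \<ge> 0" by (intro Bochner_Integration.integral_nonneg) auto
  have I1: "(LINT x|lborel. \<bar>v x\<bar> powr r) + 1 \<noteq> 0" using I by linarith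
  have "weak r (2 * ?N) v"
    using I I1 q by (intro weak_of_Lp m i) (auto simp: powr_powr)
  moreover have "2 * ?N > 0" using I1 by simp
  ultimately show ?thesis by blast
qed

section \<open>Weak and uniform bounds for one iteration step\<close>

context mixed_heat
begin

lemma Sb_weak:
  assumes w: "weak q M (apply_bcontfun v)" and q: "q > 1" and M: "M \<ge> 0" and t: "t \<ge> 0"
  shows "weak q M (apply_bcontfun (Sb t v))"
proof (cases "t = 0")
  case True
  have "Sb 0 v = v" by (intro bcontfun_eqI) (simp add: apply_Sb S_def)
  then show ?thesis using w True by simp
next
  case False
  then have "t > 0" using t by simp
  then show ?thesis
    using S_le_Cv[OF apply_bcontfun_bounds[of v]] by (intro weak_Cv[OF w q M]) (auto simp: apply_Sb)
qed

context
  fixes g :: "real \<Rightarrow> 'a \<Rightarrow>\<^sub>C real"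
  assumes g: "continuous_on {0..} g" and gC: "\<And>t. t \<ge> 0 \<Longrightarrow> g t \<in> C0b"
begin

text \<open>\<open>max 0 \<tau>\<close> extends the source continuously to negative times, as
  measurability is asked on the whole line; \<open>Du t\<close> evaluates it on [0, t) only, where
  nothing changes.\<close>

lemma Dm_measurable_le_Du:
  "(\<lambda>(\<tau>, x). apply_bcontfun (g (max 0 \<tau>)) x) \<in> borel_measurable (borel \<Otimes>\<^sub>M borel)"
  "ennreal \<bar>apply_bcontfun (Dm g t) x\<bar> \<le> Du t (\<lambda>\<tau>. apply_bcontfun (g (max 0 \<tau>))) x"
proof -
  have "continuous_on UNIV (\<lambda>\<tau>. g (max 0 \<tau>))"
    by (rule continuous_on_compose2[OF g]) (auto intro!: continuous_intros)
  from borel_measurable_continuous_onI[OF apply_bcontfun_jointly_continuous[OF this]]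
  show "(\<lambda>(\<tau>, x). apply_bcontfun (g (max 0 \<tau>)) x) \<in> borel_measurable (borel \<Otimes>\<^sub>M borel)"
    by (simp add: borel_prod)
  have "Du t (\<lambda>\<tau>. apply_bcontfun (g (max 0 \<tau>))) x = Du t (\<lambda>\<tau>. apply_bcontfun (g \<tau>)) x"
    unfolding Du_def by (intro nn_integral_cong) (auto simp: indicator_def max_def)
  then show "ennreal \<bar>apply_bcontfun (Dm g t) x\<bar> \<le> Du t (\<lambda>\<tau>. apply_bcontfun (g (max 0 \<tau>))) x"
    using Dm_le_Du[OF g gC] by simp
qed

lemma Dm_weak:
  assumes "\<And>\<tau>. 0 \<le> \<tau> \<Longrightarrow> \<tau> < t \<Longrightarrow> weak m M (apply_bcontfun (g \<tau>))" "m > 1" "M \<ge> 0"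
    "real DIM('a) / (2 * s * m) > 1" "1 / q = 1 / m - 2 * s / real DIM('a)"
  shows "weak q (HLS m * M) (apply_bcontfun (Dm g t))"
  by (rule weak_Du[OF Dm_measurable_le_Du(1) _ assms(2-5) apply_bcontfun_borel Dm_measurable_le_Du(2)]) (use assms(1) in simp)

lemma Dm_weak_trivial:
  assumes "\<And>\<tau>. 0 \<le> \<tau> \<Longrightarrow> \<tau> < t \<Longrightarrow> weak q M (apply_bcontfun (g \<tau>))" "q > 1" "M \<ge> 0" "t \<ge> 0"
  shows "weak q (t * M) (apply_bcontfun (Dm g t))"
  by (rule weak_Du_trivial[OF Dm_measurable_le_Du(1) _ assms(2-4) apply_bcontfun_borel Dm_measurable_le_Du(2)]) (use assms(1) in simp)

lemma Dm_norm_weak: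
  assumes w: "\<And>\<tau>. 0 \<le> \<tau> \<Longrightarrow> \<tau> < t \<Longrightarrow> weak q M (apply_bcontfun (g \<tau>))" "M \<ge> 0" "t \<ge> 0"
    "real DIM('a) / (2 * s * q) < 1"
  shows "norm (Dm g t) \<le> M * CP powr (1 / q) * (t powr (1 - real DIM('a) / (2 * s * q)) / (1 - real DIM('a) / (2 * s * q)))"
proof (rule bcontfun_norm_leI)
  fix x
  let ?C = "M * CP powr (1 / q) * (t powr (1 - real DIM('a) / (2 * s * q)) / (1 - real DIM('a) / (2 * s * q)))"
  have "ennreal \<bar>apply_bcontfun (Dm g t) x\<bar> \<le> ennreal ?C"
    using Dm_le_Du[OF g gC] Du_pointwise[OF w] by (rule order_trans)
  moreover have "?C \<ge> 0" using w(2,4) by (intro mult_nonneg_nonneg divide_nonneg_nonneg) auto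
  ultimately show "norm (apply_bcontfun (Dm g t) x) \<le> ?C" by simp
qed

end

definition picard_step :: "real \<Rightarrow> ('a \<Rightarrow>\<^sub>C real) \<Rightarrow> ('a \<Rightarrow>\<^sub>C real) \<Rightarrow> (real \<Rightarrow> 'a \<Rightarrow>\<^sub>C real) \<Rightarrow> real \<Rightarrow> 'a \<Rightarrow>\<^sub>C real" where
  "picard_step p u0 f w t = Sb t u0 + Dm (\<lambda>\<tau>. Fb p (w \<tau>) + f) t"

context
  fixes p :: real and u0 f :: "'a \<Rightarrow>\<^sub>C real"
  assumes p: "p > 1" and u0: "u0 \<in> C0b" and f: "f \<in> C0b"
begin

lemma C0b_add: "v \<in> C0b \<Longrightarrow> w \<in> C0b \<Longrightarrow> v + w \<in> C0b"
  by (rule subspace_add[OF subspace_C0b])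

context
  fixes w :: "real \<Rightarrow> 'a \<Rightarrow>\<^sub>C real"
  assumes w: "continuous_on {0..} w" and wC: "\<And>t. t \<ge> 0 \<Longrightarrow> w t \<in> C0b"
begin

lemma source: "continuous_on {0..} (\<lambda>\<tau>. Fb p (w \<tau>) + f)" "t \<ge> 0 \<Longrightarrow> Fb p (w t) + f \<in> C0b"
  "continuous_on {0..} (\<lambda>\<tau>. Fb p (w \<tau>))" "t \<ge> 0 \<Longrightarrow> Fb p (w t) \<in> C0b"
  by (auto intro!: continuous_on_add Fb_continuous[OF p] w C0b_add Fb_C0b[OF p] wC f)

lemma picard_step_continuous: "continuous_on {0..} (picard_step p u0 f w)"
  unfolding picard_step_def
  by (intro continuous_on_add Sb_continuous Dm_continuous source continuous_on_id continuous_on_const) (auto simp: u0)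

lemma picard_step_C0b: "t \<ge> 0 \<Longrightarrow> picard_step p u0 f w t \<in> C0b"
  unfolding picard_step_def by (intro C0b_add Sb_C0b u0 Dm_C0b source)

lemma picard_step_split: "picard_step p u0 f w t = Sb t u0 + (Dm (\<lambda>\<tau>. Fb p (w \<tau>)) t + Dm (\<lambda>\<tau>. f) t)"
  unfolding picard_step_def by (subst Dm_diff(2)) (auto intro: source f)

text \<open>With \<open>m = pcs / p\<close> and \<open>q = pcs\<close> this bounds the iterates globally in time for small data; the
  variant below bounds them on \<open>[0, T]\<close> for a large exponent \<open>q\<close>, whence in the sup norm.\<close>

lemma picard_step_weak:
  assumes t: "t \<ge> 0" and m: "m > 1" "real DIM('a) / (2 * s * m) > 1" and q: "1 / q = 1 / m - 2 * s / real DIM('a)" "q > 1"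
    and N: "\<And>\<tau>. 0 \<le> \<tau> \<Longrightarrow> \<tau> < t \<Longrightarrow> weak m N (\<lambda>x. \<bar>w \<tau> x\<bar> powr p)" "N \<ge> 0"
    and A: "weak q A (apply_bcontfun u0)" "A \<ge> 0"
    and F: "weak m F (apply_bcontfun f)" "F \<ge> 0"
  shows "weak q (A + HLS m * (N + F)) (apply_bcontfun (picard_step p u0 f w t))"
proof (rule weak_add)
  show "weak q A (apply_bcontfun (Sb t u0))" by (rule Sb_weak[OF A(1) q(2) A(2) t])
  show "weak q (HLS m * (N + F)) (apply_bcontfun (Dm (\<lambda>\<tau>. Fb p (w \<tau>) + f) t))"
  proof (rule Dm_weak[OF source(1,2) _ m(1) _ m(2) q(1)])
    fix \<tau> :: real assume "0 \<le> \<tau>" "\<tau> < t"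
    then show "weak m (N + F) (apply_bcontfun (Fb p (w \<tau>) + f))"
      by (intro weak_add[OF N(1) F(1) N(2) F(2)]) (auto simp: plus_bcontfun.rep_eq apply_Fb[OF p] intro: order_trans[OF abs_triangle_ineq])
  qed (use N F in auto)
  show "HLS m * (N + F) \<ge> 0" using HLS_pos[OF m(2)] N F by simp
qed (auto simp: picard_step_def plus_bcontfun.rep_eq A)

text \<open>Only the nonlinear term gains integrability here. The stationary source stays at the
  exponent q and is integrated by contraction, which costs the factor t.\<close>

lemma picard_step_weak_trivial:
  assumes t: "t \<ge> 0" and m: "m > 1" "real DIM('a) / (2 * s * m) > 1" and q: "1 / q = 1 / m - 2 * s / real DIM('a)" "q > 1"
    and N: "\<And>\<tau>. 0 \<le> \<tau> \<Longrightarrow> \<tau> < t \<Longrightarrow> weak m N (\<lambda>x. \<bar>w \<tau> x\<bar> powr p)" "N \<ge> 0"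
    and A: "weak q A (apply_bcontfun u0)" "A \<ge> 0"
    and F: "weak q F (apply_bcontfun f)" "F \<ge> 0"
  shows "weak q (A + (HLS m * N + t * F)) (apply_bcontfun (picard_step p u0 f w t))"
proof (rule weak_add)
  show "weak q A (apply_bcontfun (Sb t u0))" by (rule Sb_weak[OF A(1) q(2) A(2) t])
  show "weak q (HLS m * N + t * F) (apply_bcontfun (Dm (\<lambda>\<tau>. Fb p (w \<tau>)) t + Dm (\<lambda>\<tau>. f) t))"
  proof (rule weak_add)
    show "weak q (HLS m * N) (apply_bcontfun (Dm (\<lambda>\<tau>. Fb p (w \<tau>)) t))"
      by (rule Dm_weak[OF source(3,4) _ m(1) N(2) m(2) q(1)]) (use N in \<open>auto simp: Fb_eq[OF p]\<close>)
    show "weak q (t * F) (apply_bcontfun (Dm (\<lambda>\<tau>. f) t))"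
      by (rule Dm_weak_trivial) (use F f q t in auto)
  qed (use HLS_pos[OF m(2)] N F t in \<open>auto simp: plus_bcontfun.rep_eq\<close>)
  show "HLS m * N + t * F \<ge> 0" using HLS_pos[OF m(2)] N F t by simp
qed (auto simp: picard_step_split plus_bcontfun.rep_eq A)

text \<open>The weak bound at a large exponent controls the nonlinear term uniformly, whereas the
  two data terms are bounded directly in the sup norm.\<close>

lemma picard_step_norm:
  assumes t: "t \<ge> 0" and q: "real DIM('a) / (2 * s * q) < 1"
    and N: "\<And>\<tau>. 0 \<le> \<tau> \<Longrightarrow> \<tau> < t \<Longrightarrow> weak q N (\<lambda>x. \<bar>w \<tau> x\<bar> powr p)" "N \<ge> 0"
  shows "norm (picard_step p u0 f w t) \<le> norm u0 + (N * CP powr (1 / q) *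
    (t powr (1 - real DIM('a) / (2 * s * q)) / (1 - real DIM('a) / (2 * s * q))) + t * norm f)"
proof -
  have "norm (Dm (\<lambda>\<tau>. Fb p (w \<tau>)) t) \<le> N * CP powr (1 / q) *
    (t powr (1 - real DIM('a) / (2 * s * q)) / (1 - real DIM('a) / (2 * s * q)))"
    by (rule Dm_norm_weak[OF source(3,4)]) (use N t q in \<open>auto simp: Fb_eq[OF p]\<close>)
  moreover have "norm (Dm (\<lambda>\<tau>. f) t) \<le> integral {0..t} (\<lambda>\<tau>. norm f)"
    by (rule Dm_norm_le) (use f t in auto)
  ultimately show ?thesis
    using Sb_norm[OF t, of u0] t unfolding picard_step_split
    by (intro norm_triangle_le add_mono) (auto intro: norm_triangle_le)
qed

end

lemma picard_step_diff:
  assumes w: "continuous_on {0..} w" "\<And>t. t \<ge> 0 \<Longrightarrow> w t \<in> C0b"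
    and v: "continuous_on {0..} v" "\<And>t. t \<ge> 0 \<Longrightarrow> v t \<in> C0b"
    and t: "t \<ge> 0" and h: "h integrable_on {0..t}"
    and B: "\<And>\<tau>. 0 \<le> \<tau> \<Longrightarrow> \<tau> \<le> t \<Longrightarrow> norm (w \<tau>) \<le> B" "\<And>\<tau>. 0 \<le> \<tau> \<Longrightarrow> \<tau> \<le> t \<Longrightarrow> norm (v \<tau>) \<le> B"
    and le: "\<And>\<tau>. 0 \<le> \<tau> \<Longrightarrow> \<tau> \<le> t \<Longrightarrow> p * B powr (p - 1) * norm (w \<tau> - v \<tau>) \<le> h \<tau>"
  shows "norm (picard_step p u0 f w t - picard_step p u0 f v t) \<le> integral {0..t} h"
proof -
  note sw = source[OF w] and sv = source[OF v]
  have "picard_step p u0 f w t - picard_step p u0 f v t = Dm (\<lambda>\<tau>. Fb p (w \<tau>) - Fb p (v \<tau>)) t"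
    using picard_step_split[OF w, of t] picard_step_split[OF v, of t] Dm_diff(1)[OF sw(3,4) sv(3,4), of t] by simp
  also have "norm \<dots> \<le> integral {0..t} h"
  proof (rule Dm_norm_le[OF _ _ t h])
    show "continuous_on {0..} (\<lambda>\<tau>. Fb p (w \<tau>) - Fb p (v \<tau>))" by (intro continuous_on_diff sw sv)
    show "Fb p (w t) - Fb p (v t) \<in> C0b" if "t \<ge> 0" for t using that by (intro subspace_diff[OF subspace_C0b] sw sv)
    fix \<tau> assume "0 \<le> \<tau>" "\<tau> \<le> t"
    then show "norm (Fb p (w \<tau>) - Fb p (v \<tau>)) \<le> h \<tau>" using Fb_diff[OF p B] le by (meson order_trans)
  qed
  finally show ?thesis .
qed

section \<open>Convergence of the iterates\<close>

definition picard_iter :: "nat \<Rightarrow> real \<Rightarrow> 'a \<Rightarrow>\<^sub>C real" where "picard_iter n = (picard_step p u0 f ^^ n) (\<lambda>t. 0)"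

lemma picard_iter_Suc: "picard_iter (Suc n) = picard_step p u0 f (picard_iter n)" and picard_iter_0: "picard_iter 0 = (\<lambda>t. 0)" by (simp_all add: picard_iter_def)

lemma picard_iter_invariant: "continuous_on {0..} (picard_iter n) \<and> (\<forall>t\<ge>0. picard_iter n t \<in> C0b)"
proof (induction n)
  case 0
  then show ?case by (simp add: picard_iter_0 subspace_0[OF subspace_C0b])
next
  case (Suc n)
  then show ?case using picard_step_continuous[of "picard_iter n"] picard_step_C0b[of "picard_iter n"] by (simp add: picard_iter_Suc)
qed

lemmas picard_iter_cont = picard_iter_invariant[THEN conjunct1] and picard_iter_C0b = picard_iter_invariant[THEN conjunct2, rule_format]

text \<open>The exponential weight makes the map a contraction on intervals of any length: the
  integral of K exp (2 K \<tau>) over [0, t] is at most exp (2 K t) / 2, so each step gains a factor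
  1/2.\<close>

lemma picard_iter_increment:
  assumes B: "\<And>n t. 0 \<le> t \<Longrightarrow> t \<le> T \<Longrightarrow> norm (picard_iter n t) \<le> B" and K: "K = max 1 (p * B powr (p - 1))"
    and t: "0 \<le> t" "t \<le> T"
  shows "norm (picard_iter (Suc n) t - picard_iter n t) \<le> 2 * B / 2 ^ n * exp (2 * K * t)"
  using t
proof (induction n arbitrary: t)
  case 0
  have "norm (picard_iter (Suc 0) t - picard_iter 0 t) \<le> B * 1" using B[of t "Suc 0"] 0 by (simp add: picard_iter_0)
  also have "\<dots> \<le> 2 * B * exp (2 * K * t)"
    using K 0 order_trans[OF norm_ge_zero B[of t 0]] by (intro mult_mono) auto
  finally show ?case by simp
next
  case (Suc n)
  have K1: "K \<ge> 1" "p * B powr (p - 1) \<le> K" using K by auto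
  have B0: "B \<ge> 0" using order_trans[OF norm_ge_zero B[OF Suc.prems, of 0]] .
  let ?c = "2 * B / 2 ^ n"
  let ?h = "\<lambda>\<tau>. ?c * (K * exp (2 * K * \<tau>))"
  have hi: "(?h has_integral (?c * exp (2 * K * t) / 2 - ?c * exp (2 * K * 0) / 2)) {0..t}"
    by (rule fundamental_theorem_of_calculus)
      (use Suc.prems in \<open>auto intro!: derivative_eq_intros simp: has_real_derivative_iff_has_vector_derivative[symmetric]\<close>)
  have "norm (picard_step p u0 f (picard_iter (Suc n)) t - picard_step p u0 f (picard_iter n) t) \<le> integral {0..t} ?h"
  proof (rule picard_step_diff[OF picard_iter_cont picard_iter_C0b picard_iter_cont picard_iter_C0b Suc.prems(1)])
    show "?h integrable_on {0..t}" using hi by (rule has_integral_integrable)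
    fix \<tau> :: real assume \<tau>: "0 \<le> \<tau>" "\<tau> \<le> t"
    show "norm (picard_iter (Suc n) \<tau>) \<le> B" "norm (picard_iter n \<tau>) \<le> B" using \<tau> Suc.prems by (auto intro: B)
    have "p * B powr (p - 1) * norm (picard_iter (Suc n) \<tau> - picard_iter n \<tau>) \<le> K * (?c * exp (2 * K * \<tau>))"
      using \<tau> Suc.prems K1 by (intro mult_mono Suc.IH) auto
    then show "p * B powr (p - 1) * norm (picard_iter (Suc n) \<tau> - picard_iter n \<tau>) \<le> ?h \<tau>" by (simp add: mult_ac)
  qed
  also have "\<dots> = ?c * exp (2 * K * t) / 2 - ?c * exp (2 * K * 0) / 2" using hi by (rule integral_unique)
  also have "\<dots> \<le> ?c * exp (2 * K * t) / 2" using B0 by simp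
  finally show ?case by (simp add: picard_iter_Suc[of "Suc n"] picard_iter_Suc[of n] field_simps)
qed

text \<open>A sup bound uniform in n turns the local Lipschitz constant of the nonlinearity into a
  single constant on [0, T]; the telescoping series of increments then converges uniformly
  there.\<close>

lemma picard_step_fixed_point:
  assumes B: "\<And>T. T \<ge> 0 \<Longrightarrow> \<exists>B. \<forall>n. \<forall>t\<in>{0..T}. norm (picard_iter n t) \<le> B"
  shows "\<exists>u. continuous_on {0..} u \<and> (\<forall>t\<ge>0. u t \<in> C0b \<and> u t = picard_step p u0 f u t)"
proof -
  define u where "u t = (\<Sum>i. picard_iter (Suc i) t - picard_iter i t)" for t
  have lim: "uniform_limit {0..T} picard_iter u sequentially" if T: "T \<ge> 0" for T
  proof -
    obtain B where "\<forall>n. \<forall>t\<in>{0..T}. norm (picard_iter n t) \<le> B" using assms[OF T] by blast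
    then have B: "\<And>n t. 0 \<le> t \<Longrightarrow> t \<le> T \<Longrightarrow> norm (picard_iter n t) \<le> B" by simp
    define K where "K = max 1 (p * B powr (p - 1))"
    have B0: "B \<ge> 0" using order_trans[OF norm_ge_zero B[of 0 0]] T by simp
    have "uniform_limit {0..T} (\<lambda>n t. \<Sum>i<n. picard_iter (Suc i) t - picard_iter i t) (\<lambda>t. \<Sum>i. picard_iter (Suc i) t - picard_iter i t) sequentially"
    proof (rule Weierstrass_m_test)
      show "summable (\<lambda>n. 2 * B * exp (2 * K * T) * (1 / 2) ^ n)"
        by (intro summable_mult summable_geometric) simp
      fix n t assume t: "t \<in> {0..T}"
      have "norm (picard_iter (Suc n) t - picard_iter n t) \<le> 2 * B / 2 ^ n * exp (2 * K * t)"
        by (rule picard_iter_increment[OF B K_def]) (use t in auto)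
      also have "\<dots> \<le> 2 * B / 2 ^ n * exp (2 * K * T)"
        using t B0 by (intro mult_left_mono) (auto simp: K_def intro!: mult_left_mono)
      finally show "norm (picard_iter (Suc n) t - picard_iter n t) \<le> 2 * B * exp (2 * K * T) * (1 / 2) ^ n"
        by (simp add: power_divide field_simps)
    qed
    moreover have "(\<Sum>i<n. picard_iter (Suc i) t - picard_iter i t) = picard_iter n t" for n t
      using sum_lessThan_telescope[of "\<lambda>i. picard_iter i t" n] by (simp add: picard_iter_0)
    ultimately show ?thesis by (simp add: u_def[abs_def])
  qed
  have pt: "(\<lambda>n. picard_iter n t) \<longlonglongrightarrow> u t" if "t \<ge> 0" for t
    using tendsto_uniform_limitI[OF lim[OF that], of t] that by simp
  have uC: "u t \<in> C0b" if "t \<ge> 0" for t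
    by (rule closed_sequentially[OF closed_C0b _ pt[OF that]]) (use picard_iter_C0b that in auto)
  have uc: "continuous_on {0..} u"
    unfolding continuous_on_eq_continuous_within
  proof
    fix t :: real assume t: "t \<in> {0..}"
    \<comment> \<open>Convergence is uniform on bounded intervals only, and the interval must extend
      beyond t to be a neighbourhood of t in the half-line.\<close>
    have "continuous_on {0..t + 1} u"
      by (rule uniform_limit_theorem[OF _ lim]) (use t in \<open>auto intro!: always_eventually continuous_on_subset[OF picard_iter_cont]\<close>)
    then have "continuous (at t within {0..t + 1}) u" using t by (simp add: continuous_on_eq_continuous_within)
    moreover have "at t within {0..t + 1} = at t within {0..}"
      by (rule at_within_nhd[of _ "{..<t + 1}"]) auto
    ultimately show "continuous (at t within {0..}) u" by simp
  qed
  have "u t = picard_step p u0 f u t" if t: "t \<ge> 0" for t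
  proof (rule LIMSEQ_unique[OF LIMSEQ_Suc[OF pt[OF t]]])
    obtain B where "\<forall>n. \<forall>\<tau>\<in>{0..t}. norm (picard_iter n \<tau>) \<le> B" using assms[OF t] by blast
    then have B: "\<And>n \<tau>. 0 \<le> \<tau> \<Longrightarrow> \<tau> \<le> t \<Longrightarrow> norm (picard_iter n \<tau>) \<le> B" by simp
    have uB: "norm (u \<tau>) \<le> B" if "0 \<le> \<tau>" "\<tau> \<le> t" for \<tau>
      by (rule LIMSEQ_le_const2[OF tendsto_norm[OF pt[OF that(1)]]]) (use B that in auto)
    let ?K = "p * B powr (p - 1)"
    have K: "?K \<ge> 0" using p by simp
    have "(\<lambda>n. picard_step p u0 f (picard_iter n) t) \<longlonglongrightarrow> picard_step p u0 f u t"
    proof (rule metric_LIMSEQ_I)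
      fix e :: real assume e: "e > 0"
      \<comment> \<open>The summand 1 keeps the divisor positive also at t = 0.\<close>
      define Z where "Z = t * ?K + 1"
      have Z: "Z > 0" using t K by (simp add: Z_def add_nonneg_pos)
      define e' where "e' = e / (2 * Z)"
      have e': "e' > 0" using e Z by (simp add: e'_def)
      from uniform_limitD[OF lim[OF t] e'] obtain n0 where n0: "\<And>n \<tau>. n \<ge> n0 \<Longrightarrow> \<tau> \<in> {0..t} \<Longrightarrow> dist (picard_iter n \<tau>) (u \<tau>) < e'"
        unfolding eventually_sequentially by blast
      have "dist (picard_step p u0 f (picard_iter n) t) (picard_step p u0 f u t) < e" if n: "n \<ge> n0" for n
      proof -
        have "norm (picard_step p u0 f (picard_iter n) t - picard_step p u0 f u t) \<le> integral {0..t} (\<lambda>\<tau>. ?K * e')"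
        proof (rule picard_step_diff[OF picard_iter_cont picard_iter_C0b uc uC t])
          fix \<tau> :: real assume \<tau>: "0 \<le> \<tau>" "\<tau> \<le> t"
          show "norm (picard_iter n \<tau>) \<le> B" "norm (u \<tau>) \<le> B" using \<tau> B uB by auto
          show "?K * norm (picard_iter n \<tau> - u \<tau>) \<le> ?K * e'"
            using n0[OF n, of \<tau>] \<tau> K by (intro mult_left_mono) (auto simp: dist_norm)
        qed auto
        also have "\<dots> = t * ?K * e'" using t by simp
        also have "\<dots> \<le> Z * e'" using e' by (simp add: Z_def distrib_right)
        also have "\<dots> = e / 2" using Z by (simp add: e'_def)
        also have "\<dots> < e" using e by simp
        finally show ?thesis by (simp add: dist_norm)
      qed
      then show "\<exists>no. \<forall>n\<ge>no. dist (picard_step p u0 f (picard_iter n) t) (picard_step p u0 f u t) < e" by blast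
    qed
    then show "(\<lambda>n. picard_iter (Suc n) t) \<longlonglongrightarrow> picard_step p u0 f u t" by (simp add: picard_iter_Suc)
  qed
  then show ?thesis using uc uC by blast
qed

lemma fixed_point_mild:
  assumes u: "continuous_on {0..} u" "\<And>t. t \<ge> 0 \<Longrightarrow> u t \<in> C0b" "\<And>t. t \<ge> 0 \<Longrightarrow> u t = picard_step p u0 f u t"
  shows "global_mild_solution 1 1 s p (apply_bcontfun u0) (apply_bcontfun f) (\<lambda>t. apply_bcontfun (u t))"
  unfolding global_mild_solution_def Let_def heat_semigroup_eq
proof (intro conjI allI impI)
  fix t :: real assume t: "t \<ge> 0"
  show "apply_bcontfun (u t) \<in> C0" using u(2)[OF t] by (simp add: C0b_def)
  have "(u \<longlongrightarrow> u t) (at t within {0..})" using u(1) t by (simp add: continuous_on_def)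
  then show "uniform_limit UNIV (\<lambda>t. apply_bcontfun (u t)) (apply_bcontfun (u t)) (at t within {0..})"
    by (rule tendsto_bcontfun_uniform_limit)
  fix x
  have eq: "apply_bcontfun (Fb p (u \<tau>) + f) = (\<lambda>y. \<bar>u \<tau> y\<bar> powr p + f y)" for \<tau>
    by (simp add: fun_eq_iff plus_bcontfun.rep_eq apply_Fb[OF p])
  note D = Dm_apply[OF source(1,2)[OF u(1,2)], where t = t and x = x, unfolded eq]
  show "set_integrable lborel {0..t} (\<lambda>\<tau>. S (t - \<tau>) (\<lambda>y. \<bar>u \<tau> y\<bar> powr p + f y) x)" by (rule D(1))
  show "u t x = S t (apply_bcontfun u0) x + (LINT \<tau>:{0..t}|lborel. S (t - \<tau>) (\<lambda>y. \<bar>u \<tau> y\<bar> powr p + f y) x)"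
    by (subst u(3)[OF t]) (simp add: picard_step_def plus_bcontfun.rep_eq apply_Sb[OF t] D(2))
qed

end

section \<open>Choice of exponents and constants for small data\<close>

lemma mild_existence:
  fixes p :: real
  assumes d: "real DIM('a) > 2 * s" and p: "p > real DIM('a) / (real DIM('a) - 2 * s)"
    and pcs: "pcs = real DIM('a) * (p - 1) / (2 * s)" and k: "k = pcs / p"
  shows "\<exists>\<delta>>0. \<forall>u0 :: 'a \<Rightarrow> real. \<forall>f :: 'a \<Rightarrow> real.
    u0 \<in> C0 \<inter> Lp pcs \<and> f \<in> C0 \<inter> Lp k \<and> Lp_norm pcs u0 + Lp_norm k f \<le> \<delta>
    \<longrightarrow> (\<exists>u. global_mild_solution 1 1 s p u0 f u)"
proof -
  define d where "d = real DIM('a)"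
  have d0: "d > 2 * s" "d > 0" using assms(1) s by (auto simp: d_def)
  have pd: "p * (d - 2 * s) > d" using p d0 by (simp add: d_def[symmetric] pos_divide_less_eq)
  have "d / (d - 2 * s) > 1" using d0 s by simp
  then have p1: "p > 1" using p by (simp add: d_def)
  have pcs': "pcs = d * (p - 1) / (2 * s)" using pcs by (simp add: d_def)
  have k': "k = d * (p - 1) / (2 * s * p)" by (simp add: k pcs')
  have k1: "k > 1" using pd s p1 by (simp add: k' less_divide_eq algebra_simps)
  have pcsk: "pcs = k * p" using p1 by (simp add: k)
  have pcs1: "pcs > p" using k1 p1 by (simp add: pcsk)
  have ek: "1 / pcs = 1 / k - 2 * s / d" using d0 s p1 by (simp add: pcs' k' field_simps)
  have ak: "d / (2 * s * k) > 1"
  proof -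
    have "d / (2 * s * k) = p / (p - 1)" using d0 s p1 by (simp add: k' field_simps)
    then show ?thesis using p1 by simp
  qed
  \<comment> \<open>A sum of positive terms exceeds each of them. The first makes r / p > d / (2 s),
    as the sup bound requires; the second puts r above pcs; the third makes the exponent
    \<open>m2\<close> below larger than 1.\<close>
  define r where "r = d * p / (2 * s) + pcs + d / (d - 2 * s)"
  have "d * p / (2 * s) > 0" "d / (d - 2 * s) > 0" "pcs > 0" using d0 s p1 pcs1 by auto
  then have r: "r > d * p / (2 * s)" "r > pcs" "r > d / (d - 2 * s)" "r > 0" by (auto simp: r_def)
  have r1: "r > p" using r(2) pcs1 by simp
  have br: "d / (2 * s * (r / p)) < 1" using r(1,4) s p1 by (simp add: field_simps)
  \<comment> \<open>The exponent that the Duhamel integral maps to r: 1 / r = 1 / m2 - 2 s /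
    d.\<close>
  define m2 where "m2 = 1 / (2 * s / d + 1 / r)"
  have im2: "1 / m2 = 2 * s / d + 1 / r" by (simp add: m2_def)
  have m2lt: "2 * s / d + 1 / r < 1" using r(3,4) d0 by (simp add: field_simps)
  have m2pos: "2 * s / d + 1 / r > 0" using s d0 r by (intro add_pos_pos) auto
  have m2: "m2 > 1" using m2lt m2pos by (simp add: m2_def)
  have am2: "d / (2 * s * m2) > 1"
  proof -
    have "d / (2 * s * m2) = d / (2 * s) * (2 * s / d + 1 / r)" by (simp add: im2[symmetric])
    also have "\<dots> = 1 + d / (2 * s * r)" using s d0 by (simp add: distrib_left)
    finally show ?thesis using s d0 r by simp
  qed
  define q2 where "q2 = p * m2"
  have q2: "q2 > p" using m2 p1 by (simp add: q2_def)
  \<comment> \<open>The interpolation parameter between pcs and r comes out as exactly 1/p. Hence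
    the p-th power of the interpolated bound M powr (1 - 1/p) * R powr (1/p) is M powr (p - 1) * R,
    linear in the bound R at exponent r.\<close>
  have iq2: "1 / q2 = (1 - 1 / p) / pcs + (1 / p) / r"
  proof -
    have "(1 - 1 / p) / pcs = 2 * s / d / p" using d0 s p1 by (simp add: pcs' field_simps)
    then have "(1 - 1 / p) / pcs + (1 / p) / r = 1 / p * (1 / m2)" by (simp add: im2 distrib_left)
    then show ?thesis by (simp add: q2_def)
  qed
  define K1 where "K1 = 1 + p / (pcs - p)"
  define K2 where "K2 = 1 + p / (q2 - p)"
  define K3 where "K3 = 1 + p / (r - p)"
  have K: "K1 > 0" "K2 > 0" "K3 > 0" using p1 pcs1 q2 r1 by (auto simp: K1_def K2_def K3_def intro!: add_pos_pos)
  have H: "HLS k > 0" "HLS m2 > 0" using HLS_pos[of k] HLS_pos[of m2] ak am2 by (auto simp: d_def)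
  \<comment> \<open>A common constant for both recursions: with M powr (p - 1) = 1 / (2 c), the
    nonlinear coefficients at the exponents pcs and r are both at most 1/2.\<close>
  define c where "c = HLS k * K1 + HLS m2 * K2"
  have c: "c > 0" using H K by (simp add: c_def add_pos_pos)
  define M where "M = (1 / (2 * c)) powr (1 / (p - 1))"
  have M: "M > 0" using c by (simp add: M_def)
  have Mp: "M powr (p - 1) = 1 / (2 * c)" using c p1 by (simp add: M_def powr_powr)
  have small: "HLS k * K1 * M powr (p - 1) \<le> 1 / 2" "HLS m2 * K2 * M powr (p - 1) \<le> 1 / 2"
    using H K c by (auto simp: Mp c_def field_simps)
  \<comment> \<open>The embedding into weak spaces doubles \<delta>, so the data contribute 2
    \<delta> (1 + HLS k) = M / 2, which is the half of M that the nonlinear term leaves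
    free.\<close>
  define \<delta> where "\<delta> = M / (4 * (1 + HLS k))"
  have \<delta>: "\<delta> > 0" using M H by (simp add: \<delta>_def)
  have MM: "M powr p = M * M powr (p - 1)" using M by (simp add: powr_mult_base)
  have closeM: "2 * \<delta> + HLS k * (K1 * M powr p + 2 * \<delta>) \<le> M"
  proof -
    have "HLS k * (K1 * M powr p) = M * (HLS k * K1 * M powr (p - 1))" by (simp add: MM)
    also have "\<dots> \<le> M * (1 / 2)" using small(1) M by (intro mult_left_mono) auto
    finally have "HLS k * (K1 * M powr p) \<le> M / 2" by simp
    moreover have "2 * \<delta> * (1 + HLS k) = M / 2" using H by (simp add: \<delta>_def field_simps)
    moreover have "2 * \<delta> + HLS k * (K1 * M powr p + 2 * \<delta>) = HLS k * (K1 * M powr p) + 2 * \<delta> * (1 + HLS k)"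
      by (simp add: algebra_simps)
    ultimately show ?thesis by linarith
  qed
  show ?thesis
  proof (intro exI[of _ \<delta>] conjI allI impI \<delta>)
    fix u0 f :: "'a \<Rightarrow> real"
    assume a: "u0 \<in> C0 \<inter> Lp pcs \<and> f \<in> C0 \<inter> Lp k \<and> Lp_norm pcs u0 + Lp_norm k f \<le> \<delta>"
    have nn: "Lp_norm pcs u0 \<ge> 0" "Lp_norm k f \<ge> 0" by (simp_all add: Lp_norm_def)
    have wu: "weak pcs (2 * \<delta>) u0" using a nn pcs1 p1 \<delta> by (intro Lp_norm_le_weak) auto
    have wf: "weak k (2 * \<delta>) f" using a nn k1 \<delta> by (intro Lp_norm_le_weak) auto
    have kr: "k < r" using k1 p1 r(2) mult_strict_left_mono[OF p1, of k] by (simp only: pcsk) linarith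
    obtain Bu where Bu: "\<And>x. \<bar>u0 x\<bar> \<le> Bu" using C0_bounded[of u0] a by auto
    obtain Bf where Bf: "\<And>x. \<bar>f x\<bar> \<le> Bf" using C0_bounded[of f] a by auto
    \<comment> \<open>At the exponent r no smallness of the data is available or required;
      boundedness and the assumed integrability give finite constants.\<close>
    have "\<exists>A>0. weak r A u0" by (rule weak_of_bounded_Lp[OF _ Bu, where q = pcs]) (use a r r1 p1 pcs1 in auto)
    moreover have "\<exists>A>0. weak r A f" by (rule weak_of_bounded_Lp[OF _ Bf, where q = k]) (use a kr r1 p1 k1 in auto)
    ultimately obtain Au Af where A: "Au > 0" "weak r Au u0" "Af > 0" "weak r Af f" by blast
    define u0b where "u0b = b_of u0"
    define fb where "fb = b_of f"
    have ap: "apply_bcontfun u0b = u0" "apply_bcontfun fb = f" "u0b \<in> C0b" "fb \<in> C0b"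
      using a by (auto simp: u0b_def fb_def apply_b_of_C0 b_of_C0b)
    note Ug = picard_iter_cont[OF p1 ap(3,4)] picard_iter_C0b[OF p1 ap(3,4)]
    let ?picard_iter = "picard_iter p u0b fb"
    have W1: "weak pcs M (apply_bcontfun (?picard_iter n t))" if "t \<ge> 0" for n t
      using that
    proof (induction n arbitrary: t)
      case 0
      then show ?case using M by (simp add: picard_iter_0[OF p1 ap(3,4)] weak_zero)
    next
      case (Suc n)
      have "weak pcs (2 * \<delta> + HLS k * (K1 * M powr p + 2 * \<delta>)) (apply_bcontfun (picard_step p u0b fb (?picard_iter n) t))"
      proof (rule picard_step_weak[OF p1 ap(3,4) Ug Suc.prems k1])
        show "weak k (K1 * M powr p) (\<lambda>x. \<bar>?picard_iter n \<tau> x\<bar> powr p)" if "0 \<le> \<tau>" for \<tau>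
          using weak_power[OF Suc.IH[OF that], of p] p1 pcs1 M by (simp add: k K1_def)
      qed (use ak ek pcs1 p1 K M \<delta> wu wf ap in \<open>auto simp: d_def\<close>)
      then show ?case using closeM weak_mono by (simp add: picard_iter_Suc[OF p1 ap(3,4)]) blast
    qed
    have W2: "weak r (2 * (Au + T * Af)) (apply_bcontfun (?picard_iter n t))" if T: "T \<ge> 0" and t: "0 \<le> t" "t \<le> T" for n t T
      using t
    proof (induction n arbitrary: t)
      case 0
      then show ?case using A T by (simp add: picard_iter_0[OF p1 ap(3,4)] weak_zero)
    next
      case (Suc n)
      \<comment> \<open>Twice the contribution of the data on [0, T]; the nonlinear term takes at
        most the other half, so R reproduces itself.\<close>
      define R where "R = 2 * (Au + T * Af)"
      have R: "R > 0" using A T by (simp add: R_def add_pos_nonneg)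
      have pow: "(M powr (1 - 1 / p) * R powr (1 / p)) powr p = M powr (p - 1) * R"
        using M R p1 by (simp add: powr_mult powr_powr left_diff_distrib)
      have "weak r (Au + (HLS m2 * (K2 * (M powr (p - 1) * R)) + t * Af)) (apply_bcontfun (picard_step p u0b fb (?picard_iter n) t))"
      proof (rule picard_step_weak_trivial[OF p1 ap(3,4) Ug Suc.prems(1) m2])
        fix \<tau> :: real assume \<tau>: "0 \<le> \<tau>" "\<tau> < t"
        have "weak r R (apply_bcontfun (?picard_iter n \<tau>))" unfolding R_def using \<tau> Suc.prems by (intro Suc.IH) auto
        then have "weak q2 (M powr (1 - 1 / p) * R powr (1 / p)) (apply_bcontfun (?picard_iter n \<tau>))"
          by (intro weak_interp[OF W1[OF \<tau>(1)] _ _ _ _ _ iq2]) (use M R p1 in auto)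
        from weak_power[OF this, of p] show "weak m2 (K2 * (M powr (p - 1) * R)) (\<lambda>x. \<bar>?picard_iter n \<tau> x\<bar> powr p)"
          using p1 q2 M R by (simp add: pow K2_def) (simp add: q2_def)
      qed (use am2 im2 r1 p1 K M R A ap in \<open>auto simp: d_def\<close>)
      moreover have "Au + (HLS m2 * (K2 * (M powr (p - 1) * R)) + t * Af) \<le> R"
      proof -
        have "HLS m2 * (K2 * (M powr (p - 1) * R)) = HLS m2 * K2 * M powr (p - 1) * R" by simp
        also have "\<dots> \<le> 1 / 2 * R" using small(2) R by (intro mult_right_mono) auto
        finally have "HLS m2 * (K2 * (M powr (p - 1) * R)) \<le> Au + T * Af" by (simp add: R_def)
        moreover have "t * Af \<le> T * Af" using Suc.prems A by (intro mult_right_mono) auto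
        ultimately show ?thesis by (simp add: R_def)
      qed
      ultimately show ?case unfolding picard_iter_Suc[OF p1 ap(3,4)] R_def[symmetric] by (rule weak_mono)
    qed
    have "\<exists>B. \<forall>n. \<forall>t\<in>{0..T}. norm (?picard_iter n t) \<le> B" if T: "T \<ge> 0" for T
    proof -
      define R where "R = 2 * (Au + T * Af)"
      have R: "R > 0" using A T by (simp add: R_def add_pos_nonneg)
      define e where "e = 1 - d / (2 * s * (r / p))"
      have e: "e > 0" using br by (simp add: e_def)
      define N where "N = K3 * R powr p * CP powr (1 / (r / p))"
      have N: "N \<ge> 0" using K R by (simp add: N_def)
      define B where "B = norm u0b + (N * (T powr e / e) + T * norm fb)"
      have "norm (?picard_iter n t) \<le> B" if t: "t \<in> {0..T}" for n t
      proof (cases n)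
        case 0
        then show ?thesis using N e T by (simp add: picard_iter_0[OF p1 ap(3,4)] B_def)
      next
        case (Suc j)
        have "norm (picard_step p u0b fb (?picard_iter j) t) \<le> norm u0b + (K3 * R powr p * CP powr (1 / (r / p)) *
            (t powr (1 - real DIM('a) / (2 * s * (r / p))) / (1 - real DIM('a) / (2 * s * (r / p)))) + t * norm fb)"
        proof (rule picard_step_norm[OF p1 ap(3,4) Ug])
          fix \<tau> :: real assume \<tau>: "0 \<le> \<tau>" "\<tau> < t"
          have "weak r R (apply_bcontfun (?picard_iter j \<tau>))" unfolding R_def using \<tau> t T by (intro W2) auto
          from weak_power[OF this, of p] show "weak (r / p) (K3 * R powr p) (\<lambda>x. \<bar>?picard_iter j \<tau> x\<bar> powr p)"
            using p1 r1 R by (simp add: K3_def)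
        qed (use t br K in \<open>auto simp: d_def\<close>)
        also have "\<dots> = norm u0b + (N * (t powr e / e) + t * norm fb)" by (simp add: N_def e_def d_def)
        also have "\<dots> \<le> B"
          unfolding B_def using t e N
          by (intro add_left_mono add_mono mult_left_mono mult_right_mono divide_right_mono powr_mono2) auto
        finally show ?thesis by (simp add: Suc picard_iter_Suc[OF p1 ap(3,4)])
      qed
      then show ?thesis by blast
    qed
    from picard_step_fixed_point[OF p1 ap(3,4) this] obtain u where
      "continuous_on {0..} u" "\<And>t. t \<ge> 0 \<Longrightarrow> u t \<in> C0b" "\<And>t. t \<ge> 0 \<Longrightarrow> u t = picard_step p u0b fb u t" by blast
    from fixed_point_mild[OF p1 ap(3,4) this] show "\<exists>u. global_mild_solution 1 1 s p u0 f u"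
      by (auto simp: ap)
  qed
qed

end

section \<open>Nonexistence below and at the critical exponent, global existence above it\<close>

theorem theorem1p4:
  fixes d s p p_Crit :: real
  assumes d: "d = real DIM('a::euclidean_space)"
    and s: "0 < s" "s < 1" "d > 2 * s"
    and p: "1 < p"
    and p_Crit: "p_Crit = d / (d - 2 * s)"
  shows
    "(\<forall>a b. \<forall>u0 :: 'a \<Rightarrow> real. \<forall>f :: 'a \<Rightarrow> real.
        a \<ge> 0 \<and> b > 0 \<and> p < p_Crit \<and>
        u0 \<in> Lp 1 \<inter> C0 \<and> f \<in> L1_loc \<inter> C0 \<and>
        ext_integral_exists f \<and> ext_integral f > 0
        \<longrightarrow> \<not> (\<exists>u. global_weak_solution a b s p u0 f u)) \<and>
     (\<forall>a b. \<forall>u0 :: 'a \<Rightarrow> real. \<forall>f :: 'a \<Rightarrow> real.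
        a \<ge> 0 \<and> b > 0 \<and> p = p_Crit \<and>
        u0 \<in> Lp 1 \<inter> C0 \<and> f \<in> L1_loc \<inter> C0 \<and>
        ext_integral_exists f \<and> ext_integral f > 0 \<and>
        (\<exists>\<sigma>. 0 < \<sigma> \<and> \<sigma> \<le> d \<and>
          Limsup at_top (\<lambda>R. ereal (R powr (- \<sigma>) * (LINT x:ball 0 R|lborel. f x))) > 0)
        \<longrightarrow> \<not> (\<exists>u. global_weak_solution a b s p u0 f u)) \<and>
     (p > p_Crit \<longrightarrow>
        (let pcs = d * (p - 1) / (2 * s); k = pcs / p in
          \<exists>\<delta>>0. \<forall>u0 :: 'a \<Rightarrow> real. \<forall>f :: 'a \<Rightarrow> real.
            u0 \<in> C0 \<inter> Lp pcs \<and> f \<in> L1_loc \<inter> C0 \<and> f \<noteq> (\<lambda>x. 0) \<and>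
            f \<in> Lp k \<and> Lp_norm pcs u0 + Lp_norm k f \<le> \<delta>
            \<longrightarrow> (\<exists>u. global_mild_solution 1 1 s p u0 f u)))"
proof (intro conjI allI impI notI; (elim conjE exE)?)
  fix a b and u0 f :: "'a \<Rightarrow> real" and u
  assume "b > 0" "p < p_Crit" "u0 \<in> Lp 1 \<inter> C0" "f \<in> L1_loc \<inter> C0" "ext_integral_exists f" "ext_integral f > 0"
    "global_weak_solution a b s p u0 f u"
  then show False
    using nonexistence_subcritical[of s p b u0 f a u] s p by (simp add: d p_Crit)
next
  fix a b and u0 f :: "'a \<Rightarrow> real" and u \<sigma>
  assume "b > 0" "p = p_Crit" "u0 \<in> Lp 1 \<inter> C0" "f \<in> L1_loc \<inter> C0" "ext_integral_exists f" "ext_integral f > 0"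
    "0 < \<sigma>" "Limsup at_top (\<lambda>R. ereal (R powr (- \<sigma>) * (LINT x:ball 0 R|lborel. f x))) > 0"
    "global_weak_solution a b s p u0 f u"
  then show False
    using nonexistence_critical[of s p b u0 f \<sigma> a u] s p by (simp add: d p_Crit)
next
  note ds = s(3)
  interpret mixed_heat s "TYPE('a)" by unfold_locales (use s in auto)
  assume "p_Crit < p"
  then obtain \<delta> where "\<delta> > 0" and *: "\<And>u0 f :: 'a \<Rightarrow> real. u0 \<in> C0 \<inter> Lp (d * (p - 1) / (2 * s)) \<Longrightarrow>
      f \<in> C0 \<inter> Lp (d * (p - 1) / (2 * s) / p) \<Longrightarrow>
      Lp_norm (d * (p - 1) / (2 * s)) u0 + Lp_norm (d * (p - 1) / (2 * s) / p) f \<le> \<delta> \<Longrightarrow>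
      \<exists>u. global_mild_solution 1 1 s p u0 f u"
    using mild_existence[of p _ _, OF _ _ refl refl] ds unfolding d p_Crit by blast
  then show "let pcs = d * (p - 1) / (2 * s); k = pcs / p in
          \<exists>\<delta>>0. \<forall>u0 :: 'a \<Rightarrow> real. \<forall>f :: 'a \<Rightarrow> real.
            u0 \<in> C0 \<inter> Lp pcs \<and> f \<in> L1_loc \<inter> C0 \<and> f \<noteq> (\<lambda>x. 0) \<and>
            f \<in> Lp k \<and> Lp_norm pcs u0 + Lp_norm k f \<le> \<delta>
            \<longrightarrow> (\<exists>u. global_mild_solution 1 1 s p u0 f u)"
    unfolding Let_def by (intro exI[of _ \<delta>]) simp
qed

end
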